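(* Let $P=\{x\in\mathbb{R}^n : Ax\le b\}$, $A\in\mathbb{R}^{m\times n}$, be an $n$-dimensional polytope (bounded polyhedron) with $m$ constraints satisfying the local $\delta$-distance property, where $\delta>0$ is known. Then, given an objective $c\in\mathbb{R}^n$ and a vertex $v$ of $P$, a vertex of $P$ maximizing $\langle c,x\rangle$ over $P$ can be computed by a randomized (shadow) simplex algorithm using an expected $O\!\left(\frac{n^3}{\delta}\ln\frac{n}{\delta}\right)$ simplex pivots, where each pivot requires $O(mn)$ arithmetic operations.
   Context: Let $a_1,\dots,a_m$ be the rows of $A$. A basis is a set $B\subseteq[m]$ of $n$ indices with $\{a_i:i\in B\}$ linearly independent; it is feasible if the point $x_B$ with $\langle a_i,x_B\rangle=b_i$ for $i\in B$ lies in $P$ (so $x_B$ is a vertex). A simplex pivot replaces the current basis by another basis differing in exactly one index. Linearly independent vectors $v_1,\dots,v_k$ satisfy the $\delta$-distance property if for every $i$, $v_i$ has Euclidean distance at least $\delta\|v_i\|$ from $\mathrm{span}\{v_j : j\neq i\}$. $P$ satisfies the local $\delta$-distance property if for every feasible basis $B$, the rows $\{a_i : i\in B\}$ satisfy the $\delta$-distance property. *)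

theory Defs
  imports "HOL-Probability.Probability" "Jordan_Normal_Form.VS_Connect"
begin

text \<open>
  The algorithm has to be one program for all dimensions, so the statement quantifies over \<open>m\<close>
  and \<open>n\<close> below the existential quantifier over programs.  This is why vectors and matrices
  are those of \<^theory>\<open>Jordan_Normal_Form.Matrix\<close>, whose sizes are values and not types.
  Constraints and coordinates are numbered from 0.
\<close>

hide_const (open) Finite_Cartesian_Product.vec Finite_Cartesian_Product.row
hide_type (open) Finite_Cartesian_Product.vec
no_notation inner (infixl "\<bullet>" 70)
no_notation vec_nth (infixl "$" 90)

type_synonym rvec = "real Matrix.vec"
type_synonym rmat = "real Matrix.mat"


section \<open>Polyhedra, bases and the distance property\<close>

abbreviation span_of :: "nat \<Rightarrow> rvec set \<Rightarrow> rvec set" where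
  "span_of n \<equiv> LinearCombinations.module.span class_ring (module_vec TYPE(real) n)"

abbreviation lin_indep :: "nat \<Rightarrow> rvec set \<Rightarrow> bool" where
  "lin_indep n S \<equiv> \<not> LinearCombinations.module.lin_dep class_ring (module_vec TYPE(real) n) S"

definition eucl_norm :: "rvec \<Rightarrow> real" where
  "eucl_norm x = sqrt (x \<bullet> x)"

definition dist_to :: "rvec \<Rightarrow> rvec set \<Rightarrow> real" where
  "dist_to x S = (INF y\<in>S. eucl_norm (x - y))"

definition feasible_region :: "rmat \<Rightarrow> rvec \<Rightarrow> rvec set" where
  "feasible_region A b = {x \<in> carrier_vec (dim_col A). A *\<^sub>v x \<le> b}"

definition bounded_vecs :: "rvec set \<Rightarrow> bool" where
  "bounded_vecs P \<longleftrightarrow> (\<exists>R. \<forall>x\<in>P. eucl_norm x \<le> R)"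

text \<open>The affine hull of \<open>P\<close> is the whole space.\<close>
definition full_dimensional :: "nat \<Rightarrow> rvec set \<Rightarrow> bool" where
  "full_dimensional n P \<longleftrightarrow> (\<exists>x\<^sub>0\<in>P. span_of n ((\<lambda>x. x - x\<^sub>0) ` P) = carrier_vec n)"

text \<open>Extreme points, as in \<^const>\<open>extreme_point_of\<close>.\<close>
definition vertex :: "rvec set \<Rightarrow> rvec \<Rightarrow> bool" where
  "vertex P x \<longleftrightarrow> x \<in> P \<and>
     \<not> (\<exists>y\<in>P. \<exists>z\<in>P. y \<noteq> z \<and> (\<exists>u. 0 < u \<and> u < 1 \<and> x = (1 - u) \<cdot>\<^sub>v y + u \<cdot>\<^sub>v z))"

text \<open>Injectivity makes this independence of the family of rows, so repeated rows are
  excluded.\<close>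
definition is_basis :: "rmat \<Rightarrow> nat set \<Rightarrow> bool" where
  "is_basis A B \<longleftrightarrow> B \<subseteq> {..<dim_row A} \<and> card B = dim_col A \<and>
     inj_on (row A) B \<and> lin_indep (dim_col A) (row A ` B)"

definition basic_point :: "rmat \<Rightarrow> rvec \<Rightarrow> nat set \<Rightarrow> rvec \<Rightarrow> bool" where
  "basic_point A b B x \<longleftrightarrow> x \<in> carrier_vec (dim_col A) \<and> (\<forall>i\<in>B. row A i \<bullet> x = b $ i)"

definition feasible_basis :: "rmat \<Rightarrow> rvec \<Rightarrow> nat set \<Rightarrow> bool" where
  "feasible_basis A b B \<longleftrightarrow> is_basis A B \<and> (\<exists>x \<in> feasible_region A b. basic_point A b B x)"

definition distance_property :: "nat \<Rightarrow> real \<Rightarrow> 'i set \<Rightarrow> ('i \<Rightarrow> rvec) \<Rightarrow> bool" where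
  "distance_property n \<delta> I a \<longleftrightarrow>
     (\<forall>i\<in>I. dist_to (a i) (span_of n (a ` (I - {i}))) \<ge> \<delta> * eucl_norm (a i))"

definition local_distance_property :: "rmat \<Rightarrow> rvec \<Rightarrow> real \<Rightarrow> bool" where
  "local_distance_property A b \<delta> \<longleftrightarrow>
     (\<forall>B. feasible_basis A b B \<longrightarrow> distance_property (dim_col A) \<delta> B (row A))"


section \<open>Shadow simplex runs\<close>

definition adjacent :: "nat set \<Rightarrow> nat set \<Rightarrow> bool" where
  "adjacent B B' \<longleftrightarrow> card (B - B') = 1 \<and> card (B' - B) = 1"

text \<open>
  \<open>B\<close> is an optimal (dual feasible) basis for the objective \<open>\<gamma>\<close> on the face of the polyhedron
  in which the constraints \<open>F\<close> are tight: \<open>\<gamma>\<close> is a combination of the rows in \<open>B\<close> with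
  nonnegative coefficients outside \<open>F\<close>.
\<close>
definition optimal_basis :: "rmat \<Rightarrow> nat set \<Rightarrow> rvec \<Rightarrow> nat set \<Rightarrow> bool" where
  "optimal_basis A F \<gamma> B \<longleftrightarrow> F \<subseteq> B \<and>
     (\<exists>\<mu>. (\<forall>i\<in>B - F. 0 \<le> \<mu> i) \<and> \<gamma> = Matrix.vec (dim_col A) (\<lambda>j. \<Sum>i\<in>B. \<mu> i * A $$ (i, j)))"

text \<open>
  A shadow path on the face given by \<open>F\<close>, from objective \<open>\<gamma>\<close> to objective \<open>\<gamma>'\<close>: the objective
  moves along the segment, and the pivot from \<open>Bs ! k\<close> to \<open>Bs ! Suc k\<close> happens at time \<open>t k\<close>,
  when both bases are optimal.
\<close>
definition shadow_path ::
  "rmat \<Rightarrow> rvec \<Rightarrow> nat set \<Rightarrow> rvec \<Rightarrow> rvec \<Rightarrow> nat set list \<Rightarrow> bool" where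
  "shadow_path A b F \<gamma> \<gamma>' Bs \<longleftrightarrow>
     Bs \<noteq> [] \<and> (\<forall>B\<in>set Bs. feasible_basis A b B) \<and>
     optimal_basis A F \<gamma> (hd Bs) \<and> optimal_basis A F \<gamma>' (last Bs) \<and>
     (\<exists>t. mono_on {..<length Bs - 1} t \<and>
        (\<forall>k<length Bs - 1. 0 \<le> t k \<and> t k \<le> (1::real) \<and> adjacent (Bs ! k) (Bs ! Suc k) \<and>
           optimal_basis A F ((1 - t k) \<cdot>\<^sub>v \<gamma> + t k \<cdot>\<^sub>v \<gamma>') (Bs ! k) \<and>
           optimal_basis A F ((1 - t k) \<cdot>\<^sub>v \<gamma> + t k \<cdot>\<^sub>v \<gamma>') (Bs ! Suc k)))"

datatype event = Basis "nat set" | Segment "nat set" rvec rvec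

text \<open>
  \<open>shadow_simplex A b B\<^sub>0 es B\<close>: the events \<open>es\<close> report a start basis \<open>B\<^sub>0\<close> and then finitely many
  shadow paths, each announced by its face and its two objectives, each starting at the basis where
  the previous one ended.  The run ends in \<open>B\<close>.  Every \<^const>\<open>Basis\<close> event but the first is a pivot.
\<close>
inductive shadow_simplex :: "rmat \<Rightarrow> rvec \<Rightarrow> nat set \<Rightarrow> event list \<Rightarrow> nat set \<Rightarrow> bool"
  for A b B\<^sub>0 where
  start: "feasible_basis A b B\<^sub>0 \<Longrightarrow> shadow_simplex A b B\<^sub>0 [Basis B\<^sub>0] B\<^sub>0"
| phase: "shadow_simplex A b B\<^sub>0 es B \<Longrightarrow> shadow_path A b F \<gamma> \<gamma>' (B # Bs) \<Longrightarrow>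
    shadow_simplex A b B\<^sub>0 (es @ Segment F \<gamma> \<gamma>' # map Basis Bs) (last (B # Bs))"

fun is_basis_event :: "event \<Rightarrow> bool" where
  "is_basis_event (Basis B) = True"
| "is_basis_event (Segment F \<gamma> \<gamma>') = False"


section \<open>A randomized real RAM\<close>

text \<open>
  A while language over arrays of natural numbers and two-dimensional arrays of reals, both
  addressed by array number and (computed) subscripts.  The only real constants are those coming from
  natural numbers.  There is no multiplication of natural numbers, so that large numbers cannot be
  used to pack unbounded computations into one step.
\<close>

datatype iexp = Lit nat | Idx nat iexp | IPlus iexp iexp | IMinus iexp iexp

datatype rexp = Cell nat iexp iexp | OfNat iexp
  | Add rexp rexp | Sub rexp rexp | Mul rexp rexp | Div rexp rexp | Sqrt rexp

datatype bexp = ILess iexp iexp | RLess rexp rexp | BNot bexp | BAnd bexp bexp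

text \<open>
  The two report commands are observations: they log the basis currently stored in an index array,
  respectively the face and the objectives of the shadow path that the program starts to follow.
\<close>
datatype com = Skip
  | IAssign nat iexp iexp
  | RAssign nat iexp iexp rexp
  | DrawNormal nat iexp iexp
  | DrawExponential nat iexp iexp
  | Seq com com
  | Cond bexp com com
  | While bexp com
  | ReportBasis nat
  | ReportSegment nat iexp nat nat

record state =
  idx :: "nat \<Rightarrow> nat \<Rightarrow> nat"
  reg :: "nat \<Rightarrow> nat \<Rightarrow> nat \<Rightarrow> real"
  draws :: nat
  steps :: nat
  trace :: "(nat \<times> event) list"

fun ival :: "state \<Rightarrow> iexp \<Rightarrow> nat" where
  "ival s (Lit k) = k"
| "ival s (Idx a e) = idx s a (ival s e)"
| "ival s (IPlus e f) = ival s e + ival s f"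
| "ival s (IMinus e f) = ival s e - ival s f"

fun rval :: "state \<Rightarrow> rexp \<Rightarrow> real" where
  "rval s (Cell a e f) = reg s a (ival s e) (ival s f)"
| "rval s (OfNat e) = real (ival s e)"
| "rval s (Add p q) = rval s p + rval s q"
| "rval s (Sub p q) = rval s p - rval s q"
| "rval s (Mul p q) = rval s p * rval s q"
| "rval s (Div p q) = rval s p / rval s q"
| "rval s (Sqrt p) = sqrt (rval s p)"

fun bval :: "state \<Rightarrow> bexp \<Rightarrow> bool" where
  "bval s (ILess e f) = (ival s e < ival s f)"
| "bval s (RLess p q) = (rval s p < rval s q)"
| "bval s (BNot g) = (\<not> bval s g)"
| "bval s (BAnd g h) = (bval s g \<and> bval s h)"

text \<open>
  Unit cost for every operator and every access, including index arithmetic, so that the number of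
  steps bounds the number of arithmetic operations.
\<close>

fun icost :: "iexp \<Rightarrow> nat" where
  "icost (Lit k) = 1"
| "icost (Idx a e) = 1 + icost e"
| "icost (IPlus e f) = 1 + icost e + icost f"
| "icost (IMinus e f) = 1 + icost e + icost f"

fun rcost :: "rexp \<Rightarrow> nat" where
  "rcost (Cell a e f) = 1 + icost e + icost f"
| "rcost (OfNat e) = 1 + icost e"
| "rcost (Add p q) = 1 + rcost p + rcost q"
| "rcost (Sub p q) = 1 + rcost p + rcost q"
| "rcost (Mul p q) = 1 + rcost p + rcost q"
| "rcost (Div p q) = 1 + rcost p + rcost q"
| "rcost (Sqrt p) = 1 + rcost p"

fun bcost :: "bexp \<Rightarrow> nat" where
  "bcost (ILess e f) = 1 + icost e + icost f"
| "bcost (RLess p q) = 1 + rcost p + rcost q"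
| "bcost (BNot g) = 1 + bcost g"
| "bcost (BAnd g h) = 1 + bcost g + bcost h"

definition tick :: "nat \<Rightarrow> state \<Rightarrow> state" where
  "tick k s = s\<lparr>steps := steps s + k\<rparr>"

definition set_idx :: "nat \<Rightarrow> nat \<Rightarrow> nat \<Rightarrow> state \<Rightarrow> state" where
  "set_idx a i k s = s\<lparr>idx := (idx s)(a := (idx s a)(i := k))\<rparr>"

definition set_reg :: "nat \<Rightarrow> nat \<Rightarrow> nat \<Rightarrow> real \<Rightarrow> state \<Rightarrow> state" where
  "set_reg a i j r s = s\<lparr>reg := (reg s)(a := (reg s a)(i := (reg s a i)(j := r)))\<rparr>"

definition next_draw :: "state \<Rightarrow> state" where
  "next_draw s = s\<lparr>draws := Suc (draws s)\<rparr>"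

definition report :: "event \<Rightarrow> state \<Rightarrow> state" where
  "report e s = s\<lparr>trace := trace s @ [(steps s, e)]\<rparr>"

definition reg_vec :: "nat \<Rightarrow> state \<Rightarrow> nat \<Rightarrow> rvec" where
  "reg_vec n s a = Matrix.vec n (\<lambda>j. reg s a 0 j)"

text \<open>
  Big-step semantics in dimension \<open>n\<close>, deterministic once the random tape \<open>\<omega>\<close> is given: each draw
  uses up the next cell of the tape, which holds a normal and an exponential sample.
\<close>
inductive exec :: "nat \<Rightarrow> (nat \<Rightarrow> real \<times> real) \<Rightarrow> com \<Rightarrow> state \<Rightarrow> state \<Rightarrow> bool"
  for n \<omega> where
  Skip: "exec n \<omega> Skip s s"
| IAssign: "exec n \<omega> (IAssign a e f) s
    (tick (1 + icost e + icost f) (set_idx a (ival s e) (ival s f) s))"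
| RAssign: "exec n \<omega> (RAssign a e f p) s
    (tick (1 + icost e + icost f + rcost p) (set_reg a (ival s e) (ival s f) (rval s p) s))"
| DrawNormal: "exec n \<omega> (DrawNormal a e f) s
    (tick (1 + icost e + icost f)
      (next_draw (set_reg a (ival s e) (ival s f) (fst (\<omega> (draws s))) s)))"
| DrawExponential: "exec n \<omega> (DrawExponential a e f) s
    (tick (1 + icost e + icost f)
      (next_draw (set_reg a (ival s e) (ival s f) (snd (\<omega> (draws s))) s)))"
| Seq: "exec n \<omega> p s s' \<Longrightarrow> exec n \<omega> q s' s'' \<Longrightarrow> exec n \<omega> (Seq p q) s s''"
| CondTrue: "bval s g \<Longrightarrow> exec n \<omega> p (tick (1 + bcost g) s) s' \<Longrightarrow> exec n \<omega> (Cond g p q) s s'"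
| CondFalse: "\<not> bval s g \<Longrightarrow> exec n \<omega> q (tick (1 + bcost g) s) s' \<Longrightarrow> exec n \<omega> (Cond g p q) s s'"
| WhileFalse: "\<not> bval s g \<Longrightarrow> exec n \<omega> (While g p) s (tick (1 + bcost g) s)"
| WhileTrue: "bval s g \<Longrightarrow> exec n \<omega> p (tick (1 + bcost g) s) s' \<Longrightarrow>
    exec n \<omega> (While g p) s' s'' \<Longrightarrow> exec n \<omega> (While g p) s s''"
| ReportBasis: "exec n \<omega> (ReportBasis a) s (report (Basis (idx s a ` {..<n})) (tick 1 s))"
| ReportSegment: "exec n \<omega> (ReportSegment a e k l) s
    (report (Segment (idx s a ` {..<ival s e}) (reg_vec n s k) (reg_vec n s l))
      (tick (1 + icost e) s))"

lemma exec_deterministic: "exec n \<omega> p s s' \<Longrightarrow> exec n \<omega> p s s'' \<Longrightarrow> s' = s''"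
proof (induction arbitrary: s'' rule: exec.induct)
  case (Seq p s s' q t) from Seq.prems show ?case by cases (use Seq.IH in blast)
next
  case (CondTrue s g p s' q) from CondTrue.prems show ?case by cases (use CondTrue in blast)+
next
  case (CondFalse s g q s' p) from CondFalse.prems show ?case by cases (use CondFalse in blast)+
next
  case (WhileTrue s g p s' t)
  from WhileTrue.prems show ?case
  proof cases
    case WhileFalse then show ?thesis using WhileTrue.hyps by blast
  next
    case (WhileTrue u) then show ?thesis using WhileTrue.IH by blast
  qed
next
  case (WhileFalse s g p) from WhileFalse.prems show ?case by cases (use WhileFalse.hyps in auto)
qed (auto elim: exec.cases)

definition tape :: "(nat \<Rightarrow> real \<times> real) measure" where
  "tape = Pi\<^sub>M UNIV (\<lambda>_. density lborel (\<lambda>x. ennreal (std_normal_density x)) \<Otimes>\<^sub>M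
                       density lborel (\<lambda>x. ennreal (exponential_density 1 x)))"

text \<open>
  The input: real arrays 0 to 4 hold \<open>A\<close>, \<open>b\<close>, \<open>c\<close>, \<open>v\<close> and \<open>\<delta>\<close>, index array 0 holds \<open>m\<close> and \<open>n\<close>.
  The output vector is expected in row 0 of real array 5.
\<close>
definition lp_input :: "rmat \<Rightarrow> rvec \<Rightarrow> rvec \<Rightarrow> rvec \<Rightarrow> real \<Rightarrow> state" where
  "lp_input A b c v \<delta> =
     \<lparr>idx = (\<lambda>a i. if (a, i) = (0, 0) then dim_row A else if (a, i) = (0, 1) then dim_col A else 0),
      reg = (\<lambda>a i j.
        if a = 0 \<and> i < dim_row A \<and> j < dim_col A then A $$ (i, j)
        else if a = 1 \<and> i = 0 \<and> j < dim_vec b then b $ j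
        else if a = 2 \<and> i = 0 \<and> j < dim_vec c then c $ j
        else if a = 3 \<and> i = 0 \<and> j < dim_vec v then v $ j
        else if a = 4 \<and> i = 0 \<and> j = 0 then \<delta>
        else 0),
      draws = 0, steps = 0, trace = []\<rparr>"

definition lp_output :: "nat \<Rightarrow> state \<Rightarrow> rvec" where
  "lp_output n s = reg_vec n s 5"

definition num_pivots :: "state \<Rightarrow> nat" where
  "num_pivots s = length (filter (is_basis_event \<circ> snd) (trace s)) - 1"

text \<open>The cost of a pivot is the number of steps since the previous event.\<close>
definition pivot_cost_le :: "real \<Rightarrow> state \<Rightarrow> bool" where
  "pivot_cost_le q s \<longleftrightarrow>
     (\<forall>k. Suc k < length (trace s) \<and> is_basis_event (snd (trace s ! Suc k)) \<longrightarrow>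
        real (fst (trace s ! Suc k)) - real (fst (trace s ! k)) \<le> q)"

text \<open>
  The final state \<open>s\<close> witnesses a shadow simplex run from the vertex \<open>v\<close> to a vertex maximizing
  \<open>c\<close>, which is the output.
\<close>
definition solves_lp :: "rmat \<Rightarrow> rvec \<Rightarrow> rvec \<Rightarrow> rvec \<Rightarrow> state \<Rightarrow> bool" where
  "solves_lp A b c v s \<longleftrightarrow>
     (let P = feasible_region A b; x = lp_output (dim_col A) s in
       (\<exists>B\<^sub>0 B. shadow_simplex A b B\<^sub>0 (map snd (trace s)) B \<and>
          basic_point A b B\<^sub>0 v \<and> basic_point A b B x) \<and>
       vertex P x \<and> (\<forall>y\<in>P. c \<bullet> y \<le> c \<bullet> x))"

text \<open>
  \<open>n\<^sup>3 / \<delta> * ln (n / \<delta>)\<close>.  Always \<open>\<delta> \<le> 1 \<le> n\<close>, and for \<open>n \<ge> 2\<close> the logarithm is bounded below by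
  \<open>ln 2\<close>, so that the maximum only changes the constant; for \<open>n = 1\<close> it is needed, since the logarithm
  vanishes at \<open>\<delta> = 1\<close> although one pivot can be necessary on an interval.
\<close>
definition pivot_bound :: "nat \<Rightarrow> real \<Rightarrow> real" where
  "pivot_bound n \<delta> = real n ^ 3 / \<delta> * max 1 (ln (real n / \<delta>))"

end

theory Submission
  imports Defs
begin

text \<open>
  The program is a shadow simplex method with two legs.  It first finds a basis \<open>B\<^sub>0\<close> at the given
  vertex, whose rows have the sum \<open>d\<close>, and then follows the optimal bases for the objectives
  \<open>d + t x\<close> and \<open>x + t c\<close> as \<open>t\<close> runs from \<open>0\<close> to infinity, where \<open>x\<close> is a standard Gaussian vector.
  Degeneracy is resolved lexicographically, by adding infinitesimal multiples of exponential
  variables to those right-hand sides that are not in \<open>B\<^sub>0\<close>; the lexicographically feasible bases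
  are then the maximal cones of a simplicial fan, which is complete because the polytope is bounded.

  A pivot is a crossing of a wall of this fan by the ray \<open>x + t e\<close> with \<open>e = d\<close> or \<open>e = c\<close>.
  Spreading the Gaussian mass of the crossing points over short segments that lead into the adjacent
  cone bounds the crossing probability by an integral, over \<open>t\<close> and over that cone, of the velocity
  transversal to the wall.  The cones have disjoint interiors, so that summing over all walls leaves
  one integral over \<open>t\<close>.  Write \<open>e\<close> as a nonnegative combination of the \<open>n\<close> rows of a basis that is
  optimal for it.  By the distance property the transversal velocity is at most \<open>n / \<delta>\<close> times the
  largest weight of a row which the current basis does not use, and such a weight \<open>w\<close> satisfies
  \<open>t w \<le> \<bar>x\<bar> / \<delta>\<close>.  Hence each of the \<open>n\<close> rows contributes an integral of the type of \<open>1 / t\<close> between two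
  bounds whose ratio is polynomial in \<open>n / \<delta>\<close>, which produces the logarithm.
\<close>


section \<open>Simplicial fans\<close>

text \<open>The distance property is assumed for feasible bases only. This is why the perturbation
  of the right-hand side is infinitesimal, so that lexicographically feasible bases remain feasible
  for \<open>b\<close>, and why weights are compared along segments covered by the cones
  (\<open>coef_lipschitz\<close>) instead of through arbitrary bases. The perturbing variables are
  positive and are switched off on \<open>B0\<close>, which keeps \<open>B0\<close>
  lexicographically feasible; their randomness excludes ties almost surely. The detour over
  \<open>x\<close> gives both legs one fixed and one Gaussian end, and reversing a ray only inverts
  its parameter, so one crossing estimate serves both. The power of \<open>n\<close> arises as
  follows: spreading costs \<open>1 / sqrt n\<close>, the moment of the weight is of order
  \<open>n ^ 2\<close>, every cone has \<open>n\<close> walls, and each of \<open>n\<close> rows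
  contributes an integral of order \<open>ln (n / \<delta>) / (sqrt n * \<delta>)\<close>. The setup
  of the tableau has cost \<open>O(m n ^ 2)\<close>, which the bound on all steps absorbs since
  \<open>pivot_bound\<close> is at least \<open>n\<close>. Executions form a relation, so
  expectations need a separate proof that the final state is a measurable function of the
  tape.\<close>

definition ip :: "nat \<Rightarrow> (nat \<Rightarrow> real) \<Rightarrow> (nat \<Rightarrow> real) \<Rightarrow> real" where
  "ip n x y = (\<Sum>l<n. x l * y l)"

lemma finite_has_max:
  fixes f :: "'a \<Rightarrow> real"
  assumes "finite A" "A \<noteq> {}"
  obtains x where "x \<in> A" "\<And>y. y \<in> A \<Longrightarrow> f y \<le> f x"
proof -
  have "Max (f ` A) \<in> f ` A" using assms by (intro Max_in) auto
  then obtain x where "x \<in> A" "f x = Max (f ` A)" by auto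
  then show thesis using assms(1) by (intro that[of x]) auto
qed

lemma ip_commute: "ip n x y = ip n y x"
  by (simp add: ip_def mult.commute)

lemma ip_add_right: "ip n x (\<lambda>l. y l + z l) = ip n x y + ip n x z"
  by (simp add: ip_def distrib_left sum.distrib)

lemma ip_diff_right: "ip n x (\<lambda>l. y l - z l) = ip n x y - ip n x z"
  by (simp add: ip_def right_diff_distrib sum_subtractf)

lemma ip_scale_right: "ip n x (\<lambda>l. c * y l) = c * ip n x y"
  by (simp add: ip_def sum_distrib_left mult_ac)

lemma ip_add_left: "ip n (\<lambda>l. y l + z l) x = ip n y x + ip n z x"
  by (simp add: ip_def distrib_right sum.distrib)

lemma ip_diff_left: "ip n (\<lambda>l. y l - z l) x = ip n y x - ip n z x"
  by (simp add: ip_def left_diff_distrib sum_subtractf)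

lemma ip_scale_left: "ip n (\<lambda>l. c * y l) x = c * ip n y x"
  by (simp add: ip_def sum_distrib_left mult_ac)

lemma ip_sum_right: "ip n x (\<lambda>l. \<Sum>i\<in>I. c i * f i l) = (\<Sum>i\<in>I. c i * ip n x (f i))"
  unfolding ip_def sum_distrib_left by (subst sum.swap) (simp add: mult_ac)

lemma ip_cong: "(\<And>l. l < n \<Longrightarrow> x l = x' l) \<Longrightarrow> (\<And>l. l < n \<Longrightarrow> y l = y' l) \<Longrightarrow> ip n x y = ip n x' y'"
  by (simp add: ip_def)

abbreviation nrm :: "nat \<Rightarrow> (nat \<Rightarrow> real) \<Rightarrow> real" where
  "nrm n x \<equiv> L2_set x {..<n}"

lemma nrm_sq: "(nrm n x)\<^sup>2 = ip n x x"
  by (simp add: L2_set_def ip_def power2_eq_square sum_nonneg)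

lemma ip_le_nrm: "\<bar>ip n x y\<bar> \<le> nrm n x * nrm n y"
proof -
  have "\<bar>ip n x y\<bar> \<le> (\<Sum>l<n. \<bar>x l\<bar> * \<bar>y l\<bar>)"
    unfolding ip_def by (rule order_trans[OF sum_abs]) (simp add: abs_mult)
  also have "\<dots> \<le> nrm n x * nrm n y" by (rule L2_set_mult_ineq)
  finally show ?thesis .
qed

text \<open>The \<open>u j\<close> are the columns of the inverse of the matrix with rows
  \<open>a j\<close>: pairing with \<open>u j\<close> reads off the coordinate at
  \<open>a j\<close>. Vectors are total functions of which only the entries below \<open>n\<close>
  count, so a dual system is determined only through \<open>ip n\<close>, not as a function.\<close>

definition dual_basis :: "nat \<Rightarrow> (nat \<Rightarrow> nat \<Rightarrow> real) \<Rightarrow> nat set \<Rightarrow> (nat \<Rightarrow> nat \<Rightarrow> real) \<Rightarrow> bool" where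
  "dual_basis n a B u \<longleftrightarrow> finite B \<and> card B = n \<and>
     (\<forall>i\<in>B. \<forall>j\<in>B. ip n (u j) (a i) = (if i = j then 1 else 0)) \<and>
     (\<forall>y. \<forall>l<n. y l = (\<Sum>j\<in>B. ip n (u j) y * a j l))"

lemma dual_basisD:
  assumes "dual_basis n a B u"
  shows "finite B" "card B = n"
    "\<And>i j. i \<in> B \<Longrightarrow> j \<in> B \<Longrightarrow> ip n (u j) (a i) = (if i = j then 1 else 0)"
    "\<And>y l. l < n \<Longrightarrow> y l = (\<Sum>j\<in>B. ip n (u j) y * a j l)"
  using assms unfolding dual_basis_def by blast+

lemma dual_basis_expand_right:
  assumes "dual_basis n a B u"
  shows "ip n x y = (\<Sum>j\<in>B. ip n (u j) y * ip n x (a j))"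
proof -
  have "ip n x y = ip n x (\<lambda>l. \<Sum>j\<in>B. ip n (u j) y * a j l)"
    by (rule ip_cong) (simp_all add: dual_basisD(4)[OF assms, of _ y])
  then show ?thesis by (simp add: ip_sum_right)
qed

lemma dual_basis_coord_unique:
  assumes d: "dual_basis n a B u" and y: "\<And>l. l < n \<Longrightarrow> y l = (\<Sum>j\<in>B. c j * a j l)" and "j \<in> B"
  shows "ip n (u j) y = c j"
proof -
  have "ip n (u j) y = ip n (u j) (\<lambda>l. \<Sum>j\<in>B. c j * a j l)"
    by (rule ip_cong) (simp_all add: y)
  also have "\<dots> = (\<Sum>i\<in>B. c i * (if i = j then 1 else 0))"
    unfolding ip_sum_right using dual_basisD(3)[OF d] \<open>j \<in> B\<close> by (intro sum.cong) auto
  finally show ?thesis using dual_basisD(1)[OF d] \<open>j \<in> B\<close> by (simp add: if_distrib cong: if_cong)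
qed

lemma dual_basis_unique:
  assumes "dual_basis n a B u" "dual_basis n a B u'" "j \<in> B"
  shows "ip n (u j) y = ip n (u' j) y"
  by (rule dual_basis_coord_unique[OF assms(1) _ assms(3)]) (rule dual_basisD(4)[OF assms(2)])

text \<open>Gauss-Jordan exchange. Solving the expansion of \<open>a r\<close> for
  \<open>a j\<close> requires exactly that its coordinate at \<open>j\<close> is nonzero;
  substituting the result into every other expansion gives \<open>u'\<close>.\<close>

lemma dual_basis_pivot:
  fixes a :: "nat \<Rightarrow> nat \<Rightarrow> real"
  assumes d: "dual_basis n a B u" and j: "j \<in> B" and r: "r \<notin> B" and nz: "ip n (u j) (a r) \<noteq> 0"
  defines "u' \<equiv> \<lambda>i l. if i = r then u j l / ip n (u j) (a r)
                      else u i l - ip n (u i) (a r) / ip n (u j) (a r) * u j l"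
  shows "dual_basis n a (insert r (B - {j})) u'"
proof -
  let ?t = "ip n (u j) (a r)"
  have fin: "finite B" by (rule dual_basisD(1)[OF d])
  have ur: "ip n (u' r) y = ip n (u j) y / ?t" for y
    using ip_scale_left[of n "1 / ?t" "u j" y] by (simp add: u'_def)
  have ui: "ip n (u' i) y = ip n (u i) y - ip n (u i) (a r) / ?t * ip n (u j) y" if "i \<noteq> r" for i y
    using that ip_diff_left[of n "u i" "\<lambda>l. ip n (u i) (a r) / ?t * u j l" y]
      ip_scale_left[of n "ip n (u i) (a r) / ?t" "u j" y] by (simp add: u'_def)
  have card: "card (insert r (B - {j})) = n"
    using fin r j dual_basisD(2)[OF d] card_Suc_Diff1[of B j] by simp
  have bi: "ip n (u' k) (a i) = (if i = k then 1 else 0)"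
    if "i \<in> insert r (B - {j})" "k \<in> insert r (B - {j})" for i k
  proof -
    have di: "\<And>p q. p \<in> B \<Longrightarrow> q \<in> B \<Longrightarrow> ip n (u q) (a p) = (if p = q then 1 else 0)"
      using dual_basisD(3)[OF d] .
    consider "k = r" "i = r" | "k = r" "i \<noteq> r" | "k \<noteq> r" "i = r" | "k \<noteq> r" "i \<noteq> r" by blast
    then show ?thesis
    proof cases
      case 1 then show ?thesis using nz by (simp add: ur)
    next
      case 2 then show ?thesis using that j di[of i j] by (simp add: ur)
    next
      case 3 then show ?thesis using that j nz by (simp add: ui)
    next
      case 4 then show ?thesis using that j di[of i j] di[of i k] by (auto simp add: ui)
    qed
  qed
  have ex: "y l = (\<Sum>k\<in>insert r (B - {j}). ip n (u' k) y * a k l)" if l: "l < n" for y l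
  proof -
    let ?s = "ip n (u j) y / ?t"
    have ar: "a r l = ?t * a j l + (\<Sum>k\<in>B - {j}. ip n (u k) (a r) * a k l)"
      using dual_basisD(4)[OF d l, of "a r"] sum.remove[OF fin j] by metis
    have yl: "y l = ip n (u j) y * a j l + (\<Sum>k\<in>B - {j}. ip n (u k) y * a k l)"
      using dual_basisD(4)[OF d l, of y] sum.remove[OF fin j] by metis
    have "(\<Sum>k\<in>insert r (B - {j}). ip n (u' k) y * a k l)
        = ip n (u' r) y * a r l + (\<Sum>k\<in>B - {j}. ip n (u' k) y * a k l)"
      using fin r by (subst sum.insert) auto
    also have "(\<Sum>k\<in>B - {j}. ip n (u' k) y * a k l)
        = (\<Sum>k\<in>B - {j}. ip n (u k) y * a k l - ?s * (ip n (u k) (a r) * a k l))"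
    proof (rule sum.cong[OF refl])
      fix k assume "k \<in> B - {j}"
      then have "k \<noteq> r" using r by auto
      then show "ip n (u' k) y * a k l = ip n (u k) y * a k l - ?s * (ip n (u k) (a r) * a k l)"
        using nz by (simp add: ui field_simps)
    qed
    also have "\<dots> = (\<Sum>k\<in>B - {j}. ip n (u k) y * a k l) - ?s * (\<Sum>k\<in>B - {j}. ip n (u k) (a r) * a k l)"
      by (simp add: sum_subtractf sum_distrib_left)
    also have "ip n (u' r) y * a r l + \<dots> = y l"
      unfolding yl using nz by (subst ar) (simp add: ur field_simps)
    finally show ?thesis by simp
  qed
  show ?thesis unfolding dual_basis_def using fin card bi ex by blast
qed

text \<open>Transports the exchange formulas to any dual system of the new set by uniqueness,
  because later duals are picked by choice (\<open>dual_of\<close>) and not computed by these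
  formulas.\<close>

lemma dual_basis_pivot_coord:
  assumes d: "dual_basis n a B u" and d': "dual_basis n a (insert r (B - {j})) u'"
    and j: "j \<in> B" and r: "r \<notin> B" and nz: "ip n (u j) (a r) \<noteq> 0"
  shows "ip n (u' r) y = ip n (u j) y / ip n (u j) (a r)"
    "\<And>i. i \<in> B - {j} \<Longrightarrow> ip n (u' i) y = ip n (u i) y - ip n (u i) (a r) / ip n (u j) (a r) * ip n (u j) y"
proof -
  let ?t = "ip n (u j) (a r)"
  define v where "v = (\<lambda>i l. if i = r then u j l / ?t else u i l - ip n (u i) (a r) / ?t * u j l)"
  have v: "dual_basis n a (insert r (B - {j})) v"
    using dual_basis_pivot[OF d j r nz] unfolding v_def .
  have eq: "ip n (u' i) y = ip n (v i) y" if "i \<in> insert r (B - {j})" for i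
    by (rule dual_basis_unique[OF d' v that])
  show "ip n (u' r) y = ip n (u j) y / ?t"
    using ip_scale_left[of n "1 / ?t" "u j" y] eq[of r] by (simp add: v_def)
  show "ip n (u' i) y = ip n (u i) y - ip n (u i) (a r) / ?t * ip n (u j) y" if "i \<in> B - {j}" for i
  proof -
    have "i \<noteq> r" using that r by auto
    then show ?thesis
      using ip_diff_left[of n "u i" "\<lambda>l. ip n (u i) (a r) / ?t * u j l" y] that
        ip_scale_left[of n "ip n (u i) (a r) / ?t" "u j" y] eq[of i] by (simp add: v_def)
  qed
qed

text \<open>\<open>\<B>\<close> stands for the feasible bases of a simple bounded polyhedron with
  right-hand side \<open>bs\<close>: by \<open>slack_pos\<close> no further constraint is tight at a
  vertex, and by \<open>pivot_ex\<close> each edge ends in another vertex. In \<open>dist\<close>,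
  \<open>1 / nrm n (u B j)\<close> is the distance of \<open>a j\<close> from the span of the other
  rows, so this is the \<delta>-distance property in dual form.\<close>

locale fan =
  fixes n m :: nat and a :: "nat \<Rightarrow> nat \<Rightarrow> real" and bs :: "nat \<Rightarrow> real" and \<B> :: "nat set set"
    and u :: "nat set \<Rightarrow> nat \<Rightarrow> nat \<Rightarrow> real" and \<delta> :: real
  assumes n_pos: "0 < n" and delta_pos: "0 < \<delta>"
    and finite_bases: "finite \<B>" and bases_ne: "\<B> \<noteq> {}"
    and bases_sub: "B \<in> \<B> \<Longrightarrow> B \<subseteq> {..<m}"
    and dual: "B \<in> \<B> \<Longrightarrow> dual_basis n a B (u B)"
    and slack_pos: "B \<in> \<B> \<Longrightarrow> k < m \<Longrightarrow> k \<notin> B \<Longrightarrow> 0 < bs k - (\<Sum>j\<in>B. bs j * ip n (u B j) (a k))"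
    and pivot_ex: "B \<in> \<B> \<Longrightarrow> j \<in> B \<Longrightarrow> \<exists>B'\<in>\<B>. B - {j} \<subseteq> B' \<and> j \<notin> B'"
    and dist: "B \<in> \<B> \<Longrightarrow> j \<in> B \<Longrightarrow> nrm n (u B j) * nrm n (a j) \<le> 1 / \<delta>"
begin

abbreviation co :: "nat set \<Rightarrow> nat \<Rightarrow> (nat \<Rightarrow> real) \<Rightarrow> real" where
  "co B j y \<equiv> ip n (u B j) y"

definition nonneg_on :: "nat set \<Rightarrow> (nat \<Rightarrow> real) \<Rightarrow> bool" where
  "nonneg_on B y \<longleftrightarrow> (\<forall>j\<in>B. 0 \<le> co B j y)"

definition vert :: "nat set \<Rightarrow> nat \<Rightarrow> real" where
  "vert B l = (\<Sum>j\<in>B. bs j * u B j l)"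

lemma finite_basis: "B \<in> \<B> \<Longrightarrow> finite B"
  using dual dual_basisD(1) by blast

lemma co_basis: "B \<in> \<B> \<Longrightarrow> i \<in> B \<Longrightarrow> j \<in> B \<Longrightarrow> co B j (a i) = (if i = j then 1 else 0)"
  using dual dual_basisD(3) by blast

lemma row_vert: "ip n (a k) (vert B) = (\<Sum>j\<in>B. bs j * co B j (a k))"
proof -
  have "ip n (a k) (vert B) = (\<Sum>j\<in>B. bs j * ip n (a k) (u B j))"
    unfolding vert_def[abs_def] by (rule ip_sum_right)
  then show ?thesis by (simp add: ip_commute[of n "a k"])
qed

lemma row_vert_basis: "B \<in> \<B> \<Longrightarrow> k \<in> B \<Longrightarrow> ip n (a k) (vert B) = bs k"
proof -
  assume B: "B \<in> \<B>" "k \<in> B"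
  have "ip n (a k) (vert B) = (\<Sum>j\<in>B. bs j * (if k = j then 1 else 0))"
    unfolding row_vert using co_basis[OF B] by (intro sum.cong refl) simp
  then show ?thesis using B finite_basis[of B] by (simp add: if_distrib cong: if_cong)
qed

lemma row_vert_less: "B \<in> \<B> \<Longrightarrow> k < m \<Longrightarrow> k \<notin> B \<Longrightarrow> ip n (a k) (vert B) < bs k"
  using slack_pos[of B k] by (simp add: row_vert)

lemma row_vert_le: "B \<in> \<B> \<Longrightarrow> k < m \<Longrightarrow> ip n (a k) (vert B) \<le> bs k"
  using row_vert_less[of B k] row_vert_basis[of B k] by (cases "k \<in> B") auto

lemma ip_expand: "B \<in> \<B> \<Longrightarrow> ip n y x = (\<Sum>i\<in>B. co B i y * ip n (a i) x)"
  using dual_basis_expand_right[OF dual, of B x y] by (simp add: ip_commute)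

text \<open>Duality gap: every row of \<open>B\<close> is tight at its vertex, so only the slacks of
  \<open>x\<close>, weighted by the coordinates of \<open>y\<close>, remain. Completeness of the fan
  and disjointness of its cones are read off from the signs of these terms.\<close>

lemma value_gap:
  assumes "B \<in> \<B>"
  shows "ip n y (vert B) - ip n y x = (\<Sum>i\<in>B. co B i y * (bs i - ip n (a i) x))"
proof -
  have "ip n y (vert B) = (\<Sum>i\<in>B. co B i y * bs i)"
    unfolding ip_expand[OF assms, of y "vert B"] using row_vert_basis[OF assms] by (intro sum.cong) auto
  then show ?thesis by (simp add: ip_expand[OF assms, of y x] sum_subtractf right_diff_distrib)
qed

text \<open>Complementary slackness: no two bases can both be optimal for \<open>y\<close> unless the rows used by one
  of them are tight at the vertex of the other, and only the basis itself is tight there.\<close>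
lemma support_subset:
  assumes "B \<in> \<B>" "B' \<in> \<B>" "nonneg_on B y" "nonneg_on B' y" "i \<in> B'" "co B' i y > 0"
  shows "i \<in> B"
proof (rule ccontr)
  assume "i \<notin> B"
  have nn: "0 \<le> (\<Sum>k\<in>B. co B k y * (bs k - ip n (a k) (vert B')))"
    using assms bases_sub row_vert_le unfolding nonneg_on_def
    by (intro sum_nonneg mult_nonneg_nonneg) (auto simp: subset_iff)
  have "0 < (\<Sum>k\<in>B'. co B' k y * (bs k - ip n (a k) (vert B)))"
  proof (rule sum_pos2[OF finite_basis[OF assms(2)] assms(5)])
    show "0 < co B' i y * (bs i - ip n (a i) (vert B))"
      using row_vert_less[OF assms(1) _ \<open>i \<notin> B\<close>] bases_sub[OF assms(2)] assms(5,6) by auto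
    show "0 \<le> co B' k y * (bs k - ip n (a k) (vert B))" if "k \<in> B'" for k
      using assms that bases_sub[OF assms(2)] row_vert_le[OF assms(1), of k] unfolding nonneg_on_def
      by (intro mult_nonneg_nonneg) auto
  qed
  then show False
    using nn value_gap[OF assms(1), of y "vert B'"] value_gap[OF assms(2), of y "vert B"] by linarith
qed

text \<open>All rows of \<open>B\<close> have positive weight, so \<open>support_subset\<close> puts
  \<open>B\<close> inside \<open>B'\<close>, and both have \<open>n\<close> elements.\<close>

lemma interior_disjoint:
  assumes "B \<in> \<B>" "B' \<in> \<B>" "\<forall>j\<in>B. 0 < co B j y" "nonneg_on B' y"
  shows "B = B'"
proof (rule card_subset_eq)
  show "finite B'" using assms finite_basis by blast
  have "nonneg_on B y" using assms(3) by (auto simp: nonneg_on_def less_imp_le)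
  then show "B \<subseteq> B'" using support_subset[OF assms(2,1,4)] assms(3) by blast
  show "card B = card B'" using dual[OF assms(1)] dual[OF assms(2)] dual_basisD(2) by metis
qed

text \<open>The simplex argument. At a vertex of maximal value for \<open>y\<close>, a negative
  coordinate would make the neighbour from \<open>pivot_ex\<close> strictly better: the two bases
  share all other rows, so the gap consists of a single term.\<close>

lemma fan_complete: "\<exists>B\<in>\<B>. nonneg_on B y"
proof -
  obtain B where B: "B \<in> \<B>" and mx: "\<And>B'. B' \<in> \<B> \<Longrightarrow> ip n y (vert B') \<le> ip n y (vert B)"
    using finite_has_max[OF finite_bases bases_ne, of "\<lambda>B. ip n y (vert B)"] by blast
  have "0 \<le> co B j y" if j: "j \<in> B" for j
  proof (rule ccontr)
    assume neg: "\<not> 0 \<le> co B j y"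
    obtain B' where B': "B' \<in> \<B>" "B - {j} \<subseteq> B'" "j \<notin> B'" using pivot_ex[OF B j] by blast
    have jm: "j < m" using bases_sub[OF B] j by auto
    have "ip n y (vert B) - ip n y (vert B') = (\<Sum>i\<in>B. co B i y * (bs i - ip n (a i) (vert B')))"
      by (rule value_gap[OF B])
    also have "\<dots> = co B j y * (bs j - ip n (a j) (vert B'))"
      using row_vert_basis[OF B'(1)] B'(2) j
      by (subst sum.remove[OF finite_basis[OF B] j]) (auto intro!: sum.neutral)
    also have "\<dots> < 0"
      using neg row_vert_less[OF B'(1) jm B'(3)] by (auto simp: mult_less_0_iff)
    finally show False using mx[OF B'(1)] by simp
  qed
  then show ?thesis using B unfolding nonneg_on_def by blast
qed

text \<open>Weight of row \<open>k\<close> in the expansion of \<open>y\<close> along a cone that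
  contains it. Cones overlap in common faces, where \<open>coef_eq\<close> shows that the choice
  does not matter.\<close>

definition coef :: "nat \<Rightarrow> (nat \<Rightarrow> real) \<Rightarrow> real" where
  "coef k y = (let B = (SOME B. B \<in> \<B> \<and> nonneg_on B y) in if k \<in> B then co B k y else 0)"

lemma coef_eq:
  assumes B: "B \<in> \<B>" "nonneg_on B y"
  shows "coef k y = (if k \<in> B then co B k y else 0)"
proof -
  define B' where "B' = (SOME B. B \<in> \<B> \<and> nonneg_on B y)"
  have B': "B' \<in> \<B>" "nonneg_on B' y"
    using someI[of "\<lambda>B. B \<in> \<B> \<and> nonneg_on B y" B] B unfolding B'_def by auto
  \<comment> \<open>A row with positive weight in \<open>B'\<close> already lies in \<open>B\<close>
    by \<open>support_subset\<close>, so expanding \<open>y\<close> in \<open>B'\<close> and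
    applying \<open>co B k\<close> leaves only the term for \<open>k\<close>.\<close>
  have key: "co B k y = (if k \<in> B' then co B' k y else 0)"
    if "B \<in> \<B>" "nonneg_on B y" "B' \<in> \<B>" "nonneg_on B' y" "k \<in> B" for B B'
  proof -
    have "co B k y = (\<Sum>i\<in>B'. co B' i y * co B k (a i))"
      using dual_basis_expand_right[OF dual[OF that(3)]] by blast
    also have "\<dots> = (\<Sum>i\<in>B'. if i = k then co B' i y else 0)"
    proof (rule sum.cong[OF refl])
      fix i assume i: "i \<in> B'"
      show "co B' i y * co B k (a i) = (if i = k then co B' i y else 0)"
      proof (cases "co B' i y = 0")
        case False
        then have "0 < co B' i y" using that(4) i unfolding nonneg_on_def by force
        then have "i \<in> B" using support_subset[OF that(1,3,2,4) i] by simp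
        then show ?thesis using co_basis[OF that(1) _ that(5)] by simp
      qed auto
    qed
    finally show ?thesis using finite_basis[OF that(3)] by simp
  qed
  have "(if k \<in> B' then co B' k y else 0) = (if k \<in> B then co B k y else 0)"
    using key[OF B B'] key[OF B' B] by auto
  then show ?thesis unfolding coef_def B'_def[symmetric] Let_def .
qed

lemma nrm_row_pos: "B \<in> \<B> \<Longrightarrow> j \<in> B \<Longrightarrow> 0 < nrm n (a j)"
proof -
  assume B: "B \<in> \<B>" "j \<in> B"
  have "1 \<le> nrm n (u B j) * nrm n (a j)"
    using co_basis[OF B(1) B(2) B(2)] ip_le_nrm[where x="u B j" and y="a j" and n=n] by simp
  then show ?thesis by (cases "nrm n (a j) = 0") (auto simp: less_le)
qed

lemma co_bound:
  assumes "B \<in> \<B>" "j \<in> B"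
  shows "\<bar>co B j y\<bar> * nrm n (a j) \<le> nrm n y / \<delta>"
proof -
  have "\<bar>co B j y\<bar> * nrm n (a j) \<le> nrm n (u B j) * nrm n y * nrm n (a j)"
    by (intro mult_right_mono ip_le_nrm) simp
  also have "\<dots> = (nrm n (u B j) * nrm n (a j)) * nrm n y" by simp
  also have "\<dots> \<le> (1 / \<delta>) * nrm n y" by (intro mult_right_mono dist assms) simp
  finally show ?thesis by simp
qed

text \<open>On one cone the weight is linear with slope controlled by \<open>co_bound\<close>. The
  closed cones are finitely many and cover the segment from \<open>z\<close> to \<open>y\<close>, so
  the same constant holds along all of it. Only bases of the fan enter, which is what makes the
  local distance property suffice.\<close>

lemma coef_lipschitz:
  assumes "0 < nrm n (a k)"
  shows "\<bar>coef k y - coef k z\<bar> * nrm n (a k) \<le> nrm n (\<lambda>l. y l - z l) / \<delta>"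
proof -
  let ?d = "\<lambda>l. y l - z l"
  define g where "g = (\<lambda>t::real. \<lambda>l. z l + t * ?d l)"
  define L where "L = nrm n ?d / (\<delta> * nrm n (a k))"
  have L0: "0 \<le> L" using assms delta_pos by (simp add: L_def)
  have cog: "co B j (g t) = co B j z + t * co B j ?d" for B j t
    unfolding g_def by (simp add: ip_add_right ip_scale_right)
  define U where "U = (\<lambda>B. {t. nonneg_on B (g t)})"
  have "lipschitz_on L {0..1} (\<lambda>t. coef k (g t))"
  proof (rule lipschitz_on_closed_Union[OF _ _ finite_bases L0])
    fix B assume B: "B \<in> \<B>"
    show "closed (U B)"
      unfolding U_def nonneg_on_def cog Ball_def
      by (intro closed_Collect_all closed_Collect_imp open_Collect_const closed_Collect_le continuous_intros)
    show "lipschitz_on L (U B) (\<lambda>t. coef k (g t))"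
    proof (rule lipschitz_onI[OF _ L0])
      fix s t assume "s \<in> U B" "t \<in> U B"
      then have eq: "coef k (g s) = (if k \<in> B then co B k (g s) else 0)"
        "coef k (g t) = (if k \<in> B then co B k (g t) else 0)"
        using coef_eq[OF B] by (auto simp: U_def)
      show "dist (coef k (g s)) (coef k (g t)) \<le> L * dist s t"
      proof (cases "k \<in> B")
        case True
        have "\<bar>co B k ?d\<bar> \<le> L"
          using co_bound[OF B True, of ?d] assms delta_pos by (simp add: L_def field_simps)
        then have "\<bar>s - t\<bar> * \<bar>co B k ?d\<bar> \<le> \<bar>s - t\<bar> * L" by (intro mult_left_mono) auto
        moreover have "co B k (g s) - co B k (g t) = (s - t) * co B k ?d"
          by (simp add: cog algebra_simps)
        ultimately show ?thesis
          using True by (simp add: eq dist_real_def abs_mult mult.commute)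
      qed (use L0 eq in simp)
    qed
  next
    show "{0..1} \<subseteq> \<Union> (U ` \<B>)" using fan_complete by (auto simp: U_def)
  qed
  then have "dist (coef k (g 1)) (coef k (g 0)) \<le> L * dist 1 (0::real)"
    by (rule lipschitz_onD) auto
  moreover have "coef k (g 1) = coef k y" "coef k (g 0) = coef k z" by (simp_all add: g_def)
  ultimately have "\<bar>coef k y - coef k z\<bar> \<le> L" by (simp add: dist_real_def)
  then show ?thesis using assms delta_pos by (simp add: L_def field_simps)
qed

text \<open>While the row \<open>k\<close>, which the objective \<open>e\<close> uses, is not used by the objective \<open>x + \<theta>e\<close>, its
  weight \<open>\<theta>e\<^sub>k\<close> is at most of the order of the perturbation \<open>x\<close>.  The rows of this kind carry all the
  velocity transversal to the facet that is crossed.\<close>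
lemma crossing_scale:
  assumes Bs: "Bs \<in> \<B>" "nonneg_on Bs e" and B: "B \<in> \<B>" "j \<in> B" and ne: "co B j e \<noteq> 0"
  obtains k where "k \<in> Bs" "0 < co Bs k e * nrm n (a k)"
    "\<bar>co B j e\<bar> * nrm n (a j) \<le> real n / \<delta> * (co Bs k e * nrm n (a k))"
    "\<And>x \<theta>. 0 \<le> \<theta> \<Longrightarrow> nonneg_on B (\<lambda>l. x l + \<theta> * e l) \<Longrightarrow> co B j (\<lambda>l. x l + \<theta> * e l) = 0 \<Longrightarrow>
       \<theta> * (co Bs k e * nrm n (a k)) \<le> nrm n x / \<delta>"
proof -
  \<comment> \<open>Rows in \<open>B - {j}\<close> have coordinate 0 at \<open>j\<close>, so only
    \<open>K\<close> carries the velocity. The row \<open>j\<close> itself stays in \<open>K\<close>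
    if it lies in \<open>Bs\<close>, because its weight vanishes on the wall as well.\<close>
  define K where "K = Bs - (B - {j})"
  define w where "w = (\<lambda>k. co Bs k e * nrm n (a k))"
  have finBs: "finite Bs" using finite_basis[OF Bs(1)] .
  then have finK: "finite K" by (simp add: K_def)
  have cardBs: "card Bs = n" using dual_basisD(2)[OF dual[OF Bs(1)]] .
  have w0: "0 \<le> w k" if "k \<in> Bs" for k using Bs(2) that by (simp add: w_def nonneg_on_def)
  have "co B j e = (\<Sum>k\<in>Bs. co Bs k e * co B j (a k))"
    by (rule dual_basis_expand_right[OF dual[OF Bs(1)]])
  also have "\<dots> = (\<Sum>k\<in>K. co Bs k e * co B j (a k))"
    using finBs co_basis[OF B(1) _ B(2)] by (intro sum.mono_neutral_right) (auto simp: K_def)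
  finally have "co B j e = (\<Sum>k\<in>K. co Bs k e * co B j (a k))" .
  then have "\<bar>co B j e\<bar> * nrm n (a j) \<le> (\<Sum>k\<in>K. \<bar>co Bs k e * co B j (a k)\<bar>) * nrm n (a j)"
    by (intro mult_right_mono) (auto intro: sum_abs)
  also have "\<dots> = (\<Sum>k\<in>K. co Bs k e * (\<bar>co B j (a k)\<bar> * nrm n (a j)))"
    unfolding sum_distrib_right using Bs(2)
    by (intro sum.cong refl) (auto simp: K_def nonneg_on_def abs_mult mult_ac)
  also have "\<dots> \<le> (\<Sum>k\<in>K. co Bs k e * (nrm n (a k) / \<delta>))"
    using Bs(2) by (intro sum_mono mult_left_mono co_bound[OF B]) (auto simp: K_def nonneg_on_def)
  also have "\<dots> = (\<Sum>k\<in>K. w k) / \<delta>" by (simp add: w_def sum_divide_distrib)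
  finally have le: "\<bar>co B j e\<bar> * nrm n (a j) \<le> (\<Sum>k\<in>K. w k) / \<delta>" .
  have pos: "0 < \<bar>co B j e\<bar> * nrm n (a j)" using ne nrm_row_pos[OF B] by simp
  have "K \<noteq> {}" using le pos by auto
  then obtain k where k: "k \<in> K" and mx: "\<And>i. i \<in> K \<Longrightarrow> w i \<le> w k"
    using finite_has_max[OF finK, of w] by blast
  have kB: "k \<in> Bs" using k by (simp add: K_def)
  have "(\<Sum>i\<in>K. w i) \<le> real (card K) * w k" using sum_bounded_above[of K w "w k"] mx by simp
  also have "\<dots> \<le> real n * w k"
    using w0[OF kB] card_mono[OF finBs, of K] cardBs by (intro mult_right_mono) (auto simp: K_def)
  finally have le2: "\<bar>co B j e\<bar> * nrm n (a j) \<le> real n / \<delta> * w k"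
    using le delta_pos by (simp add: field_simps)
  moreover have "0 < w k" using le2 pos w0[OF kB] delta_pos by (cases "w k = 0") auto
  moreover have "\<theta> * w k \<le> nrm n x / \<delta>"
    if lam: "0 \<le> \<theta>" and nn: "nonneg_on B (\<lambda>l. x l + \<theta> * e l)" and z: "co B j (\<lambda>l. x l + \<theta> * e l) = 0" for x \<theta>
  proof -
    let ?z = "\<lambda>l. x l + \<theta> * e l"
    have z0: "coef k ?z = 0" using coef_eq[OF B(1) nn, of k] k z by (auto simp: K_def)
    have "nonneg_on Bs (\<lambda>l. \<theta> * e l)"
      using Bs(2) lam by (simp add: nonneg_on_def ip_scale_right)
    then have e1: "coef k (\<lambda>l. \<theta> * e l) = \<theta> * co Bs k e"
      using coef_eq[OF Bs(1), of "\<lambda>l. \<theta> * e l" k] kB by (simp add: ip_scale_right)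
    \<comment> \<open>The two points differ by \<open>x\<close>, and the weight of \<open>k\<close>
      is zero at the first and \<open>\<theta> * co Bs k e\<close> at the second.\<close>
    have "\<bar>coef k ?z - coef k (\<lambda>l. \<theta> * e l)\<bar> * nrm n (a k) \<le> nrm n x / \<delta>"
      using coef_lipschitz[OF nrm_row_pos[OF Bs(1) kB], of ?z "\<lambda>l. \<theta> * e l"] by simp
    moreover have "0 \<le> \<theta> * co Bs k e" using Bs(2) kB lam by (simp add: nonneg_on_def)
    ultimately show ?thesis by (simp add: z0 e1 w_def)
  qed
  ultimately show thesis using that[OF kB] unfolding w_def by blast
qed

end


section \<open>Gaussian vectors\<close>

definition gauss :: "real measure" where
  "gauss = density lborel (\<lambda>x. ennreal (std_normal_density x))"

definition gaussn :: "nat \<Rightarrow> (nat \<Rightarrow> real) measure" where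
  "gaussn n = Pi\<^sub>M {..<n} (\<lambda>_. gauss)"

lemma sets_gauss [measurable_cong, simp]: "sets gauss = sets borel"
  by (simp add: gauss_def)

lemma space_gauss [simp]: "space gauss = UNIV"
  by (simp add: gauss_def)

interpretation gauss: prob_space gauss
  unfolding gauss_def by (rule prob_space_normal_density) simp

interpretation gauss_prod: product_prob_space "\<lambda>_::nat. gauss" I for I ..

interpretation gaussn: prob_space "gaussn n" for n
  unfolding gaussn_def by (rule prob_space_PiM) (rule gauss.prob_space_axioms)

lemma space_gaussn: "space (gaussn n) = {..<n} \<rightarrow>\<^sub>E UNIV"
  by (simp add: gaussn_def space_PiM)

lemma component_gaussn:
  "f \<in> M \<rightarrow>\<^sub>M gaussn n \<Longrightarrow> l < n \<Longrightarrow> (\<lambda>x. f x l) \<in> borel_measurable M"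
  using measurable_compose[of f M "gaussn n" "\<lambda>x. x l" gauss]
    measurable_component_singleton[of l "{..<n}" "\<lambda>_. gauss"]
  by (simp add: gaussn_def measurable_cong_sets[OF refl sets_gauss])

lemma ip_measurable [measurable (raw)]:
  "f \<in> M \<rightarrow>\<^sub>M gaussn n \<Longrightarrow> (\<lambda>x. ip n u (f x)) \<in> borel_measurable M"
  unfolding ip_def by (intro borel_measurable_sum borel_measurable_times borel_measurable_const component_gaussn) auto

lemma ip_self_measurable [measurable (raw)]:
  "f \<in> M \<rightarrow>\<^sub>M gaussn n \<Longrightarrow> (\<lambda>x. ip n (f x) (f x)) \<in> borel_measurable M"
  unfolding ip_def by (intro borel_measurable_sum borel_measurable_times component_gaussn) auto

lemma nn_integral_gauss:
  "f \<in> borel_measurable borel \<Longrightarrow> (\<integral>\<^sup>+x. f x \<partial>gauss) = (\<integral>\<^sup>+x. ennreal (std_normal_density x) * f x \<partial>lborel)"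
  unfolding gauss_def by (rule nn_integral_density) auto

lemma gauss_shift:
  assumes A: "A \<in> sets borel"
  shows "(\<integral>\<^sup>+x. ennreal (exp (- (s * x) - s * s / 2)) * indicator A (x + s) \<partial>gauss) = emeasure gauss A"
proof -
  have [measurable]: "A \<in> sets borel" by fact
  have eq: "std_normal_density x * exp (- (s * x) - s * s / 2) = std_normal_density (s + 1 * x)" for x
    by (simp add: std_normal_density_def exp_add[symmetric] power2_eq_square field_simps)
  have "(\<integral>\<^sup>+x. ennreal (exp (- (s * x) - s * s / 2)) * indicator A (x + s) \<partial>gauss)
      = (\<integral>\<^sup>+x. ennreal (std_normal_density (s + 1 * x)) * indicator A (s + 1 * x) \<partial>lborel)"
  proof (subst nn_integral_gauss)
    show "(\<integral>\<^sup>+x. ennreal (std_normal_density x) * (ennreal (exp (- (s * x) - s * s / 2)) * indicator A (x + s)) \<partial>lborel)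
      = (\<integral>\<^sup>+x. ennreal (std_normal_density (s + 1 * x)) * indicator A (s + 1 * x) \<partial>lborel)"
      unfolding eq[symmetric] by (intro nn_integral_cong) (simp add: ennreal_mult' mult.assoc add.commute)
  qed measurable
  also have "\<dots> = (\<integral>\<^sup>+x. ennreal (std_normal_density x) * indicator A x \<partial>lborel)"
    using nn_integral_real_affine[of "\<lambda>x. ennreal (std_normal_density x) * indicator A x" 1 s] by simp
  also have "\<dots> = emeasure gauss A"
    by (subst nn_integral_gauss[symmetric]) auto
  finally show ?thesis .
qed

text \<open>Points of the product space are fixed to a default value outside \<open>{..<n}\<close>,
  hence the restriction; it makes opposite shifts inverse to each other on that space.\<close>

definition shift :: "nat \<Rightarrow> (nat \<Rightarrow> real) \<Rightarrow> (nat \<Rightarrow> real) \<Rightarrow> nat \<Rightarrow> real" where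
  "shift n s x = restrict (\<lambda>i. x i + s i) {..<n}"

lemma shift_measurable [measurable]: "shift n s \<in> gaussn n \<rightarrow>\<^sub>M gaussn n"
proof -
  have "(\<lambda>x. restrict (\<lambda>i. x i + s i) {..<n}) \<in> gaussn n \<rightarrow>\<^sub>M Pi\<^sub>M {..<n} (\<lambda>_. gauss)"
  proof (rule measurable_restrict)
    fix i assume "i \<in> {..<n}"
    then have "(\<lambda>x. x i + s i) \<in> borel_measurable (gaussn n)"
      by (intro borel_measurable_add borel_measurable_const component_gaussn) auto
    then show "(\<lambda>x. x i + s i) \<in> gaussn n \<rightarrow>\<^sub>M gauss" by (simp add: measurable_cong_sets[OF refl sets_gauss])
  qed
  then show ?thesis by (simp add: gaussn_def shift_def[abs_def])
qed

lemma ip_shift: "ip n y (shift n s x) = ip n y x + ip n y s"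
  unfolding ip_add_right[symmetric] by (rule ip_cong) (auto simp: shift_def)

text \<open>Cameron-Martin formula. The reweighted and shifted measure agrees with the product
  measure on boxes, where both factor into the one-dimensional identity
  \<open>gauss_shift\<close>.\<close>

lemma gaussn_shift:
  assumes G[measurable]: "G \<in> borel_measurable (gaussn n)"
  shows "(\<integral>\<^sup>+x. G x \<partial>gaussn n)
    = (\<integral>\<^sup>+x. ennreal (exp (- ip n s x - ip n s s / 2)) * G (shift n s x) \<partial>gaussn n)"
proof -
  let ?w = "\<lambda>x. ennreal (exp (- ip n s x - ip n s s / 2))"
  let ?P = "distr (density (gaussn n) ?w) (gaussn n) (shift n s)"
  have "?P = Pi\<^sub>M {..<n} (\<lambda>_. gauss)"
  proof (rule gauss_prod.PiM_eqI)
    show "sets ?P = sets (Pi\<^sub>M {..<n} (\<lambda>_. gauss))" by (simp add: gaussn_def)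
    fix A :: "nat \<Rightarrow> real set" assume A: "\<And>i. i \<in> {..<n} \<Longrightarrow> A i \<in> sets gauss"
    let ?A = "Pi\<^sub>E {..<n} A"
    have Am[measurable]: "?A \<in> sets (gaussn n)"
      unfolding gaussn_def using A by (intro sets_PiM_I_finite) auto
    have "emeasure ?P ?A = emeasure (density (gaussn n) ?w) (shift n s -` ?A \<inter> space (gaussn n))"
      by (subst emeasure_distr) auto
    also have "\<dots> = (\<integral>\<^sup>+x. ?w x * indicator (shift n s -` ?A \<inter> space (gaussn n)) x \<partial>gaussn n)"
      by (subst emeasure_density) auto
    also have "\<dots> = (\<integral>\<^sup>+x. (\<Prod>i\<in>{..<n}. ennreal (exp (- (s i * x i) - s i * s i / 2)) * indicator (A i) (x i + s i)) \<partial>gaussn n)"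
    proof (rule nn_integral_cong)
      fix x assume x: "x \<in> space (gaussn n)"
      have "(\<Prod>i<n. ennreal (exp (- (s i * x i) - s i * s i / 2))) = ?w x"
        by (simp add: prod_ennreal exp_sum[symmetric] ip_def sum_subtractf sum_negf sum_divide_distrib)
      moreover have "(\<Prod>i<n. indicator (A i) (x i + s i)) = (indicator (shift n s -` ?A \<inter> space (gaussn n)) x :: ennreal)"
      proof (cases "shift n s x \<in> ?A")
        case True
        then have "\<And>i. i < n \<Longrightarrow> x i + s i \<in> A i" by (auto simp: shift_def PiE_iff)
        then show ?thesis using True x by simp
      next
        case False
        then obtain i where "i < n" "x i + s i \<notin> A i" by (auto simp: shift_def PiE_iff)
        then have "(\<Prod>i<n. indicator (A i) (x i + s i)) = (0::ennreal)"
            by (intro prod_zero bexI[of _ i]) auto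
        then show ?thesis using False by simp
      qed
      ultimately show "?w x * indicator (shift n s -` ?A \<inter> space (gaussn n)) x
        = (\<Prod>i\<in>{..<n}. ennreal (exp (- (s i * x i) - s i * s i / 2)) * indicator (A i) (x i + s i))"
        by (simp add: prod.distrib)
    qed
    also have "\<dots> = (\<Prod>i\<in>{..<n}. \<integral>\<^sup>+x. ennreal (exp (- (s i * x) - s i * s i / 2)) * indicator (A i) (x + s i) \<partial>gauss)"
      unfolding gaussn_def
    proof (intro gauss_prod.product_nn_integral_prod)
      fix i assume "i \<in> {..<n}"
      then have [measurable]: "A i \<in> sets borel" using A[of i] by simp
      show "(\<lambda>x. ennreal (exp (- (s i * x) - s i * s i / 2)) * indicator (A i) (x + s i)) \<in> borel_measurable gauss"
        by measurable
    qed simp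
    also have "\<dots> = (\<Prod>i\<in>{..<n}. emeasure gauss (A i))"
      using A by (intro prod.cong refl gauss_shift) auto
    finally show "emeasure ?P ?A = (\<Prod>i\<in>{..<n}. emeasure gauss (A i))" .
  qed simp
  then have "(\<integral>\<^sup>+x. G x \<partial>gaussn n) = (\<integral>\<^sup>+x. G x \<partial>?P)" by (simp add: gaussn_def)
  also have "\<dots> = (\<integral>\<^sup>+x. G (shift n s x) \<partial>density (gaussn n) ?w)"
    by (rule nn_integral_distr) auto
  also have "\<dots> = (\<integral>\<^sup>+x. ?w x * G (shift n s x) \<partial>gaussn n)"
    by (rule nn_integral_density) auto
  finally show ?thesis .
qed

lemma gaussn_component:
  assumes "l < n" and [measurable]: "f \<in> borel_measurable borel"
  shows "(\<integral>\<^sup>+x. f (x l) \<partial>gaussn n) = (\<integral>\<^sup>+x. f x \<partial>gauss)"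
proof -
  have "(\<integral>\<^sup>+x. f x \<partial>gauss) = (\<integral>\<^sup>+x. f x \<partial>distr (Pi\<^sub>M {..<n} (\<lambda>_. gauss)) gauss (\<lambda>x. x l))"
    using assms(1) by (subst gauss_prod.PiM_component) auto
  also have "\<dots> = (\<integral>\<^sup>+x. f (x l) \<partial>gaussn n)"
    unfolding gaussn_def using assms
    by (intro nn_integral_distr) (auto simp: measurable_cong_sets[OF sets_gauss refl])
  finally show ?thesis by simp
qed

section \<open>Moments of Gaussian vectors\<close>

lemma gauss_moment_even:
  "(\<integral>\<^sup>+x. ennreal (x ^ (2 * k)) \<partial>gauss) = ennreal (fact (2 * k) / (2 ^ k * fact k))"
proof -
  have "(\<integral>\<^sup>+x. ennreal (x ^ (2 * k)) \<partial>gauss) = (\<integral>\<^sup>+x. ennreal (std_normal_density x * x ^ (2 * k)) \<partial>lborel)"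
    by (subst nn_integral_gauss) (auto simp: ennreal_mult')
  also have "\<dots> = ennreal (fact (2 * k) / (2 ^ k * fact k))"
    using std_normal_moment_even[of k]
    by (subst nn_integral_eq_integral)
      (auto simp: has_bochner_integral_iff zero_le_even_power mult_nonneg_nonneg)
  finally show ?thesis .
qed

text \<open>By Cauchy-Schwarz the square of \<open>ip n x x\<close> is at most \<open>n\<close>
  times the sum of the fourth powers, so only the moments 1 and 3 of a single coordinate enter:
  \<open>9 + 12 * 1 + 4 * 3 = 33\<close>.\<close>

lemma fourth_moment:
  "(\<integral>\<^sup>+x. ennreal ((3 * real n + 2 * ip n x x)\<^sup>2) \<partial>gaussn n) \<le> ennreal (33 * (real n)\<^sup>2)"
proof -
  let ?N = "real n"
  have le: "(3 * ?N + 2 * ip n x x)\<^sup>2 \<le> 9 * ?N\<^sup>2 + (\<Sum>l<n. 12 * ?N * (x l) ^ 2 + 4 * ?N * (x l) ^ 4)" for x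
  proof -
    have "(\<Sum>l<n. (x l)\<^sup>2 * 1)\<^sup>2 \<le> (\<Sum>l<n. ((x l)\<^sup>2)\<^sup>2) * (\<Sum>l<n. 1\<^sup>2)"
      by (rule Cauchy_Schwarz_ineq_sum)
    then have "(ip n x x)\<^sup>2 \<le> ?N * (\<Sum>l<n. (x l) ^ 4)"
      by (simp add: ip_def power2_eq_square power4_eq_xxxx mult_ac)
    moreover have "ip n x x = (\<Sum>l<n. (x l) ^ 2)" by (simp add: ip_def power2_eq_square)
    ultimately show ?thesis
      by (simp add: power2_sum sum.distrib sum_distrib_left[symmetric] power_mult_distrib algebra_simps)
  qed
  have m2: "(\<integral>\<^sup>+x. ennreal (x ^ 2) \<partial>gauss) = 1"
    using gauss_moment_even[of 1] by (simp add: fact_numeral)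
  have m4: "(\<integral>\<^sup>+x. ennreal (x ^ 4) \<partial>gauss) = ennreal 3"
    using gauss_moment_even[of 2] by (simp add: fact_numeral)
  have "(\<integral>\<^sup>+x. ennreal ((3 * ?N + 2 * ip n x x)\<^sup>2) \<partial>gaussn n)
      \<le> (\<integral>\<^sup>+x. ennreal (9 * ?N\<^sup>2) + (\<Sum>l<n. ennreal (12 * ?N) * ennreal ((x l) ^ 2) + ennreal (4 * ?N) * ennreal ((x l) ^ 4)) \<partial>gaussn n)"
    using le by (intro nn_integral_mono)
      (simp add: sum_nonneg ennreal_mult'[symmetric] ennreal_plus[symmetric] del: ennreal_plus)
  also have "\<dots> = ennreal (9 * ?N\<^sup>2) + (\<Sum>l<n. ennreal (12 * ?N) * 1 + ennreal (4 * ?N) * ennreal 3)"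
  proof -
    have [measurable]: "(\<lambda>x. x l) \<in> borel_measurable (gaussn n)" if "l < n" for l
      using that by (intro component_gaussn) auto
    have "(\<integral>\<^sup>+x. ennreal (12 * ?N) * ennreal ((x l) ^ 2) + ennreal (4 * ?N) * ennreal ((x l) ^ 4) \<partial>gaussn n)
        = ennreal (12 * ?N) * 1 + ennreal (4 * ?N) * ennreal 3" if [simp]: "l < n" for l
      using gaussn_component[of l n "\<lambda>x. ennreal (x ^ 2)"] gaussn_component[of l n "\<lambda>x. ennreal (x ^ 4)"] m2 m4
      by (subst nn_integral_add) (simp_all add: nn_integral_cmult)
    then have "(\<integral>\<^sup>+x. (\<Sum>l<n. ennreal (12 * ?N) * ennreal ((x l) ^ 2) + ennreal (4 * ?N) * ennreal ((x l) ^ 4)) \<partial>gaussn n)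
        = (\<Sum>l<n. ennreal (12 * ?N) * 1 + ennreal (4 * ?N) * ennreal 3)"
      by (subst nn_integral_sum) auto
    then show ?thesis
      by (subst nn_integral_add) (auto simp: gaussn.emeasure_space_1)
  qed
  also have "\<dots> = ennreal (33 * ?N\<^sup>2)"
  proof -
    have "ennreal (12 * ?N) * 1 + ennreal (4 * ?N) * ennreal 3 = ennreal (24 * ?N)"
      by (simp add: ennreal_mult'[symmetric] ennreal_plus[symmetric] del: ennreal_plus ennreal_numeral)
    then have "ennreal (9 * ?N\<^sup>2) + (\<Sum>l<n. ennreal (12 * ?N) * 1 + ennreal (4 * ?N) * ennreal 3)
        = ennreal (9 * ?N\<^sup>2) + ennreal (\<Sum>l<n. 24 * ?N)"
      by (subst sum_ennreal[symmetric]) auto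
    also have "\<dots> = ennreal (33 * ?N\<^sup>2)"
      by (subst ennreal_plus[symmetric]) (auto simp: power2_eq_square)
    finally show ?thesis .
  qed
  finally show ?thesis .
qed


section \<open>Flux through the walls of a fan\<close>

lemma nn_integral_inverse_Icc:
  assumes "0 < p" "p \<le> q"
  shows "(\<integral>\<^sup>+x. ennreal (1 / x) * indicator {p..q} x \<partial>lborel) = ennreal (ln (q / p))"
proof -
  have "(\<integral>\<^sup>+x. ennreal (1 / x) * indicator {p..q} x \<partial>lborel) = ennreal (ln q - ln p)"
    using assms by (intro nn_integral_FTC_Icc) (auto intro!: derivative_eq_intros simp: divide_inverse)
  then show ?thesis using assms by (simp add: ln_div)
qed

lemma nn_integral_inverse_square_atLeast:
  assumes "0 < p"
  shows "(\<integral>\<^sup>+x. ennreal (1 / x\<^sup>2) * indicator {p..} x \<partial>lborel) = ennreal (1 / p)"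
proof -
  have "(\<integral>\<^sup>+x. ennreal (1 / x\<^sup>2) * indicator {p..} x \<partial>lborel) = ennreal (0 - (- (1 / p)))"
  proof (rule nn_integral_FTC_atLeast)
    show "((\<lambda>x::real. - (1 / x)) \<longlongrightarrow> 0) at_top" by real_asymp
    show "((\<lambda>x. - (1 / x)) has_real_derivative 1 / x\<^sup>2) (at x)" if "p \<le> x" for x
      using that assms by (auto intro!: derivative_eq_intros simp: power2_eq_square)
  qed auto
  then show ?thesis by simp
qed

text \<open>Spreading the mass at \<open>x\<close> over the segment from \<open>x\<close> in direction \<open>v\<close> costs only the factor
  \<open>e / \<surd>n\<close> and a power of \<open>n + \<bar>x\<bar>\<^sup>2\<close>, because the Gaussian density changes by at most the factor \<open>e\<close>
  along a segment of length \<open>\<surd>n / (n + \<bar>x\<bar>\<^sup>2)\<close>.\<close>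
lemma spread_pointwise:
  assumes n: "0 < n" and v: "ip n v v = 1"
  shows "ennreal (real n + ip n x x) \<le> ennreal (exp 1 / sqrt (real n)) *
    (\<integral>\<^sup>+\<rho>. indicator {0<..} \<rho> * (ennreal (exp (- \<rho> * ip n v x - \<rho> * \<rho> / 2)) *
        ennreal ((3 * real n + 2 * ip n (\<lambda>i. x i + \<rho> * v i) (\<lambda>i. x i + \<rho> * v i))\<^sup>2)) \<partial>lborel)"
proof -
  let ?N = "real n" and ?r = "nrm n x"
  let ?V0 = "?N + ip n x x"
  \<comment> \<open>Length of the segment. The arithmetic-geometric mean inequality gives
    \<open>w * ?r \<le> 1 / 2\<close>, and also \<open>w \<le> 1\<close>, so the exponent of the
    density ratio stays at least \<open>- 1\<close> along the segment. This is the origin of the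
    factor \<open>exp 1\<close>.\<close>
  define w where "w = sqrt ?N / ?V0"
  have N: "1 \<le> ?N" using n by simp
  have r0: "0 \<le> ?r" by simp
  have xx: "ip n x x = ?r\<^sup>2" by (simp add: nrm_sq)
  have V0: "0 < ?V0" using N by (simp add: xx add_pos_nonneg)
  have w0: "0 < w" using n V0 by (simp add: w_def)
  have nv: "nrm n v = 1" using v by (simp add: nrm_sq[symmetric] power2_eq_1_iff) (metis L2_set_nonneg dual_order.trans not_one_le_zero le_minus_one_simps(1) neg_0_le_iff_le)
  have vx: "\<bar>ip n v x\<bar> \<le> ?r" using ip_le_nrm[of n v x] nv by simp
  have s1: "sqrt ?N \<le> ?N" using N by (simp add: real_le_lsqrt power2_eq_square)
  have w1: "w \<le> 1"
    using V0 s1 by (simp add: w_def xx divide_le_eq) (smt (verit) zero_le_power2)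
  have wr: "w * ?r \<le> 1 / 2"
  proof -
    have "0 \<le> (sqrt ?N - ?r)\<^sup>2" by simp
    then have "2 * (sqrt ?N * ?r) \<le> ?V0" by (simp add: xx power2_diff)
    then show ?thesis using V0 by (simp add: w_def field_simps)
  qed
  have low: "?V0\<^sup>2 \<le> exp 1 * (exp (- \<rho> * ip n v x - \<rho> * \<rho> / 2) *
        (3 * ?N + 2 * ip n (\<lambda>i. x i + \<rho> * v i) (\<lambda>i. x i + \<rho> * v i))\<^sup>2)" if "\<rho> \<in> {0..w}" for \<rho>
  proof -
    have \<rho>: "0 \<le> \<rho>" "\<rho> \<le> w" using that by auto
    have "\<rho> * \<bar>ip n v x\<bar> \<le> w * ?r" using \<rho> vx w0 by (intro mult_mono) auto
    then have a1: "\<rho> * \<bar>ip n v x\<bar> \<le> 1 / 2" using wr by simp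
    have a2: "\<rho> * \<rho> \<le> 1" using \<rho> w1 by (simp add: mult_le_one)
    have "\<rho> * ip n v x \<le> \<rho> * \<bar>ip n v x\<bar>" using \<rho> by (intro mult_left_mono) auto
    then have "1 \<le> exp (1 + (- \<rho> * ip n v x - \<rho> * \<rho> / 2))" using a1 a2 by simp
    then have e1: "1 \<le> exp 1 * exp (- \<rho> * ip n v x - \<rho> * \<rho> / 2)" by (simp add: exp_add[symmetric])
    define y where "y = (\<lambda>i. x i + \<rho> * v i)"
    have "ip n y y = ip n x x + 2 * (\<rho> * ip n v x) + \<rho> * \<rho>"
      unfolding y_def by (simp add: ip_add_left ip_add_right ip_scale_left ip_scale_right v ip_commute[of n x v])
    \<comment> \<open>Nonnegativity of the squared norm at distance \<open>2 * \<rho>\<close> yields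
      \<open>2 * ip n y y \<ge> ip n x x - 2 * (\<rho> * \<rho>)\<close>. The loss is at most 2 and
      is covered by the additional \<open>2 * real n\<close>.\<close>
    moreover have "0 \<le> ip n (\<lambda>i. x i + 2 * \<rho> * v i) (\<lambda>i. x i + 2 * \<rho> * v i)"
      unfolding nrm_sq[symmetric] by simp
    then have "0 \<le> ip n x x + 4 * (\<rho> * ip n v x) + 4 * (\<rho> * \<rho>)"
      by (simp add: ip_add_left ip_add_right ip_scale_left ip_scale_right v ip_commute[of n x v])
    ultimately have "?V0 \<le> 3 * ?N + 2 * ip n y y" using a2 N by (simp add: algebra_simps)
    then have "?V0\<^sup>2 \<le> (3 * ?N + 2 * ip n y y)\<^sup>2" using V0 by (intro power_mono) auto
    also have "\<dots> \<le> (exp 1 * exp (- \<rho> * ip n v x - \<rho> * \<rho> / 2)) * (3 * ?N + 2 * ip n y y)\<^sup>2"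
      using mult_right_mono[OF e1, of "(3 * ?N + 2 * ip n y y)\<^sup>2"] by simp
    finally show ?thesis by (simp add: y_def mult.assoc)
  qed
  have "ennreal (?V0\<^sup>2) * ennreal w = (\<integral>\<^sup>+\<rho>. ennreal (?V0\<^sup>2) * indicator {0<..w} \<rho> \<partial>lborel)"
    using w0 by (subst nn_integral_cmult_indicator) auto
  also have "\<dots> \<le> (\<integral>\<^sup>+\<rho>. ennreal (exp 1) * (indicator {0<..} \<rho> * (ennreal (exp (- \<rho> * ip n v x - \<rho> * \<rho> / 2)) *
        ennreal ((3 * ?N + 2 * ip n (\<lambda>i. x i + \<rho> * v i) (\<lambda>i. x i + \<rho> * v i))\<^sup>2))) \<partial>lborel)"
  proof (rule nn_integral_mono)
    fix \<rho> :: real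
    show "ennreal (?V0\<^sup>2) * indicator {0<..w} \<rho> \<le> ennreal (exp 1) * (indicator {0<..} \<rho> * (ennreal (exp (- \<rho> * ip n v x - \<rho> * \<rho> / 2)) *
        ennreal ((3 * ?N + 2 * ip n (\<lambda>i. x i + \<rho> * v i) (\<lambda>i. x i + \<rho> * v i))\<^sup>2)))"
    proof (cases "\<rho> \<in> {0<..w}")
      case True
      define E where "E = exp (- \<rho> * ip n v x - \<rho> * \<rho> / 2)"
      define Q where "Q = (3 * ?N + 2 * ip n (\<lambda>i. x i + \<rho> * v i) (\<lambda>i. x i + \<rho> * v i))\<^sup>2"
      have "?V0\<^sup>2 \<le> exp 1 * (E * Q)" using low[of \<rho>] True by (simp add: E_def Q_def)
      then have "ennreal (?V0\<^sup>2) \<le> ennreal (exp 1) * (ennreal E * ennreal Q)"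
        using ennreal_leI by (fastforce simp: E_def Q_def ennreal_mult[symmetric])
      then show ?thesis using True by (simp add: E_def Q_def)
    qed simp
  qed
  also have "\<dots> = ennreal (exp 1) * (\<integral>\<^sup>+\<rho>. indicator {0<..} \<rho> * (ennreal (exp (- \<rho> * ip n v x - \<rho> * \<rho> / 2)) *
        ennreal ((3 * ?N + 2 * ip n (\<lambda>i. x i + \<rho> * v i) (\<lambda>i. x i + \<rho> * v i))\<^sup>2)) \<partial>lborel)"
    unfolding ip_def by (rule nn_integral_cmult) measurable
  finally have le: "ennreal (?V0\<^sup>2) * ennreal w \<le> \<dots>" .
  have "ennreal ?V0 = ennreal (1 / sqrt ?N) * (ennreal (?V0\<^sup>2) * ennreal w)"
    using V0 n w0 by (subst ennreal_mult[symmetric], simp, simp, subst ennreal_mult[symmetric])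
      (simp_all add: w_def power2_eq_square)
  also have "\<dots> \<le> ennreal (1 / sqrt ?N) * (ennreal (exp 1) * (\<integral>\<^sup>+\<rho>. indicator {0<..} \<rho> * (ennreal (exp (- \<rho> * ip n v x - \<rho> * \<rho> / 2)) *
        ennreal ((3 * ?N + 2 * ip n (\<lambda>i. x i + \<rho> * v i) (\<lambda>i. x i + \<rho> * v i))\<^sup>2)) \<partial>lborel))"
    by (rule mult_left_mono[OF le]) simp
  also have "ennreal (1 / sqrt ?N) * (ennreal (exp 1) * a) = ennreal (exp 1 / sqrt ?N) * a" for a
    by (subst mult.assoc[symmetric], subst ennreal_mult[symmetric]) simp_all
  finally show ?thesis .
qed

lemma shift_measurable_family:
  assumes s: "\<And>i. i < n \<Longrightarrow> (\<lambda>p. s p i) \<in> borel_measurable M" and g: "g \<in> M \<rightarrow>\<^sub>M gaussn n"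
  shows "(\<lambda>p. shift n (s p) (g p)) \<in> M \<rightarrow>\<^sub>M gaussn n"
proof -
  have "(\<lambda>p. restrict (\<lambda>i. g p i + s p i) {..<n}) \<in> M \<rightarrow>\<^sub>M Pi\<^sub>M {..<n} (\<lambda>_. gauss)"
  proof (rule measurable_restrict)
    fix i assume "i \<in> {..<n}"
    then have "(\<lambda>p. g p i + s p i) \<in> borel_measurable M"
      using component_gaussn[OF g, of i] s[of i] by (intro borel_measurable_add) auto
    then show "(\<lambda>p. g p i + s p i) \<in> M \<rightarrow>\<^sub>M gauss"
      by (simp add: measurable_cong_sets[OF refl sets_gauss])
  qed
  then show ?thesis by (simp add: gaussn_def shift_def[abs_def])
qed

lemma shift_line_measurable [measurable (raw)]:
  assumes "f \<in> borel_measurable M" "g \<in> M \<rightarrow>\<^sub>M gaussn n"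
  shows "(\<lambda>p. shift n (\<lambda>i. f p * v i) (g p)) \<in> M \<rightarrow>\<^sub>M gaussn n"
    "(\<lambda>p. shift n (\<lambda>i. - (f p * v i)) (g p)) \<in> M \<rightarrow>\<^sub>M gaussn n"
  using assms by (auto intro!: shift_measurable_family borel_measurable_uminus borel_measurable_times)

text \<open>The pointwise estimate is integrated over \<open>x\<close>, and Fubini with
  \<open>gaussn_shift\<close> substitutes \<open>y = x + \<rho> v\<close>. The exponential weight is
  exactly the density ratio of this substitution, so each \<open>y\<close> collects the values of
  \<open>H\<close> on the ray backwards from \<open>y\<close>.\<close>

lemma spread:
  assumes n: "0 < n" and v: "ip n v v = 1" and H[measurable]: "H \<in> borel_measurable (gaussn n)"
  shows "(\<integral>\<^sup>+x. H x * ennreal (real n + ip n x x) \<partial>gaussn n) \<le> ennreal (exp 1 / sqrt (real n)) *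
    (\<integral>\<^sup>+y. ennreal ((3 * real n + 2 * ip n y y)\<^sup>2) *
       (\<integral>\<^sup>+\<rho>. indicator {0<..} \<rho> * H (shift n (\<lambda>i. - (\<rho> * v i)) y) \<partial>lborel) \<partial>gaussn n)"
proof -
  let ?V = "\<lambda>y. ennreal ((3 * real n + 2 * ip n y y)\<^sup>2)"
  let ?s = "\<lambda>\<rho>::real. \<lambda>i. \<rho> * v i"
  let ?g = "\<lambda>x \<rho>. ennreal (exp (- \<rho> * ip n v x - \<rho> * \<rho> / 2))"
  interpret pair_sigma_finite lborel "gaussn n" ..
  have sback: "shift n (\<lambda>i. - (\<rho> * v i)) (shift n (?s \<rho>) x) = x" if "x \<in> space (gaussn n)" for x \<rho>
    using that by (auto simp: shift_def space_gaussn PiE_iff extensional_def fun_eq_iff)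
  have ipsh: "ip n (shift n (?s \<rho>) x) (shift n (?s \<rho>) x) = ip n (\<lambda>i. x i + \<rho> * v i) (\<lambda>i. x i + \<rho> * v i)" for x \<rho>
    by (rule ip_cong) (simp_all add: shift_def)
  have g: "exp (- ip n (?s \<rho>) x - ip n (?s \<rho>) (?s \<rho>) / 2) = exp (- \<rho> * ip n v x - \<rho> * \<rho> / 2)" for \<rho> x
    by (simp add: ip_scale_left ip_scale_right v)
  let ?G = "\<lambda>\<rho> y. ?V y * H (shift n (\<lambda>i. - (\<rho> * v i)) y)"
  let ?C = "ennreal (exp 1 / sqrt (real n))"
  have "(\<integral>\<^sup>+x. H x * ennreal (real n + ip n x x) \<partial>gaussn n)
      \<le> (\<integral>\<^sup>+x. ?C * (\<integral>\<^sup>+\<rho>. indicator {0<..} \<rho> * (?g x \<rho> * ?G \<rho> (shift n (?s \<rho>) x)) \<partial>lborel) \<partial>gaussn n)"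
  proof (rule nn_integral_mono)
    fix x assume x: "x \<in> space (gaussn n)"
    have "H x * ennreal (real n + ip n x x) \<le> H x * (?C *
      (\<integral>\<^sup>+\<rho>. indicator {0<..} \<rho> * (?g x \<rho> * ?V (shift n (?s \<rho>) x)) \<partial>lborel))"
      using spread_pointwise[OF n v, of x] unfolding ipsh by (intro mult_left_mono) auto
    also have "\<dots> = ?C * (H x *
      (\<integral>\<^sup>+\<rho>. indicator {0<..} \<rho> * (?g x \<rho> * ?V (shift n (?s \<rho>) x)) \<partial>lborel))"
      by (simp add: mult_ac)
    also have "H x * (\<integral>\<^sup>+\<rho>. indicator {0<..} \<rho> * (?g x \<rho> * ?V (shift n (?s \<rho>) x)) \<partial>lborel)
      = (\<integral>\<^sup>+\<rho>. H x * (indicator {0<..} \<rho> * (?g x \<rho> * ?V (shift n (?s \<rho>) x))) \<partial>lborel)"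
      unfolding ipsh by (rule nn_integral_cmult[symmetric]) (unfold ip_def, measurable)
    also have "\<dots> = (\<integral>\<^sup>+\<rho>. indicator {0<..} \<rho> * (?g x \<rho> * ?G \<rho> (shift n (?s \<rho>) x)) \<partial>lborel)"
      by (intro nn_integral_cong) (simp add: sback[OF x] mult_ac)
    finally show "H x * ennreal (real n + ip n x x)
      \<le> ?C * (\<integral>\<^sup>+\<rho>. indicator {0<..} \<rho> * (?g x \<rho> * ?G \<rho> (shift n (?s \<rho>) x)) \<partial>lborel)" .
  qed
  also have "\<dots> = ?C * (\<integral>\<^sup>+x. (\<integral>\<^sup>+\<rho>. indicator {0<..} \<rho> * (?g x \<rho> * ?G \<rho> (shift n (?s \<rho>) x)) \<partial>lborel) \<partial>gaussn n)"
    by (rule nn_integral_cmult) measurable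
  also have "(\<integral>\<^sup>+x. (\<integral>\<^sup>+\<rho>. indicator {0<..} \<rho> * (?g x \<rho> * ?G \<rho> (shift n (?s \<rho>) x)) \<partial>lborel) \<partial>gaussn n)
    = (\<integral>\<^sup>+\<rho>. (\<integral>\<^sup>+x. indicator {0<..} \<rho> * (?g x \<rho> * ?G \<rho> (shift n (?s \<rho>) x)) \<partial>gaussn n) \<partial>lborel)"
    by (rule Fubini') measurable
  also have "\<dots> = (\<integral>\<^sup>+\<rho>. (\<integral>\<^sup>+y. indicator {0<..} \<rho> * ?G \<rho> y \<partial>gaussn n) \<partial>lborel)"
  proof (rule nn_integral_cong)
    fix \<rho> :: real
    have "(\<integral>\<^sup>+y. indicator {0<..} \<rho> * ?G \<rho> y \<partial>gaussn n)
      = (\<integral>\<^sup>+x. ennreal (exp (- ip n (?s \<rho>) x - ip n (?s \<rho>) (?s \<rho>) / 2)) *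
          (indicator {0<..} \<rho> * ?G \<rho> (shift n (?s \<rho>) x)) \<partial>gaussn n)"
      by (rule gaussn_shift) measurable
    then show "(\<integral>\<^sup>+x. indicator {0<..} \<rho> * (?g x \<rho> * ?G \<rho> (shift n (?s \<rho>) x)) \<partial>gaussn n)
      = (\<integral>\<^sup>+y. indicator {0<..} \<rho> * ?G \<rho> y \<partial>gaussn n)"
      unfolding g by (simp add: mult_ac)
  qed
  also have "\<dots> = (\<integral>\<^sup>+y. (\<integral>\<^sup>+\<rho>. indicator {0<..} \<rho> * ?G \<rho> y \<partial>lborel) \<partial>gaussn n)"
    by (rule Fubini'[symmetric]) measurable
  also have "\<dots> = (\<integral>\<^sup>+y. ?V y * (\<integral>\<^sup>+\<rho>. indicator {0<..} \<rho> * H (shift n (\<lambda>i. - (\<rho> * v i)) y) \<partial>lborel) \<partial>gaussn n)"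
    by (intro nn_integral_cong) (subst nn_integral_cmult[symmetric], measurable, simp add: mult_ac)
  finally show ?thesis .
qed

text \<open>Moving along \<open>v\<close> changes the pairing with \<open>u\<close> and with none of
  the \<open>W i\<close>, so \<open>H\<close> on such a line depends on \<rho> only through the
  crossing time, which is affine in \<rho>. Taking this time as the variable produces the Jacobian
  \<open>\<bar>ip n u e\<bar>\<close>, the transversal velocity, and turns \<open>0 < \<rho>\<close>
  into the missing inequality: \<open>y + t e\<close> lies inside the cone.\<close>

lemma flux:
  fixes W :: "'i \<Rightarrow> nat \<Rightarrow> real"
  assumes n: "0 < n" and v: "ip n v v = 1" and uv: "ip n u v = 1" and fin: "finite I"
    and Wv: "\<And>i. i \<in> I \<Longrightarrow> ip n (W i) v = 0" and c: "ip n u e \<noteq> 0"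
    and h[measurable]: "h \<in> borel_measurable borel"
  defines "\<tau> \<equiv> \<lambda>x. - ip n u x / ip n u e"
  shows "(\<integral>\<^sup>+x. (if 0 < \<tau> x \<and> (\<forall>i\<in>I. 0 < ip n (W i) x + \<tau> x * ip n (W i) e) then h (\<tau> x) else 0) *
        ennreal (real n + ip n x x) \<partial>gaussn n)
    \<le> ennreal (exp 1 / sqrt (real n)) * (\<integral>\<^sup>+y. ennreal ((3 * real n + 2 * ip n y y)\<^sup>2) *
       (ennreal \<bar>ip n u e\<bar> * (\<integral>\<^sup>+t. (if 0 < t \<and> 0 < ip n u y + t * ip n u e \<and>
          (\<forall>i\<in>I. 0 < ip n (W i) y + t * ip n (W i) e) then h t else 0) \<partial>lborel)) \<partial>gaussn n)"
proof -
  define H where "H = (\<lambda>x. if 0 < \<tau> x \<and> (\<forall>i\<in>I. 0 < ip n (W i) x + \<tau> x * ip n (W i) e) then h (\<tau> x) else 0)"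
  have [measurable]: "\<tau> \<in> borel_measurable (gaussn n)" unfolding \<tau>_def by measurable
  have Hm[measurable]: "H \<in> borel_measurable (gaussn n)" unfolding H_def using fin by measurable
  have eq: "(\<integral>\<^sup>+\<rho>. indicator {0<..} \<rho> * H (shift n (\<lambda>i. - (\<rho> * v i)) y) \<partial>lborel)
    = ennreal \<bar>ip n u e\<bar> * (\<integral>\<^sup>+t. (if 0 < t \<and> 0 < ip n u y + t * ip n u e \<and>
          (\<forall>i\<in>I. 0 < ip n (W i) y + t * ip n (W i) e) then h t else 0) \<partial>lborel)" for y
  proof -
    have s: "ip n z (\<lambda>i. - (\<rho> * v i)) = - \<rho> * ip n z v" for z \<rho>
      using ip_scale_right[of n z "-\<rho>" v] by simp
    have t: "\<tau> (shift n (\<lambda>i. - (\<rho> * v i)) y) = (\<rho> - ip n u y) / ip n u e" for \<rho>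
      using c by (simp add: \<tau>_def ip_shift s uv field_simps)
    have H: "H (shift n (\<lambda>i. - (\<rho> * v i)) y) = (let t = (\<rho> - ip n u y) / ip n u e in
      if 0 < t \<and> (\<forall>i\<in>I. 0 < ip n (W i) y + t * ip n (W i) e) then h t else 0)" for \<rho>
      unfolding H_def t using Wv by (simp add: ip_shift s Let_def)
    have "(\<integral>\<^sup>+\<rho>. indicator {0<..} \<rho> * H (shift n (\<lambda>i. - (\<rho> * v i)) y) \<partial>lborel)
      = ennreal \<bar>ip n u e\<bar> * (\<integral>\<^sup>+t. indicator {0<..} (ip n u y + ip n u e * t) *
          H (shift n (\<lambda>i. - ((ip n u y + ip n u e * t) * v i)) y) \<partial>lborel)"
      unfolding H Let_def using fin by (intro nn_integral_real_affine) (measurable, use c in simp)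
    also have "(\<integral>\<^sup>+t. indicator {0<..} (ip n u y + ip n u e * t) *
          H (shift n (\<lambda>i. - ((ip n u y + ip n u e * t) * v i)) y) \<partial>lborel)
      = (\<integral>\<^sup>+t. (if 0 < t \<and> 0 < ip n u y + t * ip n u e \<and>
          (\<forall>i\<in>I. 0 < ip n (W i) y + t * ip n (W i) e) then h t else 0) \<partial>lborel)"
      unfolding H Let_def using c by (intro nn_integral_cong) (simp add: mult.commute)
    finally show ?thesis .
  qed
  show ?thesis using spread[OF n v Hm] unfolding eq unfolding H_def by simp
qed


section \<open>The expected number of wall crossings\<close>

text \<open>The three regimes of the parameter \<open>t\<close> in the bound for the rate of facet crossings that is
  charged to a row of weight \<open>w\<close> in the objective: the weight is far below, comparable to, and far
  above the size of the perturbation.\<close>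
definition rate :: "nat \<Rightarrow> real \<Rightarrow> real \<Rightarrow> real \<Rightarrow> real" where
  "rate n \<delta> w t =
    (if w \<le> 0 \<or> t \<le> 0 then 0
     else if t < 1 / (sqrt (real n) * w) then w / \<delta>
     else if t \<le> real n * sqrt (real n) / (\<delta>\<^sup>2 * w) then 1 / (sqrt (real n) * \<delta> * t)
     else real n / (\<delta> ^ 3 * w * t\<^sup>2))"

lemma rate_nonneg: "0 < \<delta> \<Longrightarrow> 0 \<le> rate n \<delta> w t"
  by (simp add: rate_def)

lemma rate_measurable [measurable]: "rate n \<delta> w \<in> borel_measurable borel"
  unfolding rate_def[abs_def] by measurable

text \<open>The thresholds satisfy \<open>q / p = (N / \<delta>)\<^sup>2\<close>. Both outer regimes
  contribute \<open>1 / (sqrt N * \<delta>)\<close> and the middle one the logarithm of this ratio,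
  so the weight \<open>w\<close> cancels.\<close>

lemma rate_integral:
  assumes n: "0 < n" and d: "0 < \<delta>" "\<delta> \<le> 1"
  shows "(\<integral>\<^sup>+t. ennreal (rate n \<delta> w t) \<partial>lborel) \<le> ennreal ((2 + 2 * ln (real n / \<delta>)) / (sqrt (real n) * \<delta>))"
proof (cases "w \<le> 0")
  case True
  then show ?thesis by (simp add: rate_def)
next
  case False
  define N where "N = real n"
  have N: "1 \<le> N" using n by (simp add: N_def)
  have w: "0 < w" using False by simp
  define p where "p = 1 / (sqrt N * w)"
  define q where "q = N * sqrt N / (\<delta>\<^sup>2 * w)"
  have p: "0 < p" using w N by (simp add: p_def)
  have pq: "q / p = (N / \<delta>)\<^sup>2"
    using w d N by (simp add: p_def q_def power2_eq_square field_simps)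
  have Nd: "1 \<le> N / \<delta>" using N d by (simp add: le_divide_eq)
  then have qp1: "1 \<le> q / p" unfolding pq using one_le_power by blast
  then have le: "p \<le> q" using p by (simp add: le_divide_eq)
  have q: "0 < q" using p le by simp
  have l0: "0 \<le> ln (N / \<delta>)" using Nd by simp
  have "(\<integral>\<^sup>+t. ennreal (rate n \<delta> w t) \<partial>lborel)
     \<le> (\<integral>\<^sup>+t. ennreal (w / \<delta>) * indicator {0..p} t + (ennreal (1 / (sqrt N * \<delta>)) * (ennreal (1 / t) * indicator {p..q} t)
         + ennreal (N / (\<delta> ^ 3 * w)) * (ennreal (1 / t\<^sup>2) * indicator {q..} t)) \<partial>lborel)"
  proof (rule nn_integral_mono)
    fix t :: real
    consider "t \<le> 0" | "0 < t" "t < p" | "0 < t" "p \<le> t" "t \<le> q" | "0 < t" "p \<le> t" "q < t" by linarith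
    then show "ennreal (rate n \<delta> w t) \<le> ennreal (w / \<delta>) * indicator {0..p} t + (ennreal (1 / (sqrt N * \<delta>)) * (ennreal (1 / t) * indicator {p..q} t)
         + ennreal (N / (\<delta> ^ 3 * w)) * (ennreal (1 / t\<^sup>2) * indicator {q..} t))"
    proof cases
      case 1 then show ?thesis by (simp add: rate_def)
    next
      case 2
      then have "rate n \<delta> w t = w / \<delta>" using w by (simp add: rate_def p_def N_def)
      then show ?thesis using 2 by simp
    next
      case 3
      then have "rate n \<delta> w t = 1 / (sqrt N * \<delta>) * (1 / t)"
        using w by (auto simp add: rate_def p_def q_def N_def)
      moreover have "ennreal (1 / (sqrt N * \<delta>) * (1 / t)) = ennreal (1 / (sqrt N * \<delta>)) * ennreal (1 / t)"
        using 3 d N by (intro ennreal_mult) auto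
      ultimately show ?thesis using 3 by (simp add: add_increasing add_increasing2)
    next
      case 4
      then have "rate n \<delta> w t = N / (\<delta> ^ 3 * w) * (1 / t\<^sup>2)"
        using w by (auto simp add: rate_def p_def q_def N_def)
      moreover have "ennreal (N / (\<delta> ^ 3 * w) * (1 / t\<^sup>2)) = ennreal (N / (\<delta> ^ 3 * w)) * ennreal (1 / t\<^sup>2)"
        using 4 d N w by (intro ennreal_mult) auto
      ultimately show ?thesis using 4 le by (simp add: add_increasing add_increasing2)
    qed
  qed
  also have "\<dots> = ennreal (w / \<delta>) * ennreal p + (ennreal (1 / (sqrt N * \<delta>)) * ennreal (ln (q / p))
      + ennreal (N / (\<delta> ^ 3 * w)) * ennreal (1 / q))"
    using p q nn_integral_inverse_Icc[OF p le] nn_integral_inverse_square_atLeast[OF q]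
    by (simp add: nn_integral_add nn_integral_cmult nn_integral_cmult_indicator)
  also have "\<dots> = ennreal (w / \<delta> * p + (1 / (sqrt N * \<delta>) * ln (q / p) + N / (\<delta> ^ 3 * w) * (1 / q)))"
  proof -
    have "0 \<le> ln (q / p)" using qp1 by (rule ln_ge_zero)
    moreover have "0 \<le> w / \<delta>" "0 \<le> p" "0 \<le> 1 / (sqrt N * \<delta>)" "0 \<le> N / (\<delta> ^ 3 * w)" "0 \<le> 1 / q"
      using p q w d N by auto
    ultimately show ?thesis
      by (simp only: ennreal_mult[symmetric] ennreal_plus[symmetric] mult_nonneg_nonneg add_nonneg_nonneg)
  qed
  also have "w / \<delta> * p + (1 / (sqrt N * \<delta>) * ln (q / p) + N / (\<delta> ^ 3 * w) * (1 / q))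
      = (2 + 2 * ln (N / \<delta>)) / (sqrt N * \<delta>)"
  proof -
    have "w / \<delta> * p = 1 / (sqrt N * \<delta>)" using w by (simp add: p_def)
    moreover have "N / (\<delta> ^ 3 * w) * (1 / q) = 1 / (sqrt N * \<delta>)"
      using w d N by (simp add: q_def power2_eq_square power3_eq_cube field_simps)
    moreover have "ln (q / p) = 2 * ln (N / \<delta>)" using Nd by (simp add: pq ln_realpow)
    ultimately show ?thesis by (simp add: add_divide_distrib)
  qed
  finally show ?thesis by (simp add: N_def)
qed

text \<open>Each of the three values of \<open>rate\<close> dominates \<kappa> on its own: the first
  by \<open>k1\<close>, the second by \<open>k2\<close> and
  \<open>2 * (sqrt N * r) \<le> N + r\<^sup>2\<close>, the third by combining \<open>k1\<close> with
  the square of \<open>k3\<close>. The thresholds only serve to keep the integral small.\<close>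

lemma rate_dominates:
  assumes n: "0 < n" and d: "0 < \<delta>" and w: "0 < w" and t: "0 < t" and r: "0 \<le> r"
    and k1: "\<kappa> \<le> real n / \<delta> * w" and k2: "t * \<kappa> \<le> r / \<delta>" and k3: "t * w \<le> r / \<delta>"
  shows "\<kappa> \<le> rate n \<delta> w t * (real n + r\<^sup>2)"
proof -
  define N where "N = real n"
  have N: "1 \<le> N" using n by (simp add: N_def)
  consider "t < 1 / (sqrt N * w)" | "\<not> t < 1 / (sqrt N * w)" "t \<le> N * sqrt N / (\<delta>\<^sup>2 * w)"
    | "\<not> t < 1 / (sqrt N * w)" "\<not> t \<le> N * sqrt N / (\<delta>\<^sup>2 * w)" by blast
  then show ?thesis
  proof cases
    case 1
    then have "rate n \<delta> w t = w / \<delta>" using w t by (simp add: rate_def N_def)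
    moreover have "w / \<delta> * N \<le> w / \<delta> * (N + r\<^sup>2)" using w d by (intro mult_left_mono) auto
    ultimately show ?thesis using k1 by (simp add: N_def mult.commute)
  next
    case 2
    then have r2: "rate n \<delta> w t = 1 / (sqrt N * \<delta> * t)" using w t by (simp add: rate_def N_def)
    have "0 \<le> (sqrt N - r)\<^sup>2" by simp
    then have "2 * (sqrt N * r) \<le> N + r\<^sup>2" using N by (simp add: power2_diff)
    then have "sqrt N * r \<le> N + r\<^sup>2" using N r by (smt (verit) mult_nonneg_nonneg real_sqrt_ge_zero)
    then have "r \<le> (N + r\<^sup>2) / sqrt N" using N by (simp add: le_divide_eq mult.commute)
    have "\<kappa> \<le> r / (\<delta> * t)" using k2 d t by (simp add: field_simps)
    also have "\<dots> \<le> ((N + r\<^sup>2) / sqrt N) / (\<delta> * t)"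
      using \<open>r \<le> (N + r\<^sup>2) / sqrt N\<close> d t by (intro divide_right_mono) auto
    finally show ?thesis by (simp add: r2 N_def mult.assoc)
  next
    case 3
    then have r3: "rate n \<delta> w t = N / (\<delta> ^ 3 * w * t\<^sup>2)" using w t by (simp add: rate_def N_def)
    have "(t * w)\<^sup>2 \<le> (r / \<delta>)\<^sup>2" using k3 t w by (intro power_mono) auto
    then have "\<delta>\<^sup>2 * t\<^sup>2 * w\<^sup>2 \<le> r\<^sup>2" using d by (simp add: power_mult_distrib power_divide field_simps)
    then have a: "\<delta>\<^sup>2 * t\<^sup>2 * w\<^sup>2 \<le> N + r\<^sup>2" using N by simp
    have "N / \<delta> * w = N / (\<delta> ^ 3 * w * t\<^sup>2) * (\<delta>\<^sup>2 * t\<^sup>2 * w\<^sup>2)"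
      using d t w by (simp add: power2_eq_square power3_eq_cube field_simps)
    also have "\<dots> \<le> N / (\<delta> ^ 3 * w * t\<^sup>2) * (N + r\<^sup>2)"
      using a d w N by (intro mult_left_mono) auto
    finally show ?thesis using k1 by (simp add: r3 N_def)
  qed
qed

context fan
begin

text \<open>The crossing time is written out instead of being quantified, which makes the event
  visibly measurable in \<open>x\<close>.\<close>

definition hit :: "(nat \<Rightarrow> real) \<Rightarrow> (nat \<Rightarrow> real) \<Rightarrow> nat set \<Rightarrow> nat \<Rightarrow> bool" where
  "hit x e B j \<longleftrightarrow> co B j e \<noteq> 0 \<and> 0 < - co B j x / co B j e \<and>
     (\<forall>i\<in>B - {j}. 0 < co B i x + (- co B j x / co B j e) * co B i e)"

text \<open>Cauchy-Schwarz for a dual pair. It makes the logarithm in the bound nonnegative.\<close>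

lemma delta_le_1: "\<delta> \<le> 1"
proof -
  obtain B where B: "B \<in> \<B>" using bases_ne by blast
  then have "card B = n" using dual dual_basisD(2) by blast
  then obtain j where j: "j \<in> B" using n_pos by fastforce
  have "1 \<le> nrm n (u B j) * nrm n (a j)"
    using co_basis[OF B j j] ip_le_nrm[of n "u B j" "a j"] by simp
  also have "\<dots> \<le> 1 / \<delta>" by (rule dist[OF B j])
  finally show ?thesis using delta_pos by (simp add: field_simps)
qed

lemma hit_measurable [measurable]: "B \<in> \<B> \<Longrightarrow> Measurable.pred (gaussn n) (\<lambda>x. hit x e B j)"
  unfolding hit_def using finite_basis[of B] by measurable

text \<open>Every wall contributes at most the flux into its cone, weighted by one function of time
  common to all walls; the sum over the cones then collapses because their interiors are disjoint.
  The constant is \<open>2 * 33 * exp 1\<close>, and the two factors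
  \<open>1 / sqrt (real n)\<close>, from spreading and from \<open>rate_integral\<close>, lower
  \<open>n ^ 4\<close> to \<open>n ^ 3\<close>.\<close>

lemma sum_hit_probability:
  assumes Bs: "Bs \<in> \<B>" "nonneg_on Bs e"
  shows "(\<Sum>B\<in>\<B>. \<Sum>j\<in>B. \<integral>\<^sup>+x. of_bool (hit x e B j) \<partial>gaussn n)
    \<le> ennreal (66 * exp 1 * (1 + ln (real n / \<delta>)) * real n ^ 3 / \<delta>)"
proof -
  \<comment> \<open>Sum over all rows of \<open>Bs\<close>, since the row supplied by
    \<open>crossing_scale\<close> depends on the wall.\<close>
  define R where "R = (\<lambda>t. \<Sum>k\<in>Bs. rate n \<delta> (co Bs k e * nrm n (a k)) t)"
  define V where "V = (\<lambda>y. (3 * real n + 2 * ip n y y)\<^sup>2)"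
  define inside where "inside = (\<lambda>B y t. 0 < t \<and> (\<forall>i\<in>B. 0 < co B i y + t * co B i e))"
  let ?C = "ennreal (exp 1 / sqrt (real n))"
  have finBs: "finite Bs" using finite_basis[OF Bs(1)] .
  have R0: "0 \<le> R t" for t using rate_nonneg[OF delta_pos] by (simp add: R_def sum_nonneg)
  have [measurable]: "R \<in> borel_measurable borel" unfolding R_def by measurable
  have [measurable]: "V \<in> borel_measurable (gaussn n)" unfolding V_def by measurable
  have insm[measurable]: "Measurable.pred (gaussn n \<Otimes>\<^sub>M lborel) (\<lambda>p. inside B (fst p) (snd p))" if "B \<in> \<B>" for B
    unfolding inside_def using finite_basis[OF that] by measurable
  have one: "(\<integral>\<^sup>+x. of_bool (hit x e B j) \<partial>gaussn n)
      \<le> ?C * (\<integral>\<^sup>+y. ennreal (V y) * (\<integral>\<^sup>+t. of_bool (inside B y t) * ennreal (R t) \<partial>lborel) \<partial>gaussn n)"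
    if B: "B \<in> \<B>" and j: "j \<in> B" for B j
  proof (cases "co B j e = 0")
    case True
    then show ?thesis by (simp add: hit_def)
  next
    case ne: False
    define s where "s = nrm n (a j)"
    have s: "0 < s" using nrm_row_pos[OF B j] by (simp add: s_def)
    \<comment> \<open>Unit vector along row \<open>j\<close>; it changes no other coordinate of
      \<open>B\<close>. Scaling \<open>u B j\<close> by the norm of that row makes its pairing with
      \<open>v\<close> equal to 1.\<close>
    define v where "v = (\<lambda>l. (1 / s) * a j l)"
    define U where "U = (\<lambda>l. s * u B j l)"
    have U: "ip n U y = s * co B j y" for y by (simp add: U_def ip_scale_left)
    have aa: "ip n (a j) (a j) = s * s"
      using nrm_sq[where n=n and x="a j"] by (simp add: s_def power2_eq_square)
    have vv: "ip n v v = 1"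
      unfolding v_def ip_scale_left ip_scale_right aa using s by simp
    have Uv: "ip n U v = 1" unfolding U unfolding v_def ip_scale_right using co_basis[OF B j j] s by simp
    have Wv: "co B i v = 0" if "i \<in> B - {j}" for i
      unfolding v_def ip_scale_right using co_basis[OF B j, of i] that by auto
    define \<kappa> where "\<kappa> = \<bar>ip n U e\<bar>"
    have kap: "\<kappa> = \<bar>co B j e\<bar> * s" using s by (simp add: \<kappa>_def U abs_mult)
    have kpos: "0 < \<kappa>" using ne s by (simp add: kap)
    define \<tau> where "\<tau> = (\<lambda>x. - ip n U x / ip n U e)"
    have tau: "\<tau> x = - co B j x / co B j e" for x using s by (simp add: \<tau>_def U)
    \<comment> \<open>Dividing by \<kappa> cancels the Jacobian in \<open>flux\<close>, and by
      \<open>dom\<close> every hit still receives weight at least 1.\<close>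
    define h where "h = (\<lambda>t. ennreal (R t / \<kappa>))"
    obtain k where k: "k \<in> Bs" "0 < co Bs k e * nrm n (a k)"
      "\<bar>co B j e\<bar> * nrm n (a j) \<le> real n / \<delta> * (co Bs k e * nrm n (a k))"
      "\<And>x t. 0 \<le> t \<Longrightarrow> nonneg_on B (\<lambda>l. x l + t * e l) \<Longrightarrow> co B j (\<lambda>l. x l + t * e l) = 0 \<Longrightarrow>
       t * (co Bs k e * nrm n (a k)) \<le> nrm n x / \<delta>"
      using crossing_scale[OF Bs B j ne] by blast
    have dom: "1 \<le> R (\<tau> x) / \<kappa> * (real n + ip n x x)" if hit: "hit x e B j" for x
    proof -
      have t0: "0 < \<tau> x" using hit by (simp add: hit_def tau)
      have z0: "co B j x + \<tau> x * co B j e = 0" using ne by (simp add: tau)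
      have nn: "nonneg_on B (\<lambda>l. x l + \<tau> x * e l)"
        unfolding nonneg_on_def
      proof
        fix i assume "i \<in> B"
        then show "0 \<le> co B i (\<lambda>l. x l + \<tau> x * e l)"
          using hit z0 unfolding ip_add_right ip_scale_right hit_def tau[symmetric]
          by (cases "i = j") (auto simp: less_imp_le)
      qed
      have k3: "\<tau> x * (co Bs k e * nrm n (a k)) \<le> nrm n x / \<delta>"
        using k(4)[OF less_imp_le[OF t0] nn] z0 by (simp add: ip_add_right ip_scale_right)
      have "\<tau> x * \<kappa> = \<bar>co B j x\<bar> * s"
        using z0 t0 by (simp add: kap) (metis abs_minus_cancel abs_mult abs_of_pos add.commute minus_unique)
      then have k2: "\<tau> x * \<kappa> \<le> nrm n x / \<delta>" using co_bound[OF B j, of x] by (simp add: s_def)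
      have "\<kappa> \<le> rate n \<delta> (co Bs k e * nrm n (a k)) (\<tau> x) * (real n + (nrm n x)\<^sup>2)"
        using k(3) by (intro rate_dominates[OF n_pos delta_pos k(2) t0 _ _ k2 k3]) (auto simp: kap s_def)
      also have "\<dots> \<le> R (\<tau> x) * (real n + (nrm n x)\<^sup>2)"
        unfolding R_def using finBs k(1) rate_nonneg[OF delta_pos]
        by (intro mult_right_mono member_le_sum) auto
      finally show ?thesis using kpos by (simp add: nrm_sq field_simps)
    qed
    have "(\<integral>\<^sup>+x. of_bool (hit x e B j) \<partial>gaussn n)
      \<le> (\<integral>\<^sup>+x. (if 0 < \<tau> x \<and> (\<forall>i\<in>B - {j}. 0 < co B i x + \<tau> x * co B i e) then h (\<tau> x) else 0) *
        ennreal (real n + ip n x x) \<partial>gaussn n)"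
    proof (rule nn_integral_mono)
      fix x
      show "of_bool (hit x e B j) \<le> (if 0 < \<tau> x \<and> (\<forall>i\<in>B - {j}. 0 < co B i x + \<tau> x * co B i e) then h (\<tau> x) else 0) *
        ennreal (real n + ip n x x)"
      proof (cases "hit x e B j")
        case True
        then have "0 < \<tau> x \<and> (\<forall>i\<in>B - {j}. 0 < co B i x + \<tau> x * co B i e)" by (simp add: hit_def tau)
        moreover have "ennreal 1 \<le> h (\<tau> x) * ennreal (real n + ip n x x)"
          unfolding h_def using dom[OF True] R0 kpos
          by (subst ennreal_mult[symmetric]) (auto intro!: ennreal_leI simp: nrm_sq[symmetric])
        ultimately show ?thesis using True by simp
      qed simp
    qed
    also have "\<dots> \<le> ?C * (\<integral>\<^sup>+y. ennreal ((3 * real n + 2 * ip n y y)\<^sup>2) *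
       (ennreal \<bar>ip n U e\<bar> * (\<integral>\<^sup>+t. (if 0 < t \<and> 0 < ip n U y + t * ip n U e \<and>
          (\<forall>i\<in>B - {j}. 0 < co B i y + t * co B i e) then h t else 0) \<partial>lborel)) \<partial>gaussn n)"
      unfolding \<tau>_def
      by (rule flux[OF n_pos vv Uv _ Wv]) (use ne s finite_basis[OF B] in \<open>auto simp: h_def U\<close>)
    also have "\<dots> = ?C * (\<integral>\<^sup>+y. ennreal (V y) * (\<integral>\<^sup>+t. of_bool (inside B y t) * ennreal (R t) \<partial>lborel) \<partial>gaussn n)"
    proof -
      have cond: "(0 < t \<and> 0 < ip n U y + t * ip n U e \<and> (\<forall>i\<in>B - {j}. 0 < co B i y + t * co B i e)) = inside B y t" for y t
      proof -
        have "ip n U y + t * ip n U e = s * (co B j y + t * co B j e)" by (simp add: U algebra_simps)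
        then have "0 < ip n U y + t * ip n U e \<longleftrightarrow> 0 < co B j y + t * co B j e"
          using s by (simp add: zero_less_mult_iff)
        then show ?thesis using j by (auto simp: inside_def)
      qed
      have "ennreal \<kappa> * (\<integral>\<^sup>+t. (if inside B y t then h t else 0) \<partial>lborel) = (\<integral>\<^sup>+t. of_bool (inside B y t) * ennreal (R t) \<partial>lborel)"
        if y: "y \<in> space (gaussn n)" for y
      proof -
        have [measurable]: "Measurable.pred lborel (\<lambda>t. inside B y t)"
          using measurable_compose[OF measurable_Pair1'[OF y] insm[OF B]] by simp
        have "ennreal \<kappa> * (\<integral>\<^sup>+t. (if inside B y t then h t else 0) \<partial>lborel)
            = (\<integral>\<^sup>+t. ennreal \<kappa> * (if inside B y t then h t else 0) \<partial>lborel)"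
          unfolding h_def by (rule nn_integral_cmult[symmetric]) measurable
        also have "\<dots> = (\<integral>\<^sup>+t. of_bool (inside B y t) * ennreal (R t) \<partial>lborel)"
          unfolding h_def using kpos R0
          by (intro nn_integral_cong) (auto simp: ennreal_mult[symmetric])
        finally show ?thesis .
      qed
      then show ?thesis
        unfolding cond \<kappa>_def[symmetric]
        by (intro arg_cong[where f="\<lambda>z. ?C * z"] nn_integral_cong) (simp add: V_def)
    qed
    finally show ?thesis .
  qed
  define J where "J = (\<lambda>B y. \<integral>\<^sup>+t. of_bool (inside B y t) * ennreal (R t) \<partial>lborel)"
  have Jm[measurable]: "J B \<in> borel_measurable (gaussn n)" if "B \<in> \<B>" for B
    unfolding J_def using insm[OF that] by measurable
  \<comment> \<open>Each \<open>J B y\<close> occurs once for every wall of \<open>B\<close>, which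
    is the factor \<open>n\<close>; at a given time at most one cone contains \<open>y + t e\<close>
    in its interior.\<close>
  have total: "(\<Sum>B\<in>\<B>. \<Sum>j\<in>B. J B y) \<le> of_nat n * (\<integral>\<^sup>+t. ennreal (R t) \<partial>lborel)"
    if y: "y \<in> space (gaussn n)" for y
  proof -
    have pm: "Measurable.pred lborel (\<lambda>t. inside B y t)" if "B \<in> \<B>" for B
      using measurable_compose[OF measurable_Pair1'[OF y] insm[OF that]] by simp
    have "(\<Sum>B\<in>\<B>. \<Sum>j\<in>B. J B y) = of_nat n * (\<Sum>B\<in>\<B>. J B y)"
      using dual_basisD(2)[OF dual] by (simp add: sum_distrib_left)
    also have "(\<Sum>B\<in>\<B>. J B y) = (\<integral>\<^sup>+t. (\<Sum>B\<in>\<B>. of_bool (inside B y t) * ennreal (R t)) \<partial>lborel)"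
      unfolding J_def
    proof (rule nn_integral_sum[symmetric])
      fix B assume "B \<in> \<B>"
      note pm[OF this, measurable]
      show "(\<lambda>t. of_bool (inside B y t) * ennreal (R t)) \<in> borel_measurable lborel" by measurable
    qed
    also have "\<dots> \<le> (\<integral>\<^sup>+t. ennreal (R t) \<partial>lborel)"
    proof (rule nn_integral_mono)
      fix t :: real
      show "(\<Sum>B\<in>\<B>. of_bool (inside B y t) * ennreal (R t)) \<le> ennreal (R t)"
      proof (cases "\<exists>B\<in>\<B>. inside B y t")
        case True
        then obtain B where B: "B \<in> \<B>" "inside B y t" by blast
        have "B' = B" if "B' \<in> \<B>" "inside B' y t" for B'
        proof (rule interior_disjoint[OF that(1) B(1)])
          show "\<forall>j\<in>B'. 0 < co B' j (\<lambda>l. y l + t * e l)"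
            using that(2) by (simp add: inside_def ip_add_right ip_scale_right)
          show "nonneg_on B (\<lambda>l. y l + t * e l)"
            using B(2) by (simp add: inside_def nonneg_on_def ip_add_right ip_scale_right less_imp_le)
        qed
        then have "\<not> inside B' y t" if "B' \<in> \<B> - {B}" for B' using that by blast
        then have "(\<Sum>B\<in>\<B>. of_bool (inside B y t) * ennreal (R t)) = (\<Sum>B'\<in>{B}. of_bool (inside B' y t) * ennreal (R t))"
          using B finite_bases by (intro sum.mono_neutral_right ballI) simp_all
        then show ?thesis using B by simp
      next
        case False
        then have "(\<Sum>B\<in>\<B>. of_bool (inside B y t) * ennreal (R t)) = 0" by (intro sum.neutral) auto
        then show ?thesis by simp
      qed
    qed
    finally show ?thesis by (simp add: mult_left_mono)
  qed
  let ?I = "ennreal ((2 + 2 * ln (real n / \<delta>)) / (sqrt (real n) * \<delta>))"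
  have ln0: "0 \<le> ln (real n / \<delta>)" using n_pos delta_pos delta_le_1 by (simp add: le_divide_eq)
  have RI: "(\<integral>\<^sup>+t. ennreal (R t) \<partial>lborel) \<le> of_nat n * ?I"
  proof -
    have "(\<integral>\<^sup>+t. ennreal (R t) \<partial>lborel) = (\<Sum>k\<in>Bs. \<integral>\<^sup>+t. ennreal (rate n \<delta> (co Bs k e * nrm n (a k)) t) \<partial>lborel)"
      unfolding R_def using rate_nonneg[OF delta_pos]
      by (subst nn_integral_sum[symmetric]) (auto simp: sum_ennreal)
    also have "\<dots> \<le> (\<Sum>k\<in>Bs. ?I)" by (intro sum_mono rate_integral n_pos delta_pos delta_le_1)
    also have "\<dots> = of_nat n * ?I" using dual_basisD(2)[OF dual[OF Bs(1)]] by simp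
    finally show ?thesis .
  qed
  have "(\<Sum>B\<in>\<B>. \<Sum>j\<in>B. \<integral>\<^sup>+x. of_bool (hit x e B j) \<partial>gaussn n)
      \<le> (\<Sum>B\<in>\<B>. \<Sum>j\<in>B. ?C * (\<integral>\<^sup>+y. ennreal (V y) * J B y \<partial>gaussn n))"
    unfolding J_def by (intro sum_mono one) auto
  also have "\<dots> = ?C * (\<integral>\<^sup>+y. (\<Sum>B\<in>\<B>. \<Sum>j\<in>B. ennreal (V y) * J B y) \<partial>gaussn n)"
  proof -
    have VJ: "(\<lambda>y. ennreal (V y) * J B y) \<in> borel_measurable (gaussn n)" if "B \<in> \<B>" for B
      using Jm[OF that] by measurable
    have "(\<integral>\<^sup>+y. (\<Sum>B\<in>\<B>. \<Sum>j\<in>B. ennreal (V y) * J B y) \<partial>gaussn n)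
        = (\<Sum>B\<in>\<B>. \<integral>\<^sup>+y. (\<Sum>j\<in>B. ennreal (V y) * J B y) \<partial>gaussn n)"
      by (rule nn_integral_sum) (intro borel_measurable_sum VJ)
    also have "\<dots> = (\<Sum>B\<in>\<B>. \<Sum>j\<in>B. \<integral>\<^sup>+y. ennreal (V y) * J B y \<partial>gaussn n)"
      by (intro sum.cong refl nn_integral_sum VJ)
    finally show ?thesis by (simp only: sum_distrib_left)
  qed
  also have "\<dots> \<le> ?C * (\<integral>\<^sup>+y. ennreal (V y) * (of_nat n * (of_nat n * ?I)) \<partial>gaussn n)"
  proof (intro mult_left_mono nn_integral_mono)
    fix y assume y: "y \<in> space (gaussn n)"
    have "(\<Sum>B\<in>\<B>. \<Sum>j\<in>B. ennreal (V y) * J B y) = ennreal (V y) * (\<Sum>B\<in>\<B>. \<Sum>j\<in>B. J B y)"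
      by (simp only: sum_distrib_left)
    also have "\<dots> \<le> ennreal (V y) * (of_nat n * (of_nat n * ?I))"
      by (intro mult_left_mono order_trans[OF total[OF y]] RI) auto
    finally show "(\<Sum>B\<in>\<B>. \<Sum>j\<in>B. ennreal (V y) * J B y) \<le> ennreal (V y) * (of_nat n * (of_nat n * ?I))" .
  qed simp
  also have "\<dots> = ?C * ((\<integral>\<^sup>+y. ennreal (V y) \<partial>gaussn n) * (of_nat n * (of_nat n * ?I)))"
    by (subst nn_integral_multc) auto
  also have "\<dots> \<le> ?C * (ennreal (33 * (real n)\<^sup>2) * (of_nat n * (of_nat n * ?I)))"
    unfolding V_def by (intro mult_left_mono mult_right_mono fourth_moment) auto
  also have "\<dots> = ennreal (exp 1 / sqrt (real n) * (33 * (real n)\<^sup>2 * (real n * (real n * ((2 + 2 * ln (real n / \<delta>)) / (sqrt (real n) * \<delta>))))))"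
  proof -
    have "0 \<le> (2 + 2 * ln (real n / \<delta>)) / (sqrt (real n) * \<delta>)" "0 \<le> exp 1 / sqrt (real n)" "0 \<le> 33 * (real n)\<^sup>2"
      using ln0 delta_pos by auto
    then show ?thesis
      by (simp only: ennreal_of_nat_eq_real_of_nat ennreal_mult[symmetric] mult_nonneg_nonneg of_nat_0_le_iff)
  qed
  also have "exp 1 / sqrt (real n) * (33 * (real n)\<^sup>2 * (real n * (real n * ((2 + 2 * ln (real n / \<delta>)) / (sqrt (real n) * \<delta>)))))
      = 66 * exp 1 * (1 + ln (real n / \<delta>)) * real n ^ 3 / \<delta>"
  proof -
    have "sqrt (real n) * sqrt (real n) = real n" by simp
    then show ?thesis using n_pos delta_pos by (simp add: field_simps power2_eq_square power3_eq_cube)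
  qed
  finally show ?thesis .
qed

end


section \<open>Following the parametric objective\<close>

context fan
begin

text \<open>The second condition keeps two walls of a cone from being crossed at the same time:
  proportional coordinates are allowed only if neither of them varies along
  \<open>e\<close>.\<close>

definition generic :: "(nat \<Rightarrow> real) \<Rightarrow> (nat \<Rightarrow> real) \<Rightarrow> bool" where
  "generic x e \<longleftrightarrow> (\<forall>B\<in>\<B>. (\<forall>j\<in>B. co B j x \<noteq> 0) \<and>
     (\<forall>i\<in>B. \<forall>j\<in>B. i \<noteq> j \<longrightarrow> co B i x * co B j e = co B j x * co B i e \<longrightarrow> co B i e = 0 \<and> co B j e = 0))"

text \<open>The crossings still ahead after time \<open>s\<close>. Their number bounds the remaining
  pivots and is also the termination measure of a leg.\<close>

definition crossings :: "(nat \<Rightarrow> real) \<Rightarrow> (nat \<Rightarrow> real) \<Rightarrow> real \<Rightarrow> (nat set \<times> nat) set" where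
  "crossings p q s = {(B, j). B \<in> \<B> \<and> j \<in> B \<and>
     (\<exists>t>s. co B j p + t * co B j q = 0 \<and> (\<forall>i\<in>B - {j}. 0 < co B i p + t * co B i q))}"

lemma finite_crossings: "finite (crossings p q s)"
  by (rule finite_subset[of _ "Sigma \<B> (\<lambda>B. B)"]) (auto simp: crossings_def finite_bases finite_basis)

text \<open>The point \<open>e + t x\<close> is a positive multiple of \<open>x + (1 / t) e\<close>,
  so both directions of travel meet the same walls and are charged to the same event
  \<open>hit\<close>.\<close>

lemma crossings_hit:
  assumes "generic x e"
  shows "crossings x e 0 \<subseteq> {(B, j). B \<in> \<B> \<and> j \<in> B \<and> hit x e B j}"
    "crossings e x 0 \<subseteq> {(B, j). B \<in> \<B> \<and> j \<in> B \<and> hit x e B j}"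
proof safe
  fix B j assume c: "(B, j) \<in> crossings x e 0"
  then show B: "B \<in> \<B>" "j \<in> B" by (auto simp: crossings_def)
  then have x: "co B j x \<noteq> 0" using assms by (auto simp: generic_def)
  obtain t where t: "0 < t" "co B j x + t * co B j e = 0" "\<forall>i\<in>B - {j}. 0 < co B i x + t * co B i e"
    using c by (auto simp: crossings_def)
  have e: "co B j e \<noteq> 0" using t x by auto
  have "- co B j x / co B j e = t" using t(2) e by (simp add: field_simps eq_neg_iff_add_eq_0)
  then show "hit x e B j" using e t unfolding hit_def by auto
next
  fix B j assume c: "(B, j) \<in> crossings e x 0"
  then show B: "B \<in> \<B>" "j \<in> B" by (auto simp: crossings_def)
  then have x: "co B j x \<noteq> 0" using assms by (auto simp: generic_def)
  obtain t where t: "0 < t" "co B j e + t * co B j x = 0" "\<forall>i\<in>B - {j}. 0 < co B i e + t * co B i x"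
    using c by (auto simp: crossings_def)
  have e: "co B j e \<noteq> 0" using t x by auto
  have "- co B j x / co B j e = 1 / t" using t(1,2) e by (simp add: field_simps eq_neg_iff_add_eq_0)
  moreover have "0 < co B i x + 1 / t * co B i e" if "i \<in> B - {j}" for i
  proof -
    have "0 < (co B i e + t * co B i x) / t" using t(1,3) that by simp
    then show ?thesis using t(1) by (simp add: add_divide_distrib add.commute)
  qed
  ultimately show "hit x e B j" using e t unfolding hit_def by auto
qed

lemma card_crossings_le:
  assumes "generic x e"
  shows "card (crossings x e 0) \<le> (\<Sum>B\<in>\<B>. \<Sum>j\<in>B. of_bool (hit x e B j))"
    "card (crossings e x 0) \<le> (\<Sum>B\<in>\<B>. \<Sum>j\<in>B. of_bool (hit x e B j))"
proof -
  let ?H = "{(B, j). B \<in> \<B> \<and> j \<in> B \<and> hit x e B j}"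
  have "?H = Sigma \<B> (\<lambda>B. {j\<in>B. hit x e B j})" by auto
  then have "card ?H = (\<Sum>B\<in>\<B>. card {j\<in>B. hit x e B j})"
    using finite_bases finite_basis by (simp add: card_SigmaI)
  also have "\<dots> = (\<Sum>B\<in>\<B>. \<Sum>j\<in>B. of_bool (hit x e B j))"
    using finite_basis by (intro sum.cong refl) (simp add: of_bool_def sum.If_cases Collect_conj_eq Int_commute)
  finally have c: "card ?H = (\<Sum>B\<in>\<B>. \<Sum>j\<in>B. of_bool (hit x e B j))" .
  have fin: "finite ?H"
    by (rule finite_subset[of _ "Sigma \<B> (\<lambda>B. B)"]) (auto simp: finite_bases finite_basis)
  show "card (crossings x e 0) \<le> (\<Sum>B\<in>\<B>. \<Sum>j\<in>B. of_bool (hit x e B j))"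
    "card (crossings e x 0) \<le> (\<Sum>B\<in>\<B>. \<Sum>j\<in>B. of_bool (hit x e B j))"
    using card_mono[OF fin crossings_hit(1)[OF assms]] card_mono[OF fin crossings_hit(2)[OF assms]] c by auto
qed

text \<open>Refers to the times just after \<open>s\<close>, because at \<open>s\<close> itself the
  ray may lie on the wall that has just been crossed.\<close>

definition entered :: "(nat \<Rightarrow> real) \<Rightarrow> (nat \<Rightarrow> real) \<Rightarrow> real \<Rightarrow> nat set \<Rightarrow> bool" where
  "entered p q s B \<longleftrightarrow> B \<in> \<B> \<and> 0 \<le> s \<and>
     (\<exists>r>s. \<forall>t. s < t \<and> t < r \<longrightarrow> (\<forall>i\<in>B. 0 < co B i p + t * co B i q))"

lemma entered_start:
  assumes "B \<in> \<B>" "\<forall>i\<in>B. 0 < co B i p"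
  shows "entered p q 0 B"
proof -
  have "eventually (\<lambda>t. \<forall>i\<in>B. 0 < co B i p + t * co B i q) (at_right 0)"
  proof (rule eventually_ball_finite[OF finite_basis[OF assms(1)]], rule ballI)
    fix i assume i: "i \<in> B"
    have "((\<lambda>t. co B i p + t * co B i q) \<longlongrightarrow> co B i p + 0 * co B i q) (at_right 0)"
      by (intro tendsto_intros)
    then show "eventually (\<lambda>t. 0 < co B i p + t * co B i q) (at_right 0)"
      using assms(2) i by (intro order_tendstoD(1)) auto
  qed
  then show ?thesis using assms(1) unfolding entered_def eventually_at_right_field by auto
qed

text \<open>The minimum ratio is the time at which the ray leaves the cone of \<open>B\<close>.
  Genericity makes the vanishing coordinate unique; the exchange changes the other coordinates by
  multiples of it, so at \<open>t\<close> they keep their positive values. The entering coordinate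
  is the leaving one divided by the negative number \<open>co B j (a r)\<close>, hence positive
  right after \<open>t\<close>.\<close>

lemma leg_step:
  assumes gen: "generic p q \<or> generic q p" and ent: "entered p q s B" and j: "j \<in> B" and neg: "co B j q < 0"
    and min: "\<And>i. i \<in> B \<Longrightarrow> co B i q < 0 \<Longrightarrow> co B j p / - co B j q \<le> co B i p / - co B i q"
    and r: "r \<notin> B" "co B j (a r) < 0" and B': "insert r (B - {j}) \<in> \<B>"
  defines "t \<equiv> co B j p / - co B j q" and "B' \<equiv> insert r (B - {j})"
  shows "s < t" "nonneg_on B (\<lambda>l. p l + t * q l)" "nonneg_on B' (\<lambda>l. p l + t * q l)"
    "entered p q t B'" "card (crossings p q t) < card (crossings p q s)"
proof -
  have B: "B \<in> \<B>" and s0: "0 \<le> s" using ent by (auto simp: entered_def)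
  have coe: "co C i (\<lambda>l. p l + t * q l) = co C i p + t * co C i q" for C i
    by (simp add: ip_add_right ip_scale_right)
  obtain z where z: "s < z" and zp: "\<And>x i. s < x \<Longrightarrow> x < z \<Longrightarrow> i \<in> B \<Longrightarrow> 0 < co B i p + x * co B i q"
    using ent unfolding entered_def by blast
  define x where "x = (s + z) / 2"
  have x: "s < x" "x < z" using z by (auto simp: x_def)
  have "0 < co B j p + x * co B j q" using zp[OF x j] .
  then have xt: "x < t" using neg by (simp add: t_def field_simps)
  then show st: "s < t" using x by simp
  have t0: "0 < t" using st s0 by simp
  have tj: "co B j p + t * co B j q = 0" using neg by (simp add: t_def field_simps)
  have ge: "0 \<le> co B i p + t * co B i q" if i: "i \<in> B" for i
  proof (cases "co B i q < 0")
    case True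
    then have "t \<le> co B i p / - co B i q" unfolding t_def by (rule min[OF i])
    then show ?thesis using True by (simp add: field_simps)
  next
    case False
    then have "x * co B i q \<le> t * co B i q" using xt by (intro mult_right_mono) auto
    then show ?thesis using zp[OF x i] by linarith
  qed
  have gt: "0 < co B i p + t * co B i q" if i: "i \<in> B - {j}" for i
  proof -
    have "co B i p + t * co B i q \<noteq> 0"
    proof
      assume ti: "co B i p + t * co B i q = 0"
      have pi: "co B i p = - t * co B i q" and pj: "co B j p = - t * co B j q" using ti tj by auto
      have a1: "co B i p * co B j q = co B j p * co B i q" by (simp add: pi pj)
      from gen show False
      proof
        assume "generic p q"
        then show False using a1 B i j neg unfolding generic_def by (metis DiffD1 DiffD2 insertI1 less_irrefl)
      next
        assume g: "generic q p"
        then have "co B i p = 0 \<and> co B j p = 0" using a1 B i j unfolding generic_def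
          by (metis DiffD1 DiffD2 insertI1 mult.commute)
        then show False using pj t0 neg by simp
      qed
    qed
    then show ?thesis using ge[of i] i by simp
  qed
  show "nonneg_on B (\<lambda>l. p l + t * q l)" using ge by (simp add: nonneg_on_def coe)
  note cB' = dual_basis_pivot_coord[OF dual[OF B] dual[OF B'] j r(1) less_imp_neq[OF r(2)], folded B'_def]
  have cr: "co B' r y = co B j y / co B j (a r)" for y by (rule cB'(1))
  have ci: "co B' i y = co B i y - co B i (a r) / co B j (a r) * co B j y" if "i \<in> B - {j}" for i y
    by (rule cB'(2)[OF that])
  have vr: "co B' r p + y * co B' r q = (co B j p + y * co B j q) / co B j (a r)" for y
    by (simp add: cr add_divide_distrib)
  have vi: "co B' i p + t * co B' i q = co B i p + t * co B i q" if "i \<in> B - {j}" for i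
  proof -
    have "co B' i p + t * co B' i q = co B i p + t * co B i q
        - co B i (a r) / co B j (a r) * (co B j p + t * co B j q)"
      unfolding ci[OF that] by (simp add: algebra_simps add_divide_distrib)
    then show ?thesis by (simp add: tj)
  qed
  show "nonneg_on B' (\<lambda>l. p l + t * q l)"
    unfolding nonneg_on_def coe
  proof
    fix i assume "i \<in> B'"
    then consider "i = r" | "i \<in> B - {j}" by (auto simp: B'_def)
    then show "0 \<le> co B' i p + t * co B' i q"
    proof cases
      case 1 then show ?thesis using vr[of t] tj by simp
    next
      case 2 then show ?thesis using vi[OF 2] gt[OF 2] by simp
    qed
  qed
  have fin: "finite (B - {j})" using finite_basis[OF B] by simp
  have "eventually (\<lambda>y. \<forall>i\<in>B - {j}. 0 < co B' i p + y * co B' i q) (at_right t)"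
  proof (rule eventually_ball_finite[OF fin], rule ballI)
    fix i assume i: "i \<in> B - {j}"
    have "((\<lambda>y. co B' i p + y * co B' i q) \<longlongrightarrow> co B' i p + t * co B' i q) (at_right t)"
      by (intro tendsto_intros)
    then show "eventually (\<lambda>y. 0 < co B' i p + y * co B' i q) (at_right t)"
      using vi[OF i] gt[OF i] by (intro order_tendstoD(1)) auto
  qed
  then obtain w where w: "t < w" "\<And>y i. t < y \<Longrightarrow> y < w \<Longrightarrow> i \<in> B - {j} \<Longrightarrow> 0 < co B' i p + y * co B' i q"
    unfolding eventually_at_right_field by blast
  have "0 < co B' r p + y * co B' r q" if "t < y" for y
  proof -
    have "co B j p + y * co B j q < 0" using that neg tj by (smt (verit) mult_less_cancel_right)
    then show ?thesis unfolding vr using r(2) by (simp add: zero_less_divide_iff)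
  qed
  then have "\<forall>y. t < y \<and> y < w \<longrightarrow> (\<forall>i\<in>B'. 0 < co B' i p + y * co B' i q)"
    using w(2) by (auto simp: B'_def)
  then show "entered p q t B'"
    using B' t0 w(1) unfolding entered_def B'_def[symmetric] by (intro conjI) auto
  have "(B, j) \<in> crossings p q s" using B j st tj gt by (auto simp: crossings_def)
  moreover have "(B, j) \<notin> crossings p q t"
  proof
    assume "(B, j) \<in> crossings p q t"
    then obtain y where y: "t < y" "co B j p + y * co B j q = 0" by (auto simp: crossings_def)
    have "y * co B j q = t * co B j q" using y(2) tj by linarith
    then show False using y(1) neg by simp
  qed
  moreover have "crossings p q t \<subseteq> crossings p q s" using st by (auto simp: crossings_def intro: less_trans)
  ultimately have "crossings p q t \<subset> crossings p q s" by blast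
  then show "card (crossings p q t) < card (crossings p q s)"
    using finite_crossings by (intro psubset_card_mono) auto
qed

end


section \<open>Lexicographic feasibility\<close>

definition lexpos :: "real \<Rightarrow> real \<Rightarrow> bool" where
  "lexpos x y \<longleftrightarrow> 0 < x \<or> (x = 0 \<and> 0 < y)"

lemma lexpos_add: "lexpos x y \<Longrightarrow> lexpos x' y' \<Longrightarrow> lexpos (x + x') (y + y')"
  unfolding lexpos_def by auto

lemma lexpos_scale: "lexpos x y \<Longrightarrow> 0 < c \<Longrightarrow> lexpos (c * x) (c * y)"
  unfolding lexpos_def by auto

text \<open>Replaces the infinitesimal by an actual small number, which is possible because only
  finitely many strict signs have to be preserved.\<close>

lemma finite_lexpos_perturbation:
  assumes "finite S" "\<And>p. p \<in> S \<Longrightarrow> lexpos (f p) (h p)"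
  shows "\<exists>\<epsilon>>0. \<forall>p\<in>S. 0 < f p + \<epsilon> * h p"
proof -
  have "eventually (\<lambda>e. \<forall>p\<in>S. 0 < f p + e * h p) (at_right 0)"
  proof (rule eventually_ball_finite[OF assms(1)], rule ballI)
    fix p assume "p \<in> S"
    then consider "0 < f p" | "f p = 0" "0 < h p" using assms(2) unfolding lexpos_def by blast
    then show "eventually (\<lambda>e. 0 < f p + e * h p) (at_right 0)"
    proof cases
      case 1
      have "((\<lambda>e. f p + e * h p) \<longlongrightarrow> f p + 0 * h p) (at_right 0)" by (intro tendsto_intros)
      then show ?thesis using 1 by (intro order_tendstoD(1)) auto
    next
      case 2
      then show ?thesis by (auto simp: eventually_at_right_field intro!: exI[of _ 1])
    qed
  qed
  then obtain b where b: "0 < b" "\<And>e. 0 < e \<Longrightarrow> e < b \<Longrightarrow> \<forall>p\<in>S. 0 < f p + e * h p"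
    unfolding eventually_at_right_field by blast
  then show ?thesis using b(2)[of "b / 2"] by (intro exI[of _ "b / 2"]) simp
qed

text \<open>Makes the dual vectors a function of the set alone, so that fans, tableaux and counting
  formulas all refer to the same vectors.\<close>

definition dual_of :: "nat \<Rightarrow> (nat \<Rightarrow> nat \<Rightarrow> real) \<Rightarrow> nat set \<Rightarrow> nat \<Rightarrow> nat \<Rightarrow> real" where
  "dual_of n a B = (SOME u. dual_basis n a B u)"

lemma dual_of: "dual_basis n a B u \<Longrightarrow> dual_basis n a B (dual_of n a B)"
  using someI[of "dual_basis n a B" u] by (simp add: dual_of_def)

lemma dual_of_eq: "dual_basis n a B u \<Longrightarrow> j \<in> B \<Longrightarrow> ip n (dual_of n a B j) y = ip n (u j) y"
  by (rule dual_basis_unique[OF dual_of])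

text \<open>Residual of constraint \<open>k\<close> at the basic solution of \<open>B\<close> for
  the right-hand side \<open>h\<close>. It is linear in \<open>h\<close>, so \<open>b\<close> and
  the perturbation can be carried along separately.\<close>

definition slack :: "nat \<Rightarrow> (nat \<Rightarrow> nat \<Rightarrow> real) \<Rightarrow> (nat \<Rightarrow> real) \<Rightarrow> nat set \<Rightarrow> nat \<Rightarrow> real" where
  "slack n a h B k = h k - (\<Sum>j\<in>B. ip n (dual_of n a B j) (a k) * h j)"

text \<open>Bases that are feasible for the right-hand side \<open>b + \<epsilon> w\<close> with infinitesimal \<open>\<epsilon> > 0\<close>.\<close>
definition lex_bases :: "nat \<Rightarrow> nat \<Rightarrow> (nat \<Rightarrow> nat \<Rightarrow> real) \<Rightarrow> (nat \<Rightarrow> real) \<Rightarrow> (nat \<Rightarrow> real) \<Rightarrow> nat set set" where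
  "lex_bases n m a b w = {B. B \<subseteq> {..<m} \<and> (\<exists>u. dual_basis n a B u) \<and>
     (\<forall>k<m. k \<notin> B \<longrightarrow> lexpos (slack n a b B k) (slack n a w B k))}"

definition generic_rhs :: "nat \<Rightarrow> nat \<Rightarrow> (nat \<Rightarrow> nat \<Rightarrow> real) \<Rightarrow> (nat \<Rightarrow> real) \<Rightarrow> bool" where
  "generic_rhs n m a w \<longleftrightarrow> (\<forall>B\<subseteq>{..<m}. (\<exists>u. dual_basis n a B u) \<longrightarrow> (\<forall>k<m. k \<notin> B \<longrightarrow> slack n a w B k \<noteq> 0))"

lemma slack_basic:
  assumes "dual_basis n a B u" "k \<in> B"
  shows "slack n a h B k = 0"
proof -
  have "(\<Sum>j\<in>B. ip n (dual_of n a B j) (a k) * h j) = (\<Sum>j\<in>B. if k = j then h j else 0)"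
    using dual_basisD(3)[OF dual_of[OF assms(1)] assms(2)] by (intro sum.cong) auto
  then show ?thesis using dual_basisD(1)[OF assms(1)] assms(2) by (simp add: slack_def)
qed

lemma slack_pivot:
  assumes d: "dual_basis n a B u" and j: "j \<in> B" and r: "r \<notin> B" and nz: "ip n (dual_of n a B j) (a r) \<noteq> 0"
  shows "slack n a h (insert r (B - {j})) k
    = slack n a h B k - ip n (dual_of n a B j) (a k) / ip n (dual_of n a B j) (a r) * slack n a h B r"
proof -
  let ?v = "dual_of n a B" and ?B' = "insert r (B - {j})"
  have dv: "dual_basis n a B ?v" by (rule dual_of[OF d])
  obtain u' where "dual_basis n a ?B' u'" using dual_basis_pivot[OF dv j r nz] by blast
  then have dv': "dual_basis n a ?B' (dual_of n a ?B')" by (rule dual_of)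
  note co = dual_basis_pivot_coord[OF dv dv' j r nz]
  have fin: "finite B" by (rule dual_basisD(1)[OF d])
  let ?f = "ip n (?v j) (a k) / ip n (?v j) (a r)"
  have "(\<Sum>i\<in>?B'. ip n (dual_of n a ?B' i) (a k) * h i)
      = ?f * h r + (\<Sum>i\<in>B - {j}. ip n (dual_of n a ?B' i) (a k) * h i)"
    using fin r co(1)[of "a k"] by (subst sum.insert) auto
  also have "(\<Sum>i\<in>B - {j}. ip n (dual_of n a ?B' i) (a k) * h i)
      = (\<Sum>i\<in>B - {j}. ip n (?v i) (a k) * h i - ?f * (ip n (?v i) (a r) * h i))"
  proof (rule sum.cong[OF refl])
    fix i assume "i \<in> B - {j}"
    from co(2)[OF this, of "a k"]
    show "ip n (dual_of n a ?B' i) (a k) * h i = ip n (?v i) (a k) * h i - ?f * (ip n (?v i) (a r) * h i)"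
      by (simp add: left_diff_distrib)
  qed
  also have "\<dots> = (\<Sum>i\<in>B - {j}. ip n (?v i) (a k) * h i) - ?f * (\<Sum>i\<in>B - {j}. ip n (?v i) (a r) * h i)"
    by (simp add: sum_subtractf sum_distrib_left[symmetric] sum_divide_distrib[symmetric])
  also have "(\<Sum>i\<in>B - {j}. ip n (?v i) (a k) * h i) = (\<Sum>i\<in>B. ip n (?v i) (a k) * h i) - ip n (?v j) (a k) * h j"
    using fin j by (simp add: sum.remove)
  also have "(\<Sum>i\<in>B - {j}. ip n (?v i) (a r) * h i) = (\<Sum>i\<in>B. ip n (?v i) (a r) * h i) - ip n (?v j) (a r) * h j"
    using fin j by (simp add: sum.remove)
  finally have X: "(\<Sum>i\<in>?B'. ip n (dual_of n a ?B' i) (a k) * h i)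
    = ?f * h r + ((\<Sum>i\<in>B. ip n (?v i) (a k) * h i) - ip n (?v j) (a k) * h j
      - ?f * ((\<Sum>i\<in>B. ip n (?v i) (a r) * h i) - ip n (?v j) (a r) * h j))" .
  show ?thesis unfolding slack_def X using nz by (simp add: field_simps)
qed

lemma slack_linear: "slack n a (\<lambda>i. h i + \<epsilon> * w i) B k = slack n a h B k + \<epsilon> * slack n a w B k"
  by (simp add: slack_def algebra_simps sum.distrib sum_distrib_left)

text \<open>Once the first comparison has failed, the negated reverse comparison expresses equality;
  this is the form that the test in \<open>Enter\<close> evaluates.\<close>

definition lex_ratio_less :: "nat \<Rightarrow> (nat \<Rightarrow> nat \<Rightarrow> real) \<Rightarrow> (nat \<Rightarrow> real) \<Rightarrow> (nat \<Rightarrow> real) \<Rightarrow> nat set \<Rightarrow> nat \<Rightarrow> nat \<Rightarrow> nat \<Rightarrow> bool" where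
  "lex_ratio_less n a b w B j i k \<longleftrightarrow> (let t = \<lambda>s. - ip n (dual_of n a B j) (a s) in
     slack n a b B i / t i < slack n a b B k / t k \<or>
     (\<not> slack n a b B k / t k < slack n a b B i / t i \<and> slack n a w B i / t i < slack n a w B k / t k))"

text \<open>For a row with negative coordinate, the new slack is a positive multiple of the
  difference between its ratio and that of \<open>r\<close>, so a lexicographically smallest ratio
  keeps the pair nonnegative. A tie in both components would be a vanishing slack of
  \<open>w\<close> at the new basis, which \<open>generic_rhs\<close> excludes. The leaving row
  inherits a positive multiple of the slack of \<open>r\<close>.\<close>

lemma lex_pivot:
  assumes B: "B \<in> lex_bases n m a b w" and gen: "generic_rhs n m a w" and j: "j \<in> B" and r: "r < m"
    and neg: "ip n (dual_of n a B j) (a r) < 0"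
    and min: "\<And>i. i < m \<Longrightarrow> ip n (dual_of n a B j) (a i) < 0 \<Longrightarrow> \<not> lex_ratio_less n a b w B j i r"
  shows "r \<notin> B" "insert r (B - {j}) \<in> lex_bases n m a b w"
proof -
  let ?v = "dual_of n a B" and ?B' = "insert r (B - {j})"
  obtain u where d: "dual_basis n a B u" using B by (auto simp: lex_bases_def)
  have dv: "dual_basis n a B ?v" by (rule dual_of[OF d])
  have Bm: "B \<subseteq> {..<m}" and feas: "\<And>k. k < m \<Longrightarrow> k \<notin> B \<Longrightarrow> lexpos (slack n a b B k) (slack n a w B k)"
    using B by (auto simp: lex_bases_def)
  show rB: "r \<notin> B"
    using dual_basisD(3)[OF dv _ j, of r] neg by (auto split: if_splits)
  have nz: "ip n (?v j) (a r) \<noteq> 0" using neg by simp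
  obtain u' where d': "dual_basis n a ?B' u'" using dual_basis_pivot[OF dv j rB nz] by blast
  have B'm: "?B' \<subseteq> {..<m}" using Bm r by auto
  define c where "c = - ip n (?v j) (a r)"
  have c: "0 < c" using neg by (simp add: c_def)
  have sl: "slack n a h ?B' k = slack n a h B k + ip n (?v j) (a k) / c * slack n a h B r" for h k
    using slack_pivot[OF d j rB nz, of h k] by (simp add: c_def)
  have rpos: "lexpos (slack n a b B r) (slack n a w B r)" using feas[OF r rB] .
  have "lexpos (slack n a b ?B' k) (slack n a w ?B' k)" if k: "k < m" "k \<notin> ?B'" for k
  proof (cases "k = j")
    case True
    then have "ip n (?v j) (a k) = 1" using dual_basisD(3)[OF dv j j] by simp
    then show ?thesis using lexpos_scale[OF rpos, of "1 / c"] c True slack_basic[OF d j] by (simp add: sl)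
  next
    case False
    then have kB: "k \<notin> B" using k by auto
    have kpos: "lexpos (slack n a b B k) (slack n a w B k)" using feas[OF k(1) kB] .
    let ?t = "ip n (?v j) (a k)"
    consider "?t = 0" | "0 < ?t" | "?t < 0" by linarith
    then show ?thesis
    proof cases
      case 1 then show ?thesis using kpos by (simp add: sl)
    next
      case 2
      then show ?thesis unfolding sl using lexpos_add[OF kpos lexpos_scale[OF rpos, of "?t / c"]] c by simp
    next
      case 3
      have nl: "\<not> lex_ratio_less n a b w B j k r" by (rule min[OF k(1) 3])
      have e: "slack n a h ?B' k = - ?t * (slack n a h B k / - ?t - slack n a h B r / c)" for h
        using 3 c by (simp add: sl field_simps)
      have ne: "slack n a w ?B' k \<noteq> 0"
        using gen B'm d' k unfolding generic_rhs_def by blast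
      have "0 < slack n a b B k / - ?t - slack n a b B r / c \<or>
        (slack n a b B k / - ?t - slack n a b B r / c = 0 \<and> 0 \<le> slack n a w B k / - ?t - slack n a w B r / c)"
        using nl unfolding lex_ratio_less_def Let_def c_def by linarith
      moreover have "slack n a w B k / - ?t - slack n a w B r / c \<noteq> 0" using ne unfolding e by auto
      ultimately have "lexpos (slack n a b B k / - ?t - slack n a b B r / c) (slack n a w B k / - ?t - slack n a w B r / c)"
        unfolding lexpos_def by linarith
      then show ?thesis unfolding e by (rule lexpos_scale) (use 3 in simp)
    qed
  qed
  then show "?B' \<in> lex_bases n m a b w"
    using B'm d' unfolding lex_bases_def by blast
qed

lemma ex_lex_minimum:
  assumes "finite S" "S \<noteq> {}"
  shows "\<exists>r\<in>S. \<forall>i\<in>S. \<not> ((f i :: real) < f r \<or> (\<not> f r < f i \<and> (h i :: real) < h r))"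
proof -
  obtain x where x: "x \<in> S" "\<And>y. y \<in> S \<Longrightarrow> - f y \<le> - f x" using finite_has_max[OF assms, of "\<lambda>y. - f y"] by blast
  define S' where "S' = {y\<in>S. f y = f x}"
  have "finite S'" "S' \<noteq> {}" using assms x by (auto simp: S'_def)
  then obtain r where r: "r \<in> S'" "\<And>y. y \<in> S' \<Longrightarrow> - h y \<le> - h r" using finite_has_max[of S' "\<lambda>y. - h y"] by blast
  show ?thesis
  proof (rule bexI[of _ r], rule ballI)
    show "r \<in> S" using r by (simp add: S'_def)
    fix i assume i: "i \<in> S"
    show "\<not> (f i < f r \<or> (\<not> f r < f i \<and> h i < h r))"
    proof (cases "f i = f x")
      case True
      then have "i \<in> S'" using i by (simp add: S'_def)
      then show ?thesis using r(2)[of i] True r(1) by (auto simp: S'_def)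
    next
      case False
      then show ?thesis using x(2)[OF i] r(1) by (auto simp: S'_def)
    qed
  qed
qed

text \<open>One \<epsilon> realizes the lexicographic signs for all pairs of a basis and a nonbasic
  row, so \<open>b + \<epsilon> w\<close> is a genuine right-hand side without degeneracy at these
  bases. Neighbours come from the lexicographic ratio test, which has a candidate because every edge
  is bounded.\<close>

lemma lex_bases_fan:
  assumes n: "0 < n" and d: "0 < \<delta>" and gen: "generic_rhs n m a w" and ne: "lex_bases n m a b w \<noteq> {}"
    and bounded: "\<And>B j. B \<in> lex_bases n m a b w \<Longrightarrow> j \<in> B \<Longrightarrow> \<exists>r<m. ip n (dual_of n a B j) (a r) < 0"
    and dist: "\<And>B j. B \<in> lex_bases n m a b w \<Longrightarrow> j \<in> B \<Longrightarrow> nrm n (dual_of n a B j) * nrm n (a j) \<le> 1 / \<delta>"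
  shows "\<exists>bs. fan n m a bs (lex_bases n m a b w) (dual_of n a) \<delta>"
proof -
  let ?L = "lex_bases n m a b w"
  have fin: "finite ?L" by (rule finite_subset[of _ "Pow {..<m}"]) (auto simp: lex_bases_def)
  have dual: "dual_basis n a B (dual_of n a B)" if "B \<in> ?L" for B
    using that dual_of by (auto simp: lex_bases_def)
  define S where "S = {(B, k). B \<in> ?L \<and> k \<in> {..<m} \<and> k \<notin> B}"
  have "finite S" by (rule finite_subset[of _ "?L \<times> {..<m}"]) (auto simp: S_def fin)
  then obtain \<epsilon> where e: "0 < \<epsilon>" "\<forall>p\<in>S. 0 < slack n a b (fst p) (snd p) + \<epsilon> * slack n a w (fst p) (snd p)"
    using finite_lexpos_perturbation[of S "\<lambda>p. slack n a b (fst p) (snd p)" "\<lambda>p. slack n a w (fst p) (snd p)"]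
    by (auto simp: S_def lex_bases_def)
  have "fan n m a (\<lambda>i. b i + \<epsilon> * w i) ?L (dual_of n a) \<delta>"
  proof
    fix B assume B: "B \<in> ?L"
    show "B \<subseteq> {..<m}" using B by (simp add: lex_bases_def)
    show "dual_basis n a B (dual_of n a B)" by (rule dual[OF B])
    show "0 < b k + \<epsilon> * w k - (\<Sum>j\<in>B. (b j + \<epsilon> * w j) * ip n (dual_of n a B j) (a k))" if "k < m" "k \<notin> B" for k
      using e(2) B that slack_linear[of n a b \<epsilon> w B k] by (force simp: S_def slack_def mult.commute)
    show "\<exists>B'\<in>?L. B - {j} \<subseteq> B' \<and> j \<notin> B'" if j: "j \<in> B" for j
    proof -
      define R where "R = {r. r < m \<and> ip n (dual_of n a B j) (a r) < 0}"
      have "finite R" "R \<noteq> {}" using bounded[OF B j] by (auto simp: R_def)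
      then obtain r where r: "r \<in> R" "\<And>i. i \<in> R \<Longrightarrow> \<not> lex_ratio_less n a b w B j i r"
        using ex_lex_minimum[of R "\<lambda>i. slack n a b B i / - ip n (dual_of n a B j) (a i)" "\<lambda>i. slack n a w B i / - ip n (dual_of n a B j) (a i)"]
        unfolding lex_ratio_less_def Let_def by blast
      have "r \<notin> B \<and> insert r (B - {j}) \<in> ?L"
        using lex_pivot[OF B gen j, of r] r by (auto simp: R_def)
      then show ?thesis using j by (intro bexI[of _ "insert r (B - {j})"]) auto
    qed
    show "nrm n (dual_of n a B j) * nrm n (a j) \<le> 1 / \<delta>" if "j \<in> B" for j by (rule dist[OF B that])
  qed (use n d fin ne in auto)
  then show ?thesis by blast
qed


section \<open>A cost logic for the real RAM\<close>

definition forget_steps :: "state \<Rightarrow> state" where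
  "forget_steps s = s\<lparr>steps := 0\<rparr>"

text \<open>Assertions do not see the step counter; the fourth argument bounds its increase.\<close>
definition ht :: "nat \<Rightarrow> (nat \<Rightarrow> real \<times> real) \<Rightarrow> (state \<Rightarrow> bool) \<Rightarrow> com \<Rightarrow> nat \<Rightarrow> (state \<Rightarrow> bool) \<Rightarrow> bool" where
  "ht n \<omega> P p c Q \<longleftrightarrow> (\<forall>s. P (forget_steps s) \<longrightarrow>
     (\<exists>s'. exec n \<omega> p s s' \<and> Q (forget_steps s') \<and> steps s' \<le> steps s + c))"

lemma state_simps [simp]:
  "idx (forget_steps s) = idx s" "reg (forget_steps s) = reg s" "draws (forget_steps s) = draws s"
  "trace (forget_steps s) = trace s" "steps (forget_steps s) = 0"
  "idx (tick k s) = idx s" "reg (tick k s) = reg s" "draws (tick k s) = draws s" "trace (tick k s) = trace s"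
  "steps (tick k s) = steps s + k"
  "idx (set_idx a i j s) = (idx s)(a := (idx s a)(i := j))" "reg (set_idx a i j s) = reg s"
  "draws (set_idx a i j s) = draws s" "trace (set_idx a i j s) = trace s" "steps (set_idx a i j s) = steps s"
  "reg (set_reg a i l x s) = (reg s)(a := (reg s a)(i := (reg s a i)(l := x)))" "idx (set_reg a i l x s) = idx s"
  "draws (set_reg a i l x s) = draws s" "trace (set_reg a i l x s) = trace s" "steps (set_reg a i l x s) = steps s"
  "idx (next_draw s) = idx s" "reg (next_draw s) = reg s" "draws (next_draw s) = Suc (draws s)"
  "trace (next_draw s) = trace s" "steps (next_draw s) = steps s"
  "idx (report e s) = idx s" "reg (report e s) = reg s" "draws (report e s) = draws s"
  "trace (report e s) = trace s @ [(steps s, e)]" "steps (report e s) = steps s"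
  by (simp_all add: forget_steps_def tick_def set_idx_def set_reg_def next_draw_def report_def)

lemma forget_steps_simps [simp]:
  "forget_steps (tick k s) = forget_steps s"
  "forget_steps (set_idx a i j s) = set_idx a i j (forget_steps s)"
  "forget_steps (set_reg a i l x s) = set_reg a i l x (forget_steps s)"
  "forget_steps (next_draw s) = next_draw (forget_steps s)"
  "forget_steps (forget_steps s) = forget_steps s"
  by (simp_all add: forget_steps_def tick_def set_idx_def set_reg_def next_draw_def)

lemma ival_cong: "idx s = idx t \<Longrightarrow> ival s e = ival t e"
  by (induction e) auto

lemma rval_cong: "idx s = idx t \<Longrightarrow> reg s = reg t \<Longrightarrow> rval s e = rval t e"
  by (induction e) (auto simp: ival_cong[of s t])

lemma bval_cong: "idx s = idx t \<Longrightarrow> reg s = reg t \<Longrightarrow> bval s g = bval t g"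
  by (induction g) (auto simp: ival_cong[of s t] rval_cong[of s t])

lemma val_forget_steps [simp]:
  "ival (forget_steps s) e = ival s e" "rval (forget_steps s) p = rval s p" "bval (forget_steps s) g = bval s g"
  "ival (tick k s) e = ival s e" "rval (tick k s) p = rval s p" "bval (tick k s) g = bval s g"
  using ival_cong[of "forget_steps s" s] rval_cong[of "forget_steps s" s] bval_cong[of "forget_steps s" s]
    ival_cong[of "tick k s" s] rval_cong[of "tick k s" s] bval_cong[of "tick k s" s] by simp_all

lemma ht_conseq:
  assumes "ht n \<omega> P' p c' Q'" "\<And>s. P s \<Longrightarrow> P' s" "\<And>s. Q' s \<Longrightarrow> Q s" "c' \<le> c"
  shows "ht n \<omega> P p c Q"
  using assms unfolding ht_def by (meson add_left_mono le_trans)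

text \<open>Fixing the initial state lets a postcondition refer to it; the counter may be taken to
  be 0 since assertions do not see it.\<close>

lemma ht_pointwise:
  assumes "\<And>s0. P s0 \<Longrightarrow> steps s0 = 0 \<Longrightarrow> ht n \<omega> (\<lambda>s. s = s0) p c Q"
  shows "ht n \<omega> P p c Q"
  using assms unfolding ht_def by (metis state_simps(5))

lemma ht_Skip: "(\<And>s. P s \<Longrightarrow> Q s) \<Longrightarrow> ht n \<omega> P Skip c Q"
  unfolding ht_def using exec.Skip by (metis le_add1)

lemma ht_atomic:
  assumes "\<And>s. exec n \<omega> p s (F s)" "\<And>s. P s \<Longrightarrow> Q (G s)" "\<And>s. forget_steps (F s) = G (forget_steps s)"
    "\<And>s. steps (F s) \<le> steps s + c"
  shows "ht n \<omega> P p c Q"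
  unfolding ht_def using assms by metis

lemma ht_IAssign:
  assumes "\<And>s. P s \<Longrightarrow> Q (set_idx a (ival s e) (ival s f) s)" "1 + icost e + icost f \<le> c"
  shows "ht n \<omega> P (IAssign a e f) c Q"
  by (rule ht_atomic[where P=P and Q=Q, OF exec.IAssign assms(1)]) (use assms(2) in auto)

lemma ht_RAssign:
  assumes "\<And>s. P s \<Longrightarrow> Q (set_reg a (ival s e) (ival s f) (rval s p) s)" "1 + icost e + icost f + rcost p \<le> c"
  shows "ht n \<omega> P (RAssign a e f p) c Q"
  by (rule ht_atomic[where P=P and Q=Q, OF exec.RAssign assms(1)]) (use assms(2) in auto)

lemma ht_DrawNormal:
  assumes "\<And>s. P s \<Longrightarrow> Q (next_draw (set_reg a (ival s e) (ival s f) (fst (\<omega> (draws s))) s))"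
    "1 + icost e + icost f \<le> c"
  shows "ht n \<omega> P (DrawNormal a e f) c Q"
  by (rule ht_atomic[where P=P and Q=Q, OF exec.DrawNormal assms(1)]) (use assms(2) in auto)

lemma ht_DrawExponential:
  assumes "\<And>s. P s \<Longrightarrow> Q (next_draw (set_reg a (ival s e) (ival s f) (snd (\<omega> (draws s))) s))"
    "1 + icost e + icost f \<le> c"
  shows "ht n \<omega> P (DrawExponential a e f) c Q"
  by (rule ht_atomic[where P=P and Q=Q, OF exec.DrawExponential assms(1)]) (use assms(2) in auto)

lemma ht_Seq:
  assumes "ht n \<omega> P p c1 Q" "ht n \<omega> Q q c2 R" "c1 + c2 \<le> c"
  shows "ht n \<omega> P (Seq p q) c R"
  unfolding ht_def
proof (intro allI impI)
  fix s assume "P (forget_steps s)"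
  then obtain s' where s': "exec n \<omega> p s s'" "Q (forget_steps s')" "steps s' \<le> steps s + c1"
    using assms(1) unfolding ht_def by blast
  then obtain s'' where "exec n \<omega> q s' s''" "R (forget_steps s'')" "steps s'' \<le> steps s' + c2"
    using assms(2) unfolding ht_def by blast
  then show "\<exists>s''. exec n \<omega> (Seq p q) s s'' \<and> R (forget_steps s'') \<and> steps s'' \<le> steps s + c"
    using s' assms(3) exec.Seq by (intro exI[of _ s'']) auto
qed

lemma ht_Cond:
  assumes "ht n \<omega> (\<lambda>s. P s \<and> bval s g) p c1 Q" "ht n \<omega> (\<lambda>s. P s \<and> \<not> bval s g) q c1 Q" "1 + bcost g + c1 \<le> c"
  shows "ht n \<omega> P (Cond g p q) c Q"
  unfolding ht_def
proof (intro allI impI)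
  fix s assume P: "P (forget_steps s)"
  let ?s = "tick (1 + bcost g) s"
  show "\<exists>s'. exec n \<omega> (Cond g p q) s s' \<and> Q (forget_steps s') \<and> steps s' \<le> steps s + c"
  proof (cases "bval s g")
    case True
    then obtain s' where "exec n \<omega> p ?s s'" "Q (forget_steps s')" "steps s' \<le> steps ?s + c1"
      using assms(1) P unfolding ht_def by (metis forget_steps_simps(1) val_forget_steps(3))
    then show ?thesis using True assms(3) exec.CondTrue by (intro exI[of _ s']) auto
  next
    case False
    then obtain s' where "exec n \<omega> q ?s s'" "Q (forget_steps s')" "steps s' \<le> steps ?s + c1"
      using assms(2) P unfolding ht_def by (metis forget_steps_simps(1) val_forget_steps(3))
    then show ?thesis using False assms(3) exec.CondFalse by (intro exI[of _ s']) auto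
  qed
qed

abbreviation vr :: "nat \<Rightarrow> iexp" where
  "vr v \<equiv> Idx v (Lit 0)"

definition For :: "nat \<Rightarrow> iexp \<Rightarrow> com \<Rightarrow> com" where
  "For v bound body = Seq (IAssign v (Lit 0) (Lit 0)) (While (ILess (vr v) bound)
     (Seq body (IAssign v (Lit 0) (IPlus (vr v) (Lit 1)))))"

text \<open>The bound is evaluated anew in every round, so it must keep the value \<open>N\<close>
  under the invariant, and the body must leave the loop variable alone for the increment to give
  \<open>Suc k\<close>. The guard is evaluated \<open>N + 1\<close> times.\<close>

lemma ht_For:
  assumes init: "\<And>s. P s \<Longrightarrow> I 0 (set_idx v 0 0 s)"
    and bound: "\<And>k s. I k s \<Longrightarrow> ival s bound = N"
    and var: "\<And>k s. I k s \<Longrightarrow> idx s v 0 = k"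
    and body: "\<And>k. k < N \<Longrightarrow> ht n \<omega> (I k) body c (\<lambda>s. I (Suc k) (set_idx v 0 (Suc k) s) \<and> idx s v 0 = k)"
    and post: "\<And>s. I N s \<Longrightarrow> Q s"
    and cost: "3 + (N + 1) * (10 + icost bound + c) \<le> C"
  shows "ht n \<omega> P (For v bound body) C Q"
proof -
  let ?d = "10 + icost bound + c"
  let ?w = "While (ILess (vr v) bound) (Seq body (IAssign v (Lit 0) (IPlus (vr v) (Lit 1))))"
  have loop: "\<exists>s'. exec n \<omega> ?w s s' \<and> Q (forget_steps s') \<and> steps s' \<le> steps s + (d + 1) * ?d"
    if "I k (forget_steps s)" "k + d = N" for d k s
    using that
  proof (induction d arbitrary: k s)
    case 0
    then have "\<not> bval s (ILess (vr v) bound)" using bound[OF 0(1)] var[OF 0(1)] by simp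
    from exec.WhileFalse[OF this, of n \<omega> "Seq body (IAssign v (Lit 0) (IPlus (vr v) (Lit 1)))"]
    show ?case using 0 post by (intro exI[of _ "tick (1 + bcost (ILess (vr v) bound)) s"]) auto
  next
    case (Suc d)
    then have g: "bval s (ILess (vr v) bound)" using bound[OF Suc(2)] var[OF Suc(2)] by simp
    let ?s = "tick (1 + bcost (ILess (vr v) bound)) s"
    have "k < N" using Suc by simp
    then obtain s1 where s1: "exec n \<omega> body ?s s1" "I (Suc k) (set_idx v 0 (Suc k) (forget_steps s1))"
      "idx s1 v 0 = k" "steps s1 \<le> steps ?s + c"
      using body[OF \<open>k < N\<close>] Suc(2) unfolding ht_def by (metis forget_steps_simps(1) state_simps(1))
    let ?s2 = "tick (1 + icost (Lit 0) + icost (IPlus (vr v) (Lit 1))) (set_idx v (ival s1 (Lit 0)) (ival s1 (IPlus (vr v) (Lit 1))) s1)"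
    have e: "exec n \<omega> (Seq body (IAssign v (Lit 0) (IPlus (vr v) (Lit 1)))) ?s ?s2"
      by (rule exec.Seq[OF s1(1)]) (rule exec.IAssign)
    have "I (Suc k) (forget_steps ?s2)" using s1 by simp
    then obtain s' where s': "exec n \<omega> ?w ?s2 s'" "Q (forget_steps s')" "steps s' \<le> steps ?s2 + (d + 1) * ?d"
      using Suc.IH[of "Suc k" ?s2] Suc(3) by auto
    have "steps ?s2 \<le> steps s + ?d" using s1(4) by simp
    then show ?case using exec.WhileTrue[OF g e s'(1)] s' by (intro exI[of _ s']) auto
  qed
  show ?thesis
    unfolding ht_def For_def
  proof (intro allI impI)
    fix s assume "P (forget_steps s)"
    let ?s = "tick (1 + icost (Lit 0) + icost (Lit 0)) (set_idx v (ival s (Lit 0)) (ival s (Lit 0)) s)"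
    have "I 0 (forget_steps ?s)" using init[OF \<open>P _\<close>] by simp
    then obtain s' where "exec n \<omega> ?w ?s s'" "Q (forget_steps s')" "steps s' \<le> steps ?s + (N + 1) * ?d"
      using loop[of 0 ?s N] by auto
    then show "\<exists>s'. exec n \<omega> (Seq (IAssign v (Lit 0) (Lit 0)) ?w) s s' \<and> Q (forget_steps s') \<and> steps s' \<le> steps s + C"
      using exec.Seq[OF exec.IAssign] cost by (intro exI[of _ s']) auto
  qed
qed

text \<open>A selection that finds nothing leaves the bound itself in \<open>sel\<close>.\<close>
definition Choose :: "nat \<Rightarrow> nat \<Rightarrow> iexp \<Rightarrow> bexp \<Rightarrow> bexp \<Rightarrow> com" where
  "Choose sel v bound cnd better = Seq (IAssign sel (Lit 0) bound)
     (For v bound (Cond (BAnd cnd (BNot (BAnd (ILess (vr sel) bound) (BNot better))))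
        (IAssign sel (Lit 0) (vr v)) Skip))"

definition chosen :: "nat \<Rightarrow> (nat \<Rightarrow> bool) \<Rightarrow> (nat \<Rightarrow> nat \<Rightarrow> bool) \<Rightarrow> nat \<Rightarrow> bool" where
  "chosen N C L k \<longleftrightarrow> (k = N \<and> (\<forall>i<N. \<not> C i)) \<or> (k < N \<and> C k \<and> (\<forall>i<N. C i \<longrightarrow> \<not> L i k))"

lemma ht_Choose:
  fixes s0 :: state and sel v :: nat
  defines "st \<equiv> \<lambda>i k. set_idx v 0 i (set_idx sel 0 k s0)"
  assumes ne: "sel \<noteq> v"
    and bound: "\<And>i k. ival (st i k) bound = N" "ival s0 bound = N"
    and C: "\<And>i k. i < N \<Longrightarrow> k \<le> N \<Longrightarrow> bval (st i k) cnd = C i"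
    and L: "\<And>i k. i < N \<Longrightarrow> k < N \<Longrightarrow> bval (st i k) better = L i k"
    and irrefl: "\<And>i. i < N \<Longrightarrow> \<not> L i i"
    and asym: "\<And>i k. i < N \<Longrightarrow> k < N \<Longrightarrow> L i k \<Longrightarrow> \<not> L k i"
    and trans: "\<And>i j k. i < N \<Longrightarrow> j < N \<Longrightarrow> k < N \<Longrightarrow> \<not> L i j \<Longrightarrow> \<not> L j k \<Longrightarrow> \<not> L i k"
    and cost: "5 + icost bound + (N + 1) * (22 + 2 * icost bound + bcost cnd + bcost better) \<le> c"
  shows "ht n \<omega> (\<lambda>s. s = s0) (Choose sel v bound cnd better) c (\<lambda>s. \<exists>k. s = st N k \<and> chosen N C L k)"
proof -
  define good where "good = (\<lambda>i k. (k = N \<and> (\<forall>i'<i. \<not> C i')) \<or> (k < i \<and> C k \<and> (\<forall>i'<i. C i' \<longrightarrow> \<not> L i' k)))"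
  define I where "I = (\<lambda>i s. \<exists>k. s = st i k \<and> good i k \<and> i \<le> N)"
  let ?g = "BAnd cnd (BNot (BAnd (ILess (vr sel) bound) (BNot better)))"
  have set_v: "set_idx v 0 i' (st i k) = st i' k" for i i' k
    by (simp add: st_def set_idx_def)
  have set_sel: "set_idx sel 0 k' (st i k) = st i k'" for i k k'
    using ne by (simp add: st_def set_idx_def fun_upd_twist)
  have vals: "idx (st i k) v 0 = i" "idx (st i k) sel 0 = k" for i k
    using ne by (simp_all add: st_def)
  show ?thesis
    unfolding Choose_def
  proof (rule ht_Seq)
    show "ht n \<omega> (\<lambda>s. s = s0) (IAssign sel (Lit 0) bound) (2 + icost bound) (\<lambda>s. s = set_idx sel 0 N s0)"
      by (rule ht_IAssign) (use bound in auto)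
    show "ht n \<omega> (\<lambda>s. s = set_idx sel 0 N s0) (For v bound (Cond ?g (IAssign sel (Lit 0) (vr v)) Skip))
      (3 + (N + 1) * (22 + 2 * icost bound + bcost cnd + bcost better)) (\<lambda>s. \<exists>k. s = st N k \<and> chosen N C L k)"
    proof (rule ht_For[where I=I and c="12 + icost bound + bcost cnd + bcost better" and N=N])
      fix s assume "s = set_idx sel 0 N s0"
      then show "I 0 (set_idx v 0 0 s)" by (auto simp: I_def st_def good_def)
    next
      fix i assume i: "i < N"
      show "ht n \<omega> (I i) (Cond ?g (IAssign sel (Lit 0) (vr v)) Skip) (12 + icost bound + bcost cnd + bcost better)
        (\<lambda>s. I (Suc i) (set_idx v 0 (Suc i) s) \<and> idx s v 0 = i)"
      proof (rule ht_Cond)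
        \<comment> \<open>Asymmetry turns \<open>L i k\<close> into \<open>\<not> L k i\<close>, and
          transitivity of the negation carries minimality over from \<open>k\<close> to
          \<open>i\<close>.\<close>
        have upd: "good (Suc i) i" if "good i k" "C i" "k = N \<or> L i k" for k
          using that i irrefl[of i] asym[of i k] trans[of _ k i] unfolding good_def less_Suc_eq
          by (metis less_irrefl less_trans)
        have keep: "good (Suc i) k" if "good i k" "\<not> (C i \<and> (k = N \<or> L i k))" for k
          using that i unfolding good_def less_Suc_eq by auto
        have gv: "bval (st i k) ?g \<longleftrightarrow> C i \<and> (k = N \<or> L i k)" if "good i k" for k
        proof (cases "k = N")
          case True
          then show ?thesis using C[OF i, of k] bound by (simp add: vals)
        next
          case False
          then have "k < N" using that i by (auto simp: good_def)
          then show ?thesis using C[OF i, of k] L[OF i, of k] bound by (simp add: vals)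
        qed
        show "ht n \<omega> (\<lambda>s. I i s \<and> bval s ?g) (IAssign sel (Lit 0) (vr v)) 4
          (\<lambda>s. I (Suc i) (set_idx v 0 (Suc i) s) \<and> idx s v 0 = i)"
        proof (rule ht_IAssign)
          fix s assume "I i s \<and> bval s ?g"
          then obtain k where k: "s = st i k" "good i k" "bval (st i k) ?g" by (auto simp: I_def)
          then have "good (Suc i) i" using gv[OF k(2)] upd by blast
          moreover have "set_idx sel (ival s (Lit 0)) (ival s (vr v)) s = st i i"
            by (simp add: k(1) vals set_sel)
          ultimately show "I (Suc i) (set_idx v 0 (Suc i) (set_idx sel (ival s (Lit 0)) (ival s (vr v)) s))
            \<and> idx (set_idx sel (ival s (Lit 0)) (ival s (vr v)) s) v 0 = i"
            using i unfolding I_def by (auto simp: set_v vals intro!: exI[of _ i])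
        qed simp
        show "ht n \<omega> (\<lambda>s. I i s \<and> \<not> bval s ?g) Skip 4 (\<lambda>s. I (Suc i) (set_idx v 0 (Suc i) s) \<and> idx s v 0 = i)"
        proof (rule ht_Skip)
          fix s assume "I i s \<and> \<not> bval s ?g"
          then obtain k where k: "s = st i k" "good i k" "\<not> bval (st i k) ?g" by (auto simp: I_def)
          then have "good (Suc i) k" using gv[OF k(2)] keep by blast
          then show "I (Suc i) (set_idx v 0 (Suc i) s) \<and> idx s v 0 = i"
            using i unfolding I_def k(1) by (auto simp: set_v vals intro!: exI[of _ k])
        qed
      qed simp
    next
      fix s assume "I N s"
      then show "\<exists>k. s = st N k \<and> chosen N C L k" unfolding I_def good_def chosen_def by blast
    qed (auto simp: I_def vals bound)
  qed (use cost in simp)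
qed


section \<open>Tableaux\<close>

text \<open>Rows are vectors and columns are basis positions, so an exchange is a column operation:
  column \<open>j\<close> is divided by the pivot and multiples of it are subtracted from the other
  columns. Residual columns obey the same rule, hence a bound \<open>N\<close> that may exceed the
  number of basis positions.\<close>

definition pivoted :: "nat \<Rightarrow> (nat \<Rightarrow> nat \<Rightarrow> real) \<Rightarrow> nat \<Rightarrow> nat \<Rightarrow> nat \<Rightarrow> nat \<Rightarrow> real" where
  "pivoted N T r j s k = (if k < N then if k = j then T s j / T r j else T s k - T s j / T r j * T r k else T s k)"

text \<open>Row \<open>s\<close> of the tableau holds the coordinates of the vector \<open>g s\<close> in the basis \<open>g (\<beta> 0), \<dots>\<close>.\<close>
definition tableau :: "nat \<Rightarrow> nat \<Rightarrow> (nat \<Rightarrow> nat \<Rightarrow> real) \<Rightarrow> (nat \<Rightarrow> nat) \<Rightarrow> (nat \<Rightarrow> nat \<Rightarrow> real) \<Rightarrow>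
    (nat \<Rightarrow> nat \<Rightarrow> real) \<Rightarrow> bool" where
  "tableau n R g \<beta> u T \<longleftrightarrow> inj_on \<beta> {..<n} \<and> dual_basis n g (\<beta> ` {..<n}) u \<and>
     (\<forall>s<R. \<forall>k<n. T s k = ip n (u (\<beta> k)) (g s))"

text \<open>Column \<open>c\<close> holds what remains of \<open>h s\<close> after subtracting its value predicted from the basic rows.\<close>
definition residual_column :: "nat \<Rightarrow> nat \<Rightarrow> (nat \<Rightarrow> real) \<Rightarrow> (nat \<Rightarrow> nat) \<Rightarrow> nat \<Rightarrow> (nat \<Rightarrow> nat \<Rightarrow> real) \<Rightarrow> bool" where
  "residual_column n L h \<beta> c T \<longleftrightarrow> (\<forall>s<L. T s c = h s - (\<Sum>k<n. T s k * h (\<beta> k)))"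

lemma image_fun_upd_basis:
  assumes "inj_on \<beta> {..<n}" "j < n"
  shows "(\<beta>(j := r)) ` {..<n} = insert r (\<beta> ` {..<n} - {\<beta> j})"
proof -
  have "{..<n} = insert j ({..<n} - {j})" using assms(2) by auto
  then have "(\<beta>(j := r)) ` {..<n} = insert r (\<beta> ` ({..<n} - {j}))"
    by (metis (no_types, lifting) Diff_iff fun_upd_image fun_upd_same image_insert insert_Diff_single insert_iff lessThan_iff)
  moreover have "\<beta> ` ({..<n} - {j}) = \<beta> ` {..<n} - {\<beta> j}"
    using inj_on_image_set_diff[OF assms(1), of "{..<n}" "{j}"] assms(2) by auto
  ultimately show ?thesis by simp
qed

lemma tableau_pivot:
  assumes T: "tableau n R g \<beta> u T" and j: "j < n" and nN: "n \<le> N" and r: "r < R" "r \<notin> \<beta> ` {..<n}" and nz: "T r j \<noteq> 0"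
  obtains u' where "tableau n R g (\<beta>(j := r)) u' (pivoted N T r j)"
proof -
  let ?B = "\<beta> ` {..<n}"
  have inj: "inj_on \<beta> {..<n}" and d: "dual_basis n g ?B u"
    and t: "\<And>s k. s < R \<Longrightarrow> k < n \<Longrightarrow> T s k = ip n (u (\<beta> k)) (g s)"
    using T by (auto simp: tableau_def)
  have jB: "\<beta> j \<in> ?B" using j by auto
  have nz': "ip n (u (\<beta> j)) (g r) \<noteq> 0" using nz t[OF r(1) j] by simp
  obtain u' where d': "dual_basis n g (insert r (?B - {\<beta> j})) u'"
    using dual_basis_pivot[OF d jB r(2) nz'] by blast
  note co = dual_basis_pivot_coord[OF d d' jB r(2) nz']
  have im: "(\<beta>(j := r)) ` {..<n} = insert r (?B - {\<beta> j})" by (rule image_fun_upd_basis[OF inj j])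
  have "inj_on (\<beta>(j := r)) {..<n}"
    using inj r(2) by (auto simp: inj_on_def)
  moreover have "pivoted N T r j s k = ip n (u' ((\<beta>(j := r)) k)) (g s)" if s: "s < R" and k: "k < n" for s k
  proof (cases "k = j")
    case True
    then show ?thesis using co(1) t[OF s j] t[OF r(1) j] j nN by (simp add: pivoted_def)
  next
    case False
    then have "\<beta> k \<in> ?B - {\<beta> j}" using inj j k by (auto dest: inj_onD)
    then show ?thesis using False co(2)[of "\<beta> k"] t[OF s j] t[OF r(1) j] t[OF s k] t[OF r(1) k] k nN
      by (simp add: pivoted_def)
  qed
  ultimately have "tableau n R g (\<beta>(j := r)) u' (pivoted N T r j)"
    unfolding tableau_def im using d' by blast
  then show thesis by (rule that)
qed

lemma residual_column_pivot:
  assumes T: "residual_column n L h \<beta> c T" and j: "j < n" and c: "n \<le> c" "c < N" and r: "r < L" and nz: "T r j \<noteq> 0"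
  shows "residual_column n L h (\<beta>(j := r)) c (pivoted N T r j)"
  unfolding residual_column_def
proof (intro allI impI)
  fix s assume s: "s < L"
  let ?f = "T s j / T r j"
  have t: "\<And>s. s < L \<Longrightarrow> T s c = h s - (\<Sum>k<n. T s k * h (\<beta> k))" using T by (simp add: residual_column_def)
  have split: "(\<Sum>k<n. F k) = F j + (\<Sum>k\<in>{..<n} - {j}. F k)" for F :: "nat \<Rightarrow> real"
    using j by (simp add: sum.remove)
  have "(\<Sum>k<n. pivoted N T r j s k * h ((\<beta>(j := r)) k))
      = ?f * h r + (\<Sum>k\<in>{..<n} - {j}. T s k * h (\<beta> k) - ?f * (T r k * h (\<beta> k)))"
    using j c by (subst split) (auto simp: pivoted_def algebra_simps intro!: sum.cong arg_cong2[where f="(+)"])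
  also have "\<dots> = ?f * h r + (\<Sum>k<n. T s k * h (\<beta> k)) - T s j * h (\<beta> j)
      - ?f * ((\<Sum>k<n. T r k * h (\<beta> k)) - T r j * h (\<beta> j))"
    by (simp add: sum_subtractf sum_distrib_left[symmetric] sum_divide_distrib[symmetric] split[of "\<lambda>k. T s k * h (\<beta> k)"] split[of "\<lambda>k. T r k * h (\<beta> k)"])
  also have "\<dots> = (\<Sum>k<n. T s k * h (\<beta> k)) + ?f * (h r - (\<Sum>k<n. T r k * h (\<beta> k)))"
    using nz by (simp add: algebra_simps)
  finally show "pivoted N T r j s c = h s - (\<Sum>k<n. pivoted N T r j s k * h ((\<beta>(j := r)) k))"
    using t[OF s] t[OF r] c j by (simp add: pivoted_def)
qed


section \<open>Pivoting\<close>

abbreviation mE :: iexp where "mE \<equiv> Idx 0 (Lit 0)"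
abbreviation nE :: iexp where "nE \<equiv> Idx 0 (Lit 1)"
abbreviation zeroE :: rexp where "zeroE \<equiv> OfNat (Lit 0)"

text \<open>Index arrays 2 and 3 (inner loop variables) and real arrays 6 (the tableau) and 9 (scratch)
  are treated as volatile.\<close>
definition core :: "state \<Rightarrow> state" where
  "core s = s\<lparr>idx := (idx s)(2 := \<lambda>_. 0, 3 := \<lambda>_. 0), reg := (reg s)(6 := \<lambda>_ _. 0, 9 := \<lambda>_ _. 0), steps := 0\<rparr>"

lemma coreD:
  assumes "core s = core t"
  shows "a \<noteq> 2 \<Longrightarrow> a \<noteq> 3 \<Longrightarrow> idx s a = idx t a" "b \<noteq> 6 \<Longrightarrow> b \<noteq> 9 \<Longrightarrow> reg s b = reg t b"
    "draws s = draws t" "trace s = trace t"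
proof -
  have "idx (core s) a = idx (core t) a" "reg (core s) b = reg (core t) b"
    "draws (core s) = draws (core t)" "trace (core s) = trace (core t)" using assms by auto
  then show "a \<noteq> 2 \<Longrightarrow> a \<noteq> 3 \<Longrightarrow> idx s a = idx t a" "b \<noteq> 6 \<Longrightarrow> b \<noteq> 9 \<Longrightarrow> reg s b = reg t b"
    "draws s = draws t" "trace s = trace t" by (auto simp: core_def)
qed

lemma core_simps [simp]:
  "core (forget_steps s) = core s" "core (tick k s) = core s"
  "core (set_idx 2 i x s) = core s" "core (set_idx 3 i x s) = core s"
  "core (set_reg 6 i l y s) = core s" "core (set_reg 9 i l y s) = core s"
  by (simp_all add: core_def forget_steps_def tick_def set_idx_def set_reg_def)

lemma core_set_cong:
  assumes "core s = core t"
  shows "core (set_idx a i x s) = core (set_idx a i x t)" "core (set_reg a i l y s) = core (set_reg a i l y t)"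
    "core (next_draw s) = core (next_draw t)"
proof -
  have "core (set_idx a i x s) = set_idx a i x (core s)" if "a \<noteq> 2" "a \<noteq> 3" for s
    using that by (simp add: core_def set_idx_def fun_upd_twist)
  then show "core (set_idx a i x s) = core (set_idx a i x t)"
    using assms by (cases "a = 2"; cases "a = 3") simp_all
  have "core (set_reg a i l y s) = set_reg a i l y (core s)" if "a \<noteq> 6" "a \<noteq> 9" for s
    using that by (simp add: core_def set_reg_def fun_upd_twist)
  then show "core (set_reg a i l y s) = core (set_reg a i l y t)"
    using assms by (cases "a = 6"; cases "a = 9") simp_all
  have "core (next_draw s) = next_draw (core s)" for s
    by (simp add: core_def next_draw_def)
  then show "core (next_draw s) = core (next_draw t)" using assms by simp
qed

text \<open>The pivot row is in index array 10, the pivot column in index array 11.\<close>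
definition Pivot :: com where
  "Pivot = Seq (For 3 (IPlus nE (Lit 2)) (RAssign 9 (Lit 0) (vr 3) (Cell 6 (vr 10) (vr 3))))
    (Seq (For 2 (IPlus (IPlus mE nE) (Lit 3))
       (Seq (RAssign 9 (Lit 1) (Lit 0) (Div (Cell 6 (vr 2) (vr 11)) (Cell 9 (Lit 0) (vr 11))))
       (Seq (For 3 (IPlus nE (Lit 2)) (RAssign 6 (vr 2) (vr 3)
              (Sub (Cell 6 (vr 2) (vr 3)) (Mul (Cell 9 (Lit 1) (Lit 0)) (Cell 9 (Lit 0) (vr 3))))))
            (RAssign 6 (vr 2) (vr 11) (Cell 9 (Lit 1) (Lit 0))))))
     (IAssign 1 (vr 11) (vr 10)))"

definition pivot_cost :: "nat \<Rightarrow> nat \<Rightarrow> nat" where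
  "pivot_cost m n = 100 + (n + 3) * 40 + (m + n + 4) * (100 + (n + 3) * 60)"

lemma ht_Pivot:
  fixes T :: "nat \<Rightarrow> nat \<Rightarrow> real" and s0 :: state
  defines "m \<equiv> idx s0 0 0" and "n \<equiv> idx s0 0 1" and "r \<equiv> idx s0 10 0" and "j \<equiv> idx s0 11 0"
  assumes j: "j < n"
  shows "ht d \<omega> (\<lambda>s. core s = core s0 \<and> reg s 6 = T) Pivot (pivot_cost m n)
    (\<lambda>s. core s = core (set_idx 1 j r s0) \<and>
         reg s 6 = (\<lambda>a. if a < m + n + 3 then pivoted (n + 2) T r j a else T a))"
proof -
  define fr where "fr = (\<lambda>s. core s = core s0)"
  have fr [simp]: "idx s 0 0 = m" "idx s 0 (Suc 0) = n" "idx s 10 0 = r" "idx s 11 0 = j" if "fr s" for s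
    using coreD(1)[of s s0] that by (simp_all add: fr_def m_def n_def r_def j_def)
  have [simp]: "fr (set_idx 2 i x s) = fr s" "fr (set_idx 3 i x s) = fr s"
    "fr (set_reg 6 i l y s) = fr s" "fr (set_reg 9 i l y s) = fr s" for i l x y s
    by (simp_all add: fr_def)
  \<comment> \<open>Rows below \<open>i\<close> are finished. The pivot row is overwritten when its
    turn comes, so its old entries are kept in array 9. Within a round, \<open>part\<close> also
    runs over the pivot column; the last assignment sets that entry to the saved multiplier.\<close>
  define mid where "mid = (\<lambda>i a. if a < i then pivoted (n + 2) T r j a else T a)"
  define part where "part = (\<lambda>i k a b. if a = i \<and> b < k then T i b - T i j / T r j * T r b else mid i a b)"
  have row: "ht d \<omega> (\<lambda>s. fr s \<and> reg s 6 = T)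
      (For 3 (IPlus nE (Lit 2)) (RAssign 9 (Lit 0) (vr 3) (Cell 6 (vr 10) (vr 3))))
      (3 + (n + 3) * 40) (\<lambda>s. fr s \<and> reg s 6 = mid 0 \<and> (\<forall>k<n + 2. reg s 9 0 k = T r k))"
  proof (rule ht_For[where N="n + 2" and c=20 and
        I="\<lambda>i s. fr s \<and> reg s 6 = T \<and> idx s 3 0 = i \<and> (\<forall>k<i. reg s 9 0 k = T r k)"])
    show "ht d \<omega> (\<lambda>s. fr s \<and> reg s 6 = T \<and> idx s 3 0 = i \<and> (\<forall>k<i. reg s 9 0 k = T r k))
      (RAssign 9 (Lit 0) (vr 3) (Cell 6 (vr 10) (vr 3))) 20
      (\<lambda>s. (fr (set_idx 3 0 (Suc i) s) \<and> reg (set_idx 3 0 (Suc i) s) 6 = T \<and> idx (set_idx 3 0 (Suc i) s) 3 0 = Suc i \<and>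
        (\<forall>k<Suc i. reg (set_idx 3 0 (Suc i) s) 9 0 k = T r k)) \<and> idx s 3 0 = i)" for i
      by (rule ht_RAssign) (auto simp: less_Suc_eq)
  qed (auto simp: mid_def)
  have inner: "ht d \<omega> (\<lambda>s. fr s \<and> idx s 2 0 = i \<and> (\<forall>k<n + 2. reg s 9 0 k = T r k) \<and> reg s 9 1 0 = T i j / T r j \<and> reg s 6 = mid i)
      (For 3 (IPlus nE (Lit 2)) (RAssign 6 (vr 2) (vr 3)
              (Sub (Cell 6 (vr 2) (vr 3)) (Mul (Cell 9 (Lit 1) (Lit 0)) (Cell 9 (Lit 0) (vr 3))))))
      (3 + (n + 3) * 50)
      (\<lambda>s. fr s \<and> idx s 2 0 = i \<and> (\<forall>k<n + 2. reg s 9 0 k = T r k) \<and> reg s 9 1 0 = T i j / T r j \<and> reg s 6 = part i (n + 2))" for i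
  proof (rule ht_For[where N="n + 2" and c=30 and
        I="\<lambda>l s. fr s \<and> idx s 2 0 = i \<and> idx s 3 0 = l \<and> (\<forall>k<n + 2. reg s 9 0 k = T r k) \<and> reg s 9 1 0 = T i j / T r j \<and> reg s 6 = part i l"])
    show "ht d \<omega> (\<lambda>s. fr s \<and> idx s 2 0 = i \<and> idx s 3 0 = l \<and> (\<forall>k<n + 2. reg s 9 0 k = T r k) \<and> reg s 9 1 0 = T i j / T r j \<and> reg s 6 = part i l)
      (RAssign 6 (vr 2) (vr 3) (Sub (Cell 6 (vr 2) (vr 3)) (Mul (Cell 9 (Lit 1) (Lit 0)) (Cell 9 (Lit 0) (vr 3))))) 30
      (\<lambda>s. (fr (set_idx 3 0 (Suc l) s) \<and> idx (set_idx 3 0 (Suc l) s) 2 0 = i \<and> idx (set_idx 3 0 (Suc l) s) 3 0 = Suc l \<and>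
        (\<forall>k<n + 2. reg (set_idx 3 0 (Suc l) s) 9 0 k = T r k) \<and> reg (set_idx 3 0 (Suc l) s) 9 1 0 = T i j / T r j \<and>
        reg (set_idx 3 0 (Suc l) s) 6 = part i (Suc l)) \<and> idx s 3 0 = l)" if "l < n + 2" for l
      by (rule ht_RAssign) (use that in \<open>auto simp: part_def mid_def fun_eq_iff less_Suc_eq\<close>)
  qed (auto simp: part_def  fun_eq_iff)
  have outer: "ht d \<omega> (\<lambda>s. fr s \<and> reg s 6 = mid 0 \<and> (\<forall>k<n + 2. reg s 9 0 k = T r k))
    (For 2 (IPlus (IPlus mE nE) (Lit 3))
       (Seq (RAssign 9 (Lit 1) (Lit 0) (Div (Cell 6 (vr 2) (vr 11)) (Cell 9 (Lit 0) (vr 11))))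
       (Seq (For 3 (IPlus nE (Lit 2)) (RAssign 6 (vr 2) (vr 3)
              (Sub (Cell 6 (vr 2) (vr 3)) (Mul (Cell 9 (Lit 1) (Lit 0)) (Cell 9 (Lit 0) (vr 3))))))
            (RAssign 6 (vr 2) (vr 11) (Cell 9 (Lit 1) (Lit 0))))))
    (3 + (m + n + 4) * (80 + (n + 3) * 50)) (\<lambda>s. fr s \<and> reg s 6 = mid (m + n + 3))"
  proof (rule ht_For[where N="m + n + 3" and c="50 + (n + 3) * 50" and
        I="\<lambda>i s. fr s \<and> idx s 2 0 = i \<and> (\<forall>k<n + 2. reg s 9 0 k = T r k) \<and> reg s 6 = mid i"])
    fix i assume i: "i < m + n + 3"
    show "ht d \<omega> (\<lambda>s. fr s \<and> idx s 2 0 = i \<and> (\<forall>k<n + 2. reg s 9 0 k = T r k) \<and> reg s 6 = mid i)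
      (Seq (RAssign 9 (Lit 1) (Lit 0) (Div (Cell 6 (vr 2) (vr 11)) (Cell 9 (Lit 0) (vr 11))))
       (Seq (For 3 (IPlus nE (Lit 2)) (RAssign 6 (vr 2) (vr 3)
              (Sub (Cell 6 (vr 2) (vr 3)) (Mul (Cell 9 (Lit 1) (Lit 0)) (Cell 9 (Lit 0) (vr 3))))))
            (RAssign 6 (vr 2) (vr 11) (Cell 9 (Lit 1) (Lit 0)))))
      (50 + (n + 3) * 50)
      (\<lambda>s. (fr (set_idx 2 0 (Suc i) s) \<and> idx (set_idx 2 0 (Suc i) s) 2 0 = Suc i \<and>
        (\<forall>k<n + 2. reg (set_idx 2 0 (Suc i) s) 9 0 k = T r k) \<and> reg (set_idx 2 0 (Suc i) s) 6 = mid (Suc i)) \<and> idx s 2 0 = i)"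
    proof (rule ht_Seq[OF _ ht_Seq[OF inner[of i], where c="23 + (n + 3) * 50"]])
      show "ht d \<omega> (\<lambda>s. fr s \<and> idx s 2 0 = i \<and> (\<forall>k<n + 2. reg s 9 0 k = T r k) \<and> reg s 6 = mid i)
        (RAssign 9 (Lit 1) (Lit 0) (Div (Cell 6 (vr 2) (vr 11)) (Cell 9 (Lit 0) (vr 11)))) 20
        (\<lambda>s. fr s \<and> idx s 2 0 = i \<and> (\<forall>k<n + 2. reg s 9 0 k = T r k) \<and> reg s 9 1 0 = T i j / T r j \<and> reg s 6 = mid i)"
        by (rule ht_RAssign) (use j in \<open>auto simp: mid_def \<close>)
      show "ht d \<omega> (\<lambda>s. fr s \<and> idx s 2 0 = i \<and> (\<forall>k<n + 2. reg s 9 0 k = T r k) \<and> reg s 9 1 0 = T i j / T r j \<and> reg s 6 = part i (n + 2))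
        (RAssign 6 (vr 2) (vr 11) (Cell 9 (Lit 1) (Lit 0))) 20
        (\<lambda>s. (fr (set_idx 2 0 (Suc i) s) \<and> idx (set_idx 2 0 (Suc i) s) 2 0 = Suc i \<and>
        (\<forall>k<n + 2. reg (set_idx 2 0 (Suc i) s) 9 0 k = T r k) \<and> reg (set_idx 2 0 (Suc i) s) 6 = mid (Suc i)) \<and> idx s 2 0 = i)"
        by (rule ht_RAssign)
          (use j in \<open>auto simp: part_def mid_def pivoted_def  fun_eq_iff less_Suc_eq\<close>)
    qed simp_all
  qed (auto simp: algebra_simps)
  have last: "ht d \<omega> (\<lambda>s. fr s \<and> reg s 6 = mid (m + n + 3)) (IAssign 1 (vr 11) (vr 10)) 10
    (\<lambda>s. core s = core (set_idx 1 j r s0) \<and> reg s 6 = mid (m + n + 3))"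
    by (rule ht_IAssign) (auto simp: fr_def[symmetric], auto simp: fr_def intro: core_set_cong)
  have "ht d \<omega> (\<lambda>s. fr s \<and> reg s 6 = T) Pivot (pivot_cost m n)
    (\<lambda>s. core s = core (set_idx 1 j r s0) \<and> reg s 6 = mid (m + n + 3))"
    unfolding Pivot_def
    by (rule ht_Seq[OF row ht_Seq[OF outer last order_refl]])
      (simp add: pivot_cost_def algebra_simps)
  then show ?thesis by (simp add: fr_def mid_def)
qed

text \<open>Rows \<open>m\<close> to \<open>m + n - 1\<close> of the tableau hold the coordinates of
  the unit vectors, so those of any vector follow by linearity and no linear system has to be
  solved.\<close>

definition LoadRow :: "iexp \<Rightarrow> nat \<Rightarrow> com" where
  "LoadRow dst src = For 2 nE (Seq (RAssign 6 dst (vr 2) zeroE)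
     (For 3 nE (RAssign 6 dst (vr 2)
        (Add (Cell 6 dst (vr 2)) (Mul (Cell src (Lit 0) (vr 3)) (Cell 6 (IPlus mE (vr 3)) (vr 2)))))))"

lemma ht_LoadRow:
  fixes T :: "nat \<Rightarrow> nat \<Rightarrow> real" and s0 :: state
  defines "m \<equiv> idx s0 0 0" and "n \<equiv> idx s0 0 1"
  assumes dst: "\<And>s. idx s 0 = idx s0 0 \<Longrightarrow> ival s dst = q" "icost dst \<le> 10" and q: "m + n \<le> q"
    and src: "src \<noteq> 6" "src \<noteq> 9"
  shows "ht d \<omega> (\<lambda>s. core s = core s0 \<and> reg s 6 = T) (LoadRow dst src) (3 + (n + 1) * (60 + (n + 1) * 60))
    (\<lambda>s. core s = core s0 \<and>
         reg s 6 = (\<lambda>a b. if a = q \<and> b < n then \<Sum>l<n. reg s0 src 0 l * T (m + l) b else T a b))"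
proof -
  define fr where "fr = (\<lambda>s. core s = core s0)"
  have fr0: "idx s 0 = idx s0 0" "reg s src = reg s0 src" if "fr s" for s
    using coreD(1)[of s s0 0] coreD(2)[of s s0 src] that src by (simp_all add: fr_def)
  have fr [simp]: "idx s 0 0 = m" "idx s 0 (Suc 0) = n" "ival s dst = q"
    if "fr s" for s
    using fr0[OF that] dst(1)[of s] by (simp_all add: m_def n_def)
  have [simp]: "fr (set_idx 2 i x s) = fr s" "fr (set_idx 3 i x s) = fr s"
    "fr (set_reg 6 i l y s) = fr s" for i l x y s
    by (simp_all add: fr_def)
  let ?S = "\<lambda>j i. \<Sum>l<j. reg s0 src 0 l * T (m + l) i"
  define mid where "mid = (\<lambda>i a b. if a = q \<and> b < i then ?S n b else T a b)"
  define part where "part = (\<lambda>i j a b. if a = q \<and> b = i then ?S j i else mid i a b)"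
  have inner: "ht d \<omega> (\<lambda>s. fr s \<and> idx s 2 0 = i \<and> reg s 6 = part i 0)
    (For 3 nE (RAssign 6 dst (vr 2)
        (Add (Cell 6 dst (vr 2)) (Mul (Cell src (Lit 0) (vr 3)) (Cell 6 (IPlus mE (vr 3)) (vr 2))))))
    (3 + (n + 1) * 60) (\<lambda>s. fr s \<and> idx s 2 0 = i \<and> reg s 6 = part i n)" if i: "i < n" for i
  proof (rule ht_For[where N=n and c=45 and
        I="\<lambda>l s. fr s \<and> idx s 2 0 = i \<and> idx s 3 0 = l \<and> reg s 6 = part i l"])
    fix l assume l: "l < n"
    have val: "part i l (m + l) i = T (m + l) i" using l q by (simp add: part_def mid_def)
    show "ht d \<omega> (\<lambda>s. fr s \<and> idx s 2 0 = i \<and> idx s 3 0 = l \<and> reg s 6 = part i l)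
      (RAssign 6 dst (vr 2) (Add (Cell 6 dst (vr 2)) (Mul (Cell src (Lit 0) (vr 3)) (Cell 6 (IPlus mE (vr 3)) (vr 2))))) 45
      (\<lambda>s. (fr (set_idx 3 0 (Suc l) s) \<and> idx (set_idx 3 0 (Suc l) s) 2 0 = i \<and> idx (set_idx 3 0 (Suc l) s) 3 0 = Suc l \<and>
        reg (set_idx 3 0 (Suc l) s) 6 = part i (Suc l)) \<and> idx s 3 0 = l)"
    proof (rule ht_RAssign)
      fix s assume s: "fr s \<and> idx s 2 0 = i \<and> idx s 3 0 = l \<and> reg s 6 = part i l"
      then have "rval s (Add (Cell 6 dst (vr 2)) (Mul (Cell src (Lit 0) (vr 3)) (Cell 6 (IPlus mE (vr 3)) (vr 2)))) = ?S (Suc l) i"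
        using fr0(2)[of s] by (simp add: val) (simp add: part_def)
      then show "(fr (set_idx 3 0 (Suc l) (set_reg 6 (ival s dst) (ival s (vr 2)) (rval s (Add (Cell 6 dst (vr 2)) (Mul (Cell src (Lit 0) (vr 3)) (Cell 6 (IPlus mE (vr 3)) (vr 2))))) s)) \<and>
        idx (set_idx 3 0 (Suc l) (set_reg 6 (ival s dst) (ival s (vr 2)) (rval s (Add (Cell 6 dst (vr 2)) (Mul (Cell src (Lit 0) (vr 3)) (Cell 6 (IPlus mE (vr 3)) (vr 2))))) s)) 2 0 = i \<and>
        idx (set_idx 3 0 (Suc l) (set_reg 6 (ival s dst) (ival s (vr 2)) (rval s (Add (Cell 6 dst (vr 2)) (Mul (Cell src (Lit 0) (vr 3)) (Cell 6 (IPlus mE (vr 3)) (vr 2))))) s)) 3 0 = Suc l \<and>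
        reg (set_idx 3 0 (Suc l) (set_reg 6 (ival s dst) (ival s (vr 2)) (rval s (Add (Cell 6 dst (vr 2)) (Mul (Cell src (Lit 0) (vr 3)) (Cell 6 (IPlus mE (vr 3)) (vr 2))))) s)) 6 = part i (Suc l)) \<and>
        idx (set_reg 6 (ival s dst) (ival s (vr 2)) (rval s (Add (Cell 6 dst (vr 2)) (Mul (Cell src (Lit 0) (vr 3)) (Cell 6 (IPlus mE (vr 3)) (vr 2))))) s) 3 0 = l"
        using s by (simp del: rval.simps) (auto simp: part_def fun_eq_iff)
    qed (use dst(2) in simp)
  qed auto
  have "ht d \<omega> (\<lambda>s. fr s \<and> reg s 6 = T) (LoadRow dst src) (3 + (n + 1) * (60 + (n + 1) * 60)) (\<lambda>s. fr s \<and> reg s 6 = mid n)"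
    unfolding LoadRow_def
  proof (rule ht_For[where N=n and c="23 + (n + 1) * 60" and I="\<lambda>i s. fr s \<and> idx s 2 0 = i \<and> reg s 6 = mid i"])
    fix i assume i: "i < n"
    show "ht d \<omega> (\<lambda>s. fr s \<and> idx s 2 0 = i \<and> reg s 6 = mid i)
      (Seq (RAssign 6 dst (vr 2) zeroE) (For 3 nE (RAssign 6 dst (vr 2)
        (Add (Cell 6 dst (vr 2)) (Mul (Cell src (Lit 0) (vr 3)) (Cell 6 (IPlus mE (vr 3)) (vr 2)))))))
      (23 + (n + 1) * 60)
      (\<lambda>s. (fr (set_idx 2 0 (Suc i) s) \<and> idx (set_idx 2 0 (Suc i) s) 2 0 = Suc i \<and> reg (set_idx 2 0 (Suc i) s) 6 = mid (Suc i)) \<and> idx s 2 0 = i)"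
    proof (rule ht_Seq[OF _ ht_conseq[OF inner[OF i]]])
      show "ht d \<omega> (\<lambda>s. fr s \<and> idx s 2 0 = i \<and> reg s 6 = mid i) (RAssign 6 dst (vr 2) zeroE) 20
        (\<lambda>s. fr s \<and> idx s 2 0 = i \<and> reg s 6 = part i 0)"
        by (rule ht_RAssign) (use dst(2) in \<open>auto simp: part_def mid_def fun_eq_iff\<close>)
    qed (auto simp: part_def mid_def fun_eq_iff less_Suc_eq)
  qed (auto simp: mid_def algebra_simps)
  then show ?thesis by (simp add: fr_def mid_def)
qed


section \<open>The start basis\<close>

definition same :: "state \<Rightarrow> state \<Rightarrow> bool" where
  "same s t \<longleftrightarrow> idx s 0 = idx t 0 \<and> (\<forall>a. a \<noteq> 6 \<and> a \<noteq> 9 \<longrightarrow> reg s a = reg t a) \<and> draws s = draws t \<and> trace s = trace t"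

lemma same_simps [simp]:
  "a \<noteq> 0 \<Longrightarrow> same (set_idx a i x s) t = same s t"
  "same (set_reg 6 i l y s) t = same s t" "same (set_reg 9 i l y s) t = same s t" "same s s"
  by (auto simp: same_def)

lemma same_core: "core s = core t \<Longrightarrow> same s u \<longleftrightarrow> same t u"
  using coreD[of s t] by (simp add: same_def)

definition LoadConstraints :: com where
  "LoadConstraints = For 2 mE
     (Seq (For 3 nE (RAssign 6 (vr 2) (vr 3) (Cell 0 (vr 2) (vr 3))))
     (Seq (RAssign 6 (vr 2) nE (Cell 1 (Lit 0) (vr 2)))
          (For 3 nE (RAssign 6 (vr 2) nE (Sub (Cell 6 (vr 2) nE) (Mul (Cell 0 (vr 2) (vr 3)) (Cell 3 (Lit 0) (vr 3))))))))"

definition constraint_row :: "nat \<Rightarrow> (nat \<Rightarrow> nat \<Rightarrow> real) \<Rightarrow> (nat \<Rightarrow> real) \<Rightarrow> (nat \<Rightarrow> real) \<Rightarrow> nat \<Rightarrow> nat \<Rightarrow> real" where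
  "constraint_row n A b v s k = (if k < n then A s k else if k = n then b s - (\<Sum>l<n. A s l * v l) else 0)"

lemma ht_LoadConstraints:
  fixes s0 :: state
  defines "m \<equiv> idx s0 0 0" and "n \<equiv> idx s0 0 1"
  assumes zero: "reg s0 6 = (\<lambda>_ _. 0)"
  shows "ht d \<omega> (\<lambda>s. s = s0) LoadConstraints (3 + (m + 1) * (60 + 2 * (n + 1) * 60))
    (\<lambda>s. same s s0 \<and>
       reg s 6 = (\<lambda>a k. if a < m then constraint_row n (reg s0 0) (reg s0 1 0) (reg s0 3 0) a k else 0))"
proof -
  define fr where "fr = (\<lambda>s. same s s0)"
  have fr [simp]: "idx s 0 0 = m" "idx s 0 (Suc 0) = n" if "fr s" for s
    using that by (simp_all add: fr_def same_def m_def n_def)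
  have frs0: "fr s0" by (simp add: fr_def)
  have rg: "reg s 0 = reg s0 0" "reg s (Suc 0) = reg s0 1" "reg s 3 = reg s0 3" if "fr s" for s
    using that by (simp_all add: fr_def same_def)
  have [simp]: "fr (set_idx 2 i x s) = fr s" "fr (set_idx 3 i x s) = fr s"
    "fr (set_reg 6 i l y s) = fr s" for i l x y s
    by (simp_all add: fr_def)
  let ?A = "reg s0 0" and ?b = "reg s0 1 0" and ?v = "reg s0 3 0"
  define mid where "mid = (\<lambda>i a k. if a < i then constraint_row n ?A ?b ?v a k else (0::real))"
  define p1 where "p1 = (\<lambda>i j a k. if a = i then (if k < j then ?A i k else 0) else mid i a k)"
  define p2 where "p2 = (\<lambda>i j a k. if a = i then (if k < n then ?A i k else if k = n then ?b i - (\<Sum>l<j. ?A i l * ?v l) else 0) else mid i a k)"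
  have p: "p1 i 0 = mid i" "p2 i n = mid (Suc i)" for i
    by (auto simp: p1_def p2_def mid_def constraint_row_def fun_eq_iff less_Suc_eq)
  have c1: "ht d \<omega> (\<lambda>s. fr s \<and> idx s 2 0 = i \<and> reg s 6 = p1 i 0)
      (For 3 nE (RAssign 6 (vr 2) (vr 3) (Cell 0 (vr 2) (vr 3)))) (3 + (n + 1) * 60)
      (\<lambda>s. fr s \<and> idx s 2 0 = i \<and> reg s 6 = p1 i n)" for i
  proof (rule ht_For[where N=n and c=45 and
        I="\<lambda>l s. fr s \<and> idx s 2 0 = i \<and> idx s 3 0 = l \<and> reg s 6 = p1 i l"])
    show "ht d \<omega> (\<lambda>s. fr s \<and> idx s 2 0 = i \<and> idx s 3 0 = l \<and> reg s 6 = p1 i l)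
      (RAssign 6 (vr 2) (vr 3) (Cell 0 (vr 2) (vr 3))) 45
      (\<lambda>s. (fr (set_idx 3 0 (Suc l) s) \<and> idx (set_idx 3 0 (Suc l) s) 2 0 = i \<and> idx (set_idx 3 0 (Suc l) s) 3 0 = Suc l \<and>
        reg (set_idx 3 0 (Suc l) s) 6 = p1 i (Suc l)) \<and> idx s 3 0 = l)" if l: "l < n" for l
      by (rule ht_RAssign) (use l in \<open>auto simp: p1_def rg fun_eq_iff less_Suc_eq\<close>)
  qed auto
  have c2: "ht d \<omega> (\<lambda>s. fr s \<and> idx s 2 0 = i \<and> reg s 6 = p2 i 0)
      (For 3 nE (RAssign 6 (vr 2) nE (Sub (Cell 6 (vr 2) nE) (Mul (Cell 0 (vr 2) (vr 3)) (Cell 3 (Lit 0) (vr 3)))))) (3 + (n + 1) * 60)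
      (\<lambda>s. fr s \<and> idx s 2 0 = i \<and> reg s 6 = p2 i n)" for i
  proof (rule ht_For[where N=n and c=45 and
        I="\<lambda>l s. fr s \<and> idx s 2 0 = i \<and> idx s 3 0 = l \<and> reg s 6 = p2 i l"])
    show "ht d \<omega> (\<lambda>s. fr s \<and> idx s 2 0 = i \<and> idx s 3 0 = l \<and> reg s 6 = p2 i l)
      (RAssign 6 (vr 2) nE (Sub (Cell 6 (vr 2) nE) (Mul (Cell 0 (vr 2) (vr 3)) (Cell 3 (Lit 0) (vr 3))))) 45
      (\<lambda>s. (fr (set_idx 3 0 (Suc l) s) \<and> idx (set_idx 3 0 (Suc l) s) 2 0 = i \<and> idx (set_idx 3 0 (Suc l) s) 3 0 = Suc l \<and>
        reg (set_idx 3 0 (Suc l) s) 6 = p2 i (Suc l)) \<and> idx s 3 0 = l)" if l: "l < n" for l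
      by (rule ht_RAssign) (use l in \<open>auto simp: p2_def rg fun_eq_iff less_Suc_eq\<close>)
  qed auto
  have "ht d \<omega> (\<lambda>s. s = s0) LoadConstraints (3 + (m + 1) * (60 + 2 * (n + 1) * 60)) (\<lambda>s. fr s \<and> reg s 6 = mid m)"
    unfolding LoadConstraints_def
  proof (rule ht_For[where N=m and c="26 + 2 * (n + 1) * 60" and I="\<lambda>i s. fr s \<and> idx s 2 0 = i \<and> reg s 6 = mid i"])
    fix i assume i: "i < m"
    show "ht d \<omega> (\<lambda>s. fr s \<and> idx s 2 0 = i \<and> reg s 6 = mid i)
      (Seq (For 3 nE (RAssign 6 (vr 2) (vr 3) (Cell 0 (vr 2) (vr 3))))
     (Seq (RAssign 6 (vr 2) nE (Cell 1 (Lit 0) (vr 2)))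
          (For 3 nE (RAssign 6 (vr 2) nE (Sub (Cell 6 (vr 2) nE) (Mul (Cell 0 (vr 2) (vr 3)) (Cell 3 (Lit 0) (vr 3))))))))
      (26 + 2 * (n + 1) * 60)
      (\<lambda>s. (fr (set_idx 2 0 (Suc i) s) \<and> idx (set_idx 2 0 (Suc i) s) 2 0 = Suc i \<and> reg (set_idx 2 0 (Suc i) s) 6 = mid (Suc i)) \<and> idx s 2 0 = i)"
    proof -
      have a: "ht d \<omega> (\<lambda>s. fr s \<and> idx s 2 0 = i \<and> reg s 6 = p1 i n) (RAssign 6 (vr 2) nE (Cell 1 (Lit 0) (vr 2))) 20
        (\<lambda>s. fr s \<and> idx s 2 0 = i \<and> reg s 6 = p2 i 0)"
        by (rule ht_RAssign) (auto simp: p1_def p2_def rg fun_eq_iff)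
      show ?thesis
        by (rule ht_conseq[OF ht_Seq[OF c1[of i] ht_Seq[OF a c2[of i] order_refl] order_refl]]) (auto simp: p)
    qed
  qed ((use zero frs0 in \<open>auto simp: mid_def fun_eq_iff\<close>), simp add: algebra_simps)
  then show ?thesis by (simp add: fr_def mid_def)
qed

text \<open>The unit vectors act as artificial constraints with right-hand side 0 and form the first
  basis, in which coordinates are just entries. They remain rows of the tableau after leaving the
  basis: objectives are expressed through them, and the final point is read off from them.\<close>

definition LoadUnits :: com where
  "LoadUnits = For 2 nE
     (Seq (RAssign 6 (IPlus mE (vr 2)) (vr 2) (OfNat (Lit 1)))
     (Seq (RAssign 6 (IPlus mE (vr 2)) nE (Sub zeroE (Cell 3 (Lit 0) (vr 2))))
          (IAssign 1 (vr 2) (IPlus mE (vr 2)))))"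

definition unit_row :: "nat \<Rightarrow> nat \<Rightarrow> (nat \<Rightarrow> real) \<Rightarrow> nat \<Rightarrow> nat \<Rightarrow> real" where
  "unit_row m n v s k = (if k = s - m then 1 else if k = n then - v (s - m) else 0)"

lemma ht_LoadUnits:
  fixes s0 :: state
  defines "m \<equiv> idx s0 0 0" and "n \<equiv> idx s0 0 1"
  assumes zero: "\<And>a k. m \<le> a \<Longrightarrow> T a k = 0"
  shows "ht d \<omega> (\<lambda>s. same s s0 \<and> reg s 6 = T) LoadUnits (3 + (n + 1) * 80)
    (\<lambda>s. same s s0 \<and> (\<forall>k<n. idx s 1 k = m + k) \<and>
       reg s 6 = (\<lambda>a k. if m \<le> a \<and> a < m + n then unit_row m n (reg s0 3 0) a k else T a k))"
proof -
  define fr where "fr = (\<lambda>s. same s s0)"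
  have fr [simp]: "idx s 0 0 = m" "idx s 0 (Suc 0) = n" if "fr s" for s
    using that by (simp_all add: fr_def same_def m_def n_def)
  have rg: "reg s 3 = reg s0 3" if "fr s" for s
    using that by (simp_all add: fr_def same_def)
  have [simp]: "fr (set_idx 2 i x s) = fr s" "fr (set_idx 1 i x s) = fr s" "fr (set_idx (Suc 0) i x s) = fr s"
    "fr (set_reg 6 i l y s) = fr s" for i l x y s
    by (simp_all add: fr_def)
  define mid where "mid = (\<lambda>i a k. if m \<le> a \<and> a < m + i then unit_row m n (reg s0 3 0) a k else T a k)"
  have "ht d \<omega> (\<lambda>s. fr s \<and> reg s 6 = T) LoadUnits (3 + (n + 1) * 80)
    (\<lambda>s. fr s \<and> (\<forall>k<n. idx s 1 k = m + k) \<and> reg s 6 = mid n)"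
    unfolding LoadUnits_def
  proof (rule ht_For[where N=n and c=60 and I="\<lambda>i s. fr s \<and> idx s 2 0 = i \<and> (\<forall>k<i. idx s 1 k = m + k) \<and> reg s 6 = mid i"])
    fix i assume i: "i < n"
    show "ht d \<omega> (\<lambda>s. fr s \<and> idx s 2 0 = i \<and> (\<forall>k<i. idx s 1 k = m + k) \<and> reg s 6 = mid i)
      (Seq (RAssign 6 (IPlus mE (vr 2)) (vr 2) (OfNat (Lit 1)))
     (Seq (RAssign 6 (IPlus mE (vr 2)) nE (Sub zeroE (Cell 3 (Lit 0) (vr 2))))
          (IAssign 1 (vr 2) (IPlus mE (vr 2))))) 60
      (\<lambda>s. (fr (set_idx 2 0 (Suc i) s) \<and> idx (set_idx 2 0 (Suc i) s) 2 0 = Suc i \<and>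
        (\<forall>k<Suc i. idx (set_idx 2 0 (Suc i) s) 1 k = m + k) \<and> reg (set_idx 2 0 (Suc i) s) 6 = mid (Suc i)) \<and> idx s 2 0 = i)"
    proof (rule ht_Seq[where ?c1.0=20 and ?c2.0=40])
      show "ht d \<omega> (\<lambda>s. fr s \<and> idx s 2 0 = i \<and> (\<forall>k<i. idx s 1 k = m + k) \<and> reg s 6 = mid i)
        (RAssign 6 (IPlus mE (vr 2)) (vr 2) (OfNat (Lit 1))) 20
        (\<lambda>s. fr s \<and> idx s 2 0 = i \<and> (\<forall>k<i. idx s 1 k = m + k) \<and> reg s 6 = (mid i)(m + i := (T (m + i))(i := 1)))"
        by (rule ht_RAssign) (auto simp: mid_def fun_eq_iff)
      show "ht d \<omega> (\<lambda>s. fr s \<and> idx s 2 0 = i \<and> (\<forall>k<i. idx s 1 k = m + k) \<and> reg s 6 = (mid i)(m + i := (T (m + i))(i := 1)))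
        (Seq (RAssign 6 (IPlus mE (vr 2)) nE (Sub zeroE (Cell 3 (Lit 0) (vr 2)))) (IAssign 1 (vr 2) (IPlus mE (vr 2)))) 40
        (\<lambda>s. (fr (set_idx 2 0 (Suc i) s) \<and> idx (set_idx 2 0 (Suc i) s) 2 0 = Suc i \<and>
        (\<forall>k<Suc i. idx (set_idx 2 0 (Suc i) s) 1 k = m + k) \<and> reg (set_idx 2 0 (Suc i) s) 6 = mid (Suc i)) \<and> idx s 2 0 = i)"
      proof (rule ht_Seq[where ?c1.0=20 and ?c2.0=20])
        show "ht d \<omega> (\<lambda>s. fr s \<and> idx s 2 0 = i \<and> (\<forall>k<i. idx s 1 k = m + k) \<and> reg s 6 = (mid i)(m + i := (T (m + i))(i := 1)))
          (RAssign 6 (IPlus mE (vr 2)) nE (Sub zeroE (Cell 3 (Lit 0) (vr 2)))) 20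
          (\<lambda>s. fr s \<and> idx s 2 0 = i \<and> (\<forall>k<i. idx s 1 k = m + k) \<and> reg s 6 = mid (Suc i))"
          by (rule ht_RAssign) (use i zero[of "m + i"] in \<open>auto simp: mid_def rg unit_row_def fun_eq_iff less_Suc_eq\<close>)
        show "ht d \<omega> (\<lambda>s. fr s \<and> idx s 2 0 = i \<and> (\<forall>k<i. idx s 1 k = m + k) \<and> reg s 6 = mid (Suc i))
          (IAssign 1 (vr 2) (IPlus mE (vr 2))) 20
          (\<lambda>s. (fr (set_idx 2 0 (Suc i) s) \<and> idx (set_idx 2 0 (Suc i) s) 2 0 = Suc i \<and>
            (\<forall>k<Suc i. idx (set_idx 2 0 (Suc i) s) 1 k = m + k) \<and> reg (set_idx 2 0 (Suc i) s) 6 = mid (Suc i)) \<and> idx s 2 0 = i)"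
          by (rule ht_IAssign) (auto simp: less_Suc_eq)
      qed simp
    qed simp
  qed (auto simp: mid_def fun_eq_iff)
  then show ?thesis by (simp add: fr_def mid_def)
qed

text \<open>Equality with zero is tested by two negated comparisons. The preference
  \<open>ILess (Lit 0) (Lit 0)\<close> is never true, so the first suitable row is kept.\<close>

definition StartBasis :: com where
  "StartBasis = For 4 nE
     (Seq (Choose 10 2 mE
        (BAnd (BAnd (BNot (RLess (Cell 6 (vr 2) nE) zeroE)) (BNot (RLess zeroE (Cell 6 (vr 2) nE))))
          (BNot (BAnd (BNot (RLess (Cell 6 (vr 2) (vr 4)) zeroE)) (BNot (RLess zeroE (Cell 6 (vr 2) (vr 4)))))))
        (ILess (Lit 0) (Lit 0)))
     (Seq (IAssign 11 (Lit 0) (vr 4)) Pivot))"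

text \<open>The artificial rows are exchanged for tight constraints one by one. If no tight row had
  a nonzero entry in column \<open>i\<close>, the dual vector of that unit vector would be
  orthogonal to all tight rows and hence zero by \<open>vertex\<close>. Column \<open>n\<close> does
  not change because its entry in every pivot row is zero.\<close>

lemma ht_StartBasis:
  fixes s0 :: state and g :: "nat \<Rightarrow> nat \<Rightarrow> real" and z :: "nat \<Rightarrow> real"
  defines "m \<equiv> idx s0 0 0" and "n \<equiv> idx s0 0 1"
  assumes vertex: "\<And>y. (\<And>r. r < m \<Longrightarrow> z r = 0 \<Longrightarrow> ip n (g r) y = 0) \<Longrightarrow> (\<And>l. l < n \<Longrightarrow> y l = 0)"
  shows "ht d \<omega> (\<lambda>s. same s s0 \<and> (\<exists>u. tableau n (m + n) g (idx s 1) u (reg s 6)) \<and> (\<forall>k<n. idx s 1 k = m + k) \<and>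
        (\<forall>s'<m + n. reg s 6 s' n = z s') \<and> (\<forall>s'. reg s 6 s' (n + 1) = 0))
     StartBasis (3 + (n + 1) * (100 + (m + 1) * 80 + pivot_cost m n))
     (\<lambda>s. same s s0 \<and> (\<exists>u. tableau n (m + n) g (idx s 1) u (reg s 6)) \<and> (\<forall>k<n. idx s 1 k < m \<and> z (idx s 1 k) = 0) \<and>
        (\<forall>s'<m + n. reg s 6 s' n = z s'))"
proof -
  define tb where "tb = (\<lambda>s::state. \<exists>u. tableau n (m + n) g (idx s 1) u (reg s 6))"
  define I where "I = (\<lambda>i s. same s s0 \<and> idx s 4 0 = i \<and> i \<le> n \<and> tb s \<and> (\<forall>k<i. idx s 1 k < m \<and> z (idx s 1 k) = 0) \<and>
     (\<forall>k. i \<le> k \<and> k < n \<longrightarrow> idx s 1 k = m + k) \<and> (\<forall>s'<m + n. reg s 6 s' n = z s'))"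
  have fr: "idx s 0 0 = m" "idx s 0 (Suc 0) = n" if "same s s0" for s
    using that by (simp_all add: same_def m_def n_def)
  show ?thesis
    unfolding StartBasis_def tb_def[symmetric]
  proof (rule ht_For[where N=n and c="60 + (m + 1) * 80 + pivot_cost m n" and I=I])
    fix i assume i: "i < n"
    let ?cnd = "BAnd (BAnd (BNot (RLess (Cell 6 (vr 2) nE) zeroE)) (BNot (RLess zeroE (Cell 6 (vr 2) nE))))
          (BNot (BAnd (BNot (RLess (Cell 6 (vr 2) (vr 4)) zeroE)) (BNot (RLess zeroE (Cell 6 (vr 2) (vr 4))))))"
    show "ht d \<omega> (I i) (Seq (Choose 10 2 mE ?cnd (ILess (Lit 0) (Lit 0))) (Seq (IAssign 11 (Lit 0) (vr 4)) Pivot))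
      (60 + (m + 1) * 80 + pivot_cost m n) (\<lambda>s. I (Suc i) (set_idx 4 0 (Suc i) s) \<and> idx s 4 0 = i)"
    proof (rule ht_pointwise)
      fix s1 assume I1: "I i s1"
      let ?T = "reg s1 6" and ?\<beta> = "idx s1 1"
      obtain u where tab: "tableau n (m + n) g ?\<beta> u ?T" using I1 by (auto simp: I_def tb_def)
      have dual: "dual_basis n g (?\<beta> ` {..<n}) u" and inj: "inj_on ?\<beta> {..<n}"
        and tT: "\<And>s k. s < m + n \<Longrightarrow> k < n \<Longrightarrow> ?T s k = ip n (u (?\<beta> k)) (g s)"
        using tab by (auto simp: tableau_def)
      have bi: "?\<beta> i = m + i" using I1 i by (simp add: I_def)
      have s1: "same s1 s0" "idx s1 4 0 = i" using I1 by (auto simp: I_def)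
      have sl: "\<And>s'. s' < m + n \<Longrightarrow> ?T s' n = z s'" using I1 by (simp add: I_def)
      define C where "C = (\<lambda>r. z r = 0 \<and> ?T r i \<noteq> 0)"
      have ex: "\<exists>r<m. C r"
      proof (rule ccontr)
        assume no: "\<not> (\<exists>r<m. C r)"
        have "ip n (g r) (u (m + i)) = 0" if "r < m" "z r = 0" for r
          using no that tT[of r i] i bi by (auto simp: C_def ip_commute)
        then have "\<And>l. l < n \<Longrightarrow> u (m + i) l = 0" using vertex by blast
        then have "ip n (u (m + i)) (g (m + i)) = 0" by (simp add: ip_def)
        then show False using dual_basisD(3)[OF dual, of "m + i" "m + i"] bi i by (metis imageI lessThan_iff zero_neq_one)
      qed
      define st where "st = (\<lambda>k. set_idx 2 0 m (set_idx 10 0 k s1))"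
      have ch: "ht d \<omega> (\<lambda>s. s = s1) (Choose 10 2 mE ?cnd (ILess (Lit 0) (Lit 0))) (40 + (m + 1) * 80)
        (\<lambda>s. \<exists>k. s = st k \<and> chosen m C (\<lambda>_ _. False) k)"
        unfolding st_def
        by (rule ht_Choose) (use fr[OF s1(1)] s1 sl in \<open>auto simp: C_def not_less intro: antisym\<close>)
      define st2 where "st2 = (\<lambda>k. set_idx 11 0 i (st k))"
      show "ht d \<omega> (\<lambda>s. s = s1) (Seq (Choose 10 2 mE ?cnd (ILess (Lit 0) (Lit 0))) (Seq (IAssign 11 (Lit 0) (vr 4)) Pivot))
        (60 + (m + 1) * 80 + pivot_cost m n) (\<lambda>s. I (Suc i) (set_idx 4 0 (Suc i) s) \<and> idx s 4 0 = i)"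
      proof (rule ht_Seq[OF ch, where ?c2.0="20 + pivot_cost m n"])
        show "ht d \<omega> (\<lambda>s. \<exists>k. s = st k \<and> chosen m C (\<lambda>_ _. False) k) (Seq (IAssign 11 (Lit 0) (vr 4)) Pivot)
          (20 + pivot_cost m n) (\<lambda>s. I (Suc i) (set_idx 4 0 (Suc i) s) \<and> idx s 4 0 = i)"
        proof (rule ht_pointwise)
          fix s2 assume "\<exists>k. s2 = st k \<and> chosen m C (\<lambda>_ _. False) k"
          then obtain r where s2: "s2 = st r" and r: "r < m" "z r = 0" "?T r i \<noteq> 0"
            using ex by (auto simp: chosen_def C_def)
          have rB: "r \<notin> ?\<beta> ` {..<n}"
          proof
            assume "r \<in> ?\<beta> ` {..<n}"
            then obtain k where k: "k < n" "r = ?\<beta> k" by auto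
            have "k \<noteq> i" using r k bi by auto
            then have "?\<beta> k \<noteq> ?\<beta> i" using inj k i by (auto dest: inj_onD)
            then have "ip n (u (?\<beta> i)) (g (?\<beta> k)) = 0" using dual_basisD(3)[OF dual, of "?\<beta> k" "?\<beta> i"] k i by auto
            then show False using r k tT[of r i] i by simp
          qed
          have st2: "idx (st2 r) 0 0 = m" "idx (st2 r) 0 1 = n" "idx (st2 r) 10 0 = r" "idx (st2 r) 11 0 = i" "reg (st2 r) 6 = ?T"
            "idx (st2 r) 4 0 = i" "idx (st2 r) 1 = ?\<beta>" "same (st2 r) s0"
            using fr[OF s1(1)] s1 by (simp_all add: st2_def st_def)
          have asg: "ht d \<omega> (\<lambda>s. s = s2) (IAssign 11 (Lit 0) (vr 4)) 20 (\<lambda>s. core s = core (st2 r) \<and> reg s 6 = ?T)"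
            by (rule ht_IAssign) (use s1 in \<open>auto simp: s2 st2_def st_def\<close>)
          have piv: "ht d \<omega> (\<lambda>s. core s = core (st2 r) \<and> reg s 6 = ?T) Pivot (pivot_cost m n)
            (\<lambda>s. core s = core (set_idx 1 i r (st2 r)) \<and>
              reg s 6 = (\<lambda>a. if a < m + n + 3 then pivoted (n + 2) ?T r i a else ?T a))"
            using ht_Pivot[of "st2 r" d \<omega> ?T, unfolded st2] i by simp
          show "ht d \<omega> (\<lambda>s. s = s2) (Seq (IAssign 11 (Lit 0) (vr 4)) Pivot) (20 + pivot_cost m n)
            (\<lambda>s. I (Suc i) (set_idx 4 0 (Suc i) s) \<and> idx s 4 0 = i)"
          proof (rule ht_conseq[OF ht_Seq[OF asg piv order_refl]])
            fix s assume s: "core s = core (set_idx 1 i r (st2 r)) \<and>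
              reg s 6 = (\<lambda>a. if a < m + n + 3 then pivoted (n + 2) ?T r i a else ?T a)"
            then have c: "core s = core (set_idx 1 i r (st2 r))" by simp
            have b1: "idx s 1 = ?\<beta>(i := r)" "idx s 4 0 = i" using coreD(1)[OF c, of 1] coreD(1)[OF c, of 4] st2 by auto
            have sm: "same s s0" using same_core[OF c] st2 by simp
            obtain u' where u': "tableau n (m + n) g (?\<beta>(i := r)) u' (pivoted (n + 2) ?T r i)"
              using tableau_pivot[OF tab i _ _ rB r(3), of "n + 2"] r(1) by auto
            have "tableau n (m + n) g (idx s 1) u' (reg s 6)"
              using u' s b1 unfolding tableau_def by auto
            then have "tb s" by (auto simp: tb_def)
            moreover have "reg s 6 s' n = z s'" if "s' < m + n" for s'
              using s that sl[OF that] sl[of r] r i by (simp add: pivoted_def)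
            ultimately show "I (Suc i) (set_idx 4 0 (Suc i) s) \<and> idx s 4 0 = i"
              using I1 b1 sm i r unfolding I_def tb_def by (auto simp: less_Suc_eq)
          qed auto
        qed
      qed simp
    qed
  qed (auto simp: I_def tb_def fr algebra_simps)
qed


section \<open>Random draws and the first objective\<close>

definition frame :: "nat set \<Rightarrow> state \<Rightarrow> state \<Rightarrow> bool" where
  "frame R s t \<longleftrightarrow> idx s 0 = idx t 0 \<and> idx s 1 = idx t 1 \<and> (\<forall>a. a \<notin> R \<longrightarrow> reg s a = reg t a) \<and> trace s = trace t"

lemma frame_simps [simp]:
  "a \<noteq> 0 \<Longrightarrow> a \<noteq> 1 \<Longrightarrow> frame R (set_idx a i x s) t = frame R s t"
  "a \<in> R \<Longrightarrow> frame R (set_reg a i l y s) t = frame R s t" "frame R s s"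
  "frame R (next_draw s) t = frame R s t"
  by (auto simp: frame_def)

lemma frame_core: "core s = core t \<Longrightarrow> frame {6, 9} s t"
  using coreD[of s t] by (auto simp: frame_def)

definition DrawDirection :: com where
  "DrawDirection = For 2 nE (DrawNormal 8 (Lit 0) (vr 2))"

lemma ht_DrawDirection:
  fixes s0 :: state
  defines "n \<equiv> idx s0 0 1"
  shows "ht d \<omega> (\<lambda>s. s = s0) DrawDirection (3 + (n + 1) * 30)
    (\<lambda>s. frame {8} s s0 \<and> draws s = draws s0 + n \<and> (\<forall>l<n. reg s 8 0 l = fst (\<omega> (draws s0 + l))))"
proof -
  have fr [simp]: "idx s 0 (Suc 0) = n" if "frame {8} s s0" for s
    using that by (simp add: frame_def n_def)
  show ?thesis
    unfolding DrawDirection_def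
  proof (rule ht_For[where N=n and c=15 and I="\<lambda>i s. frame {8} s s0 \<and> idx s 2 0 = i \<and> draws s = draws s0 + i \<and>
        (\<forall>l<i. reg s 8 0 l = fst (\<omega> (draws s0 + l)))"])
    show "ht d \<omega> (\<lambda>s. frame {8} s s0 \<and> idx s 2 0 = i \<and> draws s = draws s0 + i \<and> (\<forall>l<i. reg s 8 0 l = fst (\<omega> (draws s0 + l))))
      (DrawNormal 8 (Lit 0) (vr 2)) 15
      (\<lambda>s. (frame {8} (set_idx 2 0 (Suc i) s) s0 \<and> idx (set_idx 2 0 (Suc i) s) 2 0 = Suc i \<and>
        draws (set_idx 2 0 (Suc i) s) = draws s0 + Suc i \<and>
        (\<forall>l<Suc i. reg (set_idx 2 0 (Suc i) s) 8 0 l = fst (\<omega> (draws s0 + l)))) \<and> idx s 2 0 = i)" for i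
      by (rule ht_DrawNormal) (auto simp: less_Suc_eq)
  qed (auto simp: algebra_simps)
qed

definition DrawPerturbation :: com where
  "DrawPerturbation = For 2 mE (DrawExponential 6 (vr 2) (IPlus nE (Lit 1)))"

lemma ht_DrawPerturbation:
  fixes s0 :: state
  defines "m \<equiv> idx s0 0 0" and "n \<equiv> idx s0 0 1"
  shows "ht d \<omega> (\<lambda>s. s = s0) DrawPerturbation (3 + (m + 1) * 30)
    (\<lambda>s. frame {6} s s0 \<and> draws s = draws s0 + m \<and>
       reg s 6 = (\<lambda>a k. if a < m \<and> k = n + 1 then snd (\<omega> (draws s0 + a)) else reg s0 6 a k))"
proof -
  have fr [simp]: "idx s 0 0 = m" "idx s 0 (Suc 0) = n" if "frame {6} s s0" for s
    using that by (simp_all add: frame_def m_def n_def)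
  define mid where "mid = (\<lambda>i a k. if a < i \<and> k = n + 1 then snd (\<omega> (draws s0 + a)) else reg s0 6 a k)"
  have "ht d \<omega> (\<lambda>s. s = s0) DrawPerturbation (3 + (m + 1) * 30)
    (\<lambda>s. frame {6} s s0 \<and> draws s = draws s0 + m \<and> reg s 6 = mid m)"
    unfolding DrawPerturbation_def
  proof (rule ht_For[where N=m and c=15 and I="\<lambda>i s. frame {6} s s0 \<and> idx s 2 0 = i \<and> draws s = draws s0 + i \<and> reg s 6 = mid i"])
    show "ht d \<omega> (\<lambda>s. frame {6} s s0 \<and> idx s 2 0 = i \<and> draws s = draws s0 + i \<and> reg s 6 = mid i)
      (DrawExponential 6 (vr 2) (IPlus nE (Lit 1))) 15
      (\<lambda>s. (frame {6} (set_idx 2 0 (Suc i) s) s0 \<and> idx (set_idx 2 0 (Suc i) s) 2 0 = Suc i \<and>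
        draws (set_idx 2 0 (Suc i) s) = draws s0 + Suc i \<and> reg (set_idx 2 0 (Suc i) s) 6 = mid (Suc i)) \<and> idx s 2 0 = i)" for i
      by (rule ht_DrawExponential) (auto simp: mid_def fun_eq_iff less_Suc_eq)
  qed (auto simp: algebra_simps mid_def)
  then show ?thesis by (simp add: mid_def)
qed

text \<open>A variable is drawn for every row and erased afterwards on the start basis, so the tape
  cell that belongs to row \<open>i\<close> does not depend on this basis. The zeros are what keeps
  the start basis lexicographically feasible.\<close>

definition ClearPerturbation :: com where
  "ClearPerturbation = For 2 nE (RAssign 6 (Idx 1 (vr 2)) (IPlus nE (Lit 1)) zeroE)"

lemma ht_ClearPerturbation:
  fixes s0 :: state
  defines "n \<equiv> idx s0 0 1"
  shows "ht d \<omega> (\<lambda>s. s = s0) ClearPerturbation (3 + (n + 1) * 30)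
    (\<lambda>s. frame {6} s s0 \<and> draws s = draws s0 \<and>
       reg s 6 = (\<lambda>a k. if a \<in> idx s0 1 ` {..<n} \<and> k = n + 1 then 0 else reg s0 6 a k))"
proof -
  have fr [simp]: "idx s 0 (Suc 0) = n" if "frame {6} s s0" for s
    using that by (simp_all add: frame_def n_def)
  have fr1: "idx s (Suc 0) = idx s0 1" if "frame {6} s s0" for s
    using that by (simp add: frame_def)
  define mid where "mid = (\<lambda>i a k. if a \<in> idx s0 1 ` {..<i} \<and> k = n + 1 then 0 else reg s0 6 a k)"
  have "ht d \<omega> (\<lambda>s. s = s0) ClearPerturbation (3 + (n + 1) * 30)
    (\<lambda>s. frame {6} s s0 \<and> draws s = draws s0 \<and> reg s 6 = mid n)"
    unfolding ClearPerturbation_def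
  proof (rule ht_For[where N=n and c=16 and I="\<lambda>i s. frame {6} s s0 \<and> idx s 2 0 = i \<and> draws s = draws s0 \<and> reg s 6 = mid i"])
    fix i
    show "ht d \<omega> (\<lambda>s. frame {6} s s0 \<and> idx s 2 0 = i \<and> draws s = draws s0 \<and> reg s 6 = mid i)
      (RAssign 6 (Idx 1 (vr 2)) (IPlus nE (Lit 1)) zeroE) 16
      (\<lambda>s. (frame {6} (set_idx 2 0 (Suc i) s) s0 \<and> idx (set_idx 2 0 (Suc i) s) 2 0 = Suc i \<and>
        draws (set_idx 2 0 (Suc i) s) = draws s0 \<and> reg (set_idx 2 0 (Suc i) s) 6 = mid (Suc i)) \<and> idx s 2 0 = i)"
    proof (rule ht_RAssign)
      fix s assume s: "frame {6} s s0 \<and> idx s 2 0 = i \<and> draws s = draws s0 \<and> reg s 6 = mid i"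
      have "(mid i)(idx s0 1 i := (mid i (idx s0 1 i))(n + 1 := 0)) = mid (Suc i)"
        by (auto simp: mid_def fun_eq_iff lessThan_Suc)
      then show "(frame {6} (set_idx 2 0 (Suc i) (set_reg 6 (ival s (Idx 1 (vr 2))) (ival s (IPlus nE (Lit 1))) (rval s zeroE) s)) s0 \<and>
        idx (set_idx 2 0 (Suc i) (set_reg 6 (ival s (Idx 1 (vr 2))) (ival s (IPlus nE (Lit 1))) (rval s zeroE) s)) 2 0 = Suc i \<and>
        draws (set_idx 2 0 (Suc i) (set_reg 6 (ival s (Idx 1 (vr 2))) (ival s (IPlus nE (Lit 1))) (rval s zeroE) s)) = draws s0 \<and>
        reg (set_idx 2 0 (Suc i) (set_reg 6 (ival s (Idx 1 (vr 2))) (ival s (IPlus nE (Lit 1))) (rval s zeroE) s)) 6 = mid (Suc i)) \<and>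
        idx (set_reg 6 (ival s (Idx 1 (vr 2))) (ival s (IPlus nE (Lit 1))) (rval s zeroE) s) 2 0 = i"
        using s fr1[of s] by simp
    qed simp
  qed (auto simp: algebra_simps mid_def)
  then show ?thesis by (simp add: mid_def)
qed

definition SumRows :: com where
  "SumRows = For 2 nE (For 3 nE (RAssign 7 (Lit 0) (vr 3) (Add (Cell 7 (Lit 0) (vr 3)) (Cell 0 (Idx 1 (vr 2)) (vr 3)))))"

lemma ht_SumRows:
  fixes s0 :: state
  defines "n \<equiv> idx s0 0 1"
  assumes zero: "\<And>l. reg s0 7 0 l = 0"
  shows "ht d \<omega> (\<lambda>s. s = s0) SumRows (3 + (n + 1) * (30 + (n + 1) * 40))
    (\<lambda>s. frame {7} s s0 \<and> draws s = draws s0 \<and> (\<forall>l<n. reg s 7 0 l = (\<Sum>k<n. reg s0 0 (idx s0 1 k) l)))"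
proof -
  define fr where "fr = (\<lambda>s. frame {7} s s0 \<and> draws s = draws s0)"
  have [simp]: "idx s 0 (Suc 0) = n" if "fr s" for s
    using that by (simp_all add: fr_def frame_def n_def)
  have [simp]: "fr (set_idx 2 i x s) = fr s" "fr (set_idx 3 i x s) = fr s" "fr (set_reg 7 i l y s) = fr s" for i l x y s
    by (auto simp: fr_def)
  define A where "A = (\<lambda>k. reg s0 0 (idx s0 1 k))"
  have frA [simp]: "reg s 0 (idx s (Suc 0) k) = A k" if "fr s" for s k
    using that by (simp add: fr_def frame_def A_def)
  have inner: "ht d \<omega> (\<lambda>s. fr s \<and> idx s 2 0 = i \<and> (\<forall>l<n. reg s 7 0 l = (\<Sum>k<i. A k l)))
    (For 3 nE (RAssign 7 (Lit 0) (vr 3) (Add (Cell 7 (Lit 0) (vr 3)) (Cell 0 (Idx 1 (vr 2)) (vr 3)))))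
    (3 + (n + 1) * 40) (\<lambda>s. fr s \<and> idx s 2 0 = i \<and> (\<forall>l<n. reg s 7 0 l = (\<Sum>k<Suc i. A k l)))" for i
  proof (rule ht_For[where N=n and c=25 and I="\<lambda>j s. fr s \<and> idx s 2 0 = i \<and> idx s 3 0 = j \<and>
      (\<forall>l<n. reg s 7 0 l = (if l < j then \<Sum>k<Suc i. A k l else \<Sum>k<i. A k l))"])
    show "ht d \<omega> (\<lambda>s. fr s \<and> idx s 2 0 = i \<and> idx s 3 0 = j \<and>
      (\<forall>l<n. reg s 7 0 l = (if l < j then \<Sum>k<Suc i. A k l else \<Sum>k<i. A k l)))
      (RAssign 7 (Lit 0) (vr 3) (Add (Cell 7 (Lit 0) (vr 3)) (Cell 0 (Idx 1 (vr 2)) (vr 3)))) 25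
      (\<lambda>s. (fr (set_idx 3 0 (Suc j) s) \<and> idx (set_idx 3 0 (Suc j) s) 2 0 = i \<and> idx (set_idx 3 0 (Suc j) s) 3 0 = Suc j \<and>
      (\<forall>l<n. reg (set_idx 3 0 (Suc j) s) 7 0 l = (if l < Suc j then \<Sum>k<Suc i. A k l else \<Sum>k<i. A k l))) \<and> idx s 3 0 = j)"
      if "j < n" for j
      by (rule ht_RAssign) (use that in \<open>auto simp: less_Suc_eq\<close>)
  qed (auto simp: algebra_simps)
  have "ht d \<omega> (\<lambda>s. s = s0) SumRows (3 + (n + 1) * (30 + (n + 1) * 40))
    (\<lambda>s. fr s \<and> (\<forall>l<n. reg s 7 0 l = (\<Sum>k<n. A k l)))"
    unfolding SumRows_def
  proof (rule ht_For[where N=n and c="3 + (n + 1) * 40" and I="\<lambda>i s. fr s \<and> idx s 2 0 = i \<and> (\<forall>l<n. reg s 7 0 l = (\<Sum>k<i. A k l))"])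
    show "ht d \<omega> (\<lambda>s. fr s \<and> idx s 2 0 = i \<and> (\<forall>l<n. reg s 7 0 l = (\<Sum>k<i. A k l)))
      (For 3 nE (RAssign 7 (Lit 0) (vr 3) (Add (Cell 7 (Lit 0) (vr 3)) (Cell 0 (Idx 1 (vr 2)) (vr 3)))))
      (3 + (n + 1) * 40)
      (\<lambda>s. (fr (set_idx 2 0 (Suc i) s) \<and> idx (set_idx 2 0 (Suc i) s) 2 0 = Suc i \<and>
        (\<forall>l<n. reg (set_idx 2 0 (Suc i) s) 7 0 l = (\<Sum>k<Suc i. A k l))) \<and> idx s 2 0 = i)" for i
      by (rule ht_conseq[OF inner[of i]]) auto
  next
    fix s assume "s = s0"
    then show "fr (set_idx 2 0 0 s) \<and> idx (set_idx 2 0 0 s) 2 0 = 0 \<and> (\<forall>l<n. reg (set_idx 2 0 0 s) 7 0 l = (\<Sum>k<0. A k l))"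
      using zero by (simp add: fr_def)
  qed (auto simp: algebra_simps)
  then show ?thesis unfolding fr_def A_def conj_assoc .
qed


section \<open>One leg of the walk\<close>

lemma ht_run:
  assumes "ht n \<omega> P p c Q" "P (forget_steps s)"
  obtains s' where "exec n \<omega> p s s'" "Q (forget_steps s')" "steps s' \<le> steps s + c"
  using assms unfolding ht_def by blast

definition negE :: "rexp \<Rightarrow> rexp" where "negE e = Sub zeroE e"

text \<open>Ratio test on two objective rows: it finds the position of the coordinate that vanishes
  first along \<open>p + t q\<close>. The default value \<open>n\<close> means that no coordinate
  decreases, and it ends the loop in \<open>Leg\<close>.\<close>

definition Find :: "iexp \<Rightarrow> iexp \<Rightarrow> com" where
  "Find p q = Choose 11 2 nE (RLess (Cell 6 q (vr 2)) zeroE)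
     (RLess (Div (Cell 6 p (vr 2)) (negE (Cell 6 q (vr 2)))) (Div (Cell 6 p (vr 11)) (negE (Cell 6 q (vr 11)))))"

definition find_cost :: "nat \<Rightarrow> nat" where "find_cost n = 7 + (n + 1) * 150"

lemma ht_Find:
  fixes s0 :: state
  defines "n \<equiv> idx s0 0 1"
  assumes rows: "\<And>s. idx s 0 = idx s0 0 \<Longrightarrow> ival s pE = p" "\<And>s. idx s 0 = idx s0 0 \<Longrightarrow> ival s qE = q"
    "icost pE \<le> 10" "icost qE \<le> 10"
  shows "ht d \<omega> (\<lambda>s. s = s0) (Find pE qE) (find_cost n)
    (\<lambda>s. \<exists>k. s = set_idx 2 0 n (set_idx 11 0 k s0) \<and>
       chosen n (\<lambda>i. reg s0 6 q i < 0) (\<lambda>i k. reg s0 6 p i / - reg s0 6 q i < reg s0 6 p k / - reg s0 6 q k) k)"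
proof -
  let ?c = "RLess (Cell 6 qE (vr 2)) zeroE"
  let ?b = "RLess (Div (Cell 6 pE (vr 2)) (negE (Cell 6 qE (vr 2)))) (Div (Cell 6 pE (vr 11)) (negE (Cell 6 qE (vr 11))))"
  have "(n + 1) * (22 + 2 * icost nE + bcost ?c + bcost ?b) \<le> (n + 1) * 150"
    using rows(3,4) by (intro mult_le_mono2) (simp add: negE_def)
  then have cost: "5 + icost nE + (n + 1) * (22 + 2 * icost nE + bcost ?c + bcost ?b) \<le> find_cost n"
  proof -
    assume le: "(n + 1) * (22 + 2 * icost nE + bcost ?c + bcost ?b) \<le> (n + 1) * 150"
    have i: "5 + icost nE = 7" by simp
    show ?thesis unfolding find_cost_def i by (rule add_left_mono[OF le])
  qed
  show ?thesis
    unfolding Find_def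
    by (rule ht_Choose[OF _ _ _ _ _ _ _ _ cost]) (use rows(1,2) in \<open>simp_all add: n_def negE_def\<close>)
qed

definition ratioE :: "nat \<Rightarrow> iexp \<Rightarrow> rexp" where
  "ratioE v c = Div (Cell 6 (vr v) c) (negE (Cell 6 (vr v) (vr 11)))"

text \<open>The lexicographic comparison of \<open>lex_ratio_less\<close> in terms of tableau
  entries, with the disjunction expressed by negation and conjunction.\<close>

definition Enter :: com where
  "Enter = Choose 10 2 mE (RLess (Cell 6 (vr 2) (vr 11)) zeroE)
     (BNot (BAnd (BNot (RLess (ratioE 2 nE) (ratioE 10 nE)))
        (BNot (BAnd (BNot (RLess (ratioE 10 nE) (ratioE 2 nE)))
           (RLess (ratioE 2 (IPlus nE (Lit 1))) (ratioE 10 (IPlus nE (Lit 1))))))))"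

definition enter_cost :: "nat \<Rightarrow> nat" where "enter_cost m = 7 + (m + 1) * 200"

lemma ht_Enter:
  fixes s0 :: state
  defines "m \<equiv> idx s0 0 0" and "n \<equiv> idx s0 0 1" and "j \<equiv> idx s0 11 0" and "T \<equiv> reg s0 6"
  shows "ht d \<omega> (\<lambda>s. s = s0) Enter (enter_cost m)
    (\<lambda>s. \<exists>k. s = set_idx 2 0 m (set_idx 10 0 k s0) \<and>
       chosen m (\<lambda>i. T i j < 0) (\<lambda>i k. T i n / - T i j < T k n / - T k j \<or>
         (\<not> T k n / - T k j < T i n / - T i j \<and> T i (n + 1) / - T i j < T k (n + 1) / - T k j)) k)"
  unfolding Enter_def
  by (rule ht_Choose)
    (auto simp: m_def n_def j_def T_def negE_def ratioE_def enter_cost_def simp del: divide_minus_right)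

definition Step :: "iexp \<Rightarrow> iexp \<Rightarrow> com" where
  "Step p q = Seq Enter (Seq Pivot (Seq (ReportBasis 1) (Find p q)))"

definition Leg :: "iexp \<Rightarrow> iexp \<Rightarrow> com" where
  "Leg p q = Seq (Find p q) (While (ILess (vr 11) nE) (Step p q))"

text \<open>The condition \<open>pivot_cost_le\<close> over the natural numbers, with addition in
  place of subtraction.\<close>

definition gaps :: "nat \<Rightarrow> (nat \<times> event) list \<Rightarrow> bool" where
  "gaps c xs \<longleftrightarrow> (\<forall>k. Suc k < length xs \<and> is_basis_event (snd (xs ! Suc k)) \<longrightarrow> fst (xs ! Suc k) \<le> fst (xs ! k) + c)"

lemma gaps_snoc:
  assumes "gaps c xs" "xs \<noteq> []" "is_basis_event e \<Longrightarrow> t \<le> fst (last xs) + c"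
  shows "gaps c (xs @ [(t, e)])"
  unfolding gaps_def
proof (intro allI impI)
  fix k assume k: "Suc k < length (xs @ [(t, e)]) \<and> is_basis_event (snd ((xs @ [(t, e)]) ! Suc k))"
  show "fst ((xs @ [(t, e)]) ! Suc k) \<le> fst ((xs @ [(t, e)]) ! k) + c"
  proof (cases "Suc k < length xs")
    case True
    then show ?thesis using assms(1) k by (auto simp: gaps_def nth_append)
  next
    case False
    then have "Suc k = length xs" using k by simp
    then have "k = length xs - 1" by simp
    then have "(xs @ [(t, e)]) ! Suc k = (t, e)" "(xs @ [(t, e)]) ! k = last xs"
      using assms(2) \<open>Suc k = length xs\<close> by (auto simp: nth_append last_conv_nth)
    then show ?thesis using assms(3) k by simp
  qed
qed

lemma dual_basis_cong: "(\<And>k. k \<in> B \<Longrightarrow> g k = a k) \<Longrightarrow> dual_basis n g B u = dual_basis n a B u"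
  unfolding dual_basis_def by (intro conj_cong refl ball_cong all_cong1 imp_cong) (auto intro!: sum.cong)

text \<open>The \<epsilon> hidden in \<open>bs\<close> serves the geometry only. The program handles
  \<open>b\<close> and \<open>w\<close> separately, and its ratio test relies on the two additional
  facts: there are no ties, and every column has a candidate row.\<close>

locale lp = fan n m a bs "lex_bases n m a b w" "dual_of n a" \<delta>
  for n m a bs b w \<delta> +
  assumes gen_rhs: "generic_rhs n m a w"
    and edge_bounded: "B \<in> lex_bases n m a b w \<Longrightarrow> j \<in> B \<Longrightarrow> \<exists>r<m. ip n (dual_of n a B j) (a r) < 0"
begin

abbreviation "\<B> \<equiv> lex_bases n m a b w"

text \<open>The rows are the \<open>m\<close> constraints, the \<open>n\<close> unit vectors and
  three objectives. The residual of \<open>b\<close> is maintained on the unit vectors too, where it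
  yields the output; that of \<open>w\<close> serves ratio tests and is maintained on the
  constraints only.\<close>

definition tab :: "(nat \<Rightarrow> nat \<Rightarrow> real) \<Rightarrow> (nat \<Rightarrow> nat) \<Rightarrow> (nat \<Rightarrow> nat \<Rightarrow> real) \<Rightarrow> bool" where
  "tab g \<beta> T \<longleftrightarrow> inj_on \<beta> {..<n} \<and> \<beta> ` {..<n} \<in> \<B> \<and>
     (\<forall>s<m + n + 3. \<forall>k<n. T s k = co (\<beta> ` {..<n}) (\<beta> k) (g s)) \<and>
     residual_column n (m + n) b \<beta> n T \<and> residual_column n m w \<beta> (n + 1) T"

lemma tab_slack:
  assumes "tab g \<beta> T" "\<And>k. k < m \<Longrightarrow> g k = a k" "s < m"
  shows "T s n = slack n a b (\<beta> ` {..<n}) s" "T s (n + 1) = slack n a w (\<beta> ` {..<n}) s"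
proof -
  have inj: "inj_on \<beta> {..<n}" and t: "\<And>k. k < n \<Longrightarrow> T s k = co (\<beta> ` {..<n}) (\<beta> k) (a s)"
    using assms by (auto simp: tab_def)
  have "(\<Sum>j\<in>\<beta> ` {..<n}. co (\<beta> ` {..<n}) j (a s) * h j) = (\<Sum>k<n. T s k * h (\<beta> k))" for h
    using inj t by (simp add: sum.reindex)
  then show "T s n = slack n a b (\<beta> ` {..<n}) s" "T s (n + 1) = slack n a w (\<beta> ` {..<n}) s"
    using assms by (simp_all add: tab_def residual_column_def slack_def)
qed

text \<open>The entries that the program compares are the slacks and coordinates of
  \<open>lex_pivot\<close>, so the selected row is lexicographically minimal;
  \<open>edge_bounded\<close> excludes the default value \<open>m\<close> of the selection.\<close>

lemma tab_pivot:
  assumes T: "tab g \<beta> T" and g: "\<And>k. k < m \<Longrightarrow> g k = a k" and j: "j < n"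
    and r: "chosen m (\<lambda>i. T i j < 0) (\<lambda>i k. T i n / - T i j < T k n / - T k j \<or>
         (\<not> T k n / - T k j < T i n / - T i j \<and> T i (n + 1) / - T i j < T k (n + 1) / - T k j)) r"
  shows "r < m" "r \<notin> \<beta> ` {..<n}" "co (\<beta> ` {..<n}) (\<beta> j) (a r) < 0"
    "insert r (\<beta> ` {..<n} - {\<beta> j}) \<in> \<B>"
    "tab g (\<beta>(j := r)) (\<lambda>s. if s < m + n + 3 then pivoted (n + 2) T r j s else T s)"
proof -
  let ?B = "\<beta> ` {..<n}" and ?T' = "\<lambda>s. if s < m + n + 3 then pivoted (n + 2) T r j s else T s"
  have inj: "inj_on \<beta> {..<n}" and B: "?B \<in> \<B>"
    and t: "\<And>s k. s < m + n + 3 \<Longrightarrow> k < n \<Longrightarrow> T s k = co ?B (\<beta> k) (g s)"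
    using T by (auto simp: tab_def)
  have Bm: "?B \<subseteq> {..<m}" using bases_sub[OF B] .
  have jB: "\<beta> j \<in> ?B" using j by auto
  have ta: "T s j = co ?B (\<beta> j) (a s)" if "s < m" for s using t[of s j] g[OF that] that j by simp
  show rm: "r < m" using r edge_bounded[OF B jB] ta by (auto simp: chosen_def)
  then have neg: "T r j < 0" and min: "\<And>i. i < m \<Longrightarrow> T i j < 0 \<Longrightarrow> \<not> (T i n / - T i j < T r n / - T r j \<or>
         (\<not> T r n / - T r j < T i n / - T i j \<and> T i (n + 1) / - T i j < T r (n + 1) / - T r j))"
    using r unfolding chosen_def by blast+
  then show rneg: "co ?B (\<beta> j) (a r) < 0" using ta[OF rm] by simp
  have min': "\<not> lex_ratio_less n a b w ?B (\<beta> j) i r" if "i < m" "co ?B (\<beta> j) (a i) < 0" for i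
    using min[OF that(1)] that ta[OF that(1)] ta[OF rm] tab_slack[OF T g that(1)] tab_slack[OF T g rm]
    unfolding lex_ratio_less_def Let_def by simp
  show rB: "r \<notin> ?B" and B': "insert r (?B - {\<beta> j}) \<in> \<B>"
    using lex_pivot[OF B gen_rhs jB rm rneg min'] by blast+
  have dg: "dual_basis n g ?B (dual_of n a ?B)"
    using dual[OF B] dual_basis_cong[of ?B g a] g Bm by blast
  have tg: "tableau n (m + n + 3) g \<beta> (dual_of n a ?B) T"
    using inj dg t by (simp add: tableau_def)
  obtain u' where u': "tableau n (m + n + 3) g (\<beta>(j := r)) u' (pivoted (n + 2) T r j)"
    using tableau_pivot[OF tg j _ _ rB, of "n + 2"] neg rm by auto
  have im: "(\<beta>(j := r)) ` {..<n} = insert r (?B - {\<beta> j})" by (rule image_fun_upd_basis[OF inj j])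
  have B'm: "(\<beta>(j := r)) ` {..<n} \<subseteq> {..<m}" using bases_sub[OF B'] im by simp
  have "dual_basis n g ((\<beta>(j := r)) ` {..<n}) u'" using u' by (simp add: tableau_def)
  then have du: "dual_basis n a ((\<beta>(j := r)) ` {..<n}) u'"
    using dual_basis_cong[of "(\<beta>(j := r)) ` {..<n}" g a] g B'm by blast
  have "?T' s k = co ((\<beta>(j := r)) ` {..<n}) ((\<beta>(j := r)) k) (g s)" if "s < m + n + 3" "k < n" for s k
    using u' that dual_of_eq[OF du, of "(\<beta>(j := r)) k"] by (auto simp: tableau_def)
  moreover have "residual_column n (m + n) b (\<beta>(j := r)) n ?T'"
    using residual_column_pivot[of n "m + n" b \<beta> n T j "n + 2" r] T j rm neg
    unfolding tab_def residual_column_def by simp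
  moreover have "residual_column n m w (\<beta>(j := r)) (n + 1) ?T'"
    using residual_column_pivot[of n m w \<beta> "n + 1" T j "n + 2" r] T j rm neg
    unfolding tab_def residual_column_def by simp
  moreover have "inj_on (\<beta>(j := r)) {..<n}" using u' by (simp add: tableau_def)
  ultimately show "tab g (\<beta>(j := r)) ?T'" using B' im unfolding tab_def by auto
qed

fun walk :: "(nat \<Rightarrow> real) \<Rightarrow> (nat \<Rightarrow> real) \<Rightarrow> real \<Rightarrow> nat set \<Rightarrow> nat set list \<Rightarrow> bool" where
  "walk p q t B [] = True"
| "walk p q t B (B' # Bs) = (\<exists>t'\<ge>t. adjacent B B' \<and> B' \<in> \<B> \<and> nonneg_on B (\<lambda>l. p l + t' * q l) \<and>
     nonneg_on B' (\<lambda>l. p l + t' * q l) \<and> walk p q t' B' Bs)"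

definition good :: "(nat \<Rightarrow> nat \<Rightarrow> real) \<Rightarrow> state \<Rightarrow> bool" where
  "good g s \<longleftrightarrow> idx s 0 0 = m \<and> idx s 0 1 = n \<and> tab g (idx s 1) (reg s 6)"

definition keep :: "state \<Rightarrow> state \<Rightarrow> bool" where
  "keep s t \<longleftrightarrow> idx s 0 = idx t 0 \<and> (\<forall>a. a \<noteq> 6 \<and> a \<noteq> 9 \<longrightarrow> reg s a = reg t a)"

definition "step_cost = enter_cost m + pivot_cost m n + find_cost n + 10"

text \<open>Induction on the number of crossings ahead, which every round lowers by
  \<open>leg_step\<close>; this bounds the pivots and proves termination at once. The invariant
  holds between \<open>Find\<close> and the guard, so the cost of \<open>Find\<close> is charged to
  the next reported basis. The summand 10 in \<open>step_cost\<close> pays for the guard and the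
  report.\<close>

lemma leg_loop:
  assumes g: "\<And>k. k < m \<Longrightarrow> g k = a k" "g P = p" "g Q = q" "P < m + n + 3" "Q < m + n + 3"
    and E: "\<And>s. idx s 0 0 = m \<Longrightarrow> idx s 0 1 = n \<Longrightarrow> ival s pE = P \<and> ival s qE = Q" "icost pE \<le> 10" "icost qE \<le> 10"
    and gen: "generic p q \<or> generic q p"
    and s: "good g s" "entered p q t (idx s 1 ` {..<n})"
      "chosen n (\<lambda>i. reg s 6 Q i < 0) (\<lambda>i k. reg s 6 P i / - reg s 6 Q i < reg s 6 P k / - reg s 6 Q k) (idx s 11 0)"
      "trace s \<noteq> []" "steps s \<le> fst (last (trace s)) + find_cost n" "gaps step_cost (trace s)"
  shows "\<exists>s' Bs tr. exec n \<omega> (While (ILess (vr 11) nE) (Step pE qE)) s s' \<and> good g s' \<and> keep s' s \<and>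
    trace s' = trace s @ tr \<and> map snd tr = map Basis Bs \<and> length Bs \<le> card (crossings p q t) \<and>
    walk p q t (idx s 1 ` {..<n}) Bs \<and> idx s' 1 ` {..<n} = last (idx s 1 ` {..<n} # Bs) \<and>
    nonneg_on (idx s' 1 ` {..<n}) q \<and> gaps step_cost (trace s') \<and> steps s' \<le> steps s + (length Bs + 1) * step_cost"
  using s
proof (induction "card (crossings p q t)" arbitrary: s t rule: less_induct)
  case (less t s)
  let ?\<beta> = "idx s 1" and ?T = "reg s 6" and ?j = "idx s 11 0"
  let ?B = "?\<beta> ` {..<n}"
  let ?w = "While (ILess (vr 11) nE) (Step pE qE)"
  have mn: "idx s 0 0 = m" "idx s 0 1 = n" and T: "tab g ?\<beta> ?T" using less.prems(1) by (auto simp: good_def)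
  have tp: "?T P k = co ?B (?\<beta> k) p" "?T Q k = co ?B (?\<beta> k) q" if "k < n" for k
    using T that g by (auto simp: tab_def)
  show ?case
  proof (cases "?j < n")
    case False
    then have nn: "\<forall>i<n. \<not> ?T Q i < 0" using less.prems(3) by (auto simp: chosen_def)
    have "nonneg_on ?B q" using nn tp unfolding nonneg_on_def by force
    moreover have "\<not> bval s (ILess (vr 11) nE)" using False mn by simp
    then have "exec n \<omega> ?w s (tick (1 + bcost (ILess (vr 11) nE)) s)" by (rule exec.WhileFalse)
    ultimately show ?thesis
      using less.prems by (intro exI[of _ "tick (1 + bcost (ILess (vr 11) nE)) s"] exI[of _ "[]"])
        (auto simp: good_def keep_def step_cost_def)
  next
    case True
    let ?s1 = "tick (1 + bcost (ILess (vr 11) nE)) s"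
    have gd: "bval s (ILess (vr 11) nE)" using True mn by simp
    have neg: "?T Q ?j < 0" and mins: "\<And>i. i < n \<Longrightarrow> ?T Q i < 0 \<Longrightarrow> \<not> ?T P i / - ?T Q i < ?T P ?j / - ?T Q ?j"
      using less.prems(3) True by (auto simp: chosen_def)
    let ?L = "\<lambda>i k. ?T i n / - ?T i ?j < ?T k n / - ?T k ?j \<or>
         (\<not> ?T k n / - ?T k ?j < ?T i n / - ?T i ?j \<and> ?T i (n + 1) / - ?T i ?j < ?T k (n + 1) / - ?T k ?j)"
    have h: "ht n \<omega> (\<lambda>z. z = forget_steps s) Enter (enter_cost m)
      (\<lambda>z. \<exists>k. z = set_idx 2 0 m (set_idx 10 0 k (forget_steps s)) \<and> chosen m (\<lambda>i. ?T i ?j < 0) ?L k)"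
      using ht_Enter[of n \<omega> "forget_steps s"] mn by simp
    obtain s2 r where s2: "exec n \<omega> Enter ?s1 s2" "forget_steps s2 = set_idx 2 0 m (set_idx 10 0 r (forget_steps s))"
      "chosen m (\<lambda>i. ?T i ?j < 0) ?L r" "steps s2 \<le> steps ?s1 + enter_cost m"
      by (rule ht_run[OF h, of ?s1]) (simp, blast)
    note piv = tab_pivot[OF T g(1) True s2(3)]
    have f2: "idx s2 = idx (set_idx 2 0 m (set_idx 10 0 r s))" "reg s2 = reg s" "trace s2 = trace s"
      using arg_cong[OF s2(2), of idx] arg_cong[OF s2(2), of reg] arg_cong[OF s2(2), of trace] by auto
    have i2: "idx s2 0 0 = m" "idx s2 0 1 = n" "idx s2 10 0 = r" "idx s2 11 0 = ?j" using f2 mn by auto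
    let ?T' = "\<lambda>a. if a < m + n + 3 then pivoted (n + 2) ?T r ?j a else ?T a"
    have h: "ht n \<omega> (\<lambda>z. core z = core s2 \<and> reg z 6 = ?T) Pivot (pivot_cost m n)
      (\<lambda>z. core z = core (set_idx 1 ?j r s2) \<and> reg z 6 = ?T')"
      using ht_Pivot[of s2 n \<omega> ?T, unfolded i2] True by simp
    obtain s3 where s3: "exec n \<omega> Pivot s2 s3" "core s3 = core (set_idx 1 ?j r s2)" "reg s3 6 = ?T'"
      "steps s3 \<le> steps s2 + pivot_cost m n"
    proof -
      have "core (forget_steps s2) = core s2 \<and> reg (forget_steps s2) 6 = ?T" using f2(2) by simp
      from ht_run[OF h this] obtain z where z: "exec n \<omega> Pivot s2 z"
        "core (forget_steps z) = core (set_idx 1 ?j r s2) \<and> reg (forget_steps z) 6 = ?T'"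
        "steps z \<le> steps s2 + pivot_cost m n" by blast
      show thesis
        by (rule that[OF z(1) _ _ z(3)]) (use z(2) in \<open>simp_all only: core_simps state_simps\<close>)
    qed
    have f3: "idx s3 1 = ?\<beta>(?j := r)" "idx s3 0 = idx s 0" "\<And>a. a \<noteq> 6 \<and> a \<noteq> 9 \<Longrightarrow> reg s3 a = reg s a" "trace s3 = trace s"
      using coreD(1)[OF s3(2), of 1] coreD(1)[OF s3(2), of 0] coreD(2)[OF s3(2)] coreD(4)[OF s3(2)] f2 by auto
    let ?B' = "insert r (?B - {?\<beta> ?j})"
    have im: "idx s3 1 ` {..<n} = ?B'"
    proof -
      have "inj_on ?\<beta> {..<n}" using T by (simp add: tab_def)
      then show ?thesis unfolding f3(1) by (rule image_fun_upd_basis[OF _ True])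
    qed
    let ?s4 = "report (Basis ?B') (tick 1 s3)"
    have e4: "exec n \<omega> (ReportBasis 1) s3 ?s4" using exec.ReportBasis[of n \<omega> 1 s3] im by simp
    have idx0: "idx s3 0 = idx s 0" by (rule f3)
    have rows: "\<And>z. idx z 0 = idx s 0 \<Longrightarrow> ival z pE = P" "\<And>z. idx z 0 = idx s 0 \<Longrightarrow> ival z qE = Q"
      using E(1) mn by simp_all
    have h: "ht n \<omega> (\<lambda>z. z = forget_steps ?s4) (Find pE qE) (find_cost n)
      (\<lambda>z. \<exists>k. z = set_idx 2 0 n (set_idx 11 0 k (forget_steps ?s4)) \<and>
       chosen n (\<lambda>i. ?T' Q i < 0) (\<lambda>i k. ?T' P i / - ?T' Q i < ?T' P k / - ?T' Q k) k)"
      using ht_Find[of "forget_steps ?s4" pE P qE Q n \<omega>] rows E(2,3) mn idx0 s3(3) by simp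
    obtain s5 k where s5: "exec n \<omega> (Find pE qE) ?s4 s5" "forget_steps s5 = set_idx 2 0 n (set_idx 11 0 k (forget_steps ?s4))"
      "chosen n (\<lambda>i. ?T' Q i < 0) (\<lambda>i k. ?T' P i / - ?T' Q i < ?T' P k / - ?T' Q k) k" "steps s5 \<le> steps ?s4 + find_cost n"
      by (rule ht_run[OF h refl]) blast
    have f5: "idx s5 = idx (set_idx 2 0 n (set_idx 11 0 k s3))" "reg s5 = reg s3" "trace s5 = trace s @ [(steps s3 + 1, Basis ?B')]"
      using arg_cong[OF s5(2), of idx] arg_cong[OF s5(2), of reg] arg_cong[OF s5(2), of trace] f3 by auto
    have step: "exec n \<omega> (Step pE qE) ?s1 s5"
      unfolding Step_def by (rule exec.Seq[OF s2(1) exec.Seq[OF s3(1) exec.Seq[OF e4 s5(1)]]])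
    have b5: "idx s5 1 = ?\<beta>(?j := r)" "idx s5 1 ` {..<n} = ?B'" "idx s5 11 0 = k" "reg s5 6 = ?T'" using f5 f3 im s3(3) by auto
    have good5: "good g s5" unfolding good_def b5 using piv(5) f5 f3 mn by simp
    have jB: "?\<beta> ?j \<in> ?B" using True by auto
    have negj: "co ?B (?\<beta> ?j) q < 0" using neg tp[OF True] by simp
    have minj: "co ?B (?\<beta> ?j) p / - co ?B (?\<beta> ?j) q \<le> co ?B i p / - co ?B i q" if "i \<in> ?B" "co ?B i q < 0" for i
    proof -
      obtain k where k: "k < n" "i = ?\<beta> k" using \<open>i \<in> ?B\<close> by blast
      show ?thesis using mins[OF k(1)] tp[OF k(1)] tp[OF True] that(2) k(2) by (simp add: not_less)
    qed
    define t' where "t' = co ?B (?\<beta> ?j) p / - co ?B (?\<beta> ?j) q"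
    have ls: "t < t'" "nonneg_on ?B (\<lambda>l. p l + t' * q l)" "nonneg_on ?B' (\<lambda>l. p l + t' * q l)"
      "entered p q t' ?B'" "card (crossings p q t') < card (crossings p q t)"
      using leg_step[OF gen less.prems(2) jB negj minj piv(2,3,4)] unfolding t'_def by blast+
    have st3: "steps s3 + 1 \<le> fst (last (trace s)) + step_cost"
      using less.prems(5) s2(4) s3(4) by (simp add: step_cost_def)
    have gaps5: "gaps step_cost (trace s5)"
      unfolding f5 using less.prems(4,6) st3 by (intro gaps_snoc) auto
    have "\<exists>s' Bs tr. exec n \<omega> ?w s5 s' \<and> good g s' \<and> keep s' s5 \<and>
      trace s' = trace s5 @ tr \<and> map snd tr = map Basis Bs \<and> length Bs \<le> card (crossings p q t') \<and>
      walk p q t' (idx s5 1 ` {..<n}) Bs \<and> idx s' 1 ` {..<n} = last (idx s5 1 ` {..<n} # Bs) \<and>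
      nonneg_on (idx s' 1 ` {..<n}) q \<and> gaps step_cost (trace s') \<and> steps s' \<le> steps s5 + (length Bs + 1) * step_cost"
    proof (rule less.hyps[OF ls(5) good5])
      show "entered p q t' (idx s5 1 ` {..<n})" using ls(4) b5 by simp
      show "chosen n (\<lambda>i. reg s5 6 Q i < 0) (\<lambda>i k. reg s5 6 P i / - reg s5 6 Q i < reg s5 6 P k / - reg s5 6 Q k) (idx s5 11 0)"
        unfolding b5 by (rule s5(3))
      show "trace s5 \<noteq> []" by (simp add: f5)
      show "steps s5 \<le> fst (last (trace s5)) + find_cost n" using s5(4) by (simp add: f5)
      show "gaps step_cost (trace s5)" by (rule gaps5)
    qed
    then obtain s' Bs tr where s': "exec n \<omega> ?w s5 s'" "good g s'" "keep s' s5"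
      "trace s' = trace s5 @ tr" "map snd tr = map Basis Bs" "length Bs \<le> card (crossings p q t')"
      "walk p q t' ?B' Bs" "idx s' 1 ` {..<n} = last (?B' # Bs)"
      "nonneg_on (idx s' 1 ` {..<n}) q" "gaps step_cost (trace s')" "steps s' \<le> steps s5 + (length Bs + 1) * step_cost"
      unfolding b5(2) by blast
    have ex: "exec n \<omega> ?w s s'" by (rule exec.WhileTrue[OF gd step s'(1)])
    have kp: "keep s' s" using s'(3) f5 f3 by (auto simp: keep_def)
    have B: "?B \<in> \<B>" using T by (simp add: tab_def)
    have adj: "adjacent ?B ?B'"
    proof -
      have "?B - ?B' = {?\<beta> ?j}" "?B' - ?B = {r}" using jB piv(2) by auto
      then show ?thesis by (simp add: adjacent_def)
    qed
    have w: "walk p q t ?B (?B' # Bs)"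
      using ls adj piv(4) s'(7) by (auto intro!: exI[of _ t'])
    have st5: "steps s5 \<le> steps s + step_cost"
      using s2(4) s3(4) s5(4) by (simp add: step_cost_def)
    show ?thesis
      using ex s' kp w st5 ls(5) f5
      by (intro exI[of _ s'] exI[of _ "?B' # Bs"] exI[of _ "(steps s3 + 1, Basis ?B') # tr"]) auto
  qed
qed

end


section \<open>Measurability of runs\<close>

text \<open>Interpreter with bounded fuel. The relation \<open>exec\<close> offers no recursion
  along which measurability in \<omega> could be proved; for given fuel the resulting state is a
  function of \<omega> built from finitely many case distinctions.\<close>

fun run :: "nat \<Rightarrow> (nat \<Rightarrow> real \<times> real) \<Rightarrow> nat \<Rightarrow> com \<Rightarrow> state \<Rightarrow> bool \<times> state" where
  "run n \<omega> 0 p s = (False, s)"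
| "run n \<omega> (Suc k) Skip s = (True, s)"
| "run n \<omega> (Suc k) (IAssign a e f) s = (True, tick (1 + icost e + icost f) (set_idx a (ival s e) (ival s f) s))"
| "run n \<omega> (Suc k) (RAssign a e f p) s =
     (True, tick (1 + icost e + icost f + rcost p) (set_reg a (ival s e) (ival s f) (rval s p) s))"
| "run n \<omega> (Suc k) (DrawNormal a e f) s = (True, tick (1 + icost e + icost f)
      (next_draw (set_reg a (ival s e) (ival s f) (fst (\<omega> (draws s))) s)))"
| "run n \<omega> (Suc k) (DrawExponential a e f) s = (True, tick (1 + icost e + icost f)
      (next_draw (set_reg a (ival s e) (ival s f) (snd (\<omega> (draws s))) s)))"
| "run n \<omega> (Suc k) (Seq p q) s =
     (if fst (run n \<omega> k p s) then run n \<omega> k q (snd (run n \<omega> k p s)) else (False, s))"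
| "run n \<omega> (Suc k) (Cond g p q) s =
     (if bval s g then run n \<omega> k p (tick (1 + bcost g) s) else run n \<omega> k q (tick (1 + bcost g) s))"
| "run n \<omega> (Suc k) (While g p) s = (if bval s g
     then (if fst (run n \<omega> k p (tick (1 + bcost g) s))
           then run n \<omega> k (While g p) (snd (run n \<omega> k p (tick (1 + bcost g) s))) else (False, s))
     else (True, tick (1 + bcost g) s))"
| "run n \<omega> (Suc k) (ReportBasis a) s = (True, report (Basis (idx s a ` {..<n})) (tick 1 s))"
| "run n \<omega> (Suc k) (ReportSegment a e i j) s =
     (True, report (Segment (idx s a ` {..<ival s e}) (reg_vec n s i) (reg_vec n s j)) (tick (1 + icost e) s))"

lemma run_sound: "fst (run n \<omega> k p s) \<Longrightarrow> exec n \<omega> p s (snd (run n \<omega> k p s))"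
proof (induction k arbitrary: p s)
  case (Suc k)
  then show ?case
  proof (cases p)
    case Skip then show ?thesis using exec.Skip by simp
  next
    case (IAssign a e f) then show ?thesis using exec.IAssign[of n \<omega> a e f s] by simp
  next
    case (RAssign a e f x) then show ?thesis using exec.RAssign[of n \<omega> a e f x s] by simp
  next
    case (DrawNormal a e f) then show ?thesis using exec.DrawNormal[of n \<omega> a e f s] by simp
  next
    case (DrawExponential a e f) then show ?thesis using exec.DrawExponential[of n \<omega> a e f s] by simp
  next
    case (Seq q r)
    then have t: "fst (run n \<omega> k q s)" "fst (run n \<omega> k r (snd (run n \<omega> k q s)))"
      using Suc.prems by (auto split: if_splits)
    show ?thesis using exec.Seq[OF Suc.IH[OF t(1)] Suc.IH[OF t(2)]] Seq t by simp
  next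
    case (Cond g q r)
    then show ?thesis
      using Suc.prems Suc.IH[of q "tick (1 + bcost g) s"] Suc.IH[of r "tick (1 + bcost g) s"]
        exec.CondTrue[of s g n \<omega> q _ r] exec.CondFalse[of s g n \<omega> r _ q] by (auto split: if_splits)
  next
    case (While g q)
    show ?thesis
    proof (cases "bval s g")
      case True
      then have t: "fst (run n \<omega> k q (tick (1 + bcost g) s))"
        "fst (run n \<omega> k (While g q) (snd (run n \<omega> k q (tick (1 + bcost g) s))))"
        using Suc.prems While by (auto split: if_splits)
      then show ?thesis
        using True While exec.WhileTrue[OF True Suc.IH[OF t(1)] Suc.IH[OF t(2)]] by simp
    next
      case False
      then show ?thesis using While exec.WhileFalse[OF False, of n \<omega> q] by simp
    qed
  next
    case (ReportBasis a) then show ?thesis using exec.ReportBasis[of n \<omega> a s] by simp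
  next
    case (ReportSegment a e i j) then show ?thesis using exec.ReportSegment[of n \<omega> a e i j s] by simp
  qed
qed simp

text \<open>The induction needs success for all sufficiently large fuel: the parts of a sequence
  then succeed with a common amount.\<close>

lemma run_complete: "exec n \<omega> p s s' \<Longrightarrow> \<exists>k. \<forall>k'\<ge>k. run n \<omega> k' p s = (True, s')"
proof (induction rule: exec.induct)
  case (Seq p s s' q s'')
  then obtain k1 k2 where "\<forall>k'\<ge>k1. run n \<omega> k' p s = (True, s')" "\<forall>k'\<ge>k2. run n \<omega> k' q s' = (True, s'')" by blast
  then have "run n \<omega> k' (Seq p q) s = (True, s'')" if "k' \<ge> Suc (max k1 k2)" for k'
    using that by (cases k') auto
  then show ?case by blast
next
  case (CondTrue s g p s' q)
  then obtain k where "\<forall>k'\<ge>k. run n \<omega> k' p (tick (1 + bcost g) s) = (True, s')" by blast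
  then have "run n \<omega> k' (Cond g p q) s = (True, s')" if "k' \<ge> Suc k" for k'
    using that CondTrue by (cases k') auto
  then show ?case by blast
next
  case (CondFalse s g q s' p)
  then obtain k where "\<forall>k'\<ge>k. run n \<omega> k' q (tick (1 + bcost g) s) = (True, s')" by blast
  then have "run n \<omega> k' (Cond g p q) s = (True, s')" if "k' \<ge> Suc k" for k'
    using that CondFalse by (cases k') auto
  then show ?case by blast
next
  case (WhileTrue s g p s' s'')
  then obtain k1 k2 where "\<forall>k'\<ge>k1. run n \<omega> k' p (tick (1 + bcost g) s) = (True, s')"
    "\<forall>k'\<ge>k2. run n \<omega> k' (While g p) s' = (True, s'')" by blast
  then have "run n \<omega> k' (While g p) s = (True, s'')" if "k' \<ge> Suc (max k1 k2)" for k'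
    using that WhileTrue(1) by (cases k') auto
  then show ?case by blast
next
  case (WhileFalse s g p)
  then have "run n \<omega> k' (While g p) s = (True, tick (1 + bcost g) s)" if "k' \<ge> Suc 0" for k'
    using that by (cases k') auto
  then show ?case by blast
qed (rule exI[of _ "Suc 0"], metis Suc_le_D run.simps)+

lemma fst_tape_measurable [measurable]: "(\<lambda>\<omega>. fst (\<omega> i)) \<in> borel_measurable tape"
  and snd_tape_measurable [measurable]: "(\<lambda>\<omega>. snd (\<omega> i)) \<in> borel_measurable tape"
proof -
  let ?D = "density lborel (\<lambda>x. ennreal (std_normal_density x)) \<Otimes>\<^sub>M density lborel (\<lambda>x. ennreal (exponential_density 1 x))"
  have c: "(\<lambda>\<omega>. \<omega> i) \<in> tape \<rightarrow>\<^sub>M ?D"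
    unfolding tape_def by (rule measurable_component_singleton) simp
  have "fst \<in> ?D \<rightarrow>\<^sub>M borel" "snd \<in> ?D \<rightarrow>\<^sub>M borel"
    by (simp_all add: measurable_cong_sets[OF sets_pair_measure_cong[OF sets_density sets_density] refl])
  then show "(\<lambda>\<omega>. fst (\<omega> i)) \<in> borel_measurable tape" "(\<lambda>\<omega>. snd (\<omega> i)) \<in> borel_measurable tape"
    using c by (auto intro: measurable_compose)
qed

definition bases_reported :: "state \<Rightarrow> nat" where
  "bases_reported s = length (filter (is_basis_event \<circ> snd) (trace s))"

text \<open>Measurability is required of each component separately, which avoids a \<sigma>-algebra
  on states. The trace contains real vectors and enters only through the number of reported bases,
  which is all that the expected number of pivots needs.\<close>

definition mstate :: "((nat \<Rightarrow> real \<times> real) \<Rightarrow> state) \<Rightarrow> bool" where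
  "mstate S \<longleftrightarrow> (\<forall>a i. (\<lambda>\<omega>. idx (S \<omega>) a i) \<in> tape \<rightarrow>\<^sub>M count_space UNIV) \<and>
     (\<forall>a i j. (\<lambda>\<omega>. reg (S \<omega>) a i j) \<in> borel_measurable tape) \<and>
     (\<lambda>\<omega>. draws (S \<omega>)) \<in> tape \<rightarrow>\<^sub>M count_space UNIV \<and> (\<lambda>\<omega>. steps (S \<omega>)) \<in> tape \<rightarrow>\<^sub>M count_space UNIV \<and>
     (\<lambda>\<omega>. bases_reported (S \<omega>)) \<in> tape \<rightarrow>\<^sub>M count_space UNIV"

lemma mstateD [measurable_dest]:
  assumes "mstate S"
  shows "(\<lambda>\<omega>. idx (S \<omega>) a i) \<in> tape \<rightarrow>\<^sub>M count_space UNIV" "(\<lambda>\<omega>. reg (S \<omega>) a i j) \<in> borel_measurable tape"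
    "(\<lambda>\<omega>. draws (S \<omega>)) \<in> tape \<rightarrow>\<^sub>M count_space UNIV" "(\<lambda>\<omega>. steps (S \<omega>)) \<in> tape \<rightarrow>\<^sub>M count_space UNIV"
    "(\<lambda>\<omega>. bases_reported (S \<omega>)) \<in> tape \<rightarrow>\<^sub>M count_space UNIV"
  using assms by (simp_all add: mstate_def)

lemma ival_measurable: "mstate S \<Longrightarrow> (\<lambda>\<omega>. ival (S \<omega>) e) \<in> tape \<rightarrow>\<^sub>M count_space UNIV"
proof (induction e)
  case (Idx a e)
  then show ?case
    using measurable_compose_countable[of "\<lambda>i \<omega>. idx (S \<omega>) a i" tape "count_space UNIV" "\<lambda>\<omega>. ival (S \<omega>) e"] mstateD(1)
    by simp
next
  case (IPlus e f)
  then show ?case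
    using measurable_compose_countable[of "\<lambda>i \<omega>. i + ival (S \<omega>) f" tape "count_space UNIV" "\<lambda>\<omega>. ival (S \<omega>) e"]
      measurable_compose[of "\<lambda>\<omega>. ival (S \<omega>) f" tape "count_space UNIV" "\<lambda>x. i + x" "count_space UNIV" for i]
    by simp
next
  case (IMinus e f)
  then show ?case
    using measurable_compose_countable[of "\<lambda>i \<omega>. i - ival (S \<omega>) f" tape "count_space UNIV" "\<lambda>\<omega>. ival (S \<omega>) e"]
      measurable_compose[of "\<lambda>\<omega>. ival (S \<omega>) f" tape "count_space UNIV" "\<lambda>x. i - x" "count_space UNIV" for i]
    by simp
qed simp

lemma rval_measurable: "mstate S \<Longrightarrow> (\<lambda>\<omega>. rval (S \<omega>) p) \<in> borel_measurable tape"
proof (induction p)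
  case (Cell a e f)
  have "(\<lambda>\<omega>. reg (S \<omega>) a i (ival (S \<omega>) f)) \<in> borel_measurable tape" for i
    by (rule measurable_compose_countable[OF mstateD(2)[OF Cell] ival_measurable[OF Cell]])
  then show ?case
    using measurable_compose_countable[OF _ ival_measurable[OF Cell, of e], of "\<lambda>i \<omega>. reg (S \<omega>) a i (ival (S \<omega>) f)" borel] by simp
next
  case (OfNat e)
  then show ?case using measurable_compose[OF ival_measurable[OF OfNat, of e], of real borel] by simp
next
  case (Sqrt p)
  then show ?case using borel_measurable_sqrt by (auto intro: measurable_compose)
qed simp_all

lemma bval_measurable: "mstate S \<Longrightarrow> Measurable.pred tape (\<lambda>\<omega>. bval (S \<omega>) g)"
proof (induction g)
  case (ILess e f)
  \<comment> \<open>The comparison of natural numbers is reduced to that of real numbers.\<close>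
  have "Measurable.pred tape (\<lambda>\<omega>. rval (S \<omega>) (OfNat e) < rval (S \<omega>) (OfNat f))"
    using rval_measurable[OF ILess] by measurable
  then show ?case by simp
next
  case (RLess p q)
  then show ?case using rval_measurable[OF RLess, of p] rval_measurable[OF RLess, of q] by simp
qed simp_all

lemma mstate_If:
  assumes "Measurable.pred tape P" "mstate S" "mstate S'"
  shows "mstate (\<lambda>\<omega>. if P \<omega> then S \<omega> else S' \<omega>)"
proof -
  have d: "F (if b then x else y) = (if b then F x else F y)" for F :: "state \<Rightarrow> 'x" and b x y by simp
  show ?thesis
    unfolding mstate_def d[of idx] d[of reg] d[of draws] d[of steps] d[of bases_reported]
    using assms(1) mstateD[OF assms(2)] mstateD[OF assms(3)]
    by (auto simp: if_distribR intro!: measurable_If)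
qed

lemma mstate_tick: "mstate S \<Longrightarrow> mstate (\<lambda>\<omega>. tick k (S \<omega>))"
  unfolding mstate_def by (auto simp: bases_reported_def intro: measurable_compose[where g="\<lambda>x. x + k"])

lemma mstate_next_draw: "mstate S \<Longrightarrow> mstate (\<lambda>\<omega>. next_draw (S \<omega>))"
  unfolding mstate_def by (auto simp: bases_reported_def intro: measurable_compose[where g=Suc])

lemma mstate_report: "mstate S \<Longrightarrow> mstate (\<lambda>\<omega>. report (Basis (B \<omega>)) (S \<omega>))"
  "mstate S \<Longrightarrow> mstate (\<lambda>\<omega>. report (Segment (F \<omega>) (x \<omega>) (y \<omega>)) (S \<omega>))"
  unfolding mstate_def by (auto simp: bases_reported_def intro: measurable_compose[where g=Suc])

lemma mstate_set_idx:
  assumes S: "mstate S" and i: "i \<in> tape \<rightarrow>\<^sub>M count_space UNIV" and k: "k \<in> tape \<rightarrow>\<^sub>M count_space UNIV"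
  shows "mstate (\<lambda>\<omega>. set_idx a (i \<omega>) (k \<omega>) (S \<omega>))"
proof -
  have "(\<lambda>\<omega>. idx (set_idx a (i \<omega>) (k \<omega>) (S \<omega>)) a' i') \<in> tape \<rightarrow>\<^sub>M count_space UNIV" for a' i'
  proof -
    have "Measurable.pred tape (\<lambda>\<omega>. i' = i \<omega>)"
      using measurable_compose[OF i, of "\<lambda>x. i' = x" "count_space UNIV"] by simp
    then have P: "Measurable.pred tape (\<lambda>\<omega>. a' = a \<and> i' = i \<omega>)" by (cases "a' = a") simp_all
    have "(\<lambda>\<omega>. if a' = a \<and> i' = i \<omega> then k \<omega> else idx (S \<omega>) a' i') \<in> tape \<rightarrow>\<^sub>M count_space UNIV"
      by (rule measurable_If[OF k mstateD(1)[OF S] predE[OF P]])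
    moreover have "(\<lambda>\<omega>. idx (set_idx a (i \<omega>) (k \<omega>) (S \<omega>)) a' i') = (\<lambda>\<omega>. if a' = a \<and> i' = i \<omega> then k \<omega> else idx (S \<omega>) a' i')"
      by auto
    ultimately show ?thesis by simp
  qed
  then show ?thesis using S unfolding mstate_def by (simp add: bases_reported_def)
qed

lemma mstate_set_reg:
  assumes S: "mstate S" and i: "i \<in> tape \<rightarrow>\<^sub>M count_space UNIV" and k: "k \<in> tape \<rightarrow>\<^sub>M count_space UNIV"
    and x: "x \<in> borel_measurable tape"
  shows "mstate (\<lambda>\<omega>. set_reg a (i \<omega>) (k \<omega>) (x \<omega>) (S \<omega>))"
proof -
  have "(\<lambda>\<omega>. reg (set_reg a (i \<omega>) (k \<omega>) (x \<omega>) (S \<omega>)) a' i' k') \<in> borel_measurable tape" for a' i' k'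
  proof -
    have "Measurable.pred tape (\<lambda>\<omega>. i' = i \<omega>)" "Measurable.pred tape (\<lambda>\<omega>. k' = k \<omega>)"
      using measurable_compose[OF i, of "\<lambda>x. i' = x" "count_space UNIV"]
        measurable_compose[OF k, of "\<lambda>x. k' = x" "count_space UNIV"] by simp_all
    then have "Measurable.pred tape (\<lambda>\<omega>. i' = i \<omega> \<and> k' = k \<omega>)" by (intro pred_intros_logic)
    then have P: "Measurable.pred tape (\<lambda>\<omega>. a' = a \<and> i' = i \<omega> \<and> k' = k \<omega>)"
      by (cases "a' = a") simp_all
    have "(\<lambda>\<omega>. if a' = a \<and> i' = i \<omega> \<and> k' = k \<omega> then x \<omega> else reg (S \<omega>) a' i' k') \<in> borel_measurable tape"
      by (rule measurable_If[OF x mstateD(2)[OF S] predE[OF P]])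
    moreover have "(\<lambda>\<omega>. reg (set_reg a (i \<omega>) (k \<omega>) (x \<omega>) (S \<omega>)) a' i' k')
        = (\<lambda>\<omega>. if a' = a \<and> i' = i \<omega> \<and> k' = k \<omega> then x \<omega> else reg (S \<omega>) a' i' k')"
      by auto
    ultimately show ?thesis by simp
  qed
  then show ?thesis using S unfolding mstate_def by (simp add: bases_reported_def)
qed

lemma run_measurable:
  "mstate S \<Longrightarrow> Measurable.pred tape (\<lambda>\<omega>. fst (run n \<omega> k p (S \<omega>))) \<and> mstate (\<lambda>\<omega>. snd (run n \<omega> k p (S \<omega>)))"
proof (induction k arbitrary: p S)
  case (Suc k)
  note S = Suc.prems and iv = ival_measurable[OF Suc.prems] and rv = rval_measurable[OF Suc.prems]
    and bv = bval_measurable[OF Suc.prems]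
  have If: "Measurable.pred tape (\<lambda>\<omega>. fst (if P \<omega> then F \<omega> else G \<omega>)) \<and> mstate (\<lambda>\<omega>. snd (if P \<omega> then F \<omega> else G \<omega>))"
    if "Measurable.pred tape P" "Measurable.pred tape (\<lambda>\<omega>. fst (F \<omega>)) \<and> mstate (\<lambda>\<omega>. snd (F \<omega>))"
      "Measurable.pred tape (\<lambda>\<omega>. fst (G \<omega>)) \<and> mstate (\<lambda>\<omega>. snd (G \<omega>))" for P and F G :: "_ \<Rightarrow> bool \<times> state"
  proof -
    have "(\<lambda>\<omega>. snd (if P \<omega> then F \<omega> else G \<omega>)) = (\<lambda>\<omega>. if P \<omega> then snd (F \<omega>) else snd (G \<omega>))" by auto
    moreover have "(\<lambda>\<omega>. fst (if P \<omega> then F \<omega> else G \<omega>)) = (\<lambda>\<omega>. if P \<omega> then fst (F \<omega>) else fst (G \<omega>))" by auto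
    ultimately show ?thesis using that mstate_If[of P] by (auto intro!: measurable_If)
  qed
  show ?case
  proof (cases p)
    case Skip then show ?thesis using S by simp
  next
    case (IAssign a e f)
    then show ?thesis by (auto intro!: mstate_tick mstate_set_idx S iv)
  next
    case (RAssign a e f p)
    then show ?thesis by (auto intro!: mstate_tick mstate_set_reg S iv rv)
  next
    case (DrawNormal a e f)
    have "(\<lambda>\<omega>. fst (\<omega> (draws (S \<omega>)))) \<in> borel_measurable tape"
      by (rule measurable_compose_countable[OF fst_tape_measurable mstateD(3)[OF S]])
    with DrawNormal show ?thesis by (auto intro!: mstate_tick mstate_next_draw mstate_set_reg S iv)
  next
    case (DrawExponential a e f)
    have "(\<lambda>\<omega>. snd (\<omega> (draws (S \<omega>)))) \<in> borel_measurable tape"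
      by (rule measurable_compose_countable[OF snd_tape_measurable mstateD(3)[OF S]])
    with DrawExponential show ?thesis by (auto intro!: mstate_tick mstate_next_draw mstate_set_reg S iv)
  next
    case (Seq p q)
    note p = Suc.IH[OF S, of p]
    show ?thesis unfolding Seq run.simps using p Suc.IH[of _ q] S by (intro If) auto
  next
    case (Cond g p q)
    show ?thesis unfolding Cond run.simps using bv Suc.IH mstate_tick[OF S] by (intro If) auto
  next
    case (While g p)
    note p = Suc.IH[OF mstate_tick[OF S], of p]
    show ?thesis unfolding While run.simps
      using bv p Suc.IH[of _ "While g p"] S mstate_tick[OF S] by (intro If) auto
  next
    case (ReportBasis a) then show ?thesis by (auto intro!: mstate_report mstate_tick S)
  next
    case (ReportSegment a e i j) then show ?thesis by (auto intro!: mstate_report mstate_tick S)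
  qed
qed simp

text \<open>The least sufficient fuel is a measurable natural number, and inserting it as the fuel
  preserves measurability because there are countably many values. For a tape without a halting run,
  the fuel is unspecified.\<close>

lemma final_state_measurable:
  obtains final where "mstate final" "\<And>\<omega> s'. exec n \<omega> p s0 s' \<Longrightarrow> final \<omega> = s'"
proof -
  define halts where "halts = (\<lambda>\<omega> k. fst (run n \<omega> k p s0))"
  define final where "final = (\<lambda>\<omega>. snd (run n \<omega> (LEAST k. halts \<omega> k) p s0))"
  have s0: "mstate (\<lambda>_. s0)" by (simp add: mstate_def)
  note m = run_measurable[OF s0, of n _ p]
  have [measurable]: "Measurable.pred tape (\<lambda>\<omega>. halts \<omega> k)" for k using m by (simp add: halts_def)
  have L: "(\<lambda>\<omega>. LEAST k. halts \<omega> k) \<in> tape \<rightarrow>\<^sub>M count_space UNIV" by measurable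
  have d: "(\<lambda>\<omega>. idx (final \<omega>) a i) \<in> tape \<rightarrow>\<^sub>M count_space UNIV" "(\<lambda>\<omega>. reg (final \<omega>) a i j) \<in> borel_measurable tape"
    "(\<lambda>\<omega>. draws (final \<omega>)) \<in> tape \<rightarrow>\<^sub>M count_space UNIV" "(\<lambda>\<omega>. steps (final \<omega>)) \<in> tape \<rightarrow>\<^sub>M count_space UNIV"
    "(\<lambda>\<omega>. bases_reported (final \<omega>)) \<in> tape \<rightarrow>\<^sub>M count_space UNIV" for a i j
    unfolding final_def by (rule measurable_compose_countable[OF mstateD(1)[OF conjunct2[OF m]] L]
      measurable_compose_countable[OF mstateD(2)[OF conjunct2[OF m]] L]
      measurable_compose_countable[OF mstateD(3)[OF conjunct2[OF m]] L]
      measurable_compose_countable[OF mstateD(4)[OF conjunct2[OF m]] L]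
      measurable_compose_countable[OF mstateD(5)[OF conjunct2[OF m]] L])+
  have "mstate final" unfolding mstate_def using d by blast
  moreover have "final \<omega> = s'" if ex: "exec n \<omega> p s0 s'" for \<omega> s'
  proof -
    obtain k where "run n \<omega> k p s0 = (True, s')" using run_complete[OF ex] by blast
    then have "halts \<omega> k" by (simp add: halts_def)
    then have "halts \<omega> (LEAST k. halts \<omega> k)" by (rule LeastI)
    then have "exec n \<omega> p s0 (final \<omega>)" unfolding final_def halts_def by (rule run_sound)
    then show ?thesis using exec_deterministic[OF ex] by blast
  qed
  ultimately show thesis by (rule that)
qed

text \<open>The start basis must not depend on the tape: the first objective and the set of
  unperturbed rows are defined from it, while the Gaussian estimate is for fixed objectives. It is
  therefore found by commands that make no draws.\<close>

fun draw_free :: "com \<Rightarrow> bool" where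
  "draw_free (DrawNormal a e f) = False"
| "draw_free (DrawExponential a e f) = False"
| "draw_free (Seq p q) = (draw_free p \<and> draw_free q)"
| "draw_free (Cond g p q) = (draw_free p \<and> draw_free q)"
| "draw_free (While g p) = draw_free p"
| "draw_free _ = True"

lemma draw_free_exec: "exec n \<omega> p s s' \<Longrightarrow> draw_free p \<Longrightarrow> exec n \<omega>' p s s'"
  by (induction rule: exec.induct) (simp_all only: draw_free.simps, (blast intro: exec.intros)+)


section \<open>Genericity of the random draws\<close>

text \<open>Fubini in a coordinate with nonzero coefficient: for fixed values of the others the form
  vanishes at a single value, which has probability zero.\<close>

lemma AE_PiM_linear_ne:
  fixes M :: "'i \<Rightarrow> real measure"
  assumes M: "\<And>i. prob_space (M i)" "\<And>i. sets (M i) = sets borel" "\<And>i y. emeasure (M i) {y} = 0"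
    and I: "finite I" "i \<in> I" "c i \<noteq> 0"
  shows "AE x in Pi\<^sub>M I M. (\<Sum>l\<in>I. c l * x l) \<noteq> 0"
proof -
  interpret product_prob_space M I
    unfolding product_prob_space_def product_prob_space_axioms_def product_sigma_finite_def
    using M(1) by (auto simp: prob_space_imp_sigma_finite)
  define J where "J = I - {i}"
  have J: "finite J" "i \<notin> J" "I = insert i J" using I by (auto simp: J_def)
  have cm: "(\<lambda>x. x l) \<in> borel_measurable (Pi\<^sub>M I M)" if "l \<in> I" for l
    using measurable_component_singleton[OF that, of M] by (simp add: measurable_cong_sets[OF refl M(2)])
  have [measurable]: "(\<lambda>x. \<Sum>l\<in>I. c l * x l) \<in> borel_measurable (Pi\<^sub>M I M)"
    by (intro borel_measurable_sum borel_measurable_times borel_measurable_const cm)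
  let ?Z = "\<lambda>x. of_bool ((\<Sum>l\<in>I. c l * x l) = 0) :: ennreal"
  have Zm[measurable]: "?Z \<in> borel_measurable (Pi\<^sub>M I M)" by measurable
  have "(\<integral>\<^sup>+x. ?Z x \<partial>Pi\<^sub>M I M) = (\<integral>\<^sup>+x. (\<integral>\<^sup>+y. ?Z (x(i := y)) \<partial>M i) \<partial>Pi\<^sub>M J M)"
    by (rule product_nn_integral_insert[OF J(1,2), of ?Z, folded J(3), OF Zm])
  also have "\<dots> = (\<integral>\<^sup>+x. 0 \<partial>Pi\<^sub>M J M)"
  proof (rule nn_integral_cong)
    fix x
    define y0 where "y0 = - (\<Sum>l\<in>J. c l * x l) / c i"
    have "(\<Sum>l\<in>I. c l * (x(i := y)) l) = c i * y + (\<Sum>l\<in>J. c l * x l)" for y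
      using J by (auto intro!: sum.cong)
    then have "(\<integral>\<^sup>+y. ?Z (x(i := y)) \<partial>M i) = (\<integral>\<^sup>+y. indicator {y0} y \<partial>M i)"
      using I(3) by (intro nn_integral_cong) (auto simp: y0_def field_simps eq_neg_iff_add_eq_0 split: split_indicator)
    also have "\<dots> = 0" using M(2,3) by (subst nn_integral_indicator) auto
    finally show "(\<integral>\<^sup>+y. ?Z (x(i := y)) \<partial>M i) = 0" .
  qed
  finally have "AE x in Pi\<^sub>M I M. ?Z x = 0"
    using nn_integral_0_iff_AE[of ?Z "Pi\<^sub>M I M"] by simp
  then show ?thesis by eventually_elim auto
qed

section \<open>Distribution of the numbers read from the tape\<close>

definition expo :: "real measure" where
  "expo = density lborel (\<lambda>x. ennreal (exponential_density 1 x))"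

lemma sets_expo [measurable_cong, simp]: "sets expo = sets borel"
  by (simp add: expo_def)

lemma space_expo [simp]: "space expo = UNIV"
  by (simp add: expo_def)

interpretation expo: prob_space expo
  unfolding expo_def by (rule prob_space_exponential_density) simp

lemma density_lborel_atomless:
  assumes "f \<in> borel_measurable borel"
  shows "emeasure (density lborel f) {y} = 0"
proof -
  have "emeasure (density lborel f) {y} = (\<integral>\<^sup>+x. f x * indicator {y} x \<partial>lborel)"
    using assms by (intro emeasure_density) auto
  also have "\<dots> = 0" using assms by (subst nn_integral_indicator_singleton) auto
  finally show ?thesis .
qed

lemma AE_expo_pos: "AE x in expo. 0 < x"
proof -
  have "AE x in lborel. x \<noteq> (0::real)" by (rule AE_lborel_singleton)
  then have "AE x in lborel. 0 < ennreal (exponential_density 1 x) \<longrightarrow> 0 < x"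
    by eventually_elim (auto simp: exponential_density_def not_less le_less)
  then show ?thesis unfolding expo_def by (subst AE_density) auto
qed

definition law :: "nat \<Rightarrow> nat \<Rightarrow> real measure" where
  "law n i = (if i < n then gauss else expo)"

lemma law_props [simp]: "prob_space (law n i)" "sets (law n i) = sets borel" "space (law n i) = UNIV"
  "emeasure (law n i) {y} = 0"
  using gauss.prob_space_axioms expo.prob_space_axioms
  by (auto simp: law_def gauss_def expo_def intro!: density_lborel_atomless)

text \<open>The program draws \<open>n\<close> normal variables and then \<open>m\<close>
  exponential ones. Of each cell it reads only one component, and cell \<open>n + i\<close> belongs
  to constraint \<open>i\<close>.\<close>

definition draws_of :: "nat \<Rightarrow> nat \<Rightarrow> (nat \<Rightarrow> real \<times> real) \<Rightarrow> nat \<Rightarrow> real" where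
  "draws_of n m \<omega> = restrict (\<lambda>i. if i < n then fst (\<omega> i) else snd (\<omega> i)) {..<n + m}"

lemma draws_of_measurable [measurable]: "draws_of n m \<in> tape \<rightarrow>\<^sub>M Pi\<^sub>M {..<n + m} (law n)"
  unfolding draws_of_def
proof (rule measurable_restrict)
  fix i
  have "(\<lambda>\<omega>. if i < n then fst (\<omega> i) else snd (\<omega> i)) \<in> borel_measurable tape" by (cases "i < n") simp_all
  then show "(\<lambda>\<omega>. if i < n then fst (\<omega> i) else snd (\<omega> i)) \<in> tape \<rightarrow>\<^sub>M law n i"
    by (simp add: measurable_cong_sets[OF refl law_props(2)])
qed

lemma distr_draws_of: "distr tape (Pi\<^sub>M {..<n + m} (law n)) (draws_of n m) = Pi\<^sub>M {..<n + m} (law n)"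
proof -
  let ?D = "gauss \<Otimes>\<^sub>M expo"
  interpret D: pair_prob_space gauss expo ..
  interpret T: product_prob_space "\<lambda>_::nat. ?D" UNIV ..
  have tape: "tape = Pi\<^sub>M UNIV (\<lambda>_. ?D)" by (simp add: tape_def gauss_def expo_def)
  interpret L: product_prob_space "law n" "{..<n + m}"
    unfolding product_prob_space_def product_prob_space_axioms_def product_sigma_finite_def
    by (auto simp: prob_space_imp_sigma_finite)
  show ?thesis
  proof (rule L.PiM_eqI)
    fix A assume A: "\<And>i. i \<in> {..<n + m} \<Longrightarrow> A i \<in> sets (law n i)"
    define E where "E = (\<lambda>i. if i < n then A i \<times> UNIV else UNIV \<times> A i)"
    have E: "E i \<in> sets ?D" if "i \<in> {..<n + m}" for i
      using A[OF that] by (auto simp: E_def law_def intro!: pair_measureI)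
    have mE: "emeasure ?D (E i) = emeasure (law n i) (A i)" if "i \<in> {..<n + m}" for i
      using A[OF that] gauss.emeasure_space_1 expo.emeasure_space_1
      by (auto simp: E_def law_def expo.emeasure_pair_measure_Times)
    have "emeasure (distr tape (Pi\<^sub>M {..<n + m} (law n)) (draws_of n m)) (Pi\<^sub>E {..<n + m} A)
        = emeasure tape (draws_of n m -` Pi\<^sub>E {..<n + m} A \<inter> space tape)"
      using A by (intro emeasure_distr sets_PiM_I_finite) auto
    also have "draws_of n m -` Pi\<^sub>E {..<n + m} A \<inter> space tape = prod_emb UNIV (\<lambda>_. ?D) {..<n + m} (Pi\<^sub>E {..<n + m} E)"
      by (auto simp: draws_of_def prod_emb_def tape space_PiM PiE_iff E_def space_pair_measure mem_Times_iff split: if_splits)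
    also have "emeasure tape \<dots> = (\<Prod>i\<in>{..<n + m}. emeasure ?D (E i))"
      unfolding tape using E by (intro T.emeasure_PiM_emb) auto
    also have "\<dots> = (\<Prod>i\<in>{..<n + m}. emeasure (law n i) (A i))"
      by (intro prod.cong refl mE)
    finally show "emeasure (distr tape (Pi\<^sub>M {..<n + m} (law n)) (draws_of n m)) (Pi\<^sub>E {..<n + m} A)
      = (\<Prod>i\<in>{..<n + m}. emeasure (law n i) (A i))" .
  qed simp_all
qed

lemma AE_tape:
  assumes "AE y in Pi\<^sub>M {..<n + m} (law n). P y"
  shows "AE \<omega> in tape. P (draws_of n m \<omega>)"
proof -
  have "AE y in distr tape (Pi\<^sub>M {..<n + m} (law n)) (draws_of n m). P y"
    unfolding distr_draws_of by (rule assms)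
  then show ?thesis by (rule AE_distrD[OF draws_of_measurable])
qed

text \<open>The exponential variables form the outer integral: once they are fixed, so is the fan,
  and the estimate for Gaussian directions applies to the inner one.\<close>

lemma nn_integral_tape:
  assumes f: "f \<in> borel_measurable (Pi\<^sub>M {..<n + m} (law n))"
  shows "(\<integral>\<^sup>+\<omega>. f (draws_of n m \<omega>) \<partial>tape)
    = (\<integral>\<^sup>+y. (\<integral>\<^sup>+x. f (merge {n..<n + m} {..<n} (y, x)) \<partial>gaussn n) \<partial>Pi\<^sub>M {n..<n + m} (law n))"
proof -
  interpret L: product_sigma_finite "law n"
    unfolding product_sigma_finite_def by (auto simp: prob_space_imp_sigma_finite)
  have U: "{n..<n + m} \<union> {..<n} = {..<n + m}" by auto
  have g: "Pi\<^sub>M {..<n} (law n) = gaussn n" unfolding gaussn_def by (rule PiM_cong) (auto simp: law_def)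
  have "(\<integral>\<^sup>+\<omega>. f (draws_of n m \<omega>) \<partial>tape) = (\<integral>\<^sup>+y. f y \<partial>distr tape (Pi\<^sub>M {..<n + m} (law n)) (draws_of n m))"
    using f by (intro nn_integral_distr[symmetric]) auto
  also have "\<dots> = (\<integral>\<^sup>+y. f y \<partial>Pi\<^sub>M {..<n + m} (law n))" unfolding distr_draws_of ..
  also have "\<dots> = (\<integral>\<^sup>+y. (\<integral>\<^sup>+x. f (merge {n..<n + m} {..<n} (y, x)) \<partial>Pi\<^sub>M {..<n} (law n)) \<partial>Pi\<^sub>M {n..<n + m} (law n))"
    unfolding U[symmetric] using f by (intro L.product_nn_integral_fold) (auto simp: U)
  finally show ?thesis by (simp add: g)
qed

text \<open>Quantifies over all bases and not only over those of the fan, because the fan itself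
  depends on the random perturbation.\<close>

definition generic_direction :: "nat \<Rightarrow> nat \<Rightarrow> (nat \<Rightarrow> nat \<Rightarrow> real) \<Rightarrow> (nat \<Rightarrow> real) \<Rightarrow> (nat \<Rightarrow> real) \<Rightarrow> bool" where
  "generic_direction n m a e x \<longleftrightarrow> (\<forall>B\<subseteq>{..<m}. (\<exists>u. dual_basis n a B u) \<longrightarrow>
     (let co = \<lambda>j. ip n (dual_of n a B j) in (\<forall>j\<in>B. co j x \<noteq> 0) \<and>
       (\<forall>i\<in>B. \<forall>j\<in>B. i \<noteq> j \<longrightarrow> co i x * co j e = co j x * co i e \<longrightarrow> co i e = 0 \<and> co j e = 0)))"

lemma AE_ip_ne:
  assumes "finite I" "{..<n} \<subseteq> I" "ip n z y \<noteq> 0"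
  shows "AE x in Pi\<^sub>M I (law n'). ip n z x \<noteq> 0"
proof -
  obtain l where l: "l < n" "z l \<noteq> 0"
    using assms(3) unfolding ip_def by (metis (no_types, lifting) lessThan_iff mult_zero_left sum.neutral)
  have eq: "ip n z x = (\<Sum>l\<in>I. (if l < n then z l else 0) * x l)" for x
    unfolding ip_def using assms(1,2) by (intro sum.mono_neutral_cong_left) auto
  have "l \<in> I" using l assms(2) by auto
  show ?thesis
    unfolding eq by (rule AE_PiM_linear_ne[OF law_props(1,2,4) assms(1) \<open>l \<in> I\<close>]) (use l in simp)
qed

text \<open>Every condition follows from the nonvanishing of a linear form. For a pair
  \<open>i\<close>, \<open>j\<close> this form is \<open>z\<close>; it is not identically zero
  because its values at \<open>a i\<close> and \<open>a j\<close> are, up to sign, the coordinates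
  of \<open>e\<close> at \<open>j\<close> and \<open>i\<close>.\<close>

lemma AE_generic_direction:
  assumes I: "finite I" "{..<n} \<subseteq> I"
  shows "AE x in Pi\<^sub>M I (law n'). generic_direction n m a e x"
proof -
  have one: "AE x in Pi\<^sub>M I (law n'). (let co = \<lambda>j. ip n (dual_of n a B j) in (\<forall>j\<in>B. co j x \<noteq> 0) \<and>
       (\<forall>i\<in>B. \<forall>j\<in>B. i \<noteq> j \<longrightarrow> co i x * co j e = co j x * co i e \<longrightarrow> co i e = 0 \<and> co j e = 0))"
    if "dual_basis n a B u" for B u
  proof -
    let ?co = "\<lambda>j. ip n (dual_of n a B j)"
    have d: "dual_basis n a B (dual_of n a B)" by (rule dual_of[OF that])
    have fin: "finite B" by (rule dual_basisD(1)[OF d])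
    have bi: "?co j (a i) = (if i = j then 1 else 0)" if "i \<in> B" "j \<in> B" for i j by (rule dual_basisD(3)[OF d that])
    have 1: "AE x in Pi\<^sub>M I (law n'). ?co j x \<noteq> 0" if "j \<in> B" for j
      using bi[OF that that] by (intro AE_ip_ne[OF I, of _ "a j"]) simp
    have 2: "AE x in Pi\<^sub>M I (law n'). i \<noteq> j \<longrightarrow> ?co i x * ?co j e = ?co j x * ?co i e \<longrightarrow> ?co i e = 0 \<and> ?co j e = 0"
      if i: "i \<in> B" and j: "j \<in> B" for i j
    proof (cases "i = j \<or> (?co i e = 0 \<and> ?co j e = 0)")
      case False
      define z where "z = (\<lambda>l. ?co j e * dual_of n a B i l - ?co i e * dual_of n a B j l)"
      have z: "ip n z y = ?co j e * ?co i y - ?co i e * ?co j y" for y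
        by (simp add: z_def ip_diff_left ip_scale_left)
      have "ip n z (a i) = ?co j e" "ip n z (a j) = - ?co i e"
        using bi[OF i i] bi[OF i j] bi[OF j i] bi[OF j j] False by (auto simp: z)
      then have "\<exists>y. ip n z y \<noteq> 0" using False by (metis neg_equal_0_iff_equal)
      then have "AE x in Pi\<^sub>M I (law n'). ip n z x \<noteq> 0" using AE_ip_ne[OF I] by blast
      then show ?thesis by eventually_elim (auto simp: z mult.commute)
    qed auto
    show ?thesis unfolding Let_def using fin 1 2 by (intro AE_conjI AE_finite_allI) auto
  qed
  have "AE x in Pi\<^sub>M I (law n'). \<forall>B\<in>Pow {..<m}. (\<exists>u. dual_basis n a B u) \<longrightarrow>
     (let co = \<lambda>j. ip n (dual_of n a B j) in (\<forall>j\<in>B. co j x \<noteq> 0) \<and>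
       (\<forall>i\<in>B. \<forall>j\<in>B. i \<noteq> j \<longrightarrow> co i x * co j e = co j x * co i e \<longrightarrow> co i e = 0 \<and> co j e = 0))"
  proof (intro AE_finite_allI)
    fix B
    show "AE x in Pi\<^sub>M I (law n'). (\<exists>u. dual_basis n a B u) \<longrightarrow>
     (let co = \<lambda>j. ip n (dual_of n a B j) in (\<forall>j\<in>B. co j x \<noteq> 0) \<and>
       (\<forall>i\<in>B. \<forall>j\<in>B. i \<noteq> j \<longrightarrow> co i x * co j e = co j x * co i e \<longrightarrow> co i e = 0 \<and> co j e = 0))"
      using one[of B] by (cases "\<exists>u. dual_basis n a B u") auto
  qed simp
  then show ?thesis by eventually_elim (auto simp: generic_direction_def)
qed

definition pert :: "nat set \<Rightarrow> nat \<Rightarrow> (nat \<Rightarrow> real) \<Rightarrow> nat \<Rightarrow> real" where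
  "pert B0 n y i = (if i \<in> B0 then 0 else y (n + i))"

text \<open>The slack is a linear form in the draws with coefficients \<open>c\<close>. For
  \<open>k\<close> outside \<open>B0\<close> the coefficient at \<open>k\<close> is 1. If
  \<open>k\<close> is in \<open>B0\<close> and all coefficients vanished, \<open>a k\<close> would
  be a combination of rows of \<open>B0\<close> other than itself, which \<open>u0\<close>
  refutes.\<close>

lemma AE_generic_pert:
  assumes I: "finite I" "{n'..<n' + m} \<subseteq> I" and B0: "B0 \<subseteq> {..<m}" "dual_basis n a B0 u0"
  shows "AE y in Pi\<^sub>M I (law n'). generic_rhs n m a (pert B0 n' y)"
proof -
  have one: "AE y in Pi\<^sub>M I (law n'). slack n a (pert B0 n' y) B k \<noteq> 0"
    if B: "B \<subseteq> {..<m}" "dual_basis n a B u" and k: "k < m" "k \<notin> B" for B u k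
  proof -
    let ?v = "dual_of n a B"
    have dv: "dual_basis n a B ?v" by (rule dual_of[OF B(2)])
    define c where "c = (\<lambda>i. if i \<in> B0 then 0 else (if i = k then 1 else 0) - (if i \<in> B then ip n (?v i) (a k) else 0))"
    have eq: "slack n a (pert B0 n' y) B k = (\<Sum>l\<in>I. (if l \<in> {n'..<n' + m} then c (l - n') else 0) * y l)" for y
    proof -
      have "(\<Sum>l\<in>I. (if l \<in> {n'..<n' + m} then c (l - n') else 0) * y l) = (\<Sum>l\<in>{n'..<n' + m}. c (l - n') * y l)"
        using I by (intro sum.mono_neutral_cong_right) auto
      also have "\<dots> = (\<Sum>i<m. c i * y (n' + i))"
        using sum.shift_bounds_nat_ivl[of "\<lambda>l. c (l - n') * y l" 0 n' m] by (simp add: atLeast0LessThan add.commute)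
      also have "\<dots> = (\<Sum>i<m. (if i = k then pert B0 n' y i else 0)) -
          (\<Sum>i<m. (if i \<in> B then ip n (?v i) (a k) * pert B0 n' y i else 0))"
        unfolding sum_subtractf[symmetric] by (intro sum.cong) (auto simp: c_def pert_def algebra_simps)
      also have "(\<Sum>i<m. (if i \<in> B then ip n (?v i) (a k) * pert B0 n' y i else 0))
          = (\<Sum>i\<in>B. ip n (?v i) (a k) * pert B0 n' y i)"
        using B(1) by (subst sum.inter_restrict[symmetric]) (auto simp: Int_absorb1)
      finally show ?thesis using k by (simp add: slack_def)
    qed
    have "\<exists>i<m. c i \<noteq> 0"
    proof (cases "k \<in> B0")
      case False
      then show ?thesis using k by (intro exI[of _ k]) (simp add: c_def)
    next
      case True
      show ?thesis
      proof (rule ccontr)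
        assume no: "\<not> (\<exists>i<m. c i \<noteq> 0)"
        have z: "ip n (?v i) (a k) = 0" if "i \<in> B" "i \<notin> B0" for i
        proof -
          have "i < m" "i \<noteq> k" using that B(1) k by auto
          then have "c i = 0" using no by blast
          then show ?thesis using that \<open>i \<noteq> k\<close> by (simp add: c_def)
        qed
        have "ip n (u0 k) (a k) = (\<Sum>i\<in>B. ip n (?v i) (a k) * ip n (u0 k) (a i))"
          by (rule dual_basis_expand_right[OF dv])
        also have "\<dots> = 0"
        proof (rule sum.neutral, rule ballI)
          fix i assume i: "i \<in> B"
          show "ip n (?v i) (a k) * ip n (u0 k) (a i) = 0"
          proof (cases "i \<in> B0")
            case True
            then have "ip n (u0 k) (a i) = 0" using dual_basisD(3)[OF B0(2) True \<open>k \<in> B0\<close>] i k by auto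
            then show ?thesis by simp
          qed (simp add: z[OF i])
        qed
        finally show False using dual_basisD(3)[OF B0(2) True True] by simp
      qed
    qed
    then obtain i where i: "i < m" "c i \<noteq> 0" by blast
    then have "n' + i \<in> I" using I(2) by auto
    then show ?thesis
      unfolding eq by (rule AE_PiM_linear_ne[OF law_props(1,2,4) I(1)]) (use i in simp)
  qed
  have "AE y in Pi\<^sub>M I (law n'). \<forall>B\<in>Pow {..<m}. \<forall>k\<in>{..<m}. (\<exists>u. dual_basis n a B u) \<longrightarrow> k \<notin> B \<longrightarrow>
      slack n a (pert B0 n' y) B k \<noteq> 0"
  proof (intro AE_finite_allI)
    fix B k assume "B \<in> Pow {..<m}" "k \<in> {..<m}"
    then show "AE y in Pi\<^sub>M I (law n'). (\<exists>u. dual_basis n a B u) \<longrightarrow> k \<notin> B \<longrightarrow>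
      slack n a (pert B0 n' y) B k \<noteq> 0"
      using one[of B _ k] by (cases "(\<exists>u. dual_basis n a B u) \<and> k \<notin> B") auto
  qed auto
  then show ?thesis by eventually_elim (auto simp: generic_rhs_def)
qed

lemma AE_pert_pos:
  assumes "finite I" "{n..<n + m} \<subseteq> I"
  shows "AE y in Pi\<^sub>M I (law n). \<forall>i<m. 0 < y (n + i)"
proof -
  interpret product_prob_space "law n" I
    unfolding product_prob_space_def product_prob_space_axioms_def product_sigma_finite_def
    by (auto simp: prob_space_imp_sigma_finite)
  have "AE y in Pi\<^sub>M I (law n). 0 < y (n + i)" if "i < m" for i
  proof -
    have law: "law n (n + i) = expo" by (simp add: law_def)
    have d: "distr (Pi\<^sub>M I (law n)) (law n (n + i)) (\<lambda>y. y (n + i)) = law n (n + i)"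
      using that assms by (intro PiM_component) auto
    have mm: "(\<lambda>y. y (n + i)) \<in> Pi\<^sub>M I (law n) \<rightarrow>\<^sub>M law n (n + i)"
      by (rule measurable_component_singleton) (use that assms in auto)
    have "AE x in distr (Pi\<^sub>M I (law n)) (law n (n + i)) (\<lambda>y. y (n + i)). 0 < x"
      unfolding d unfolding law by (rule AE_expo_pos)
    then show ?thesis by (rule AE_distrD[OF mm])
  qed
  then have "AE y in Pi\<^sub>M I (law n). \<forall>i\<in>{..<m}. 0 < y (n + i)" by (intro AE_finite_allI) auto
  then show ?thesis by eventually_elim auto
qed


section \<open>The program\<close>

definition Prelude :: com where
  "Prelude = Seq LoadConstraints (Seq LoadUnits StartBasis)"

abbreviation xE :: iexp where "xE \<equiv> IPlus mE nE"
abbreviation cE :: iexp where "cE \<equiv> IPlus xE (Lit 1)"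
abbreviation dE :: iexp where "dE \<equiv> IPlus xE (Lit 2)"

definition Randomize :: com where
  "Randomize = Seq DrawDirection (Seq DrawPerturbation (Seq ClearPerturbation (Seq SumRows
     (Seq (LoadRow xE 8) (Seq (LoadRow cE 2) (LoadRow dE 7))))))"

text \<open>The residual of \<open>b\<close> on a unit vector is 0 minus the corresponding
  coordinate of the basic solution, hence the change of sign.\<close>

definition Output :: com where
  "Output = For 2 nE (RAssign 5 (Lit 0) (vr 2) (negE (Cell 6 (IPlus mE (vr 2)) nE)))"

definition Legs :: com where
  "Legs = Seq (ReportBasis 1) (Seq (ReportSegment 1 (Lit 0) 7 8) (Seq (Leg dE xE)
     (Seq (ReportSegment 1 (Lit 0) 8 2) (Leg xE cE))))"

definition Shadow :: com where
  "Shadow = Seq Prelude (Seq Randomize (Seq Legs Output))"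

lemma ht_Output:
  fixes s0 :: state
  defines "m \<equiv> idx s0 0 0" and "n \<equiv> idx s0 0 1"
  shows "ht d \<omega> (\<lambda>s. s = s0) Output (3 + (n + 1) * 40)
    (\<lambda>s. frame {5} s s0 \<and> (\<forall>l<n. reg s 5 0 l = - reg s0 6 (m + l) n))"
proof -
  have fr [simp]: "idx s 0 0 = m" "idx s 0 (Suc 0) = n" if "frame {5} s s0" for s
    using that by (simp_all add: frame_def m_def n_def)
  have r6: "reg s 6 = reg s0 6" if "frame {5} s s0" for s
    using that by (simp add: frame_def)
  show ?thesis
    unfolding Output_def
  proof (rule ht_For[where N=n and c=25 and I="\<lambda>i s. frame {5} s s0 \<and> idx s 2 0 = i \<and>
        (\<forall>l<i. reg s 5 0 l = - reg s0 6 (m + l) n)"])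
    fix i
    show "ht d \<omega> (\<lambda>s. frame {5} s s0 \<and> idx s 2 0 = i \<and> (\<forall>l<i. reg s 5 0 l = - reg s0 6 (m + l) n))
      (RAssign 5 (Lit 0) (vr 2) (negE (Cell 6 (IPlus mE (vr 2)) nE))) 25
      (\<lambda>s. (frame {5} (set_idx 2 0 (Suc i) s) s0 \<and> idx (set_idx 2 0 (Suc i) s) 2 0 = Suc i \<and>
        (\<forall>l<Suc i. reg (set_idx 2 0 (Suc i) s) 5 0 l = - reg s0 6 (m + l) n)) \<and> idx s 2 0 = i)"
    proof (rule ht_RAssign)
      fix s assume s: "frame {5} s s0 \<and> idx s 2 0 = i \<and> (\<forall>l<i. reg s 5 0 l = - reg s0 6 (m + l) n)"
      then have v: "rval s (negE (Cell 6 (IPlus mE (vr 2)) nE)) = - reg s0 6 (m + i) n"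
        using r6[of s] by (simp add: negE_def)
      show "(frame {5} (set_idx 2 0 (Suc i) (set_reg 5 (ival s (Lit 0)) (ival s (vr 2)) (rval s (negE (Cell 6 (IPlus mE (vr 2)) nE))) s)) s0 \<and>
        idx (set_idx 2 0 (Suc i) (set_reg 5 (ival s (Lit 0)) (ival s (vr 2)) (rval s (negE (Cell 6 (IPlus mE (vr 2)) nE))) s)) 2 0 = Suc i \<and>
        (\<forall>l<Suc i. reg (set_idx 2 0 (Suc i) (set_reg 5 (ival s (Lit 0)) (ival s (vr 2)) (rval s (negE (Cell 6 (IPlus mE (vr 2)) nE))) s)) 5 0 l
          = - reg s0 6 (m + l) n)) \<and>
        idx (set_reg 5 (ival s (Lit 0)) (ival s (vr 2)) (rval s (negE (Cell 6 (IPlus mE (vr 2)) nE))) s) 2 0 = i"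
        unfolding v using s by (auto simp: less_Suc_eq)
    qed (simp add: negE_def)
  qed (auto simp: algebra_simps)
qed

lemma frame_forget_steps:
  "frame R (forget_steps s) t = frame R s t" "frame R s (forget_steps t) = frame R s t"
  by (simp_all add: frame_def)

lemma ht_ex:
  assumes "ht n \<omega> P p c Q" "P (forget_steps s)"
  shows "\<exists>s'. exec n \<omega> p s s' \<and> Q (forget_steps s') \<and> steps s' \<le> steps s + c"
  using assms unfolding ht_def by blast

lemma draw_free_Prelude: "draw_free Prelude"
  by (simp add: Prelude_def LoadConstraints_def LoadUnits_def StartBasis_def Choose_def Pivot_def For_def)

text \<open>Coordinate form of the geometric hypotheses: \<open>vertex_v\<close> replaces
  extremality of \<open>v\<close> by rigidity, \<open>no_recession\<close> replaces boundedness, and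
  \<open>dist_prop\<close> bounds dual vectors instead of distances. By \<open>b0\<close> the
  artificial rows have right-hand side 0.\<close>

locale instance_data =
  fixes n m :: nat and A :: "nat \<Rightarrow> nat \<Rightarrow> real" and b v c :: "nat \<Rightarrow> real" and \<delta> :: real
  assumes n_pos: "0 < n" and delta_pos: "0 < \<delta>" and b0: "m \<le> i \<Longrightarrow> b i = 0"
    and feas: "r < m \<Longrightarrow> ip n (A r) v \<le> b r"
    and vertex_v: "(\<And>r. r < m \<Longrightarrow> ip n (A r) v = b r \<Longrightarrow> ip n (A r) y = 0) \<Longrightarrow> l < n \<Longrightarrow> y l = 0"
    and no_recession: "(\<And>r. r < m \<Longrightarrow> ip n (A r) y \<le> 0) \<Longrightarrow> l < n \<Longrightarrow> y l = 0"
    and dist_prop: "B \<subseteq> {..<m} \<Longrightarrow> dual_basis n A B u \<Longrightarrow>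
      (\<And>k. k < m \<Longrightarrow> (\<Sum>j\<in>B. ip n (u j) (A k) * b j) \<le> b k) \<Longrightarrow> j \<in> B \<Longrightarrow> nrm n (u j) * nrm n (A j) \<le> 1 / \<delta>"
begin

definition a :: "nat \<Rightarrow> nat \<Rightarrow> real" where
  "a s = (if s < m then A s else (\<lambda>l. if l = s - m then 1 else 0))"

definition z :: "nat \<Rightarrow> real" where "z s = b s - ip n (a s) v"

definition input :: "state \<Rightarrow> bool" where
  "input s \<longleftrightarrow> idx s 0 0 = m \<and> idx s 0 1 = n \<and> reg s 0 = A \<and> reg s 1 0 = b \<and> reg s 2 0 = c \<and> reg s 3 0 = v \<and>
     reg s 6 = (\<lambda>_ _. 0) \<and> (\<forall>l. reg s 7 0 l = 0) \<and> draws s = 0 \<and> steps s = 0 \<and> trace s = []"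

lemma a_constraint: "s < m \<Longrightarrow> a s = A s"
  by (simp add: a_def)

lemma a_unit: "a (m + l) = (\<lambda>l'. if l' = l then 1 else 0)"
  by (simp add: a_def)

lemma ip_unit: "l < n \<Longrightarrow> ip n x (a (m + l)) = x l"
  by (simp add: a_unit ip_def if_distrib cong: if_cong)

definition prelude_cost :: nat where
  "prelude_cost = (3 + (m + 1) * (60 + 2 * (n + 1) * 60)) + ((3 + (n + 1) * 80) +
     (3 + (n + 1) * (100 + (m + 1) * 80 + pivot_cost m n)))"

lemma prelude:
  assumes s0: "input s0"
  obtains s1 u where "\<And>\<omega>. exec n \<omega> Prelude s0 s1" "same s1 s0" "steps s1 \<le> prelude_cost"
    "tableau n (m + n) a (idx s1 1) u (reg s1 6)" "\<And>k. k < n \<Longrightarrow> idx s1 1 k < m" "\<And>k. k < n \<Longrightarrow> z (idx s1 1 k) = 0"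
    "\<And>s. s < m + n \<Longrightarrow> reg s1 6 s n = z s"
proof -
  let ?T0 = "\<lambda>s k. if s < m then constraint_row n A b v s k else 0"
  let ?T1 = "\<lambda>s k. if m \<le> s \<and> s < m + n then unit_row m n v s k else ?T0 s k"
  have mn: "idx s0 0 0 = m" "idx s0 0 1 = n" "reg s0 0 = A" "reg s0 1 0 = b" "reg s0 3 0 = v"
    using s0 by (auto simp: input_def)
  \<comment> \<open>Any tape will do: the prelude makes no draws, so \<open>draw_free_exec\<close>
    transfers the run to all tapes.\<close>
  let ?\<omega> = "\<lambda>_. (0, 0)"
  have h1: "ht n ?\<omega> (\<lambda>s. s = s0) LoadConstraints (3 + (m + 1) * (60 + 2 * (n + 1) * 60)) (\<lambda>s. same s s0 \<and> reg s 6 = ?T0)"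
    using ht_LoadConstraints[of s0 n ?\<omega>, unfolded mn] s0 by (simp add: input_def)
  have h2: "ht n ?\<omega> (\<lambda>s. same s s0 \<and> reg s 6 = ?T0) LoadUnits (3 + (n + 1) * 80)
    (\<lambda>s. same s s0 \<and> (\<forall>k<n. idx s 1 k = m + k) \<and> reg s 6 = ?T1)"
    using ht_LoadUnits[of s0 ?T0 n ?\<omega>, unfolded mn] by simp
  have vx: "y l = 0" if "\<And>r. r < m \<Longrightarrow> z r = 0 \<Longrightarrow> ip n (a r) y = 0" "l < n" for y l
    using vertex_v[of y l] that by (auto simp: z_def a_constraint)
  have h3: "ht n ?\<omega> (\<lambda>s. same s s0 \<and> (\<exists>u. tableau n (m + n) a (idx s 1) u (reg s 6)) \<and> (\<forall>k<n. idx s 1 k = m + k) \<and>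
        (\<forall>s'<m + n. reg s 6 s' n = z s') \<and> (\<forall>s'. reg s 6 s' (n + 1) = 0))
     StartBasis (3 + (n + 1) * (100 + (m + 1) * 80 + pivot_cost m n))
     (\<lambda>s. same s s0 \<and> (\<exists>u. tableau n (m + n) a (idx s 1) u (reg s 6)) \<and> (\<forall>k<n. idx s 1 k < m \<and> z (idx s 1 k) = 0) \<and>
        (\<forall>s'<m + n. reg s 6 s' n = z s'))"
    by (rule ht_StartBasis[of s0 z a n ?\<omega>, unfolded mn]) (rule vx)
  have start: "\<exists>u. tableau n (m + n) a \<beta> u ?T1" if \<beta>: "\<forall>k<n. \<beta> k = m + k" for \<beta>
  proof -
    define u where "u = (\<lambda>i l. if l = i - m then (1::real) else 0)"
    have ipu: "ip n (u (m + k)) y = y k" if "k < n" for k y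
    proof -
      have "ip n (u (m + k)) y = (\<Sum>l<n. if l = k then y l else 0)"
        unfolding ip_def u_def by (intro sum.cong) auto
      then show ?thesis using that by simp
    qed
    have im: "\<beta> ` {..<n} = (\<lambda>k. m + k) ` {..<n}" using \<beta> by (intro image_cong) auto
    have inj: "inj_on (\<lambda>k. m + k) {..<n}" by (simp add: inj_on_def)
    have "dual_basis n a ((\<lambda>k. m + k) ` {..<n}) u"
      unfolding dual_basis_def
    proof (intro conjI allI impI ballI)
      show "card ((\<lambda>k. m + k) ` {..<n}) = n" using card_image[OF inj] by simp
      fix i j assume "i \<in> (\<lambda>k. m + k) ` {..<n}" "j \<in> (\<lambda>k. m + k) ` {..<n}"
      then show "ip n (u j) (a i) = (if i = j then 1 else 0)" by (auto simp: ipu a_unit)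
    next
      fix y :: "nat \<Rightarrow> real" and l assume l: "l < n"
      have "(\<Sum>j\<in>(\<lambda>k. m + k) ` {..<n}. ip n (u j) y * a j l) = (\<Sum>k<n. y k * (if l = k then 1 else 0))"
        by (subst sum.reindex[OF inj]) (simp add: ipu a_unit)
      then show "y l = (\<Sum>j\<in>(\<lambda>k. m + k) ` {..<n}. ip n (u j) y * a j l)" using l by (simp add: if_distrib cong: if_cong)
    qed simp
    moreover have "?T1 s k = ip n (u (\<beta> k)) (a s)" if "s < m + n" "k < n" for s k
      using that \<beta> by (auto simp: ipu constraint_row_def unit_row_def a_def)
    moreover have "inj_on \<beta> {..<n}" using \<beta> by (simp add: inj_on_def)
    ultimately show ?thesis unfolding tableau_def im by blast
  qed
  have slack: "?T1 s n = z s" if "s < m + n" for s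
  proof (cases "s < m")
    case True
    then show ?thesis by (simp add: constraint_row_def z_def a_def ip_def)
  next
    case False
    define l where "l = s - m"
    have "s = m + l" "l < n" using False that by (auto simp: l_def)
    then show ?thesis using ip_unit[of l v] b0[of s] by (simp add: unit_row_def z_def ip_commute)
  qed
  have h2': "ht n ?\<omega> (\<lambda>s. same s s0 \<and> reg s 6 = ?T0) LoadUnits (3 + (n + 1) * 80)
    (\<lambda>s. same s s0 \<and> (\<exists>u. tableau n (m + n) a (idx s 1) u (reg s 6)) \<and> (\<forall>k<n. idx s 1 k = m + k) \<and>
        (\<forall>s'<m + n. reg s 6 s' n = z s') \<and> (\<forall>s'. reg s 6 s' (n + 1) = 0))"
  proof (rule ht_conseq[OF h2])
    fix s assume s: "same s s0 \<and> (\<forall>k<n. idx s 1 k = m + k) \<and> reg s 6 = ?T1"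
    then have T: "reg s 6 = ?T1" by simp
    have "?T1 s' (n + 1) = 0" for s' by (auto simp: constraint_row_def unit_row_def)
    then show "same s s0 \<and> (\<exists>u. tableau n (m + n) a (idx s 1) u (reg s 6)) \<and> (\<forall>k<n. idx s 1 k = m + k) \<and>
        (\<forall>s'<m + n. reg s 6 s' n = z s') \<and> (\<forall>s'. reg s 6 s' (n + 1) = 0)"
      using s start[of "idx s 1"] slack unfolding T by blast
  qed simp_all
  have h: "ht n ?\<omega> (\<lambda>s. s = s0) Prelude prelude_cost
     (\<lambda>s. same s s0 \<and> (\<exists>u. tableau n (m + n) a (idx s 1) u (reg s 6)) \<and> (\<forall>k<n. idx s 1 k < m \<and> z (idx s 1 k) = 0) \<and>
        (\<forall>s'<m + n. reg s 6 s' n = z s'))"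
    unfolding Prelude_def prelude_cost_def by (rule ht_Seq[OF h1 ht_Seq[OF h2' h3 order_refl] order_refl])
  have st: "steps s0 = 0" using s0 unfolding input_def by blast
  then have f: "forget_steps s0 = s0" by (cases s0) (simp add: forget_steps_def)
  define Q where "Q = (\<lambda>s. same s s0 \<and> (\<exists>u. tableau n (m + n) a (idx s 1) u (reg s 6)) \<and>
    (\<forall>k<n. idx s 1 k < m \<and> z (idx s 1 k) = 0) \<and> (\<forall>s'<m + n. reg s 6 s' n = z s'))"
  obtain s1 where s1: "exec n ?\<omega> Prelude s0 s1" "Q (forget_steps s1)" "steps s1 \<le> steps s0 + prelude_cost"
    using ht_ex[OF h[folded Q_def], OF f] by blast
  have Q: "same s1 s0" "\<exists>u. tableau n (m + n) a (idx s1 1) u (reg s1 6)"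
    "\<And>k. k < n \<Longrightarrow> idx s1 1 k < m \<and> z (idx s1 1 k) = 0" "\<And>s'. s' < m + n \<Longrightarrow> reg s1 6 s' n = z s'"
    using s1(2) unfolding Q_def state_simps(1-4) same_def by blast+
  obtain u where u: "tableau n (m + n) a (idx s1 1) u (reg s1 6)" using Q(2) ..
  show thesis
  proof (rule that[OF _ Q(1) _ u])
    show "exec n \<omega> Prelude s0 s1" for \<omega> by (rule draw_free_exec[OF s1(1) draw_free_Prelude])
    show "steps s1 \<le> prelude_cost" using s1(3) st by simp
  qed (use Q(3,4) in blast)+
qed

definition randomize_cost :: nat where
  "randomize_cost = (3 + (n + 1) * 30) + (3 + (m + 1) * 30) + (3 + (n + 1) * 30) + (3 + (n + 1) * (30 + (n + 1) * 40)) +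
     3 * (3 + (n + 1) * (60 + (n + 1) * 60))"

lemma randomize:
  assumes s1: "idx s1 0 0 = m" "idx s1 0 1 = n" "\<And>l. reg s1 7 0 l = 0" "draws s1 = 0"
  obtains s2 where "exec n \<omega> Randomize s1 s2" "frame {6, 7, 8, 9} s2 s1" "steps s2 \<le> steps s1 + randomize_cost"
    "\<And>l. l < n \<Longrightarrow> reg s2 8 0 l = fst (\<omega> l)" "\<And>l. l < n \<Longrightarrow> reg s2 7 0 l = (\<Sum>k<n. reg s1 0 (idx s1 1 k) l)"
    "\<And>s k. s < m + n \<Longrightarrow> k \<le> n \<Longrightarrow> reg s2 6 s k = reg s1 6 s k"
    "\<And>s. s < m \<Longrightarrow> reg s2 6 s (n + 1) = (if s \<in> idx s1 1 ` {..<n} then 0 else snd (\<omega> (n + s)))"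
    "\<And>k. k < n \<Longrightarrow> reg s2 6 (m + n) k = (\<Sum>l<n. reg s2 8 0 l * reg s1 6 (m + l) k)"
    "\<And>k. k < n \<Longrightarrow> reg s2 6 (m + n + 1) k = (\<Sum>l<n. reg s1 2 0 l * reg s1 6 (m + l) k)"
    "\<And>k. k < n \<Longrightarrow> reg s2 6 (m + n + 2) k = (\<Sum>l<n. reg s2 7 0 l * reg s1 6 (m + l) k)"
proof -
  note e = state_simps(1-4) frame_forget_steps
  obtain t1 where t1: "exec n \<omega> DrawDirection s1 t1" "steps t1 \<le> steps s1 + (3 + (n + 1) * 30)"
    "frame {8} t1 s1" "draws t1 = n" "\<And>l. l < n \<Longrightarrow> reg t1 8 0 l = fst (\<omega> l)"
    using ht_ex[OF ht_DrawDirection[where ?s0.0="forget_steps s1" and d=n and \<omega>=\<omega>] refl, unfolded e s1 add_0] by blast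
  have i1: "idx t1 0 0 = m" "idx t1 0 1 = n" "idx t1 1 = idx s1 1" using t1(3) s1 by (auto simp: frame_def)
  obtain t2 where t2: "exec n \<omega> DrawPerturbation t1 t2" "steps t2 \<le> steps t1 + (3 + (m + 1) * 30)"
    "frame {6} t2 t1" "reg t2 6 = (\<lambda>s k. if s < m \<and> k = n + 1 then snd (\<omega> (n + s)) else reg t1 6 s k)"
    using ht_ex[OF ht_DrawPerturbation[where ?s0.0="forget_steps t1" and d=n and \<omega>=\<omega>] refl, unfolded e i1 t1(4)] by blast
  have i2: "idx t2 0 0 = m" "idx t2 0 1 = n" "idx t2 1 = idx s1 1" using t2(3) i1 by (auto simp: frame_def)
  obtain t3 where t3: "exec n \<omega> ClearPerturbation t2 t3" "steps t3 \<le> steps t2 + (3 + (n + 1) * 30)"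
    "frame {6} t3 t2" "reg t3 6 = (\<lambda>s k. if s \<in> idx s1 1 ` {..<n} \<and> k = n + 1 then 0 else reg t2 6 s k)"
    using ht_ex[OF ht_ClearPerturbation[where ?s0.0="forget_steps t2" and d=n and \<omega>=\<omega>] refl, unfolded e i2] by blast
  have i3: "idx t3 0 0 = m" "idx t3 0 1 = n" "idx t3 1 = idx s1 1" using t3(3) i2 by (auto simp: frame_def)
  have z7: "reg (forget_steps t3) 7 0 l = 0" for l using t1(3) t2(3) t3(3) s1(3) by (simp add: frame_def)
  obtain t4 where t4: "exec n \<omega> SumRows t3 t4" "steps t4 \<le> steps t3 + (3 + (n + 1) * (30 + (n + 1) * 40))"
    "frame {7} t4 t3" "\<And>l. l < n \<Longrightarrow> reg t4 7 0 l = (\<Sum>k<n. reg t3 0 (idx s1 1 k) l)"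
    using ht_ex[OF ht_SumRows[where ?s0.0="forget_steps t3" and d=n and \<omega>=\<omega>, OF z7] refl, unfolded e i3] by blast
  have i4: "idx t4 0 0 = m" "idx t4 0 1 = n" using t4(3) i3 by (auto simp: frame_def)
  let ?L = "\<lambda>T q x s k. if s = q \<and> k < n then \<Sum>l<n. x l * T (m + l) k else (T s k :: real)"
  have load: "\<exists>t'. exec n \<omega> (LoadRow dst src) t t' \<and> steps t' \<le> steps t + (3 + (n + 1) * (60 + (n + 1) * 60)) \<and>
      frame {6, 9} t' t \<and> reg t' 6 = ?L (reg t 6) q (reg t src 0)"
    if t: "idx t 0 0 = m" "idx t 0 1 = n" and dst: "\<And>s. idx s 0 = idx t 0 \<Longrightarrow> ival s dst = q" "icost dst \<le> 10"
      and q: "m + n \<le> q" "src \<noteq> 6" "src \<noteq> 9" for t dst q src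
  proof -
    have h: "ht n \<omega> (\<lambda>s. core s = core t \<and> reg s 6 = reg t 6) (LoadRow dst src) (3 + (n + 1) * (60 + (n + 1) * 60))
      (\<lambda>s. core s = core t \<and> reg s 6 = ?L (reg t 6) q (reg t src 0))"
      using ht_LoadRow[of t dst q src n \<omega> "reg t 6", unfolded t] dst q by simp
    have "core (forget_steps t) = core t \<and> reg (forget_steps t) 6 = reg t 6" by simp
    from ht_run[OF h this] obtain t' where t': "exec n \<omega> (LoadRow dst src) t t'"
      "core (forget_steps t') = core t \<and> reg (forget_steps t') 6 = ?L (reg t 6) q (reg t src 0)"
      "steps t' \<le> steps t + (3 + (n + 1) * (60 + (n + 1) * 60))" by blast
    have "core t' = core t" "reg t' 6 = ?L (reg t 6) q (reg t src 0)"
      using t'(2) by (simp_all only: core_simps state_simps)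
    then show ?thesis using t' frame_core by blast
  qed
  obtain t5 where t5: "exec n \<omega> (LoadRow xE 8) t4 t5" "steps t5 \<le> steps t4 + (3 + (n + 1) * (60 + (n + 1) * 60))"
    "frame {6, 9} t5 t4" "reg t5 6 = ?L (reg t4 6) (m + n) (reg t4 8 0)"
    using load[of t4 xE "m + n" 8] i4 by auto
  have i5: "idx t5 0 0 = m" "idx t5 0 1 = n" using t5(3) i4 by (auto simp: frame_def)
  obtain t6 where t6: "exec n \<omega> (LoadRow cE 2) t5 t6" "steps t6 \<le> steps t5 + (3 + (n + 1) * (60 + (n + 1) * 60))"
    "frame {6, 9} t6 t5" "reg t6 6 = ?L (reg t5 6) (m + n + 1) (reg t5 2 0)"
    using load[of t5 cE "m + n + 1" 2] i5 by auto
  have i6: "idx t6 0 0 = m" "idx t6 0 1 = n" using t6(3) i5 by (auto simp: frame_def)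
  obtain t7 where t7: "exec n \<omega> (LoadRow dE 7) t6 t7" "steps t7 \<le> steps t6 + (3 + (n + 1) * (60 + (n + 1) * 60))"
    "frame {6, 9} t7 t6" "reg t7 6 = ?L (reg t6 6) (m + n + 2) (reg t6 7 0)"
    using load[of t6 dE "m + n + 2" 7] i6 by auto
  have low: "reg t4 6 s k = reg s1 6 s k" if "s < m + n" "k \<le> n" for s k
    using that t1(3) t4(3) by (simp add: t3(4) t2(4) frame_def)
  show thesis
  proof (rule that[of t7])
    show "exec n \<omega> Randomize s1 t7"
      unfolding Randomize_def using t1(1) t2(1) t3(1) t4(1) t5(1) t6(1) t7(1) by (blast intro: exec.Seq)
    show "frame {6, 7, 8, 9} t7 s1" using t1(3) t2(3) t3(3) t4(3) t5(3) t6(3) t7(3) by (simp add: frame_def)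
    show "steps t7 \<le> steps s1 + randomize_cost"
      using t1(2) t2(2) t3(2) t4(2) t5(2) t6(2) t7(2) unfolding randomize_cost_def by (simp add: algebra_simps)
    show "reg t7 8 0 l = fst (\<omega> l)" if "l < n" for l
      using that t1(5) t2(3) t3(3) t4(3) t5(3) t6(3) t7(3) by (simp add: frame_def)
    show "reg t7 7 0 l = (\<Sum>k<n. reg s1 0 (idx s1 1 k) l)" if "l < n" for l
      using that t1(3) t2(3) t3(3) t4(4) t5(3) t6(3) t7(3) by (simp add: frame_def)
    show "reg t7 6 s k = reg s1 6 s k" if "s < m + n" "k \<le> n" for s k
      using that low[OF that] by (simp add: t7(4) t6(4) t5(4))
    show "reg t7 6 s (n + 1) = (if s \<in> idx s1 1 ` {..<n} then 0 else snd (\<omega> (n + s)))" if "s < m" for s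
      using that t4(3) by (simp add: t7(4) t6(4) t5(4) frame_def t3(4) t2(4))
    show "reg t7 6 (m + n) k = (\<Sum>l<n. reg t7 8 0 l * reg s1 6 (m + l) k)" if "k < n" for k
      using that low t5(3) t6(3) t7(3) by (simp add: t7(4) t6(4) t5(4) frame_def)
    show "reg t7 6 (m + n + 1) k = (\<Sum>l<n. reg s1 2 0 l * reg s1 6 (m + l) k)" if "k < n" for k
      using that low t1(3) t2(3) t3(3) t4(3) t5(3) by (simp add: t7(4) t6(4) t5(4) frame_def)
    show "reg t7 6 (m + n + 2) k = (\<Sum>l<n. reg t7 7 0 l * reg s1 6 (m + l) k)" if "k < n" for k
      using that low t7(3) by (simp add: t7(4) t6(4) t5(4) frame_def)
  qed
qed

end


section \<open>Optimality and feasibility for the unperturbed constraints\<close>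

definition optimal_for :: "nat \<Rightarrow> (nat \<Rightarrow> nat \<Rightarrow> real) \<Rightarrow> nat set \<Rightarrow> (nat \<Rightarrow> real) \<Rightarrow> bool" where
  "optimal_for n a B y \<longleftrightarrow> (\<forall>j\<in>B. 0 \<le> ip n (dual_of n a B j) y)"

definition feasible_set :: "nat \<Rightarrow> nat \<Rightarrow> (nat \<Rightarrow> nat \<Rightarrow> real) \<Rightarrow> (nat \<Rightarrow> real) \<Rightarrow> nat set \<Rightarrow> bool" where
  "feasible_set n m a b B \<longleftrightarrow> B \<subseteq> {..<m} \<and> (\<exists>u. dual_basis n a B u) \<and> (\<forall>k<m. 0 \<le> slack n a b B k)"

text \<open>A lexicographically positive pair has a nonnegative first component. Thus an
  infinitesimal perturbation never leaves the feasible bases of \<open>b\<close>, to which the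
  distance property is restricted.\<close>

lemma lex_bases_feasible:
  assumes "B \<in> lex_bases n m a b w"
  shows "feasible_set n m a b B"
proof -
  obtain u where u: "dual_basis n a B u" using assms by (auto simp: lex_bases_def)
  have "0 \<le> slack n a b B k" if "k < m" for k
    using assms that slack_basic[OF u, of k b] by (cases "k \<in> B") (auto simp: lex_bases_def lexpos_def)
  then show ?thesis using assms by (auto simp: feasible_set_def lex_bases_def)
qed

fun optimal_walk :: "nat \<Rightarrow> nat \<Rightarrow> (nat \<Rightarrow> nat \<Rightarrow> real) \<Rightarrow> (nat \<Rightarrow> real) \<Rightarrow> (nat \<Rightarrow> real) \<Rightarrow> (nat \<Rightarrow> real) \<Rightarrow> real \<Rightarrow>
    nat set \<Rightarrow> nat set list \<Rightarrow> bool" where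
  "optimal_walk n m a b p q t B [] = True"
| "optimal_walk n m a b p q t B (B' # Bs) = (\<exists>t'\<ge>t. adjacent B B' \<and> feasible_set n m a b B' \<and>
     optimal_for n a B (\<lambda>l. p l + t' * q l) \<and> optimal_for n a B' (\<lambda>l. p l + t' * q l) \<and>
     optimal_walk n m a b p q t' B' Bs)"

lemma dual_basis_add_ip:
  assumes "dual_basis n a B u" "i \<in> B"
  shows "ip n (u i) (\<lambda>l. \<Sum>k\<in>B. a k l) = 1"
proof -
  have "ip n (u i) (\<lambda>l. \<Sum>k\<in>B. 1 * a k l) = (\<Sum>k\<in>B. 1 * ip n (u i) (a k))" by (rule ip_sum_right)
  also have "\<dots> = (\<Sum>k\<in>B. if k = i then 1 else 0)" using dual_basisD(3)[OF assms(1) _ assms(2)] by (intro sum.cong) auto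
  also have "\<dots> = 1" using dual_basisD(1)[OF assms(1)] assms(2) by simp
  finally show ?thesis by simp
qed

context lp
begin

lemma walk_optimal_walk: "walk p q t B Bs \<Longrightarrow> optimal_walk n m a b p q t B Bs"
proof (induction Bs arbitrary: t B)
  case (Cons B' Bs)
  then obtain t' where "t \<le> t'" "adjacent B B'" "B' \<in> \<B>" "nonneg_on B (\<lambda>l. p l + t' * q l)"
    "nonneg_on B' (\<lambda>l. p l + t' * q l)" "walk p q t' B' Bs" by auto
  then show ?case using Cons.IH lex_bases_feasible by (auto simp: nonneg_on_def optimal_for_def intro!: exI[of _ t'])
qed simp

lemma generic_cong:
  assumes "generic_direction n m a e y" "\<And>l. l < n \<Longrightarrow> x l = y l"
  shows "generic x e"
proof -
  have c: "co B j x = co B j y" for B j using assms(2) by (intro ip_cong) auto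
  have "(\<forall>j\<in>B. co B j y \<noteq> 0) \<and>
     (\<forall>i\<in>B. \<forall>j\<in>B. i \<noteq> j \<longrightarrow> co B i y * co B j e = co B j y * co B i e \<longrightarrow> co B i e = 0 \<and> co B j e = 0)"
    if B: "B \<in> \<B>" for B
    using assms(1) bases_sub[OF B] dual[OF B] unfolding generic_direction_def Let_def by blast
  then show ?thesis unfolding generic_def c by blast
qed

lemma leg:
  assumes g: "\<And>k. k < m \<Longrightarrow> g k = a k" "g P = p" "g Q = q" "P < m + n + 3" "Q < m + n + 3"
    and E: "\<And>s. idx s 0 0 = m \<Longrightarrow> idx s 0 1 = n \<Longrightarrow> ival s pE = P \<and> ival s qE = Q" "icost pE \<le> 10" "icost qE \<le> 10"
    and gen: "generic p q \<or> generic q p"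
    and B: "idx s 1 ` {..<n} = B"
    and s: "good g s" "entered p q t B" "trace s \<noteq> []" "steps s = fst (last (trace s))" "gaps step_cost (trace s)"
  obtains s' Bs tr where "exec n \<omega> (Leg pE qE) s s'" "good g s'" "keep s' s"
    "trace s' = trace s @ tr" "map snd tr = map Basis Bs" "length Bs \<le> card (crossings p q t)"
    "optimal_walk n m a b p q t B Bs" "idx s' 1 ` {..<n} = last (B # Bs)"
    "nonneg_on (idx s' 1 ` {..<n}) q" "gaps step_cost (trace s')" "steps s' \<le> steps s + (length Bs + 2) * step_cost"
proof -
  have mn: "idx s 0 0 = m" "idx s 0 1 = n" using s(1) by (auto simp: good_def)
  let ?C = "\<lambda>k. chosen n (\<lambda>i. reg s 6 Q i < 0) (\<lambda>i k. reg s 6 P i / - reg s 6 Q i < reg s 6 P k / - reg s 6 Q k) k"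
  have h: "ht n \<omega> (\<lambda>z. z = forget_steps s) (Find pE qE) (find_cost n)
    (\<lambda>z. \<exists>k. z = set_idx 2 0 n (set_idx 11 0 k (forget_steps s)) \<and> ?C k)"
    using ht_Find[of "forget_steps s" pE P qE Q n \<omega>] E mn by simp
  obtain s1 k where s1: "exec n \<omega> (Find pE qE) s s1" "forget_steps s1 = set_idx 2 0 n (set_idx 11 0 k (forget_steps s))"
    "?C k" "steps s1 \<le> steps s + find_cost n"
    using ht_ex[OF h refl] by blast
  have f: "idx s1 = idx (set_idx 2 0 n (set_idx 11 0 k s))" "reg s1 = reg s" "trace s1 = trace s"
    using arg_cong[OF s1(2), of idx] arg_cong[OF s1(2), of reg] arg_cong[OF s1(2), of trace] by auto
  have i1: "idx s1 1 = idx s 1" "idx s1 0 = idx s 0" "idx s1 11 0 = k" using f by auto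
  have "\<exists>s' Bs tr. exec n \<omega> (While (ILess (vr 11) nE) (Step pE qE)) s1 s' \<and> good g s' \<and> keep s' s1 \<and>
    trace s' = trace s1 @ tr \<and> map snd tr = map Basis Bs \<and> length Bs \<le> card (crossings p q t) \<and>
    walk p q t (idx s1 1 ` {..<n}) Bs \<and> idx s' 1 ` {..<n} = last (idx s1 1 ` {..<n} # Bs) \<and>
    nonneg_on (idx s' 1 ` {..<n}) q \<and> gaps step_cost (trace s') \<and> steps s' \<le> steps s1 + (length Bs + 1) * step_cost"
  proof (rule leg_loop[OF g E gen])
    show "good g s1" using s(1) i1 f by (simp add: good_def)
    show "entered p q t (idx s1 1 ` {..<n})" unfolding i1 B by (rule s(2))
    show "chosen n (\<lambda>i. reg s1 6 Q i < 0) (\<lambda>i k. reg s1 6 P i / - reg s1 6 Q i < reg s1 6 P k / - reg s1 6 Q k) (idx s1 11 0)"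
      unfolding i1 f(2) by (rule s1(3))
    show "trace s1 \<noteq> []" "steps s1 \<le> fst (last (trace s1)) + find_cost n" "gaps step_cost (trace s1)"
      using s s1(4) f by auto
  qed auto
  then obtain s' Bs tr where s': "exec n \<omega> (While (ILess (vr 11) nE) (Step pE qE)) s1 s'" "good g s'" "keep s' s1"
    "trace s' = trace s1 @ tr" "map snd tr = map Basis Bs" "length Bs \<le> card (crossings p q t)"
    "walk p q t (idx s1 1 ` {..<n}) Bs" "idx s' 1 ` {..<n} = last (idx s1 1 ` {..<n} # Bs)"
    "nonneg_on (idx s' 1 ` {..<n}) q" "gaps step_cost (trace s')" "steps s' \<le> steps s1 + (length Bs + 1) * step_cost"
    by blast
  show thesis
  proof (rule that[of s' tr Bs])
    show "exec n \<omega> (Leg pE qE) s s'" unfolding Leg_def by (rule exec.Seq[OF s1(1) s'(1)])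
    show "keep s' s" using s'(3) f i1 by (simp add: keep_def)
    show "optimal_walk n m a b p q t B Bs" using walk_optimal_walk[OF s'(7)] i1 B by simp
    show "idx s' 1 ` {..<n} = last (B # Bs)" using s'(8) i1 B by simp
    show "steps s' \<le> steps s + (length Bs + 2) * step_cost" using s'(11) s1(4) by (simp add: step_cost_def)
  qed (use s' f i1 in auto)
qed

end

definition hits :: "nat \<Rightarrow> nat \<Rightarrow> (nat \<Rightarrow> nat \<Rightarrow> real) \<Rightarrow> (nat \<Rightarrow> real) \<Rightarrow> (nat \<Rightarrow> real) \<Rightarrow> (nat \<Rightarrow> real) \<Rightarrow> (nat \<Rightarrow> real) \<Rightarrow> nat" where
  "hits n m a b w e x = (\<Sum>B\<in>lex_bases n m a b w. \<Sum>j\<in>B. of_bool (fan.hit n (dual_of n a) x e B j))"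

definition leg_step_cost :: "nat \<Rightarrow> nat \<Rightarrow> nat" where
  "leg_step_cost m n = enter_cost m + pivot_cost m n + find_cost n + 10"

context instance_data
begin

lemma dual_basis_A: "B \<subseteq> {..<m} \<Longrightarrow> dual_basis n a B u = dual_basis n A B u"
  by (rule dual_basis_cong) (auto simp: a_constraint)

lemma feasible_dist:
  assumes B: "feasible_set n m a b B" "j \<in> B"
  shows "nrm n (dual_of n a B j) * nrm n (a j) \<le> 1 / \<delta>"
proof -
  have Bm: "B \<subseteq> {..<m}" and d: "dual_basis n a B (dual_of n a B)"
    using B dual_of by (auto simp: feasible_set_def)
  have "nrm n (dual_of n a B j) * nrm n (A j) \<le> 1 / \<delta>"
  proof (rule dist_prop[OF Bm _ _ B(2)])
    show "dual_basis n A B (dual_of n a B)" using d dual_basis_A[OF Bm] by simp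
    show "(\<Sum>j\<in>B. ip n (dual_of n a B j) (A k) * b j) \<le> b k" if "k < m" for k
      using B(1) that by (auto simp: feasible_set_def slack_def a_constraint)
  qed
  then show ?thesis using Bm B(2) by (simp add: a_constraint subset_iff)
qed

text \<open>Otherwise the negative of the dual vector, which is the direction of the edge that
  relaxes constraint \<open>j\<close>, would be a nonzero recession direction.\<close>

lemma feasible_edge:
  assumes B: "feasible_set n m a b B" "j \<in> B"
  shows "\<exists>r<m. ip n (dual_of n a B j) (a r) < 0"
proof (rule ccontr)
  assume no: "\<not> (\<exists>r<m. ip n (dual_of n a B j) (a r) < 0)"
  have d: "dual_basis n a B (dual_of n a B)" using B dual_of by (auto simp: feasible_set_def)
  let ?y = "\<lambda>l. - dual_of n a B j l"
  have ipy: "ip n x ?y = - ip n (dual_of n a B j) x" for x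
    using ip_scale_right[of n x "-1" "dual_of n a B j"] by (simp add: ip_commute)
  have "ip n (A r) ?y \<le> 0" if "r < m" for r
  proof -
    have "0 \<le> ip n (dual_of n a B j) (a r)" using no that by (meson not_less)
    then show ?thesis using that by (simp add: ipy a_constraint)
  qed
  then have "\<And>l. l < n \<Longrightarrow> ?y l = 0" using no_recession by blast
  then have "ip n (dual_of n a B j) (a j) = 0" by (simp add: ip_def)
  then show False using dual_basisD(3)[OF d B(2) B(2)] by simp
qed

text \<open>The perturbation is zero on \<open>B0\<close>, whose basic solution is \<open>v\<close>.
  So the pair of slacks of a nonbasic row \<open>k\<close> consists of the slack of constraint
  \<open>k\<close> at \<open>v\<close> and the positive draw \<open>y (n + k)\<close>.\<close>

lemma perturbed_lp:
  assumes B0: "B0 \<subseteq> {..<m}" "dual_basis n a B0 u0" "\<And>j. j \<in> B0 \<Longrightarrow> z j = 0"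
    and pos: "\<forall>i<m. 0 < y (n + i)" and gen: "generic_rhs n m a (pert B0 n y)"
  shows "\<exists>bs. lp n m a bs b (pert B0 n y) \<delta>" "B0 \<in> lex_bases n m a b (pert B0 n y)"
proof -
  let ?w = "pert B0 n y"
  have d0: "dual_basis n a B0 (dual_of n a B0)" by (rule dual_of[OF B0(2)])
  have "lexpos (slack n a b B0 k) (slack n a ?w B0 k)" if k: "k < m" "k \<notin> B0" for k
  proof -
    have "(\<Sum>j\<in>B0. ip n (dual_of n a B0 j) (a k) * b j) = (\<Sum>j\<in>B0. ip n (dual_of n a B0 j) (a k) * ip n v (a j))"
      using B0(3) by (intro sum.cong refl) (simp add: z_def ip_commute)
    also have "\<dots> = ip n v (a k)" by (rule dual_basis_expand_right[OF d0, symmetric])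
    finally have "slack n a b B0 k = b k - ip n (A k) v" using k by (simp add: slack_def ip_commute a_constraint)
    moreover have "slack n a ?w B0 k = y (n + k)" using k by (simp add: slack_def pert_def)
    ultimately show ?thesis using feas[OF k(1)] pos k by (auto simp: lexpos_def)
  qed
  then show B0': "B0 \<in> lex_bases n m a b ?w" using B0 by (auto simp: lex_bases_def)
  have "\<exists>bs. fan n m a bs (lex_bases n m a b ?w) (dual_of n a) \<delta>"
    using B0' by (intro lex_bases_fan n_pos delta_pos gen feasible_edge feasible_dist lex_bases_feasible) auto
  then obtain bs where "fan n m a bs (lex_bases n m a b ?w) (dual_of n a) \<delta>" ..
  then have "lp n m a bs b ?w \<delta>"
    using gen feasible_edge lex_bases_feasible unfolding lp_def lp_axioms_def by blast
  then show "\<exists>bs. lp n m a bs b ?w \<delta>" by blast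
qed

text \<open>All that later arguments need from a run, without reference to the fan's
  \<open>bs\<close>. Each leg is charged two step costs beyond its pivots, which explains the
  \<open>+ 4\<close>; the summand 6 covers the three reports.\<close>

definition outcome :: "nat set \<Rightarrow> (nat \<Rightarrow> real) \<Rightarrow> state \<Rightarrow> bool" where
  "outcome B0 y s \<longleftrightarrow> (\<exists>Bs1 Bs2. let d = (\<lambda>l. \<Sum>k\<in>B0. a k l); B1 = last (B0 # Bs1); B2 = last (B1 # Bs2) in
     map snd (trace s) = Basis B0 # Segment {} (Matrix.vec n d) (Matrix.vec n y) # map Basis Bs1 @
       Segment {} (Matrix.vec n y) (Matrix.vec n c) # map Basis Bs2 \<and>
     feasible_set n m a b B0 \<and> feasible_set n m a b B2 \<and>
     optimal_walk n m a b d y 0 B0 Bs1 \<and> optimal_walk n m a b y c 0 B1 Bs2 \<and>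
     optimal_for n a B0 d \<and> optimal_for n a B1 y \<and> optimal_for n a B2 c \<and>
     length Bs1 + length Bs2 \<le> hits n m a b (pert B0 n y) d y + hits n m a b (pert B0 n y) c y \<and>
     gaps (leg_step_cost m n) (trace s) \<and>
     steps s \<le> prelude_cost + randomize_cost + (3 + (n + 1) * 40) + 6 + (length Bs1 + length Bs2 + 4) * leg_step_cost m n \<and>
     (\<forall>l<n. reg s 5 0 l = (\<Sum>j\<in>B2. b j * dual_of n a B2 j l)))"

lemma vec_cong: "(\<And>l. l < n \<Longrightarrow> x l = y l) \<Longrightarrow> Matrix.vec n x = Matrix.vec n y"
  by auto

text \<open>\<open>B0\<close> is obtained before the tape is given, so the genericity conditions,
  which mention \<open>B0\<close>, concern fixed objects and can be shown to hold almost
  surely.\<close>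

lemma shadow_run:
  assumes s0: "input s0"
  obtains B0 u0 where "B0 \<subseteq> {..<m}" "dual_basis n a B0 u0" "\<And>j. j \<in> B0 \<Longrightarrow> z j = 0"
    "\<And>\<omega> y. (\<And>l. l < n \<Longrightarrow> y l = fst (\<omega> l)) \<Longrightarrow> (\<And>i. i < m \<Longrightarrow> y (n + i) = snd (\<omega> (n + i))) \<Longrightarrow>
       \<forall>i<m. 0 < y (n + i) \<Longrightarrow> generic_rhs n m a (pert B0 n y) \<Longrightarrow>
       generic_direction n m a (\<lambda>l. \<Sum>k\<in>B0. a k l) y \<Longrightarrow> generic_direction n m a c y \<Longrightarrow>
       \<exists>s'. exec n \<omega> Shadow s0 s' \<and> outcome B0 y s'"
proof -
  obtain s1 u where s1: "\<And>\<omega>. exec n \<omega> Prelude s0 s1" "same s1 s0" "steps s1 \<le> prelude_cost"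
    "tableau n (m + n) a (idx s1 1) u (reg s1 6)" "\<And>k. k < n \<Longrightarrow> idx s1 1 k < m" "\<And>k. k < n \<Longrightarrow> z (idx s1 1 k) = 0"
    "\<And>s. s < m + n \<Longrightarrow> reg s1 6 s n = z s"
    by (rule prelude[OF s0]) blast
  define \<beta> where "\<beta> = idx s1 1"
  define B0 where "B0 = \<beta> ` {..<n}"
  have inj: "inj_on \<beta> {..<n}" and d0: "dual_basis n a B0 u"
    and t1: "\<And>s k. s < m + n \<Longrightarrow> k < n \<Longrightarrow> reg s1 6 s k = ip n (u (\<beta> k)) (a s)"
    using s1(4) by (auto simp: tableau_def \<beta>_def B0_def)
  have B0: "B0 \<subseteq> {..<m}" "\<And>j. j \<in> B0 \<Longrightarrow> z j = 0" using s1(5,6) by (auto simp: B0_def \<beta>_def)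
  have in1: "idx s1 0 0 = m" "idx s1 0 1 = n" "\<And>l. reg s1 7 0 l = 0" "draws s1 = 0"
    "reg s1 0 = A" "reg s1 2 0 = c" "trace s1 = []"
    using s1(2) s0 by (auto simp: same_def input_def)
  have bn: "\<beta> k \<in> B0" if "k < n" for k using that by (simp add: B0_def)
  have tu: "reg s1 6 s k = ip n (dual_of n a B0 (\<beta> k)) (a s)" if "s < m + n" "k < n" for s k
    using t1[OF that] dual_of_eq[OF d0 bn[OF that(2)]] by simp
  have tunit: "reg s1 6 (m + l) k = dual_of n a B0 (\<beta> k) l" if "l < n" "k < n" for l k
    using tu[of "m + l" k] that ip_unit[OF that(1)] by simp
  show thesis
  proof (rule that[OF B0(1) d0 B0(2)])
    fix \<omega> y
    assume y: "\<And>l. l < n \<Longrightarrow> y l = fst (\<omega> l)" "\<And>i. i < m \<Longrightarrow> y (n + i) = snd (\<omega> (n + i))"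
      and pos: "\<forall>i<m. 0 < y (n + i)" and gen: "generic_rhs n m a (pert B0 n y)"
      and gd: "generic_direction n m a (\<lambda>l. \<Sum>k\<in>B0. a k l) y" and gc: "generic_direction n m a c y"
    let ?w = "pert B0 n y" and ?d = "\<lambda>l. \<Sum>k\<in>B0. a k l"
    obtain bs where "lp n m a bs b ?w \<delta>" using perturbed_lp(1)[OF B0(1) d0 B0(2) pos gen] by blast
    then interpret L: lp n m a bs b ?w \<delta> .
    have B0L: "B0 \<in> L.\<B>" by (rule perturbed_lp(2)[OF B0(1) d0 B0(2) pos gen])
    obtain s2 where s2: "exec n \<omega> Randomize s1 s2" "frame {6, 7, 8, 9} s2 s1" "steps s2 \<le> steps s1 + randomize_cost"
      "\<And>l. l < n \<Longrightarrow> reg s2 8 0 l = fst (\<omega> l)" "\<And>l. l < n \<Longrightarrow> reg s2 7 0 l = (\<Sum>k<n. reg s1 0 (idx s1 1 k) l)"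
      "\<And>s k. s < m + n \<Longrightarrow> k \<le> n \<Longrightarrow> reg s2 6 s k = reg s1 6 s k"
      "\<And>s. s < m \<Longrightarrow> reg s2 6 s (n + 1) = (if s \<in> idx s1 1 ` {..<n} then 0 else snd (\<omega> (n + s)))"
      "\<And>k. k < n \<Longrightarrow> reg s2 6 (m + n) k = (\<Sum>l<n. reg s2 8 0 l * reg s1 6 (m + l) k)"
      "\<And>k. k < n \<Longrightarrow> reg s2 6 (m + n + 1) k = (\<Sum>l<n. reg s1 2 0 l * reg s1 6 (m + l) k)"
      "\<And>k. k < n \<Longrightarrow> reg s2 6 (m + n + 2) k = (\<Sum>l<n. reg s2 7 0 l * reg s1 6 (m + l) k)"
      by (rule randomize[where \<omega>=\<omega>, OF in1(1-4)]) blast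
    have in2: "idx s2 0 0 = m" "idx s2 0 1 = n" "idx s2 1 = \<beta>" "reg s2 2 0 = c" "trace s2 = []"
      using s2(2) in1 by (auto simp: frame_def \<beta>_def)
    have x8: "reg s2 8 0 l = y l" if "l < n" for l using s2(4)[OF that] y(1)[OF that] by simp
    have d7: "reg s2 7 0 l = ?d l" if "l < n" for l
    proof -
      have "(\<Sum>k\<in>B0. a k l) = (\<Sum>k<n. a (\<beta> k) l)" unfolding B0_def by (subst sum.reindex[OF inj]) simp
      also have "\<dots> = (\<Sum>k<n. A (\<beta> k) l)" using s1(5) by (intro sum.cong refl) (simp add: a_constraint \<beta>_def)
      finally show ?thesis using s2(5)[OF that] in1(5) by (simp add: \<beta>_def)
    qed
    have row: "(\<Sum>l<n. x l * reg s1 6 (m + l) k) = ip n (dual_of n a B0 (\<beta> k)) x" if "k < n" for x k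
      unfolding ip_def using tunit that by (intro sum.cong refl) (simp add: mult.commute)
    define g where "g = (\<lambda>s. if s = m + n then y else if s = m + n + 1 then c else if s = m + n + 2 then ?d else a s)"
    have gr: "\<And>k. k < m \<Longrightarrow> g k = a k" "g (m + n) = y" "g (m + n + 1) = c" "g (m + n + 2) = ?d" by (simp_all add: g_def)
    have tab: "L.tab g \<beta> (reg s2 6)"
      unfolding L.tab_def B0_def[symmetric]
    proof (intro conjI allI impI)
      fix s k assume sk: "s < m + n + 3" "k < n"
      consider "s < m + n" | "s = m + n" | "s = m + n + 1" | "s = m + n + 2" using sk(1) by linarith
      then show "reg s2 6 s k = L.co B0 (\<beta> k) (g s)"
      proof cases
        case 1
        then have "g s = a s" by (simp add: g_def)
        then show ?thesis using s2(6)[OF 1, of k] tu[OF 1] sk(2) by simp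
      next
        case 2
        have "reg s2 6 s k = ip n (dual_of n a B0 (\<beta> k)) (reg s2 8 0)" using s2(8)[OF sk(2)] row[OF sk(2), of "reg s2 8 0"] 2 by simp
        also have "\<dots> = ip n (dual_of n a B0 (\<beta> k)) y" by (rule ip_cong) (simp_all add: x8)
        finally show ?thesis using 2 gr(2) by simp
      next
        case 3
        then show ?thesis using s2(9)[OF sk(2)] row[OF sk(2), of c] in1(6) gr(3) by simp
      next
        case 4
        have "reg s2 6 s k = ip n (dual_of n a B0 (\<beta> k)) (reg s2 7 0)" using s2(10)[OF sk(2)] row[OF sk(2), of "reg s2 7 0"] 4 by simp
        also have "\<dots> = ip n (dual_of n a B0 (\<beta> k)) ?d" by (rule ip_cong) (simp_all add: d7)
        finally show ?thesis using 4 gr(4) by simp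
      qed
    next
      show "residual_column n (m + n) b \<beta> n (reg s2 6)"
        unfolding residual_column_def
      proof (intro allI impI)
        fix s assume s: "s < m + n"
        \<comment> \<open>On the rows of the start basis, \<open>b\<close> agrees with the pairing
          with \<open>v\<close>. Hence column \<open>n\<close>, which the prelude filled with the
          slacks at \<open>v\<close>, is now the residual column.\<close>
        have "(\<Sum>k<n. reg s2 6 s k * b (\<beta> k)) = (\<Sum>k<n. ip n (u (\<beta> k)) (a s) * ip n v (a (\<beta> k)))"
          using s2(6)[OF s] t1[OF s] B0(2)[OF bn] by (intro sum.cong refl) (simp add: z_def ip_commute)
        also have "\<dots> = (\<Sum>j\<in>B0. ip n (u j) (a s) * ip n v (a j))"
          unfolding B0_def by (subst sum.reindex[OF inj]) simp
        also have "\<dots> = ip n v (a s)" by (rule dual_basis_expand_right[OF d0, symmetric])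
        finally show "reg s2 6 s n = b s - (\<Sum>k<n. reg s2 6 s k * b (\<beta> k))"
          using s2(6)[OF s, of n] s1(7)[OF s] by (simp add: z_def ip_commute)
      qed
      show "residual_column n m ?w \<beta> (n + 1) (reg s2 6)"
        unfolding residual_column_def
      proof (intro allI impI)
        fix s assume s: "s < m"
        have "(\<Sum>k<n. reg s2 6 s k * ?w (\<beta> k)) = 0" using bn by (intro sum.neutral) (simp add: pert_def)
        then show "reg s2 6 s (n + 1) = ?w s - (\<Sum>k<n. reg s2 6 s k * ?w (\<beta> k))"
          using s2(7)[OF s] y(2)[OF s] by (simp add: pert_def B0_def \<beta>_def)
      qed
    qed (use inj B0L in auto)
    let ?s3 = "report (Basis B0) (tick 1 s2)"
    have e3: "exec n \<omega> (ReportBasis 1) s2 ?s3" using exec.ReportBasis[of n \<omega> 1 s2] in2 by (simp add: B0_def)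
    have v7: "reg_vec n ?s3 7 = Matrix.vec n ?d" "reg_vec n ?s3 8 = Matrix.vec n y"
      unfolding reg_vec_def by (rule vec_cong, simp add: d7 x8)+
    let ?s4 = "report (Segment {} (Matrix.vec n ?d) (Matrix.vec n y)) (tick 2 ?s3)"
    have e4: "exec n \<omega> (ReportSegment 1 (Lit 0) 7 8) ?s3 ?s4"
      using exec.ReportSegment[of n \<omega> 1 "Lit 0" 7 8 ?s3] v7 by (simp add: numeral_2_eq_2)
    have good4: "L.good g ?s4" using in2 tab by (simp add: L.good_def)
    have i4: "idx ?s4 1 = \<beta>" using in2 by simp
    have sc: "L.step_cost = leg_step_cost m n" by (simp add: L.step_cost_def leg_step_cost_def)
    have dd: "dual_basis n a B0 (dual_of n a B0)" by (rule dual_of[OF d0])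
    \<comment> \<open>The first objective has all coordinates equal to 1 in \<open>B0\<close>, so
      the leg starts in the interior of that cone.\<close>
    have ent: "L.entered ?d y 0 B0" by (rule L.entered_start[OF B0L]) (simp add: dual_basis_add_ip[OF dd])
    have genL: "L.generic y ?d" "L.generic y c" by (rule L.generic_cong[OF gd], simp) (rule L.generic_cong[OF gc], simp)
    obtain s5 Bs1 tr1 where s5: "exec n \<omega> (Leg dE xE) ?s4 s5" "L.good g s5" "L.keep s5 ?s4"
      "trace s5 = trace ?s4 @ tr1" "map snd tr1 = map Basis Bs1" "length Bs1 \<le> card (L.crossings ?d y 0)"
      "optimal_walk n m a b ?d y 0 B0 Bs1" "idx s5 1 ` {..<n} = last (B0 # Bs1)"
      "L.nonneg_on (idx s5 1 ` {..<n}) y" "gaps L.step_cost (trace s5)" "steps s5 \<le> steps ?s4 + (length Bs1 + 2) * L.step_cost"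
    proof (rule L.leg[of g "m + n + 2" ?d "m + n" y dE xE ?s4 B0 0 \<omega>])
      show "idx ?s4 1 ` {..<n} = B0" using in2 by (simp add: B0_def)
      show "gaps L.step_cost (trace ?s4)" using in2 by (auto simp: gaps_def less_Suc_eq nth_append)
      show "L.generic ?d y \<or> L.generic y ?d" using genL by simp
    qed ((rule that; assumption) | (use gr good4 ent in2 in \<open>simp; fail\<close>))+
    define B1 where "B1 = last (B0 # Bs1)"
    have i5: "idx s5 0 0 = m" "idx s5 0 1 = n" "L.tab g (idx s5 1) (reg s5 6)" using s5(2) by (auto simp: L.good_def)
    have B1L: "B1 \<in> L.\<B>" using i5(3) s5(8) by (simp add: L.tab_def B1_def)
    have nn1: "L.nonneg_on B1 y" using s5(8,9) by (simp add: B1_def)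
    \<comment> \<open>By genericity \<open>y\<close> avoids all walls, so it lies in the interior of
      the cone in which the first leg ends, and the second leg can start there.\<close>
    have pos1: "0 < L.co B1 j y" if "j \<in> B1" for j
    proof -
      have "L.co B1 j y \<noteq> 0" using genL(1) B1L that unfolding L.generic_def by blast
      moreover have "0 \<le> L.co B1 j y" using nn1 that by (simp add: L.nonneg_on_def)
      ultimately show ?thesis by simp
    qed
    have k5: "reg s5 8 = reg s2 8" "reg s5 2 = reg s2 2" using s5(3) by (auto simp: L.keep_def)
    have v8: "reg_vec n s5 8 = Matrix.vec n y" "reg_vec n s5 2 = Matrix.vec n c"
      unfolding reg_vec_def k5 by (rule vec_cong, simp add: x8 in2)+
    let ?s6 = "report (Segment {} (Matrix.vec n y) (Matrix.vec n c)) (tick 2 s5)"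
    have e6: "exec n \<omega> (ReportSegment 1 (Lit 0) 8 2) s5 ?s6"
      using exec.ReportSegment[of n \<omega> 1 "Lit 0" 8 2 s5] v8 by (simp add: numeral_2_eq_2)
    have good6: "L.good g ?s6" using s5(2) by (simp add: L.good_def)
    have im6: "idx ?s6 1 ` {..<n} = B1" using s5(8) by (simp add: B1_def)
    have ent2: "L.entered y c 0 B1" by (rule L.entered_start[OF B1L]) (simp add: pos1)
    have gaps6: "gaps L.step_cost (trace ?s6)" 
    proof -
      have "gaps L.step_cost (trace s5 @ [(steps (tick 2 s5), Segment {} (Matrix.vec n y) (Matrix.vec n c))])"
        by (rule gaps_snoc[OF s5(10)]) (simp_all add: s5(4))
      then show ?thesis by simp
    qed
    obtain s7 Bs2 tr2 where s7: "exec n \<omega> (Leg xE cE) ?s6 s7" "L.good g s7" "L.keep s7 ?s6"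
      "trace s7 = trace ?s6 @ tr2" "map snd tr2 = map Basis Bs2" "length Bs2 \<le> card (L.crossings y c 0)"
      "optimal_walk n m a b y c 0 B1 Bs2" "idx s7 1 ` {..<n} = last (B1 # Bs2)"
      "L.nonneg_on (idx s7 1 ` {..<n}) c" "gaps L.step_cost (trace s7)" "steps s7 \<le> steps ?s6 + (length Bs2 + 2) * L.step_cost"
    proof (rule L.leg[of g "m + n" y "m + n + 1" c xE cE ?s6 B1 0 \<omega>])
      show "L.generic y c \<or> L.generic c y" using genL by simp
    qed ((rule that; assumption) | (use gr good6 gaps6 im6 ent2 in \<open>simp; fail\<close>))+
    define B2 where "B2 = last (B1 # Bs2)"
    have i7: "idx s7 0 0 = m" "idx s7 0 1 = n" "L.tab g (idx s7 1) (reg s7 6)" using s7(2) by (auto simp: L.good_def)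
    have im7: "idx s7 1 ` {..<n} = B2" using s7(8) by (simp add: B2_def)
    have B2L: "B2 \<in> L.\<B>" using i7(3) im7 by (simp add: L.tab_def)
    obtain s8 where s8: "exec n \<omega> Output s7 s8" "frame {5} s8 s7" "\<And>l. l < n \<Longrightarrow> reg s8 5 0 l = - reg s7 6 (m + l) n"
      "steps s8 \<le> steps s7 + (3 + (n + 1) * 40)"
      using ht_ex[OF ht_Output[where ?s0.0="forget_steps s7" and d=n and \<omega>=\<omega>] refl, unfolded state_simps(1-4) frame_forget_steps i7(1,2)] by blast
    have out: "reg s8 5 0 l = (\<Sum>j\<in>B2. b j * dual_of n a B2 j l)" if l: "l < n" for l
    proof -
      have inj7: "inj_on (idx s7 1) {..<n}" and res: "residual_column n (m + n) b (idx s7 1) n (reg s7 6)"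
        and tt: "\<And>k. k < n \<Longrightarrow> reg s7 6 (m + l) k = L.co B2 (idx s7 1 k) (g (m + l))"
        using i7(3) l im7 by (auto simp: L.tab_def)
      have ga: "g (m + l) = a (m + l)" using l by (simp add: g_def)
      have "reg s8 5 0 l = (\<Sum>k<n. reg s7 6 (m + l) k * b (idx s7 1 k))"
        using s8(3)[OF l] res l b0[of "m + l"] by (simp add: residual_column_def)
      also have "\<dots> = (\<Sum>k<n. b (idx s7 1 k) * dual_of n a B2 (idx s7 1 k) l)"
        using tt ip_unit[OF l] by (intro sum.cong refl) (simp add: ga mult.commute)
      also have "\<dots> = (\<Sum>j\<in>B2. b j * dual_of n a B2 j l)"
        unfolding im7[symmetric] by (subst sum.reindex[OF inj7]) simp
      finally show ?thesis .
    qed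
    have ex: "exec n \<omega> Shadow s0 s8"
      unfolding Shadow_def Legs_def
      by (rule exec.Seq[OF s1(1) exec.Seq[OF s2(1) exec.Seq[OF exec.Seq[OF e3 exec.Seq[OF e4 exec.Seq[OF s5(1) exec.Seq[OF e6 s7(1)]]]] s8(1)]]])
    have tr8: "trace s8 = trace s7" using s8(2) by (simp add: frame_def)
    have "outcome B0 y s8"
      unfolding outcome_def Let_def
    proof (intro exI[of _ Bs1] exI[of _ Bs2], fold B1_def, fold B2_def, intro conjI)
      show "map snd (trace s8) = Basis B0 # Segment {} (Matrix.vec n ?d) (Matrix.vec n y) # map Basis Bs1 @
        Segment {} (Matrix.vec n y) (Matrix.vec n c) # map Basis Bs2"
        using tr8 s7(4,5) s5(4,5) in2 by simp
      show "feasible_set n m a b B0" "feasible_set n m a b B2" using lex_bases_feasible B0L B2L by blast+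
      show "optimal_walk n m a b ?d y 0 B0 Bs1" by (rule s5(7))
      show "optimal_walk n m a b y c 0 B1 Bs2" by (rule s7(7))
      show "optimal_for n a B0 ?d" by (simp add: optimal_for_def dual_basis_add_ip[OF dd])
      show "optimal_for n a B1 y" using nn1 by (simp add: optimal_for_def L.nonneg_on_def)
      show "optimal_for n a B2 c" using s7(9) unfolding im7 by (simp add: optimal_for_def L.nonneg_on_def)
      show "length Bs1 + length Bs2 \<le> hits n m a b ?w ?d y + hits n m a b ?w c y"
        using s5(6) s7(6) L.card_crossings_le(2)[OF genL(1)] L.card_crossings_le(1)[OF genL(2)] unfolding hits_def by linarith
      show "gaps (leg_step_cost m n) (trace s8)" using s7(10) tr8 sc by simp
      show "steps s8 \<le> prelude_cost + randomize_cost + (3 + (n + 1) * 40) + 6 + (length Bs1 + length Bs2 + 4) * leg_step_cost m n"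
        using s8(4) s7(11) s5(11) s2(3) s1(3) unfolding sc by (simp add: algebra_simps)
      show "\<forall>l<n. reg s8 5 0 l = (\<Sum>j\<in>B2. b j * dual_of n a B2 j l)" using out by blast
    qed
    then show "\<exists>s'. exec n \<omega> Shadow s0 s' \<and> outcome B0 y s'" using ex by blast
  qed
qed

end


section \<open>The expected number of pivots\<close>

lemma lex_bases_cong:
  assumes "\<And>i. i < m \<Longrightarrow> w i = w' i"
  shows "lex_bases n m a b w = lex_bases n m a b w'"
proof -
  have "slack n a w B k = slack n a w' B k" if "B \<subseteq> {..<m}" "k < m" for B k
  proof -
    have "(\<Sum>j\<in>B. ip n (dual_of n a B j) (a k) * w j) = (\<Sum>j\<in>B. ip n (dual_of n a B j) (a k) * w' j)"
      using that assms by (intro sum.cong) auto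
    then show ?thesis using that assms by (simp add: slack_def)
  qed
  then show ?thesis unfolding lex_bases_def by (intro Collect_cong) auto
qed

definition hit_formula :: "nat \<Rightarrow> (nat \<Rightarrow> nat \<Rightarrow> real) \<Rightarrow> (nat \<Rightarrow> real) \<Rightarrow> (nat \<Rightarrow> real) \<Rightarrow> nat set \<Rightarrow> nat \<Rightarrow> bool" where
  "hit_formula n a e x B j \<longleftrightarrow> (let co = \<lambda>j. ip n (dual_of n a B j) in co j e \<noteq> 0 \<and> 0 < - co j x / co j e \<and>
     (\<forall>i\<in>B - {j}. 0 < co i x + (- co j x / co j e) * co i e))"

text \<open>The fan depends on the draws, so the sum runs over all sets of rows with an indicator;
  with a fixed index set it is measurable in \<open>y\<close>.\<close>

definition count_hits :: "nat \<Rightarrow> nat \<Rightarrow> (nat \<Rightarrow> nat \<Rightarrow> real) \<Rightarrow> (nat \<Rightarrow> real) \<Rightarrow> nat set \<Rightarrow> (nat \<Rightarrow> real) \<Rightarrow> (nat \<Rightarrow> real) \<Rightarrow> ennreal" where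
  "count_hits n m a b B0 e y = (\<Sum>B\<in>Pow {..<m}. \<Sum>j\<in>B.
     of_bool (B \<in> lex_bases n m a b (pert B0 n y) \<and> hit_formula n a e y B j))"

lemma hit_formula_cong: "(\<And>l. l < n \<Longrightarrow> x l = y l) \<Longrightarrow> hit_formula n a e x B j = hit_formula n a e y B j"
  unfolding hit_formula_def Let_def using ip_cong[of n _ _ x y] by metis

lemma count_hits_lex_bases:
  "count_hits n m a b B0 e y = (\<Sum>B\<in>lex_bases n m a b (pert B0 n y). \<Sum>j\<in>B. of_bool (hit_formula n a e y B j))"
proof -
  have "(\<Sum>B\<in>lex_bases n m a b (pert B0 n y). \<Sum>j\<in>B. of_bool (hit_formula n a e y B j) :: ennreal)
    = (\<Sum>B\<in>lex_bases n m a b (pert B0 n y). \<Sum>j\<in>B. of_bool (B \<in> lex_bases n m a b (pert B0 n y) \<and> hit_formula n a e y B j))"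
    by (intro sum.cong refl) simp
  also have "\<dots> = count_hits n m a b B0 e y"
    unfolding count_hits_def
  proof (rule sum.mono_neutral_left)
    show "lex_bases n m a b (pert B0 n y) \<subseteq> Pow {..<m}" by (auto simp: lex_bases_def)
  qed (auto intro!: sum.neutral)
  finally show ?thesis ..
qed

lemma (in lp) hit_formula: "hit x e B j = hit_formula n a e x B j"
  by (simp add: hit_def hit_formula_def Let_def)

lemma count_hits_measurable: "count_hits n m a b B0 e \<in> borel_measurable (Pi\<^sub>M {..<n + m} (law n))"
proof -
  let ?M = "Pi\<^sub>M {..<n + m} (law n)"
  have coord [measurable]: "(\<lambda>y. y i) \<in> borel_measurable ?M" if "i < n + m" for i
    using measurable_component_singleton[of i "{..<n + m}" "law n"] that
    by (subst measurable_cong_sets[OF refl, of borel "law n i"]) auto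
  have pert [measurable]: "(\<lambda>y. pert B0 n y i) \<in> borel_measurable ?M" if "i < m" for i
    using coord[of "n + i"] that by (cases "i \<in> B0") (simp_all add: pert_def)
  have ip [measurable]: "(\<lambda>y. ip n u y) \<in> borel_measurable ?M" for u
    unfolding ip_def by (intro borel_measurable_sum borel_measurable_times borel_measurable_const coord) auto
  have sl: "(\<lambda>y. slack n a (pert B0 n y) B k) \<in> borel_measurable ?M" if "B \<subseteq> {..<m}" "k < m" for B k
    unfolding slack_def
    by (intro borel_measurable_diff borel_measurable_sum borel_measurable_times borel_measurable_const pert) (use that in auto)
  have "Measurable.pred ?M (\<lambda>y. B \<in> lex_bases n m a b (pert B0 n y))" if B: "B \<in> Pow {..<m}" for B
  proof -
    have "Measurable.pred ?M (\<lambda>y. lexpos (slack n a b B k) (slack n a (pert B0 n y) B k))" if "k \<in> {..<m}" for k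
    proof -
      have [measurable]: "(\<lambda>y. slack n a (pert B0 n y) B k) \<in> borel_measurable ?M" using sl B that by auto
      show ?thesis unfolding lexpos_def by measurable
    qed
    then have "Measurable.pred ?M (\<lambda>y. \<forall>k\<in>{..<m} - B. lexpos (slack n a b B k) (slack n a (pert B0 n y) B k))"
      by (intro pred_intros_finite(3)) auto
    moreover have "B \<in> lex_bases n m a b (pert B0 n y) \<longleftrightarrow>
        (\<forall>k\<in>{..<m} - B. lexpos (slack n a b B k) (slack n a (pert B0 n y) B k))" if "\<exists>u. dual_basis n a B u" for y
      using that B by (auto simp: lex_bases_def)
    moreover have "B \<notin> lex_bases n m a b (pert B0 n y)" if "\<nexists>u. dual_basis n a B u" for y
      using that by (auto simp: lex_bases_def)
    ultimately show ?thesis by (cases "\<exists>u. dual_basis n a B u") simp_all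
  qed
  note lex = this
  have hit: "Measurable.pred ?M (\<lambda>y. hit_formula n a e y B j)" if "B \<in> Pow {..<m}" for B j
  proof -
    have "finite B" using that by (auto intro: finite_subset)
    then have "Measurable.pred ?M (\<lambda>y. \<forall>i\<in>B - {j}. 0 < ip n (dual_of n a B i) y +
        (- ip n (dual_of n a B j) y / ip n (dual_of n a B j) e) * ip n (dual_of n a B i) e)"
      by (intro pred_intros_finite(3)) measurable
    then show ?thesis unfolding hit_formula_def Let_def by measurable
  qed
  have "Measurable.pred ?M (\<lambda>y. B \<in> lex_bases n m a b (pert B0 n y) \<and> hit_formula n a e y B j)" if "B \<in> Pow {..<m}" for B j
    by (rule pred_intros_logic(3)[OF lex[OF that] hit[OF that]])
  then show ?thesis unfolding count_hits_def
    by (intro borel_measurable_sum measurable_compose[OF _ measurable_of_bool]) auto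
qed

context instance_data
begin

definition leg_bound :: real where
  "leg_bound = 66 * exp 1 * (1 + ln (real n / \<delta>)) * real n ^ 3 / \<delta>"

text \<open>Almost every perturbation yields a complete fan, which therefore has a cone containing
  \<open>e\<close>, and \<open>sum_hit_probability\<close> bounds the inner integral by a constant
  that does not depend on the fan.\<close>

lemma expected_hits:
  assumes B0: "B0 \<subseteq> {..<m}" "dual_basis n a B0 u0" "\<And>j. j \<in> B0 \<Longrightarrow> z j = 0"
  shows "(\<integral>\<^sup>+\<omega>. count_hits n m a b B0 e (draws_of n m \<omega>) \<partial>tape) \<le> ennreal leg_bound"
proof -
  let ?M = "Pi\<^sub>M {n..<n + m} (law n)"
  interpret M: prob_space ?M by (rule prob_space_PiM) simp
  have le: "(\<integral>\<^sup>+x. count_hits n m a b B0 e (merge {n..<n + m} {..<n} (y, x)) \<partial>gaussn n) \<le> ennreal leg_bound"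
    if y: "\<forall>i<m. 0 < y (n + i)" "generic_rhs n m a (pert B0 n y)" for y
  proof -
    obtain bs where "lp n m a bs b (pert B0 n y) \<delta>" using perturbed_lp(1)[OF B0 y] by blast
    then interpret L: lp n m a bs b "pert B0 n y" \<delta> .
    obtain B where B: "B \<in> L.\<B>" "L.nonneg_on B e" using L.fan_complete by blast
    have lb: "lex_bases n m a b (pert B0 n (merge {n..<n + m} {..<n} (y, x))) = L.\<B>" for x
      by (rule lex_bases_cong) (simp add: pert_def merge_def)
    have hf: "hit_formula n a e (merge {n..<n + m} {..<n} (y, x)) B j = L.hit x e B j" for x B j
      unfolding L.hit_formula by (rule hit_formula_cong) (simp add: merge_def)
    have "(\<integral>\<^sup>+x. count_hits n m a b B0 e (merge {n..<n + m} {..<n} (y, x)) \<partial>gaussn n)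
      = (\<integral>\<^sup>+x. (\<Sum>B\<in>L.\<B>. \<Sum>j\<in>B. of_bool (L.hit x e B j)) \<partial>gaussn n)"
      unfolding count_hits_lex_bases lb hf ..
    also have "\<dots> = (\<Sum>B\<in>L.\<B>. \<integral>\<^sup>+x. (\<Sum>j\<in>B. of_bool (L.hit x e B j)) \<partial>gaussn n)"
      by (rule nn_integral_sum) (intro borel_measurable_sum measurable_compose[OF L.hit_measurable measurable_of_bool])
    also have "\<dots> = (\<Sum>B\<in>L.\<B>. \<Sum>j\<in>B. \<integral>\<^sup>+x. of_bool (L.hit x e B j) \<partial>gaussn n)"
      by (intro sum.cong refl nn_integral_sum measurable_compose[OF L.hit_measurable measurable_of_bool])
    also have "\<dots> \<le> ennreal leg_bound" unfolding leg_bound_def by (rule L.sum_hit_probability[OF B])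
    finally show ?thesis .
  qed
  have "(\<integral>\<^sup>+\<omega>. count_hits n m a b B0 e (draws_of n m \<omega>) \<partial>tape)
    = (\<integral>\<^sup>+y. (\<integral>\<^sup>+x. count_hits n m a b B0 e (merge {n..<n + m} {..<n} (y, x)) \<partial>gaussn n) \<partial>?M)"
    by (rule nn_integral_tape[OF count_hits_measurable])
  also have "\<dots> \<le> (\<integral>\<^sup>+y. ennreal leg_bound \<partial>?M)"
  proof (rule nn_integral_mono_AE)
    have "AE y in ?M. \<forall>i<m. 0 < y (n + i)" by (rule AE_pert_pos) auto
    moreover have "AE y in ?M. generic_rhs n m a (pert B0 n y)" by (rule AE_generic_pert[OF _ _ B0(1,2)]) auto
    ultimately show "AE y in ?M. (\<integral>\<^sup>+x. count_hits n m a b B0 e (merge {n..<n + m} {..<n} (y, x)) \<partial>gaussn n) \<le> ennreal leg_bound"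
      by eventually_elim (rule le)
  qed
  also have "\<dots> = ennreal leg_bound" by (simp add: M.emeasure_space_1)
  finally show ?thesis .
qed

lemma hits_eq_count_hits:
  assumes "lp n m a bs b (pert B0 n y) \<delta>"
  shows "of_nat (hits n m a b (pert B0 n y) e y) = count_hits n m a b B0 e y"
proof -
  interpret L: lp n m a bs b "pert B0 n y" \<delta> by fact
  show ?thesis unfolding hits_def count_hits_lex_bases L.hit_formula of_nat_sum of_nat_of_bool ..
qed

lemma outcome_pivots:
  assumes "outcome B0 y s"
  shows "bases_reported s - 1 \<le> hits n m a b (pert B0 n y) (\<lambda>l. \<Sum>k\<in>B0. a k l) y + hits n m a b (pert B0 n y) c y"
    "steps s \<le> prelude_cost + randomize_cost + (3 + (n + 1) * 40) + 6 + (bases_reported s - 1 + 4) * leg_step_cost m n"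
proof -
  obtain Bs1 Bs2 where o: "map snd (trace s) = Basis B0 # Segment {} (Matrix.vec n (\<lambda>l. \<Sum>k\<in>B0. a k l)) (Matrix.vec n y) # map Basis Bs1 @
       Segment {} (Matrix.vec n y) (Matrix.vec n c) # map Basis Bs2"
    "length Bs1 + length Bs2 \<le> hits n m a b (pert B0 n y) (\<lambda>l. \<Sum>k\<in>B0. a k l) y + hits n m a b (pert B0 n y) c y"
    "steps s \<le> prelude_cost + randomize_cost + (3 + (n + 1) * 40) + 6 + (length Bs1 + length Bs2 + 4) * leg_step_cost m n"
    using assms unfolding outcome_def Let_def by (elim exE conjE) (rule that; assumption)
  have "bases_reported s = length (filter is_basis_event (map snd (trace s)))"
    by (simp add: bases_reported_def filter_map)
  also have "\<dots> = 1 + (length Bs1 + length Bs2)" unfolding o(1) by (simp add: filter_map comp_def)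
  finally have "bases_reported s - 1 = length Bs1 + length Bs2" by simp
  then show "bases_reported s - 1 \<le> hits n m a b (pert B0 n y) (\<lambda>l. \<Sum>k\<in>B0. a k l) y + hits n m a b (pert B0 n y) c y"
    "steps s \<le> prelude_cost + randomize_cost + (3 + (n + 1) * 40) + 6 + (bases_reported s - 1 + 4) * leg_step_cost m n"
    using o by simp_all
qed

lemma expected_run:
  assumes s0: "input s0"
  obtains final B0 u0 where "mstate final" "B0 \<subseteq> {..<m}" "dual_basis n a B0 u0" "\<And>j. j \<in> B0 \<Longrightarrow> z j = 0"
    "AE \<omega> in tape. exec n \<omega> Shadow s0 (final \<omega>) \<and> outcome B0 (draws_of n m \<omega>) (final \<omega>)"
    "(\<integral>\<^sup>+\<omega>. of_nat (bases_reported (final \<omega>) - 1) \<partial>tape) \<le> 2 * ennreal leg_bound"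
proof -
  obtain B0 u0 where B0: "B0 \<subseteq> {..<m}" "dual_basis n a B0 u0" "\<And>j. j \<in> B0 \<Longrightarrow> z j = 0"
    and run: "\<And>\<omega> y. (\<And>l. l < n \<Longrightarrow> y l = fst (\<omega> l)) \<Longrightarrow> (\<And>i. i < m \<Longrightarrow> y (n + i) = snd (\<omega> (n + i))) \<Longrightarrow>
       \<forall>i<m. 0 < y (n + i) \<Longrightarrow> generic_rhs n m a (pert B0 n y) \<Longrightarrow>
       generic_direction n m a (\<lambda>l. \<Sum>k\<in>B0. a k l) y \<Longrightarrow> generic_direction n m a c y \<Longrightarrow>
       \<exists>s'. exec n \<omega> Shadow s0 s' \<and> outcome B0 y s'"
    by (rule shadow_run[OF s0]) blast
  obtain final where final: "mstate final" "\<And>\<omega> s'. exec n \<omega> Shadow s0 s' \<Longrightarrow> final \<omega> = s'"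
    by (rule final_state_measurable) blast
  let ?d = "\<lambda>l. \<Sum>k\<in>B0. a k l" and ?Y = "draws_of n m"
  let ?good = "\<lambda>y. (\<forall>i<m. 0 < y (n + i)) \<and> generic_rhs n m a (pert B0 n y) \<and>
    generic_direction n m a ?d y \<and> generic_direction n m a c y"
  have good: "AE \<omega> in tape. ?good (?Y \<omega>)"
  proof (rule AE_tape)
    let ?M = "Pi\<^sub>M {..<n + m} (law n)"
    have "AE y in ?M. \<forall>i<m. 0 < y (n + i)" by (rule AE_pert_pos) auto
    moreover have "AE y in ?M. generic_rhs n m a (pert B0 n y)" by (rule AE_generic_pert[OF _ _ B0(1,2)]) auto
    moreover have "AE y in ?M. generic_direction n m a ?d y" "AE y in ?M. generic_direction n m a c y"
      by (rule AE_generic_direction; auto)+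
    ultimately show "AE y in ?M. ?good y" by eventually_elim blast
  qed
  have ok: "exec n \<omega> Shadow s0 (final \<omega>) \<and> outcome B0 (?Y \<omega>) (final \<omega>)" if "?good (?Y \<omega>)" for \<omega>
  proof -
    have "\<exists>s'. exec n \<omega> Shadow s0 s' \<and> outcome B0 (?Y \<omega>) s'"
      by (rule run) (use that in \<open>simp_all add: draws_of_def\<close>)
    then show ?thesis using final(2) by blast
  qed
  have bound: "of_nat (bases_reported (final \<omega>) - 1) \<le> count_hits n m a b B0 ?d (?Y \<omega>) + count_hits n m a b B0 c (?Y \<omega>)"
    if g: "?good (?Y \<omega>)" for \<omega>
  proof -
    obtain bs where "lp n m a bs b (pert B0 n (?Y \<omega>)) \<delta>" using perturbed_lp(1)[OF B0, of "?Y \<omega>"] g by blast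
    note h = hits_eq_count_hits[OF this]
    have "(of_nat (bases_reported (final \<omega>) - 1) :: ennreal)
      \<le> of_nat (hits n m a b (pert B0 n (?Y \<omega>)) ?d (?Y \<omega>) + hits n m a b (pert B0 n (?Y \<omega>)) c (?Y \<omega>))"
      using outcome_pivots(1) ok[OF g] by (intro of_nat_mono) blast
    then show ?thesis by (simp only: of_nat_add h)
  qed
  show thesis
  proof (rule that[OF final(1) B0])
    show "AE \<omega> in tape. exec n \<omega> Shadow s0 (final \<omega>) \<and> outcome B0 (?Y \<omega>) (final \<omega>)"
      using good by eventually_elim (rule ok)
    have [measurable]: "(\<lambda>\<omega>. count_hits n m a b B0 e (?Y \<omega>)) \<in> borel_measurable tape" for e
      by (rule measurable_compose[OF draws_of_measurable count_hits_measurable])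
    have "(\<integral>\<^sup>+\<omega>. of_nat (bases_reported (final \<omega>) - 1) \<partial>tape)
      \<le> (\<integral>\<^sup>+\<omega>. count_hits n m a b B0 ?d (?Y \<omega>) + count_hits n m a b B0 c (?Y \<omega>) \<partial>tape)"
    proof (rule nn_integral_mono_AE)
      show "AE \<omega> in tape. of_nat (bases_reported (final \<omega>) - 1)
        \<le> count_hits n m a b B0 ?d (?Y \<omega>) + count_hits n m a b B0 c (?Y \<omega>)"
        using good by eventually_elim (rule bound)
    qed
    also have "\<dots> = (\<integral>\<^sup>+\<omega>. count_hits n m a b B0 ?d (?Y \<omega>) \<partial>tape) + (\<integral>\<^sup>+\<omega>. count_hits n m a b B0 c (?Y \<omega>) \<partial>tape)"
      by (rule nn_integral_add) measurable
    also have "\<dots> \<le> ennreal leg_bound + ennreal leg_bound" by (intro add_mono expected_hits[OF B0])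
    finally show "(\<integral>\<^sup>+\<omega>. of_nat (bases_reported (final \<omega>) - 1) \<partial>tape) \<le> 2 * ennreal leg_bound" by (simp add: mult_2)
  qed
qed

end


section \<open>Matrices and coordinates\<close>

text \<open>Matrices and vectors as total functions, extended by zeros as in the input of a program.\<close>

definition entries :: "rmat \<Rightarrow> nat \<Rightarrow> nat \<Rightarrow> real" where
  "entries A = (\<lambda>s l. if s < dim_row A \<and> l < dim_col A then A $$ (s, l) else 0)"

definition coords :: "rvec \<Rightarrow> nat \<Rightarrow> real" where
  "coords x = (\<lambda>l. if l < dim_vec x then x $ l else 0)"

lemma ip_coords:
  "ip n (coords (Matrix.vec n y)) x = ip n y x" "ip n x (coords (Matrix.vec n y)) = ip n x y"
  by (rule ip_cong; simp add: coords_def)+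

lemma scalar_prod_ip: "x \<in> carrier_vec n \<Longrightarrow> y \<in> carrier_vec n \<Longrightarrow> scalar_prod x y = ip n (coords x) (coords y)"
  unfolding scalar_prod_def ip_def by (intro sum.cong) (auto simp: coords_def)

lemma eucl_norm_nrm: "x \<in> carrier_vec n \<Longrightarrow> eucl_norm x = nrm n (coords x)"
  by (simp add: eucl_norm_def scalar_prod_ip L2_set_def ip_def power2_eq_square)

lemma nrm_coords: "nrm n (coords (Matrix.vec n y)) = nrm n y"
  unfolding L2_set_def by (intro arg_cong[of _ _ sqrt] sum.cong) (auto simp: coords_def)

lemma coords_row: "s < dim_row A \<Longrightarrow> coords (row A s) = entries A s"
  by (auto simp: coords_def entries_def fun_eq_iff)

lemma row_scalar_prod:
  assumes "A \<in> carrier_mat m n" "x \<in> carrier_vec n" "s < m"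
  shows "scalar_prod (row A s) x = ip n (entries A s) (coords x)"
proof -
  have "row A s \<in> carrier_vec n" using assms by auto
  then show ?thesis using assms coords_row[of s A] by (simp add: scalar_prod_ip[of _ n])
qed

lemma feasible_region_iff:
  assumes "A \<in> carrier_mat m n" "b \<in> carrier_vec m"
  shows "x \<in> feasible_region A b \<longleftrightarrow> x \<in> carrier_vec n \<and> (\<forall>s<m. ip n (entries A s) (coords x) \<le> coords b s)"
  using assms row_scalar_prod[OF assms(1)] by (auto simp: feasible_region_def less_eq_vec_def coords_def)

lemma feasible_vec_iff:
  assumes "A \<in> carrier_mat m n" "b \<in> carrier_vec m"
  shows "Matrix.vec n y \<in> feasible_region A b \<longleftrightarrow> (\<forall>s<m. ip n (entries A s) y \<le> coords b s)"
  by (simp add: feasible_region_iff[OF assms] ip_coords)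

text \<open>Small steps along a nonzero \<open>y\<close> in both directions would keep the tight
  constraints tight and the others satisfied, making \<open>v\<close> the midpoint of two distinct
  feasible points.\<close>

lemma vertex_rigid:
  assumes A: "A \<in> carrier_mat m n" "b \<in> carrier_vec m" and v: "vertex (feasible_region A b) v"
    and tight: "\<And>r. r < m \<Longrightarrow> ip n (entries A r) (coords v) = coords b r \<Longrightarrow> ip n (entries A r) y = 0"
    and l: "l < n"
  shows "y l = 0"
proof (rule ccontr)
  assume ne: "y l \<noteq> 0"
  let ?v = "coords v"
  let ?S = "{r. r < m \<and> ip n (entries A r) ?v \<noteq> coords b r}"
  have vP: "v \<in> feasible_region A b" using v by (simp add: vertex_def)
  have vn: "v \<in> carrier_vec n" and vle: "\<And>r. r < m \<Longrightarrow> ip n (entries A r) ?v \<le> coords b r"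
    using vP by (simp_all add: feasible_region_iff[OF A])
  have "\<exists>\<epsilon>>0. \<forall>r\<in>?S. 0 < (coords b r - ip n (entries A r) ?v) + \<epsilon> * - \<bar>ip n (entries A r) y\<bar>"
    by (rule finite_lexpos_perturbation) (use vle in \<open>auto simp: lexpos_def less_le\<close>)
  then obtain \<epsilon> where \<epsilon>: "0 < \<epsilon>"
    "\<And>r. r \<in> ?S \<Longrightarrow> \<epsilon> * \<bar>ip n (entries A r) y\<bar> < coords b r - ip n (entries A r) ?v" by fastforce
  have feas: "Matrix.vec n (\<lambda>l. ?v l + s * y l) \<in> feasible_region A b" if s: "\<bar>s\<bar> = \<epsilon>" for s
    unfolding feasible_vec_iff[OF A]
  proof (intro allI impI)
    fix r assume r: "r < m"
    have "s * ip n (entries A r) y \<le> \<epsilon> * \<bar>ip n (entries A r) y\<bar>" using s by (metis abs_ge_self abs_mult)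
    then show "ip n (entries A r) (\<lambda>l. ?v l + s * y l) \<le> coords b r"
      using \<epsilon>(2)[of r] tight[OF r] r by (cases "r \<in> ?S") (auto simp: ip_add_right ip_scale_right)
  qed
  let ?y = "Matrix.vec n (\<lambda>l. ?v l + \<epsilon> * y l)" and ?z = "Matrix.vec n (\<lambda>l. ?v l + (- \<epsilon>) * y l)"
  have "?y $ l \<noteq> ?z $ l" using l ne \<epsilon>(1) by simp
  then have "?y \<noteq> ?z" by metis
  moreover have "v = (1 - 1 / 2) \<cdot>\<^sub>v ?y + (1 / 2) \<cdot>\<^sub>v ?z"
    using vn by (intro eq_vecI) (auto simp: coords_def field_simps)
  moreover have "?y \<in> feasible_region A b" "?z \<in> feasible_region A b" using feas[of \<epsilon>] feas[of "- \<epsilon>"] \<epsilon>(1) by simp_all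
  moreover have "0 < (1 / 2 :: real)" "(1 / 2 :: real) < 1" by simp_all
  ultimately show False using v unfolding vertex_def by blast
qed

lemma bounded_no_recession:
  assumes A: "A \<in> carrier_mat m n" "b \<in> carrier_vec m" and bd: "bounded_vecs (feasible_region A b)"
    and v: "v \<in> feasible_region A b" and y: "\<And>r. r < m \<Longrightarrow> ip n (entries A r) y \<le> 0" and l: "l < n"
  shows "y l = 0"
proof (rule ccontr)
  assume ne: "y l \<noteq> 0"
  obtain R where R: "\<And>x. x \<in> feasible_region A b \<Longrightarrow> eucl_norm x \<le> R" using bd by (auto simp: bounded_vecs_def)
  have vn: "v \<in> carrier_vec n" and vle: "\<And>r. r < m \<Longrightarrow> ip n (entries A r) (coords v) \<le> coords b r"
    using v by (simp_all add: feasible_region_iff[OF A])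
  \<comment> \<open>So large that coordinate \<open>l\<close> alone pushes the norm beyond
    \<open>R\<close>.\<close>
  define t where "t = (\<bar>R\<bar> + \<bar>coords v l\<bar> + 1) / \<bar>y l\<bar>"
  have t: "0 \<le> t" "t * \<bar>y l\<bar> = \<bar>R\<bar> + \<bar>coords v l\<bar> + 1" using ne by (simp_all add: t_def)
  let ?x = "\<lambda>l. coords v l + t * y l"
  have "Matrix.vec n ?x \<in> feasible_region A b"
    unfolding feasible_vec_iff[OF A] ip_add_right ip_scale_right
    using vle y t(1) by (metis add.right_neutral add_mono mult_nonneg_nonpos)
  then have "eucl_norm (Matrix.vec n ?x) \<le> R" by (rule R)
  then have "nrm n ?x \<le> R" using eucl_norm_nrm[of "Matrix.vec n ?x" n] by (simp add: nrm_coords)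
  moreover have "\<bar>?x l\<bar> \<le> nrm n ?x" using member_le_L2_set[of "{..<n}" l "\<lambda>l. \<bar>?x l\<bar>"] l
    by (simp add: L2_set_def)
  moreover have "t * \<bar>y l\<bar> - \<bar>coords v l\<bar> \<le> \<bar>?x l\<bar>" using t(1) by (simp add: abs_mult flip: abs_of_nonneg)
  ultimately show False using t(2) by linarith
qed

text \<open>Pairing a vanishing combination of rows with \<open>u j\<close> isolates the coefficient
  of row \<open>j\<close>.\<close>

lemma dual_basis_is_basis:
  assumes A: "A \<in> carrier_mat m n" and B: "B \<subseteq> {..<m}" and d: "dual_basis n (entries A) B u"
  shows "is_basis A B"
  unfolding is_basis_def
proof (intro conjI)
  interpret vec_space "TYPE(real)" n .
  have ip_row: "ip n (u j) (coords (row A i)) = (if i = j then 1 else 0)" if "i \<in> B" "j \<in> B" for i j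
    using dual_basisD(3)[OF d that] coords_row[of i A] that(1) A B by auto
  show "B \<subseteq> {..<dim_row A}" using A B by simp
  show "card B = dim_col A" using A dual_basisD(2)[OF d] by simp
  show "inj_on (row A) B" using ip_row by (intro inj_onI) (metis zero_neq_one)
  have "\<not> lin_dep (row A ` B)"
  proof
    assume "lin_dep (row A ` B)"
    then obtain X f x where X: "finite X" "X \<subseteq> row A ` B" "lincomb f X = 0\<^sub>v n" "x \<in> X" "f x \<noteq> 0"
      by (auto simp: lin_dep_def)
    have "row A ` B \<subseteq> carrier_vec n" using A by auto
    then have Xn: "X \<subseteq> carrier_vec n" using X(2) by blast
    obtain j where j: "j \<in> B" "x = row A j" using X(2,4) by auto
    have "0 = ip n (u j) (coords (lincomb f X))"
      unfolding X(3) by (simp add: ip_def coords_def)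
    also have "\<dots> = ip n (u j) (\<lambda>l. \<Sum>x\<in>X. f x * coords x l)"
    proof (rule ip_cong)
      fix l assume l: "l < n"
      have "coords (lincomb f X) l = lincomb f X $ l" using l lincomb_dim[OF X(1) Xn] by (simp add: coords_def)
      also have "\<dots> = (\<Sum>x\<in>X. f x * x $ l)" by (rule lincomb_index[OF l Xn])
      also have "\<dots> = (\<Sum>x\<in>X. f x * coords x l)" using Xn l by (intro sum.cong) (auto simp: coords_def)
      finally show "coords (lincomb f X) l = (\<Sum>x\<in>X. f x * coords x l)" .
    qed simp
    also have "\<dots> = (\<Sum>x'\<in>X. f x' * ip n (u j) (coords x'))" by (rule ip_sum_right)
    also have "\<dots> = (\<Sum>x'\<in>X. if x' = x then f x else 0)"
    proof (rule sum.cong[OF refl])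
      fix x' assume "x' \<in> X"
      then obtain i where "i \<in> B" "x' = row A i" using X(2) by auto
      then show "f x' * ip n (u j) (coords x') = (if x' = x then f x else 0)"
        using ip_row[OF \<open>i \<in> B\<close> j(1)] ip_row[OF j(1) j(1)] j(2) by auto
    qed
    also have "\<dots> = f x" using X(1,4) by simp
    finally show False using X(5) by simp
  qed
  then show "lin_indep (dim_col A) (row A ` B)" using A by simp
qed

text \<open>The foot of the perpendicular is explicit: row \<open>j\<close> minus
  \<open>u j / q\<close> is orthogonal to \<open>u j\<close>, so its expansion avoids row
  \<open>j\<close>, and it has distance \<open>1 / nrm n (u j)\<close> from that row. Comparing with
  this one point of the span suffices.\<close>

lemma dual_basis_dist:
  assumes A: "A \<in> carrier_mat m n" and B: "B \<subseteq> {..<m}" and d: "dual_basis n (entries A) B u" and j: "j \<in> B"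
  shows "dist_to (row A j) (span_of n (row A ` (B - {j}))) * nrm n (u j) \<le> 1"
proof -
  interpret vec_space "TYPE(real)" n .
  let ?a = "entries A" and ?X = "row A ` (B - {j})"
  have fin: "finite B" by (rule dual_basisD(1)[OF d])
  have Am: "dim_row A = m" "dim_col A = n" using A by auto
  have one: "ip n (u j) (?a j) = 1" using dual_basisD(3)[OF d j j] by simp
  define q where "q = ip n (u j) (u j)"
  have q: "q = (nrm n (u j))\<^sup>2" by (simp add: q_def nrm_sq)
  have "nrm n (u j) \<noteq> 0" using one ip_le_nrm[of n "u j" "?a j"] by auto
  then have pos: "0 < nrm n (u j)" by (simp add: less_le)
  then have q0: "q \<noteq> 0" by (simp add: q)
  define y where "y = (\<lambda>l. ?a j l - (1 / q) * u j l)"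
  have "ip n (u j) y = 1 - (1 / q) * q" unfolding y_def ip_diff_right ip_scale_right one q_def ..
  then have uy: "ip n (u j) y = 0" using q0 by simp
  have inj: "inj_on (row A) B" using dual_basis_is_basis[OF A B d] by (simp add: is_basis_def)
  define f where "f = (\<lambda>x. ip n (u (the_inv_into B (row A) x)) y)"
  have Xn: "?X \<subseteq> carrier_vec n" using A by auto
  have "Matrix.vec n y = lincomb f ?X"
  proof (rule eq_vecI)
    show "dim_vec (Matrix.vec n y) = dim_vec (lincomb f ?X)" using lincomb_dim[OF _ Xn] fin by simp
    fix l assume "l < dim_vec (lincomb f ?X)"
    then have l: "l < n" using lincomb_dim[OF _ Xn] fin by simp
    have "lincomb f ?X $ l = (\<Sum>x\<in>?X. f x * x $ l)" by (rule lincomb_index[OF l Xn])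
    also have "\<dots> = (\<Sum>i\<in>B - {j}. f (row A i) * row A i $ l)"
      using inj by (subst sum.reindex) (auto intro: inj_on_subset)
    also have "\<dots> = (\<Sum>i\<in>B - {j}. ip n (u i) y * ?a i l)"
      using B l Am inj by (intro sum.cong refl) (auto simp: f_def the_inv_into_f_f entries_def)
    also have "\<dots> = (\<Sum>i\<in>B. ip n (u i) y * ?a i l)" using fin j uy by (simp add: sum.remove)
    also have "\<dots> = y l" by (rule dual_basisD(4)[OF d l, symmetric])
    finally show "Matrix.vec n y $ l = lincomb f ?X $ l" using l by simp
  qed
  then have yS: "Matrix.vec n y \<in> span ?X" using fin unfolding span_def by auto
  have "dist_to (row A j) (span ?X) \<le> eucl_norm (row A j - Matrix.vec n y)"
    unfolding dist_to_def
  proof (rule cINF_lower[OF _ yS])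
    show "bdd_below ((\<lambda>y. eucl_norm (row A j - y)) ` span ?X)"
      by (rule bdd_belowI[of _ 0]) (auto simp: eucl_norm_def scalar_prod_def intro!: sum_nonneg)
  qed
  also have "row A j - Matrix.vec n y = Matrix.vec n (\<lambda>l. (1 / q) * u j l)"
    using j B Am by (intro eq_vecI) (auto simp: y_def entries_def)
  also have "eucl_norm (Matrix.vec n (\<lambda>l. (1 / q) * u j l)) = nrm n (\<lambda>l. (1 / q) * u j l)"
    by (simp add: eucl_norm_nrm[of _ n] nrm_coords)
  also have "\<dots> = (1 / q) * nrm n (u j)" using q by (intro L2_set_right_distrib[symmetric]) simp
  finally have "dist_to (row A j) (span ?X) * nrm n (u j) \<le> (1 / q) * nrm n (u j) * nrm n (u j)"
    using pos by (intro mult_right_mono) auto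
  also have "\<dots> = 1" using pos by (simp add: q power2_eq_square)
  finally show ?thesis .
qed

section \<open>Basic solutions, vertices and optimality\<close>

definition basic_solution :: "nat \<Rightarrow> (nat \<Rightarrow> nat \<Rightarrow> real) \<Rightarrow> (nat \<Rightarrow> real) \<Rightarrow> nat set \<Rightarrow> (nat \<Rightarrow> nat \<Rightarrow> real) \<Rightarrow> rvec" where
  "basic_solution n a b B u = Matrix.vec n (\<lambda>l. \<Sum>j\<in>B. b j * u j l)"

lemma ip_basic_solution:
  "ip n y (coords (basic_solution n a b B u)) = (\<Sum>j\<in>B. b j * ip n (u j) y)"
  unfolding basic_solution_def ip_coords by (simp add: ip_sum_right ip_commute[of n y])

lemma basic_solution_tight:
  assumes "dual_basis n a B u" "i \<in> B"
  shows "ip n (a i) (coords (basic_solution n a b B u)) = b i"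
proof -
  have "(\<Sum>j\<in>B. b j * ip n (u j) (a i)) = (\<Sum>j\<in>B. if i = j then b j else 0)"
    using dual_basisD(3)[OF assms(1,2)] by (intro sum.cong) auto
  then show ?thesis unfolding ip_basic_solution using dual_basisD(1)[OF assms(1)] assms(2) by simp
qed

lemma basic_point_iff:
  assumes "A \<in> carrier_mat m n" "b \<in> carrier_vec m" "B \<subseteq> {..<m}"
  shows "basic_point A b B x \<longleftrightarrow> x \<in> carrier_vec n \<and> (\<forall>i\<in>B. ip n (entries A i) (coords x) = coords b i)"
  using assms row_scalar_prod[OF assms(1)] by (auto simp: basic_point_def coords_def subset_iff)

lemma basic_solution_point:
  assumes A: "A \<in> carrier_mat m n" "b \<in> carrier_vec m" and B: "B \<subseteq> {..<m}" and d: "dual_basis n (entries A) B u"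
  shows "basic_point A b B (basic_solution n (entries A) (coords b) B u)"
  unfolding basic_point_iff[OF A B] using basic_solution_tight[OF d] by (simp add: basic_solution_def)

lemma basic_solution_feasible:
  assumes A: "A \<in> carrier_mat m n" "b \<in> carrier_vec m"
    and le: "\<And>k. k < m \<Longrightarrow> (\<Sum>j\<in>B. ip n (u j) (entries A k) * coords b j) \<le> coords b k"
  shows "basic_solution n (entries A) (coords b) B u \<in> feasible_region A b"
  unfolding feasible_region_iff[OF A] ip_basic_solution using le by (simp add: basic_solution_def mult.commute)

lemma dual_basis_feasible:
  assumes A: "A \<in> carrier_mat m n" "b \<in> carrier_vec m" and B: "B \<subseteq> {..<m}" and d: "dual_basis n (entries A) B u"
    and le: "\<And>k. k < m \<Longrightarrow> (\<Sum>j\<in>B. ip n (u j) (entries A k) * coords b j) \<le> coords b k"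
  shows "feasible_basis A b B"
  unfolding feasible_basis_def
  using dual_basis_is_basis[OF A(1) B d] basic_solution_feasible[OF A le] basic_solution_point[OF A B d] by blast

text \<open>A constraint that is tight at a proper convex combination of feasible points is tight at
  both of them, and the rows of a basis determine the point.\<close>

lemma basic_point_vertex:
  assumes A: "A \<in> carrier_mat m n" "b \<in> carrier_vec m" and B: "B \<subseteq> {..<m}" and d: "dual_basis n (entries A) B u"
    and x: "basic_point A b B x" "x \<in> feasible_region A b"
  shows "vertex (feasible_region A b) x"
  unfolding vertex_def
proof (intro conjI notI x(2))
  assume "\<exists>y\<in>feasible_region A b. \<exists>z\<in>feasible_region A b. y \<noteq> z \<and> (\<exists>u. 0 < u \<and> u < 1 \<and> x = (1 - u) \<cdot>\<^sub>v y + u \<cdot>\<^sub>v z)"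
  then obtain y z r where y: "y \<in> feasible_region A b" and z: "z \<in> feasible_region A b" and ne: "y \<noteq> z"
    and r: "0 < r" "r < 1" "x = (1 - r) \<cdot>\<^sub>v y + r \<cdot>\<^sub>v z" by blast
  have yn: "y \<in> carrier_vec n" and zn: "z \<in> carrier_vec n" using y z by (simp_all add: feasible_region_iff[OF A])
  have xc: "ip n w (coords x) = (1 - r) * ip n w (coords y) + r * ip n w (coords z)" for w
  proof -
    have "ip n w (coords x) = ip n w (\<lambda>l. (1 - r) * coords y l + r * coords z l)"
      using yn zn unfolding r(3) by (intro ip_cong) (auto simp: coords_def)
    then show ?thesis by (simp only: ip_add_right ip_scale_right)
  qed
  have tight: "ip n (entries A i) (coords y) = ip n (entries A i) (coords z)" if i: "i \<in> B" for i
  proof -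
    let ?p = "ip n (entries A i) (coords y)" and ?q = "ip n (entries A i) (coords z)"
    have im: "i < m" using i B by auto
    have le: "?p \<le> coords b i" "?q \<le> coords b i" using y z im by (simp_all add: feasible_region_iff[OF A])
    have eq: "(1 - r) * (coords b i - ?p) + r * (coords b i - ?q) = 0"
      using x(1) i xc[of "entries A i"] by (simp add: basic_point_iff[OF A B] algebra_simps)
    have "(1 - r) * (coords b i - ?p) = 0" "r * (coords b i - ?q) = 0"
      using eq le r(1,2) by (smt (verit) mult_nonneg_nonneg)+
    then show ?thesis using r(1,2) by simp
  qed
  have "coords y l = coords z l" if "l < n" for l
  proof -
    define e where "e = (\<lambda>l'. if l' = l then 1 else 0 :: real)"
    have el: "ip n e w = w l" for w using that by (simp add: ip_def e_def if_distrib[of "\<lambda>x. x * _"] cong: if_cong)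
    have ex: "ip n e w = (\<Sum>j\<in>B. ip n (u j) e * ip n w (entries A j))" for w
      using dual_basis_expand_right[OF d, of w e] by (simp add: ip_commute[of n e])
    show ?thesis using ex[of "coords y"] ex[of "coords z"] tight el by (simp add: ip_commute)
  qed
  then have "y = z" using yn zn by (intro eq_vecI) (auto simp: coords_def)
  then show False using ne by simp
qed

lemma optimal_basis_iff_dual:
  assumes A: "A \<in> carrier_mat m n" and B: "B \<subseteq> {..<m}" and d: "dual_basis n (entries A) B u"
    and nn: "\<And>j. j \<in> B \<Longrightarrow> 0 \<le> ip n (u j) y"
  shows "optimal_basis A {} (Matrix.vec n y) B"
  unfolding optimal_basis_def
proof (intro conjI exI[of _ "\<lambda>j. ip n (u j) y"])
  have "y l = (\<Sum>i\<in>B. ip n (u i) y * A $$ (i, l))" if l: "l < n" for l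
    unfolding dual_basisD(4)[OF d l, of y] using A B l by (intro sum.cong) (auto simp: entries_def)
  then show "Matrix.vec n y = Matrix.vec (dim_col A) (\<lambda>l. \<Sum>i\<in>B. ip n (u i) y * A $$ (i, l))" using A by auto
qed (use nn in auto)

lemma optimal_basic_point:
  assumes A: "A \<in> carrier_mat m n" "b \<in> carrier_vec m" and B: "B \<subseteq> {..<m}" and d: "dual_basis n (entries A) B u"
    and nn: "\<And>j. j \<in> B \<Longrightarrow> 0 \<le> ip n (u j) (coords c)" and c: "c \<in> carrier_vec n"
    and x: "basic_point A b B x" and y: "y \<in> feasible_region A b"
  shows "scalar_prod c y \<le> scalar_prod c x"
proof -
  have xn: "x \<in> carrier_vec n" and yn: "y \<in> carrier_vec n"
    using x y by (simp_all add: feasible_region_iff[OF A] basic_point_iff[OF A B])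
  have ex: "scalar_prod c w = (\<Sum>j\<in>B. ip n (u j) (coords c) * ip n (entries A j) (coords w))" if "w \<in> carrier_vec n" for w
    unfolding scalar_prod_ip[OF c that]
    using dual_basis_expand_right[OF d, of "coords w" "coords c"] by (simp add: ip_commute)
  show ?thesis unfolding ex[OF xn] ex[OF yn]
    using nn x y B by (intro sum_mono mult_left_mono) (auto simp: feasible_region_iff[OF A] basic_point_iff[OF A B])
qed

lemma optimal_walk_times:
  assumes "optimal_walk n m a b p q t B Bs"
  shows "\<exists>ts. length ts = length Bs \<and> sorted (t # ts) \<and> (\<forall>k<length Bs. adjacent ((B # Bs) ! k) (Bs ! k) \<and>
    feasible_set n m a b (Bs ! k) \<and> optimal_for n a ((B # Bs) ! k) (\<lambda>l. p l + ts ! k * q l) \<and>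
    optimal_for n a (Bs ! k) (\<lambda>l. p l + ts ! k * q l))"
  using assms
proof (induction Bs arbitrary: t B)
  case (Cons B' Bs)
  then obtain t' where t': "t \<le> t'" "adjacent B B'" "feasible_set n m a b B'"
    "optimal_for n a B (\<lambda>l. p l + t' * q l)" "optimal_for n a B' (\<lambda>l. p l + t' * q l)"
    "optimal_walk n m a b p q t' B' Bs" by auto
  obtain ts where ts: "length ts = length Bs" "sorted (t' # ts)" "\<forall>k<length Bs. adjacent ((B' # Bs) ! k) (Bs ! k) \<and>
    feasible_set n m a b (Bs ! k) \<and> optimal_for n a ((B' # Bs) ! k) (\<lambda>l. p l + ts ! k * q l) \<and>
    optimal_for n a (Bs ! k) (\<lambda>l. p l + ts ! k * q l)" using Cons.IH[OF t'(6)] by blast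
  show ?case
    by (rule exI[of _ "t' # ts"]) (use ts t' in \<open>auto simp: less_Suc_eq_0_disj all_conj_distrib\<close>)
qed simp


section \<open>Explicit constants for the cost bounds\<close>

lemma pivot_cost_mn:
  assumes "1 \<le> n" "n \<le> m"
  shows "pivot_cost m n \<le> 2300 * (m * n)"
proof -
  define P where "P = (m + n + 4) * (100 + (n + 3) * 60)"
  have "P \<le> (6 * m) * (340 * n)" unfolding P_def using assms by (intro mult_le_mono) auto
  then have "P \<le> 2040 * (m * n)" by simp
  moreover have "n \<le> m * n" "1 \<le> m * n" using assms by auto
  \<comment> \<open>The product \<open>m * n\<close> is replaced by a variable, which makes the
    arithmetic linear.\<close>
  moreover have "P \<le> 2040 * X \<Longrightarrow> n \<le> X \<Longrightarrow> 1 \<le> X \<Longrightarrow> 100 + (n + 3) * 40 + P \<le> 2300 * X" for X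
    by (simp add: algebra_simps)
  ultimately show ?thesis unfolding pivot_cost_def P_def[symmetric] by blast
qed

lemma leg_step_cost_le:
  assumes "1 \<le> n" "n \<le> m"
  shows "leg_step_cost m n \<le> 3100 * (m * n)"
proof -
  have "n \<le> m * n" "m \<le> m * n" "1 \<le> m * n" using assms by auto
  moreover have "m \<le> X \<Longrightarrow> n \<le> X \<Longrightarrow> 1 \<le> X \<Longrightarrow> p \<le> 2300 * X \<Longrightarrow>
    7 + (m + 1) * 200 + p + (7 + (n + 1) * 150) + 10 \<le> 3100 * X" for X p by (simp add: algebra_simps)
  ultimately show ?thesis using pivot_cost_mn[OF assms] unfolding leg_step_cost_def enter_cost_def find_cost_def by blast
qed

context instance_data
begin

lemma start_feasible:
  assumes B0: "B0 \<subseteq> {..<m}" "dual_basis n a B0 u0" "\<And>j. j \<in> B0 \<Longrightarrow> z j = 0"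
  shows "feasible_set n m a b B0"
proof -
  have d0: "dual_basis n a B0 (dual_of n a B0)" by (rule dual_of[OF B0(2)])
  have "0 \<le> slack n a b B0 k" if k: "k < m" for k
  proof -
    have "(\<Sum>j\<in>B0. ip n (dual_of n a B0 j) (a k) * b j) = (\<Sum>j\<in>B0. ip n (dual_of n a B0 j) (a k) * ip n v (a j))"
      using B0(3) by (intro sum.cong refl) (simp add: z_def ip_commute)
    also have "\<dots> = ip n v (a k)" by (rule dual_basis_expand_right[OF d0, symmetric])
    finally show ?thesis using k feas[OF k] by (simp add: slack_def ip_commute a_constraint)
  qed
  then show ?thesis using B0(1,2) by (auto simp: feasible_set_def)
qed

lemma delta_le_one:
  assumes "feasible_set n m a b B"
  shows "\<delta> \<le> 1"
proof -
  have d: "dual_basis n a B (dual_of n a B)" using assms dual_of by (auto simp: feasible_set_def)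
  obtain j where j: "j \<in> B" using dual_basisD(2)[OF d] n_pos by fastforce
  have "1 \<le> nrm n (dual_of n a B j) * nrm n (a j)"
    using dual_basisD(3)[OF d j j] ip_le_nrm[of n "dual_of n a B j" "a j"] by simp
  also have "\<dots> \<le> 1 / \<delta>" by (rule feasible_dist[OF assms j])
  finally show ?thesis using delta_pos by (simp add: field_simps)
qed

text \<open>Finding the start basis takes \<open>n\<close> pivots of cost \<open>O(m n)\<close>,
  which dominates the setup. The extra factor \<open>n\<close> is absorbed later through
  \<open>le_pivot_bound\<close>.\<close>

lemma overhead_le:
  assumes "n \<le> m"
  shows "prelude_cost + randomize_cost + (3 + (n + 1) * 40) + 6 \<le> 10000 * (m * n * n)"
proof -
  have n1: "1 \<le> n" using n_pos by simp
  have o: "n \<le> m * n * n" "m \<le> m * n * n" "1 \<le> m * n * n" "m * n \<le> m * n * n" "n * n \<le> m * n * n" using n1 assms by auto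
  define P1 where "P1 = (m + 1) * (60 + 2 * (n + 1) * 60)"
  define P2 where "P2 = (n + 1) * (100 + (m + 1) * 80 + pivot_cost m n)"
  define P3 where "P3 = (n + 1) * (30 + (n + 1) * 40)"
  define P4 where "P4 = (n + 1) * (60 + (n + 1) * 60)"
  have "P1 \<le> (2 * m) * (300 * n)" unfolding P1_def using n1 assms by (intro mult_le_mono) auto
  then have "P1 \<le> 600 * (m * n)" by simp
  moreover have "P2 \<le> (2 * n) * (2560 * (m * n))"
    unfolding P2_def
  proof (rule mult_le_mono)
    have "m \<le> m * n" "1 \<le> m * n" using n1 assms by auto
    moreover have "m \<le> X \<Longrightarrow> 1 \<le> X \<Longrightarrow> p \<le> 2300 * X \<Longrightarrow> 100 + (m + 1) * 80 + p \<le> 2560 * X" for X p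
      by (simp add: algebra_simps)
    ultimately show "100 + (m + 1) * 80 + pivot_cost m n \<le> 2560 * (m * n)" using pivot_cost_mn[OF n1 assms] by blast
  qed (use n1 in auto)
  then have "P2 \<le> 5120 * (m * n * n)" by (simp add: mult_ac)
  moreover have "P3 \<le> (2 * n) * (110 * n)" "P4 \<le> (2 * n) * (180 * n)"
    unfolding P3_def P4_def using n1 by (intro mult_le_mono; auto)+
  then have "P3 \<le> 220 * (n * n)" "P4 \<le> 360 * (n * n)" by simp_all
  moreover have "P1 \<le> 600 * X \<Longrightarrow> P2 \<le> 5120 * Y \<Longrightarrow> P3 \<le> 220 * Z \<Longrightarrow> P4 \<le> 360 * Z \<Longrightarrow>
    n \<le> Y \<Longrightarrow> m \<le> Y \<Longrightarrow> 1 \<le> Y \<Longrightarrow> X \<le> Y \<Longrightarrow> Z \<le> Y \<Longrightarrow>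
    3 + P1 + (3 + (n + 1) * 80 + (3 + P2)) + (3 + (n + 1) * 30 + (3 + (m + 1) * 30) + (3 + (n + 1) * 30) +
      (3 + P3) + 3 * (3 + P4)) + (3 + (n + 1) * 40) + 6 \<le> 10000 * Y" for X Y Z by (simp add: algebra_simps)
  ultimately show ?thesis using o unfolding prelude_cost_def randomize_cost_def
      P1_def[symmetric] P2_def[symmetric] P3_def[symmetric] P4_def[symmetric] by blast
qed

text \<open>The two legs give \<open>2 * 66 = 132\<close>; bounding \<open>exp 1\<close> by 3 and
  \<open>1 + x\<close> by \<open>2 * max 1 x\<close> contributes the remaining factor 6.\<close>

lemma leg_bound_le: "2 * leg_bound \<le> 792 * pivot_bound n \<delta>"
proof -
  let ?L = "ln (real n / \<delta>)"
  have "exp 1 * (1 + ?L) \<le> 3 * (2 * max 1 ?L)"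
  proof (cases "0 \<le> 1 + ?L")
    case True
    then show ?thesis using exp_le by (intro mult_mono) auto
  next
    case False
    then have "exp 1 * (1 + ?L) \<le> 0" by (simp add: mult_le_0_iff)
    then show ?thesis by simp
  qed
  then have "exp 1 * (1 + ?L) * (132 * (real n ^ 3 / \<delta>)) \<le> 3 * (2 * max 1 ?L) * (132 * (real n ^ 3 / \<delta>))"
    using delta_pos by (intro mult_right_mono) auto
  moreover have "0 \<le> real n ^ 3 / \<delta> * max 1 ?L" using delta_pos by simp
  ultimately show ?thesis unfolding leg_bound_def pivot_bound_def by (simp add: algebra_simps)
qed

lemma le_pivot_bound:
  assumes "\<delta> \<le> 1"
  shows "real n \<le> pivot_bound n \<delta>"
proof -
  have "real n * 1 \<le> real n * (real n)\<^sup>2" using n_pos by (intro mult_left_mono) auto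
  also have "\<dots> = real n ^ 3 / 1" by (simp add: power3_eq_cube power2_eq_square)
  also have "real n ^ 3 / 1 \<le> real n ^ 3 / \<delta>" using assms delta_pos by (intro divide_left_mono) auto
  also have "\<dots> \<le> real n ^ 3 / \<delta> * max 1 (ln (real n / \<delta>))"
    using delta_pos mult_left_mono[of 1 "max 1 (ln (real n / \<delta>))" "real n ^ 3 / \<delta>"] by simp
  finally show ?thesis by (simp add: pivot_bound_def)
qed

end

lemma integral_le_nn_integral:
  fixes f :: "'a \<Rightarrow> real"
  assumes "f \<in> borel_measurable M" "AE x in M. 0 \<le> f x" "(\<integral>\<^sup>+x. ennreal (f x) \<partial>M) \<le> ennreal c" "0 \<le> c"
  shows "integrable M f" "(LINT x|M. f x) \<le> c"
proof -
  have "(\<integral>\<^sup>+x. ennreal (f x) \<partial>M) < \<infinity>" using assms(3) ennreal_less_top order_le_less_trans by fastforce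
  then show i: "integrable M f" by (intro integrableI_nonneg[OF assms(1,2)])
  have "(LINT x|M. f x) = enn2real (\<integral>\<^sup>+x. ennreal (f x) \<partial>M)" by (rule integral_eq_nn_integral[OF assms(1,2)])
  also have "\<dots> \<le> c" using assms(3,4) by (metis enn2real_ennreal enn2real_mono ennreal_less_top)
  finally show "(LINT x|M. f x) \<le> c" .
qed

lemma instance_data_of_polytope:
  assumes n: "1 \<le> n" and A: "A \<in> carrier_mat m n" "b \<in> carrier_vec m" and bd: "bounded_vecs (feasible_region A b)"
    and \<delta>: "0 < \<delta>" "local_distance_property A b \<delta>" and v: "vertex (feasible_region A b) v"
  shows "instance_data n m (entries A) (coords b) (coords v) \<delta>"
proof
  have vP: "v \<in> feasible_region A b" using v by (simp add: vertex_def)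
  show "0 < n" using n by simp
  show "0 < \<delta>" by (rule \<delta>(1))
  show "coords b i = 0" if "m \<le> i" for i using that A(2) by (simp add: coords_def)
  show "ip n (entries A r) (coords v) \<le> coords b r" if "r < m" for r using vP that by (simp add: feasible_region_iff[OF A])
  show "y l = 0" if "\<And>r. r < m \<Longrightarrow> ip n (entries A r) (coords v) = coords b r \<Longrightarrow> ip n (entries A r) y = 0" "l < n" for y l
    by (rule vertex_rigid[OF A v that])
  show "y l = 0" if "\<And>r. r < m \<Longrightarrow> ip n (entries A r) y \<le> 0" "l < n" for y l
    by (rule bounded_no_recession[OF A bd vP that])
  show "nrm n (u j) * nrm n (entries A j) \<le> 1 / \<delta>"
    if B: "B \<subseteq> {..<m}" and d: "dual_basis n (entries A) B u"
      and le: "\<And>k. k < m \<Longrightarrow> (\<Sum>j\<in>B. ip n (u j) (entries A k) * coords b j) \<le> coords b k" and j: "j \<in> B" for B u j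
  proof -
    have "distance_property n \<delta> B (row A)"
      using \<delta>(2) dual_basis_feasible[OF A B d le] A(1) unfolding local_distance_property_def by auto
    then have "\<delta> * eucl_norm (row A j) \<le> dist_to (row A j) (span_of n (row A ` (B - {j})))"
      using j by (simp add: distance_property_def)
    moreover have "eucl_norm (row A j) = nrm n (entries A j)"
      using j B A(1) coords_row[of j A] eucl_norm_nrm[of "row A j" n] by auto
    ultimately have "\<delta> * nrm n (entries A j) * nrm n (u j) \<le> 1"
      using dual_basis_dist[OF A(1) B d j] mult_right_mono[OF _ L2_set_nonneg] by (metis order_trans)
    then show ?thesis using \<delta>(1) by (simp add: field_simps)
  qed
qed

section \<open>Runs on a given polytope\<close>

locale polytope =
  fixes n m :: nat and A :: rmat and b v c :: rvec and \<delta> :: real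
  assumes n1: "1 \<le> n" and A: "A \<in> carrier_mat m n" and b: "b \<in> carrier_vec m" and c: "c \<in> carrier_vec n"
    and bd: "bounded_vecs (feasible_region A b)" and \<delta>: "0 < \<delta>" and ldp: "local_distance_property A b \<delta>"
    and v: "vertex (feasible_region A b) v"

sublocale polytope \<subseteq> instance_data n m "entries A" "coords b" "coords v" "coords c" \<delta>
  by (rule instance_data_of_polytope[OF n1 A b bd \<delta> ldp v])

context polytope
begin

lemma input: "input (lp_input A b c v \<delta>)"
proof -
  have "v \<in> carrier_vec n" using v feasible_region_iff[OF A b] by (simp add: vertex_def)
  then show ?thesis using A b c unfolding input_def lp_input_def
    by (auto simp: entries_def coords_def fun_eq_iff)
qed

context
  fixes B assumes B: "feasible_set n m a (coords b) B"
begin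

lemma basis_rows: "B \<subseteq> {..<m}" using B by (simp add: feasible_set_def)

lemma dual_entries: "dual_basis n (entries A) B (dual_of n a B)"
proof -
  obtain u where "dual_basis n a B u" using B by (auto simp: feasible_set_def)
  from dual_of[OF this] show ?thesis by (simp add: dual_basis_A[OF basis_rows])
qed

lemma basic_point_le: "k < m \<Longrightarrow> (\<Sum>j\<in>B. ip n (dual_of n a B j) (entries A k) * coords b j) \<le> coords b k"
  using B by (auto simp: feasible_set_def slack_def a_constraint)

lemma feasible_basis: "feasible_basis A b B"
  by (rule dual_basis_feasible[OF A b basis_rows dual_entries basic_point_le])

lemma optimal_basis: "optimal_for n a B y \<Longrightarrow> optimal_basis A {} (Matrix.vec n y) B"
  by (rule optimal_basis_iff_dual[OF A basis_rows dual_entries]) (simp add: optimal_for_def)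

end

text \<open>The walk follows \<open>p + s q\<close> with \<open>s\<close> running from 0 to
  infinity, a shadow path the segment from \<open>p\<close> to \<open>q\<close>. At
  \<open>t = s / (1 + s)\<close> the two objectives differ by the positive factor
  \<open>1 + s\<close>, which does not affect the optimality of a basis.\<close>

lemma shadow_path:
  assumes walk: "optimal_walk n m a (coords b) p q 0 B Bs" and B: "feasible_set n m a (coords b) B"
    and opt: "optimal_for n a B p" "optimal_for n a (last (B # Bs)) q"
  shows "shadow_path A b {} (Matrix.vec n p) (Matrix.vec n q) (B # Bs)"
proof -
  obtain ts where len: "length ts = length Bs" and sorted: "sorted (0 # ts)"
    and ts: "\<And>k. k < length Bs \<Longrightarrow> adjacent ((B # Bs) ! k) (Bs ! k) \<and>
      feasible_set n m a (coords b) (Bs ! k) \<and> optimal_for n a ((B # Bs) ! k) (\<lambda>l. p l + ts ! k * q l) \<and>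
      optimal_for n a (Bs ! k) (\<lambda>l. p l + ts ! k * q l)"
    using optimal_walk_times[OF walk] by blast
  have feas: "feasible_set n m a (coords b) B'" if "B' \<in> set (B # Bs)" for B'
    using that B ts by (auto simp: in_set_conv_nth)
  define t where "t = (\<lambda>k. 1 - 1 / (1 + ts ! k))"
  have ts0: "0 \<le> ts ! k" if "k < length Bs" for k using sorted that len nth_mem[of k ts] by simp
  have comb: "(1 - t k) \<cdot>\<^sub>v Matrix.vec n p + t k \<cdot>\<^sub>v Matrix.vec n q
      = Matrix.vec n (\<lambda>l. 1 / (1 + ts ! k) * (p l + ts ! k * q l))" if "k < length Bs" for k
  proof -
    define r where "r = 1 / (1 + ts ! k)"
    have e: "1 - t k = r" "t k = r * ts ! k" using ts0[OF that] by (simp_all add: t_def r_def field_simps)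
    have "(1 - t k) * x + t k * y = r * (x + ts ! k * y)" for x y
      by (simp only: e(1), simp only: e(2), simp add: algebra_simps)
    then show ?thesis unfolding r_def by (intro eq_vecI) auto
  qed
  have ob: "optimal_basis A {} ((1 - t k) \<cdot>\<^sub>v Matrix.vec n p + t k \<cdot>\<^sub>v Matrix.vec n q) B'"
    if k: "k < length Bs" and B': "B' \<in> set (B # Bs)" and o: "optimal_for n a B' (\<lambda>l. p l + ts ! k * q l)" for k B'
    unfolding comb[OF k]
  proof (rule optimal_basis[OF feas[OF B']])
    show "optimal_for n a B' (\<lambda>l. 1 / (1 + ts ! k) * (p l + ts ! k * q l))"
      using o ts0[OF k] unfolding optimal_for_def ip_scale_right by simp
  qed
  show ?thesis
    unfolding shadow_path_def
  proof (intro conjI exI[of _ t] allI impI ballI)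
    show "mono_on {..<length (B # Bs) - 1} t"
    proof (rule mono_onI)
      fix i k assume ik: "i \<in> {..<length (B # Bs) - 1}" "k \<in> {..<length (B # Bs) - 1}" "i \<le> k"
      then have "ts ! i \<le> ts ! k" using sorted len by (auto intro: sorted_nth_mono)
      then have "1 / (1 + ts ! k) \<le> 1 / (1 + ts ! i)" using ts0[of i] ik by (intro divide_left_mono) auto
      then show "t i \<le> t k" by (simp add: t_def)
    qed
    fix k assume "k < length (B # Bs) - 1"
    then have k: "k < length Bs" by simp
    have "1 / (1 + ts ! k) \<le> 1" "0 \<le> 1 / (1 + ts ! k)" using ts0[OF k] by (auto simp: divide_simps)
    then show "0 \<le> t k" "t k \<le> 1" by (simp_all add: t_def)
    show "adjacent ((B # Bs) ! k) ((B # Bs) ! Suc k)" using ts[OF k] by simp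
    show "optimal_basis A {} ((1 - t k) \<cdot>\<^sub>v Matrix.vec n p + t k \<cdot>\<^sub>v Matrix.vec n q) ((B # Bs) ! k)"
      using ts[OF k] k by (intro ob) (auto simp: nth_Cons')
    show "optimal_basis A {} ((1 - t k) \<cdot>\<^sub>v Matrix.vec n p + t k \<cdot>\<^sub>v Matrix.vec n q) ((B # Bs) ! Suc k)"
      using ts[OF k] k by (intro ob) auto
  next
    show "optimal_basis A {} (Matrix.vec n p) (hd (B # Bs))" using optimal_basis[OF B opt(1)] by simp
    show "optimal_basis A {} (Matrix.vec n q) (last (B # Bs))" by (intro optimal_basis feas opt) simp
    show "feasible_basis A b B'" if "B' \<in> set (B # Bs)" for B' using that by (intro feasible_basis feas)
  qed simp
qed

lemma outcome_solves:
  assumes o: "outcome B0 y s" and B0: "\<And>j. j \<in> B0 \<Longrightarrow> z j = 0"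
  shows "solves_lp A b c v s" "pivot_cost_le (real (leg_step_cost m n)) s"
proof -
  let ?d = "\<lambda>l. \<Sum>k\<in>B0. a k l"
  obtain Bs1 Bs2 B1 B2 where B12: "B1 = last (B0 # Bs1)" "B2 = last (B1 # Bs2)"
    and tr: "map snd (trace s) = Basis B0 # Segment {} (Matrix.vec n ?d) (Matrix.vec n y) # map Basis Bs1 @
       Segment {} (Matrix.vec n y) (Matrix.vec n (coords c)) # map Basis Bs2"
    and f0: "feasible_set n m a (coords b) B0" and f2: "feasible_set n m a (coords b) B2"
    and w1: "optimal_walk n m a (coords b) ?d y 0 B0 Bs1" and w2: "optimal_walk n m a (coords b) y (coords c) 0 B1 Bs2"
    and o0: "optimal_for n a B0 ?d" and o1: "optimal_for n a B1 y" and o2: "optimal_for n a B2 (coords c)"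
    and gaps: "gaps (leg_step_cost m n) (trace s)"
    and out: "\<forall>l<n. reg s 5 0 l = (\<Sum>j\<in>B2. coords b j * dual_of n a B2 j l)"
    using o unfolding outcome_def Let_def by (elim exE conjE) (rule that; (assumption | rule refl))
  have "Suc k < length (trace s) \<Longrightarrow> is_basis_event (snd (trace s ! Suc k)) \<Longrightarrow>
      fst (trace s ! Suc k) \<le> fst (trace s ! k) + leg_step_cost m n" for k using gaps by (simp add: gaps_def)
  then show "pivot_cost_le (real (leg_step_cost m n)) s"
    unfolding pivot_cost_le_def by (metis add.commute diff_le_eq of_nat_add of_nat_le_iff)
  have p1: "shadow_path A b {} (Matrix.vec n ?d) (Matrix.vec n y) (B0 # Bs1)"
    by (rule shadow_path[OF w1 f0 o0]) (use o1 B12 in simp)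
  have f1: "feasible_set n m a (coords b) B1"
  proof -
    obtain ts where "\<And>k. k < length Bs1 \<Longrightarrow> feasible_set n m a (coords b) (Bs1 ! k)" using optimal_walk_times[OF w1] by blast
    then show ?thesis using f0 B12(1) by (auto simp: last_conv_nth)
  qed
  have p2: "shadow_path A b {} (Matrix.vec n y) (Matrix.vec n (coords c)) (B1 # Bs2)"
    by (rule shadow_path[OF w2 f1 o1]) (use o2 B12 in simp)
  have "shadow_simplex A b B0 [Basis B0] B0" by (rule shadow_simplex.start[OF feasible_basis[OF f0]])
  from shadow_simplex.phase[OF shadow_simplex.phase[OF this p1, folded B12(1)] p2, folded B12(2)]
  have run: "shadow_simplex A b B0 (map snd (trace s)) B2" unfolding tr by simp
  let ?x = "lp_output n s"
  have x: "?x = basic_solution n (entries A) (coords b) B2 (dual_of n a B2)"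
    using out by (auto simp: lp_output_def reg_vec_def basic_solution_def)
  have bx: "basic_point A b B2 ?x" unfolding x by (rule basic_solution_point[OF A b basis_rows[OF f2] dual_entries[OF f2]])
  have fx: "?x \<in> feasible_region A b" unfolding x by (rule basic_solution_feasible[OF A b basic_point_le[OF f2]])
  have "basic_point A b B0 v"
  proof -
    have "v \<in> carrier_vec n" using v feasible_region_iff[OF A b] by (simp add: vertex_def)
    moreover have "ip n (entries A i) (coords v) = coords b i" if "i \<in> B0" for i
      using B0[OF that] basis_rows[OF f0] that by (auto simp: z_def a_constraint)
    ultimately show ?thesis unfolding basic_point_iff[OF A b basis_rows[OF f0]] by blast
  qed
  moreover have "vertex (feasible_region A b) ?x"
    by (rule basic_point_vertex[OF A b basis_rows[OF f2] dual_entries[OF f2] bx fx])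
  moreover have "\<forall>y\<in>feasible_region A b. scalar_prod c y \<le> scalar_prod c ?x"
    using optimal_basic_point[OF A b basis_rows[OF f2] dual_entries[OF f2] _ c bx] o2 by (simp add: optimal_for_def)
  moreover have "dim_col A = n" using A by simp
  ultimately show "solves_lp A b c v s" unfolding solves_lp_def Let_def using run bx by auto
qed

lemma expected_cost:
  obtains final where
    "AE \<omega> in tape. exec n \<omega> Shadow (lp_input A b c v \<delta>) (final \<omega>) \<and> solves_lp A b c v (final \<omega>) \<and>
       pivot_cost_le (3000000 * (real m * real n)) (final \<omega>)"
    "integrable tape (\<lambda>\<omega>. real (num_pivots (final \<omega>)))"
    "(LINT \<omega>|tape. real (num_pivots (final \<omega>))) \<le> 3000000 * pivot_bound n \<delta>"
    "integrable tape (\<lambda>\<omega>. real (steps (final \<omega>)))"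
    "(LINT \<omega>|tape. real (steps (final \<omega>))) \<le> 3000000 * (real m * real n) * pivot_bound n \<delta>"
proof -
  obtain final B0 u0 where final: "mstate final" and B0: "B0 \<subseteq> {..<m}" "dual_basis n a B0 u0" "\<And>j. j \<in> B0 \<Longrightarrow> z j = 0"
    and run: "AE \<omega> in tape. exec n \<omega> Shadow (lp_input A b c v \<delta>) (final \<omega>) \<and> outcome B0 (draws_of n m \<omega>) (final \<omega>)"
    and ex: "(\<integral>\<^sup>+\<omega>. of_nat (bases_reported (final \<omega>) - 1) \<partial>tape) \<le> 2 * ennreal leg_bound"
    by (rule expected_run[OF input]) blast
  have nm: "n \<le> m" using card_mono[OF _ B0(1)] dual_basisD(2)[OF B0(2)] by simp
  have d1: "\<delta> \<le> 1" by (rule delta_le_one[OF start_feasible[OF B0]])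
  define P where "P = pivot_bound n \<delta>"
  have nP: "real n \<le> P" unfolding P_def by (rule le_pivot_bound[OF d1])
  have P1: "1 \<le> P" using nP n1 by linarith
  have lc: "leg_step_cost m n \<le> 3100 * (m * n)" by (rule leg_step_cost_le[OF n1 nm])
  have np: "num_pivots s = bases_reported s - 1" for s by (simp add: num_pivots_def bases_reported_def)
  note [measurable] = mstateD[OF final]
  have m1: "(\<lambda>\<omega>. real (num_pivots (final \<omega>))) \<in> borel_measurable tape" unfolding np by measurable
  have m2: "(\<lambda>\<omega>. real (steps (final \<omega>))) \<in> borel_measurable tape" by measurable
  have e1: "(\<integral>\<^sup>+\<omega>. ennreal (real (num_pivots (final \<omega>))) \<partial>tape) \<le> ennreal (792 * P)"
  proof -
    have "(\<integral>\<^sup>+\<omega>. ennreal (real (num_pivots (final \<omega>))) \<partial>tape) \<le> 2 * ennreal leg_bound"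
      using ex by (simp add: np ennreal_of_nat_eq_real_of_nat)
    also have "\<dots> = ennreal (2 * leg_bound)" by (simp add: ennreal_mult')
    also have "\<dots> \<le> ennreal (792 * P)" unfolding P_def by (rule ennreal_leI[OF leg_bound_le])
    finally show ?thesis .
  qed
  \<comment> \<open>\<open>C\<close> collects the setup, \<open>10000 * (m * n * n)\<close>, and
    four surplus step costs of 3100 each, using that \<open>n\<close> and 1 are at most
    \<open>P\<close>; \<open>D\<close> is the cost of one pivot. With the bound
    \<open>792 * P\<close> for the pivots this gives
    \<open>22400 + 3100 * 792 = 2477600\<close>.\<close>
  define C where "C = 22400 * (real m * real n) * P"
  define D where "D = 3100 * (real m * real n)"
  have D0: "0 \<le> D" "0 \<le> C" using P1 by (simp_all add: D_def C_def)
  interpret T: prob_space tape unfolding tape_def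
    by (intro prob_space_PiM prob_space_pair prob_space_normal_density prob_space_exponential_density) simp_all
  have st: "real (steps s) \<le> C + D * real (num_pivots s)" if "outcome B0 y s" for y s
  proof -
    have "steps s \<le> 10000 * (m * n * n) + (num_pivots s + 4) * leg_step_cost m n"
      unfolding np by (rule order_trans[OF outcome_pivots(2)[OF that] add_le_mono1[OF overhead_le[OF nm]]])
    also have "\<dots> \<le> 10000 * (m * n * n) + (num_pivots s + 4) * (3100 * (m * n))" using lc by simp
    finally have "real (steps s) \<le> real (10000 * (m * n * n) + (num_pivots s + 4) * (3100 * (m * n)))"
      by (rule of_nat_mono)
    also have "\<dots> = 10000 * (real m * real n) * real n + 12400 * (real m * real n) * 1 + D * real (num_pivots s)"
      by (simp add: D_def algebra_simps)
    also have "\<dots> \<le> 10000 * (real m * real n) * P + 12400 * (real m * real n) * P + D * real (num_pivots s)"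
      using nP P1 by (intro add_mono mult_left_mono order_refl) auto
    finally show ?thesis by (simp add: C_def algebra_simps)
  qed
  have e2: "(\<integral>\<^sup>+\<omega>. ennreal (real (steps (final \<omega>))) \<partial>tape) \<le> ennreal (C + D * (792 * P))"
  proof -
    have "(\<integral>\<^sup>+\<omega>. ennreal (real (steps (final \<omega>))) \<partial>tape)
      \<le> (\<integral>\<^sup>+\<omega>. ennreal C + ennreal D * ennreal (real (num_pivots (final \<omega>))) \<partial>tape)"
    proof (rule nn_integral_mono_AE)
      show "AE \<omega> in tape. ennreal (real (steps (final \<omega>))) \<le> ennreal C + ennreal D * ennreal (real (num_pivots (final \<omega>)))"
        using run
      proof eventually_elim
        case (elim \<omega>)
        then have "ennreal (real (steps (final \<omega>))) \<le> ennreal (C + D * real (num_pivots (final \<omega>)))"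
          using st by (intro ennreal_leI) blast
        then show ?case using D0 by (simp add: ennreal_plus ennreal_mult)
      qed
    qed
    also have "\<dots> = (\<integral>\<^sup>+\<omega>. ennreal C \<partial>tape) + ennreal D * (\<integral>\<^sup>+\<omega>. ennreal (real (num_pivots (final \<omega>))) \<partial>tape)"
      using m1 by (subst nn_integral_add) (auto intro!: nn_integral_cmult arg_cong2[of _ _ _ _ "(+)"])
    also have "\<dots> \<le> ennreal C + ennreal D * ennreal (792 * P)"
      using e1 by (intro add_mono mult_left_mono) (auto simp: T.emeasure_space_1)
    also have "\<dots> = ennreal (C + D * (792 * P))" using D0 P1 by (simp add: ennreal_plus ennreal_mult)
    finally show ?thesis .
  qed
  note i1 = integral_le_nn_integral[OF m1 _ e1] and i2 = integral_le_nn_integral[OF m2 _ e2]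
  show thesis
  proof (rule that[of final])
    show "AE \<omega> in tape. exec n \<omega> Shadow (lp_input A b c v \<delta>) (final \<omega>) \<and> solves_lp A b c v (final \<omega>) \<and>
       pivot_cost_le (3000000 * (real m * real n)) (final \<omega>)"
      using run
    proof eventually_elim
      case (elim \<omega>)
      have "real (leg_step_cost m n) \<le> real (3100 * (m * n))" by (rule of_nat_mono[OF lc])
      also have "\<dots> \<le> 3000000 * (real m * real n)" by simp
      finally have "pivot_cost_le (3000000 * (real m * real n)) (final \<omega>)"
        using outcome_solves(2)[OF _ B0(3)] elim unfolding pivot_cost_le_def by (meson order_trans)
      then show ?case using outcome_solves(1)[OF _ B0(3)] elim by blast
    qed
    show "integrable tape (\<lambda>\<omega>. real (num_pivots (final \<omega>)))" by (rule i1(1)) (use P1 in auto)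
    show "integrable tape (\<lambda>\<omega>. real (steps (final \<omega>)))" by (rule i2(1)) (use D0 P1 in auto)
    have "(LINT \<omega>|tape. real (num_pivots (final \<omega>))) \<le> 792 * P" by (rule i1(2)) (use P1 in auto)
    then show "(LINT \<omega>|tape. real (num_pivots (final \<omega>))) \<le> 3000000 * pivot_bound n \<delta>" using P1 unfolding P_def by linarith
    have "(LINT \<omega>|tape. real (steps (final \<omega>))) \<le> C + D * (792 * P)" by (rule i2(2)) (use D0 P1 in auto)
    also have "\<dots> = 2477600 * (real m * real n * P)" by (simp add: C_def D_def)
    also have "\<dots> \<le> 3000000 * (real m * real n * P)" using P1 by (intro mult_right_mono) auto
    finally show "(LINT \<omega>|tape. real (steps (final \<omega>))) \<le> 3000000 * (real m * real n) * pivot_bound n \<delta>"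
      by (simp add: P_def mult.assoc)
  qed
qed

end

theorem theorem5:
  shows "\<exists>(prog :: com) (K :: real).
    \<forall>(m :: nat) (n :: nat) (A :: rmat) (b :: rvec) (c :: rvec) (v :: rvec) (\<delta> :: real).
      n \<ge> 1 \<longrightarrow> A \<in> carrier_mat m n \<longrightarrow> b \<in> carrier_vec m \<longrightarrow> c \<in> carrier_vec n \<longrightarrow>
      bounded_vecs (feasible_region A b) \<longrightarrow> full_dimensional n (feasible_region A b) \<longrightarrow>
      \<delta> > 0 \<longrightarrow> local_distance_property A b \<delta> \<longrightarrow>
      vertex (feasible_region A b) v \<longrightarrow>
      (\<exists>final :: (nat \<Rightarrow> real \<times> real) \<Rightarrow> state.
        (AE \<omega> in tape. exec n \<omega> prog (lp_input A b c v \<delta>) (final \<omega>) \<and>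
           solves_lp A b c v (final \<omega>) \<and>
           pivot_cost_le (K * (real m * real n)) (final \<omega>)) \<and>
        integrable tape (\<lambda>\<omega>. real (num_pivots (final \<omega>))) \<and>
        (LINT \<omega>|tape. real (num_pivots (final \<omega>))) \<le> K * pivot_bound n \<delta> \<and>
        integrable tape (\<lambda>\<omega>. real (steps (final \<omega>))) \<and>
        (LINT \<omega>|tape. real (steps (final \<omega>))) \<le> K * (real m * real n) * pivot_bound n \<delta>)"
proof (rule exI[of _ Shadow], rule exI[of _ 3000000], intro allI impI, goal_cases)
  case (1 m n A b c v \<delta>)
  then interpret polytope n m A b v c \<delta> by unfold_locales
  show ?case by (rule expected_cost) blast
qed

end
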